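(* Let $n \ge 2$. There is a constant $c<0$, independent of $m$, such that for every $0<m<1/2$ the following holds for the domain $$E_{2m} = \{ z \in \mathbb{C}^n : |z_1|^{2m} + |z_2|^2 + \cdots + |z_n|^2 < 1 \}$$ and the set $Z = \{ (0,z_2,\ldots,z_n) \in E_{2m} \}$. The Wu metric on $E_{2m}$ is a continuous Hermitian metric on $E_{2m}$ which is real analytic on $E_{2m}\setminus Z$. It is nowhere Kähler. Furthermore, its holomorphic sectional curvature is non-constant and is bounded above by $c$ on $E_{2m}$ in the sense of currents.
   Context: Kobayashi metric: let $\mathbb{D}$ be the open unit disc in $\mathbb{C}$. For a domain $D\subset\mathbb{C}^n$, $z\in D$, $v\in\mathbb{C}^n$, $$K_D(z,v)=\inf\{ |\lambda| : \lambda \in\mathbb{C},\ \text{there is a holomorphic } f:\mathbb{D}\to D \text{ with } f(0)=z,\ \lambda f'(0)=v\}.$$ The Kobayashi indicatrix at $z$ is $\{v\in\mathbb{C}^n : K_D(z,v)<1\}$. Wu metric: for a bounded domain $D$ and $z\in D$, among all Hermitian inner products on $T_zD=\mathbb{C}^n$ whose open unit ball (a complex ellipsoid centred at $0$) contains the Kobayashi indicatrix at $z$, there is exactly one whose unit ball has the smallest volume. The Wu metric at $z$ is this inner product (with no further normalizing factor). It is written $\sum h_{i\bar j}\,dz_i\otimes d\bar z_j$. Nowhere Kähler: at every point of the open dense set $E_{2m}\setminus Z$ (where the metric is real analytic), the Kähler condition $d\omega=0$ fails for the associated $(1,1)$-form $\omega$ of the metric; equivalently, the identities $\partial h_{i\bar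 j}/\partial z_k=\partial h_{k\bar j}/\partial z_i$ do not all hold at that point. Holomorphic sectional curvature: for a $C^2$-smooth Hermitian metric $\sum g_{i\bar j}\,dz_i\otimes d\bar z_j$, the holomorphic sectional curvature at $p$ in the direction $\xi\neq0$ is $$\frac{\sum R_{i\bar jk\bar l}(p)\,\xi_i\bar\xi_j\xi_k\bar\xi_l}{\sum g_{i\bar j}(p)g_{k\bar l}(p)\,\xi_i\bar\xi_j\xi_k\bar\xi_l},\qquad R_{i\bar jk\bar l}=-\frac{\partial^2 g_{i\bar j}}{\partial z_k\partial\bar z_l}+\sum_{\alpha,\beta}g^{\alpha\bar\beta}\frac{\partial g_{i\bar\beta}}{\partial z_k}\frac{\partial g_{\alpha\bar j}}{\partial\bar z_l},$$ where $(g^{\alpha\bar\beta})$ is the inverse matrix of $(g_{\alpha\bar\beta})$. Non-constancy refers to this function of points and directions over the set where the Wu metric is smooth. Curvature bound in the sense of currents: for a Hermitian metric $H$ that is only continuous, its holomorphic sectional curvature is said to be bounded above by a negative constant $c$ in the sense of currents if, for every embedded Riemann surface $S$ in the manifold with local holomorphic coordinate $\xi$, writing $H|_S=h_0\,d\xi\otimes d\bar\xi$, one has $\frac{\partial^2\log h_0}{\partial\xi\,\partial\bar\xi}>-c\,h_0$ in the sense of distributions (i.e. after pairing with any nonnegative, not identically zero, compactly supported smooth test function). *)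

theory Defs
  imports "HOL-Analysis.Analysis"
begin

section \<open>Holomorphic maps into complex n-space and Wirtinger derivatives\<close>

definition vec_holomorphic_on :: "(complex \<Rightarrow> complex ^ 'n) \<Rightarrow> complex set \<Rightarrow> bool" where
  "vec_holomorphic_on f U \<longleftrightarrow> (\<forall>i. (\<lambda>\<zeta>. f \<zeta> $ i) holomorphic_on U)"

definition vec_deriv :: "(complex \<Rightarrow> complex ^ 'n) \<Rightarrow> complex \<Rightarrow> complex ^ 'n" where
  "vec_deriv f \<zeta> = (\<chi> i. deriv (\<lambda>w. f w $ i) \<zeta>)"

definition dz :: "(complex \<Rightarrow> complex) \<Rightarrow> complex \<Rightarrow> complex" where
  "dz f \<zeta> = (frechet_derivative f (at \<zeta>) 1 - \<i> * frechet_derivative f (at \<zeta>) \<i>) / 2"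

definition dzbar :: "(complex \<Rightarrow> complex) \<Rightarrow> complex \<Rightarrow> complex" where
  "dzbar f \<zeta> = (frechet_derivative f (at \<zeta>) 1 + \<i> * frechet_derivative f (at \<zeta>) \<i>) / 2"

definition pdz :: "'n::finite \<Rightarrow> (complex ^ 'n \<Rightarrow> complex) \<Rightarrow> complex ^ 'n \<Rightarrow> complex" where
  "pdz k f p = dz (\<lambda>\<zeta>. f (p + axis k \<zeta>)) 0"

definition pdzbar :: "'n::finite \<Rightarrow> (complex ^ 'n \<Rightarrow> complex) \<Rightarrow> complex ^ 'n \<Rightarrow> complex" where
  "pdzbar k f p = dzbar (\<lambda>\<zeta>. f (p + axis k \<zeta>)) 0"


section \<open>The Kobayashi metric\<close>

definition kobayashi :: "(complex ^ 'n::finite) set \<Rightarrow> complex ^ 'n \<Rightarrow> complex ^ 'n \<Rightarrow> real" where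
  "kobayashi D z v = Inf {cmod l |l. \<exists>f. vec_holomorphic_on f (ball 0 1) \<and>
      f ` ball 0 1 \<subseteq> D \<and> f 0 = z \<and> l *s vec_deriv f 0 = v}"

definition kobayashi_indicatrix :: "(complex ^ 'n::finite) set \<Rightarrow> complex ^ 'n \<Rightarrow> (complex ^ 'n) set" where
  "kobayashi_indicatrix D z = {v. kobayashi D z v < 1}"


section \<open>Hermitian inner products and the Wu metric\<close>

text \<open>The matrix \<open>H\<close> represents the inner product
  \<open>\<langle>u, v\<rangle> = \<Sum>\<^sub>i\<^sub>j H\<^sub>i\<^sub>j u\<^sub>i (cnj v\<^sub>j)\<close>, that is, \<open>\<Sum> H\<^sub>i\<^sub>j dz\<^sub>i \<otimes> d(cnj z\<^sub>j)\<close>.\<close>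

definition herm :: "complex ^ 'n ^ 'n \<Rightarrow> complex ^ 'n::finite \<Rightarrow> complex ^ 'n \<Rightarrow> complex" where
  "herm H u v = (\<Sum>i\<in>UNIV. \<Sum>j\<in>UNIV. H $ i $ j * u $ i * cnj (v $ j))"

definition hermitian_inner_product :: "complex ^ 'n ^ 'n::finite \<Rightarrow> bool" where
  "hermitian_inner_product H \<longleftrightarrow>
     (\<forall>i j. H $ j $ i = cnj (H $ i $ j)) \<and> (\<forall>v. v \<noteq> 0 \<longrightarrow> 0 < Re (herm H v v))"

definition herm_ball :: "complex ^ 'n ^ 'n::finite \<Rightarrow> (complex ^ 'n) set" where
  "herm_ball H = {v. Re (herm H v v) < 1}"

definition wu_metric :: "(complex ^ 'n::finite) set \<Rightarrow> complex ^ 'n \<Rightarrow> complex ^ 'n ^ 'n" where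
  "wu_metric D z = (THE H.
     hermitian_inner_product H \<and> kobayashi_indicatrix D z \<subseteq> herm_ball H \<and>
     (\<forall>H'. hermitian_inner_product H' \<and> kobayashi_indicatrix D z \<subseteq> herm_ball H' \<longrightarrow>
        emeasure lborel (herm_ball H) \<le> emeasure lborel (herm_ball H')))"

definition continuous_hermitian_metric_on ::
    "(complex ^ 'n::finite) set \<Rightarrow> (complex ^ 'n \<Rightarrow> complex ^ 'n ^ 'n) \<Rightarrow> bool" where
  "continuous_hermitian_metric_on D h \<longleftrightarrow>
     continuous_on D h \<and> (\<forall>z\<in>D. hermitian_inner_product (h z))"


section \<open>Smooth and real analytic functions\<close>

text \<open>Class \<open>C\<^sup>k\<close> on an open set \<open>S\<close>.\<close>

primrec Ck_on :: "nat \<Rightarrow> 'a::euclidean_space set \<Rightarrow> ('a \<Rightarrow> 'b::real_normed_vector) \<Rightarrow> bool" where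
  "Ck_on 0 S f \<longleftrightarrow> continuous_on S f"
| "Ck_on (Suc k) S f \<longleftrightarrow> (\<forall>x\<in>S. f differentiable (at x)) \<and>
     (\<forall>v. Ck_on k S (\<lambda>x. frechet_derivative f (at x) v))"

definition smooth_on :: "'a::euclidean_space set \<Rightarrow> ('a \<Rightarrow> 'b::real_normed_vector) \<Rightarrow> bool" where
  "smooth_on S f \<longleftrightarrow> (\<forall>k. Ck_on k S f)"

text \<open>Near each point of the open set \<open>S\<close>, \<open>f\<close> is the sum of a power series in the real
  coordinates; the multi-indices are the extensional functions from \<open>Basis\<close> to the naturals.\<close>

definition real_analytic_on ::
    "'a::euclidean_space set \<Rightarrow> ('a \<Rightarrow> 'b::real_normed_vector) \<Rightarrow> bool" where
  "real_analytic_on S f \<longleftrightarrow> (\<forall>p\<in>S. \<exists>r>0. \<exists>a :: ('a \<Rightarrow> nat) \<Rightarrow> 'b. \<forall>x\<in>ball p r.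
     ((\<lambda>\<alpha>. (\<Prod>b\<in>Basis. ((x - p) \<bullet> b) ^ \<alpha> b) *\<^sub>R a \<alpha>) has_sum f x) (Basis \<rightarrow>\<^sub>E UNIV))"


section \<open>The Kaehler condition\<close>

text \<open>\<open>\<omega> = (\<i>/2) \<Sum> h\<^sub>i\<^sub>j dz\<^sub>i \<and> d(cnj z\<^sub>j)\<close>, evaluated on a pair of tangent vectors.\<close>

definition fundamental_form ::
    "(complex ^ 'n::finite \<Rightarrow> complex ^ 'n ^ 'n) \<Rightarrow> complex ^ 'n \<Rightarrow> complex ^ 'n \<Rightarrow> complex ^ 'n \<Rightarrow> complex" where
  "fundamental_form h p u v =
     (\<i> / 2) * (\<Sum>i\<in>UNIV. \<Sum>j\<in>UNIV. h p $ i $ j * (u $ i * cnj (v $ j) - v $ i * cnj (u $ j)))"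

text \<open>The exterior derivative of a 2-form, evaluated on constant vector fields (whose Lie
  brackets vanish).\<close>

definition ext_deriv2 ::
    "('a::real_normed_vector \<Rightarrow> 'a \<Rightarrow> 'a \<Rightarrow> complex) \<Rightarrow> 'a \<Rightarrow> 'a \<Rightarrow> 'a \<Rightarrow> 'a \<Rightarrow> complex" where
  "ext_deriv2 w p u v x =
     frechet_derivative (\<lambda>z. w z v x) (at p) u
     - frechet_derivative (\<lambda>z. w z u x) (at p) v
     + frechet_derivative (\<lambda>z. w z u v) (at p) x"

definition kaehler_at :: "(complex ^ 'n::finite \<Rightarrow> complex ^ 'n ^ 'n) \<Rightarrow> complex ^ 'n \<Rightarrow> bool" where
  "kaehler_at h p \<longleftrightarrow> (\<forall>u v x. ext_deriv2 (fundamental_form h) p u v x = 0)"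


section \<open>Holomorphic sectional curvature\<close>

text \<open>The upper-index coefficients \<open>g\<^sup>\<alpha>\<^sup>\<beta>\<close> satisfy
  \<open>\<Sum>\<^sub>\<beta> g\<^sup>\<alpha>\<^sup>\<beta> g\<^sub>\<gamma>\<^sub>\<beta> = \<delta>\<^sub>\<alpha>\<^sub>\<gamma>\<close> (the usual tensor convention, with the barred indices
  contracted), so \<open>g\<^sup>\<alpha>\<^sup>\<beta>\<close> is the \<open>(\<beta>, \<alpha>)\<close> entry of the inverse matrix.\<close>

definition curvature_tensor ::
    "(complex ^ 'n::finite \<Rightarrow> complex ^ 'n ^ 'n) \<Rightarrow> complex ^ 'n \<Rightarrow> 'n \<Rightarrow> 'n \<Rightarrow> 'n \<Rightarrow> 'n \<Rightarrow> complex" where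
  "curvature_tensor g p i j k l =
     - pdz k (pdzbar l (\<lambda>z. g z $ i $ j)) p
     + (\<Sum>\<alpha>\<in>UNIV. \<Sum>\<beta>\<in>UNIV. matrix_inv (g p) $ \<beta> $ \<alpha> *
          pdz k (\<lambda>z. g z $ i $ \<beta>) p * pdzbar l (\<lambda>z. g z $ \<alpha> $ j) p)"

text \<open>The quotient is real for a Hermitian metric; \<open>Re\<close> only changes its type.\<close>

definition hol_sectional_curvature ::
    "(complex ^ 'n::finite \<Rightarrow> complex ^ 'n ^ 'n) \<Rightarrow> complex ^ 'n \<Rightarrow> complex ^ 'n \<Rightarrow> real" where
  "hol_sectional_curvature g p \<xi> = Re (
     (\<Sum>i\<in>UNIV. \<Sum>j\<in>UNIV. \<Sum>k\<in>UNIV. \<Sum>l\<in>UNIV.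
        curvature_tensor g p i j k l * \<xi> $ i * cnj (\<xi> $ j) * \<xi> $ k * cnj (\<xi> $ l)) /
     (\<Sum>i\<in>UNIV. \<Sum>j\<in>UNIV. \<Sum>k\<in>UNIV. \<Sum>l\<in>UNIV.
        g p $ i $ j * g p $ k $ l * \<xi> $ i * cnj (\<xi> $ j) * \<xi> $ k * cnj (\<xi> $ l)))"


section \<open>Curvature bounds in the sense of currents\<close>

text \<open>\<open>\<phi>\<close> is the inverse of a local holomorphic coordinate on \<open>S\<close> with image \<open>U\<close>.\<close>

definition local_parametrization ::
    "(complex ^ 'n::finite) set \<Rightarrow> complex set \<Rightarrow> (complex \<Rightarrow> complex ^ 'n) \<Rightarrow> bool" where
  "local_parametrization S U \<phi> \<longleftrightarrow>
     open U \<and> vec_holomorphic_on \<phi> U \<and> (\<forall>\<zeta>\<in>U. vec_deriv \<phi> \<zeta> \<noteq> 0) \<and>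
     (\<exists>\<psi>. homeomorphism U (\<phi> ` U) \<phi> \<psi>) \<and> openin (top_of_set S) (\<phi> ` U)"

definition embedded_riemann_surface :: "(complex ^ 'n::finite) set \<Rightarrow> bool" where
  "embedded_riemann_surface S \<longleftrightarrow>
     S \<noteq> {} \<and> connected S \<and> (\<forall>p\<in>S. \<exists>U \<phi>. local_parametrization S U \<phi> \<and> p \<in> \<phi> ` U)"

text \<open>The coefficient \<open>h\<^sub>0\<close> of the restricted metric \<open>h\<^sub>0 d\<xi> \<otimes> d(cnj \<xi>)\<close>.\<close>

definition restricted_metric ::
    "(complex ^ 'n::finite \<Rightarrow> complex ^ 'n ^ 'n) \<Rightarrow> (complex \<Rightarrow> complex ^ 'n) \<Rightarrow> complex \<Rightarrow> real" where
  "restricted_metric h \<phi> \<zeta> = Re (herm (h (\<phi> \<zeta>)) (vec_deriv \<phi> \<zeta>) (vec_deriv \<phi> \<zeta>))"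

definition nonneg_test_function :: "complex set \<Rightarrow> (complex \<Rightarrow> real) \<Rightarrow> bool" where
  "nonneg_test_function U \<rho> \<longleftrightarrow>
     smooth_on UNIV \<rho> \<and> compact (closure {\<zeta>. \<rho> \<zeta> \<noteq> 0}) \<and> closure {\<zeta>. \<rho> \<zeta> \<noteq> 0} \<subseteq> U \<and>
     (\<forall>\<zeta>. 0 \<le> \<rho> \<zeta>) \<and> (\<exists>\<zeta>. \<rho> \<zeta> \<noteq> 0)"

text \<open>The second derivative of \<open>log h\<^sub>0\<close> as a distribution: both derivatives are moved
  to the test function, which produces no sign. For real \<open>\<rho>\<close> the mixed derivative
  is a quarter of the Laplacian, hence real.\<close>

definition curvature_bounded_above_currents ::
    "(complex ^ 'n::finite) set \<Rightarrow> (complex ^ 'n \<Rightarrow> complex ^ 'n ^ 'n) \<Rightarrow> real \<Rightarrow> bool" where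
  "curvature_bounded_above_currents D h c \<longleftrightarrow>
     (\<forall>S U \<phi> \<rho>. S \<subseteq> D \<and> embedded_riemann_surface S \<and> local_parametrization S U \<phi> \<and>
        nonneg_test_function U \<rho> \<longrightarrow>
        (LINT \<zeta>:U|lborel. ln (restricted_metric h \<phi> \<zeta>) * Re (dz (dzbar (\<lambda>w. of_real (\<rho> w))) \<zeta>))
        > (LINT \<zeta>:U|lborel. - c * restricted_metric h \<phi> \<zeta> * \<rho> \<zeta>))"


section \<open>The domain\<close>

text \<open>The index \<open>\<iota>\<close> plays the role of the first coordinate.\<close>

definition egg :: "'n::finite \<Rightarrow> real \<Rightarrow> (complex ^ 'n) set" where
  "egg \<iota> m = {z. cmod (z $ \<iota>) powr (2 * m) + (\<Sum>i\<in>UNIV - {\<iota>}. (cmod (z $ i))\<^sup>2) < 1}"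

definition egg_slice :: "'n::finite \<Rightarrow> real \<Rightarrow> (complex ^ 'n) set" where
  "egg_slice \<iota> m = {z \<in> egg \<iota> m. z $ \<iota> = 0}"

end

theory Submission
  imports Defs "HOL-Complex_Analysis.Conformal_Mappings"
begin

text \<open>Write a point of the egg as \<open>(z, w)\<close>, with \<open>s = 1 - \<bar>w\<bar>\<^sup>2\<close>, \<open>\<tau> = z s powr (- 1/(2m))\<close> and
  \<open>E = \<bar>\<tau>\<bar>\<^sup>2\<close>. The Wu metric is \<open>\<bar>\<partial>\<tau>\<bar>\<^sup>2 / (1 - E)\<^sup>2 + \<beta> / (1 - E powr m)\<close>, where
  \<open>\<partial>\<tau>\<close> is the covariant derivative given by \<open>\<partial>E = cnj \<tau> \<partial>\<tau>\<close> (so that \<open>\<bar>\<partial>\<tau>\<bar>\<close> is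
  \<open>s powr (- 1/(2m))\<close> times the modulus of \<open>conn_form\<close>) and \<open>\<beta>\<close> is the ball metric in \<open>w\<close>.
  Indeed its unit ball contains the Kobayashi indicatrix by a Schwarz lemma, and for each vector of one orthonormal frame an explicit disc
  shows that the vector is in the closure of the indicatrix; a Hermitian form that is at most \<open>1\<close> on an
  orthonormal frame cannot have a unit ball of smaller volume.

  Everything else is read off this formula, and the strict inequality
  \<open>E / (1 - E)\<^sup>2 < m\<^sup>2 E powr m / (1 - E powr m)\<^sup>2\<close> is decisive throughout: it is the
  non-vanishing torsion coefficient, and it makes the curvature in the \<open>w\<close> directions at \<open>w = 0\<close>
  differ from its limit \<open>-2\<close> at the origin. For the currents, \<open>E powr m\<close> is replaced by
  \<open>(E + \<epsilon>) powr m\<close>; then the mixed derivative of \<open>ln h\<close> along any curve is at least \<open>h\<close>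
  pointwise. Integrate by parts against the test function and let \<open>\<epsilon> \<rightarrow> 0\<close>.\<close>

section \<open>Volumes of Hermitian balls\<close>

text \<open>Volumes are compared without determinants: the volume of \<open>herm_ball H\<close> is a
  fixed multiple of the integral of the positive part of 1 - H(v, v), and the sign change of one
  coordinate removes all off-diagonal terms from the integral of H over the round ball. This is why
  bounds on single frame vectors carry enough information.

  For \<open>m < 1/2\<close> the egg is not convex, so linear functionals do not bound its discs.
  What replaces them is that \<open>(1 - x) / (1 - x powr m)\<close> has minorants
  \<open>C * x powr c\<close>, sharp at a prescribed point of the open unit interval. Along a disc
  such a power is, off its zeros, locally the squared modulus of a holomorphic function, so a
  maximum principle for sums of squares applies.

  The estimate for the currents is one Cauchy-Schwarz inequality together with two scalar
  inequalities in E. It has the factor 1 for every m; half of it is given away to turn a weak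
  inequality into the strict one, hence c = -1/2.\<close>

lemma nn_integral_lborel_translate:
  fixes f :: "'a::euclidean_space \<Rightarrow> ennreal"
  assumes [measurable]: "f \<in> borel_measurable borel"
  shows "(\<integral>\<^sup>+x. f (c + x) \<partial>lborel) = (\<integral>\<^sup>+x. f x \<partial>lborel)"
proof -
  have "(\<integral>\<^sup>+x. f x \<partial>lborel) = (\<integral>\<^sup>+x. f x \<partial>distr lborel borel ((+) c))"
    by (simp add: lborel_distr_plus)
  then show ?thesis by (simp add: nn_integral_distr)
qed

lemma nn_integral_lborel_reflect:
  fixes f :: "'a::euclidean_space \<Rightarrow> ennreal"
  assumes [measurable]: "f \<in> borel_measurable borel"
  shows "(\<integral>\<^sup>+x. f (c - x) \<partial>lborel) = (\<integral>\<^sup>+x. f x \<partial>lborel)"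
proof -
  have "(\<integral>\<^sup>+x. f x \<partial>lborel) = (\<integral>\<^sup>+x. f x \<partial>density (distr lborel borel (\<lambda>x. c + (-1::real) *\<^sub>R x)) (\<lambda>x. ennreal (\<bar>-1\<bar> ^ DIM('a))))"
    by (subst lborel_affine[of "-1" c, symmetric]) auto
  then show ?thesis by (simp add: nn_integral_distr nn_integral_density)
qed

text \<open>Uniqueness of the translation-invariant measure, for the image of Lebesgue measure
  under a linear isomorphism: expand the product of integrals by Tonelli and shift.\<close>

lemma nn_integral_linear_iso:
  fixes T R :: "'a::euclidean_space \<Rightarrow> 'a"
  assumes T: "linear T" and R: "linear R" and RT: "\<And>x. R (T x) = x" and TR: "\<And>x. T (R x) = x"
    and [measurable]: "f \<in> borel_measurable borel" "g \<in> borel_measurable borel"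
  shows "(\<integral>\<^sup>+x. f (R x) \<partial>lborel) * (\<integral>\<^sup>+x. g x \<partial>lborel) = (\<integral>\<^sup>+x. g (R x) \<partial>lborel) * (\<integral>\<^sup>+x. f x \<partial>lborel)"
proof -
  have cR: "continuous_on UNIV R" "continuous_on UNIV T"
    using R T by (simp_all add: linear_continuous_on linear_conv_bounded_linear)
  have [measurable]: "R \<in> borel_measurable borel" "T \<in> borel_measurable borel"
    using cR by (auto intro: borel_measurable_continuous_onI)
  have "(\<integral>\<^sup>+x. f (R x) \<partial>lborel) * (\<integral>\<^sup>+x. g x \<partial>lborel)
      = (\<integral>\<^sup>+x. (\<integral>\<^sup>+y. f (R x) * g y \<partial>lborel) \<partial>lborel)"
    by (simp add: nn_integral_cmult nn_integral_multc)
  also have "\<dots> = (\<integral>\<^sup>+x. (\<integral>\<^sup>+y. f (R x) * g (R x + y) \<partial>lborel) \<partial>lborel)"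
    by (rule nn_integral_cong) (simp add: nn_integral_cmult nn_integral_lborel_translate)
  also have "\<dots> = (\<integral>\<^sup>+y. (\<integral>\<^sup>+x. f (R x) * g (R x + y) \<partial>lborel) \<partial>lborel)"
    by (rule lborel_pair.Fubini'[symmetric]) measurable
  also have "\<dots> = (\<integral>\<^sup>+y. (\<integral>\<^sup>+x. f (R x - y) * g (R x) \<partial>lborel) \<partial>lborel)"
  proof (rule nn_integral_cong)
    fix y :: 'a
    have "(\<integral>\<^sup>+x. f (R x) * g (R x + y) \<partial>lborel)
        = (\<integral>\<^sup>+x. f (R (- T y + x)) * g (R (- T y + x) + y) \<partial>lborel)"
      by (rule nn_integral_lborel_translate[symmetric, of "\<lambda>x. f (R x) * g (R x + y)"]) measurable
    also have "\<dots> = (\<integral>\<^sup>+x. f (R x - y) * g (R x) \<partial>lborel)"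
      using linear_diff[OF R, of _ "T y"] by (intro nn_integral_cong) (simp add: RT)
    finally show "(\<integral>\<^sup>+x. f (R x) * g (R x + y) \<partial>lborel) = (\<integral>\<^sup>+x. f (R x - y) * g (R x) \<partial>lborel)" .
  qed
  also have "\<dots> = (\<integral>\<^sup>+x. (\<integral>\<^sup>+y. f (R x - y) * g (R x) \<partial>lborel) \<partial>lborel)"
    by (rule lborel_pair.Fubini') measurable
  also have "\<dots> = (\<integral>\<^sup>+x. (\<integral>\<^sup>+y. f y \<partial>lborel) * g (R x) \<partial>lborel)"
    by (rule nn_integral_cong) (simp add: nn_integral_multc nn_integral_lborel_reflect)
  also have "\<dots> = (\<integral>\<^sup>+x. g (R x) \<partial>lborel) * (\<integral>\<^sup>+x. f x \<partial>lborel)"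
    by (simp add: nn_integral_cmult mult.commute)
  finally show ?thesis .
qed

lemma emeasure_open_ne_0:
  fixes S :: "'a::euclidean_space set"
  assumes "open S" "S \<noteq> {}"
  shows "emeasure lborel S \<noteq> 0"
proof
  assume "emeasure lborel S = 0"
  then have "S \<in> null_sets lborel" using assms(1) by (auto simp: null_sets_def)
  then have "negligible S" using negligible_iff_null_sets null_sets_completionI by blast
  then show False using open_not_negligible assms by blast
qed

text \<open>The unit ball serves as the gauge: by the preceding identity the volume of a preimage
  under \<open>R\<close> is a fixed multiple of the volume of the set. The ball and its preimage
  have finite nonzero volume, so the multiple cancels and no determinant has to be computed.\<close>

lemma emeasure_linear_iso_mono_iff:
  fixes T R :: "'a::euclidean_space \<Rightarrow> 'a"
  assumes T: "linear T" and R: "linear R" and RT: "\<And>x. R (T x) = x" and TR: "\<And>x. T (R x) = x"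
    and [measurable]: "A \<in> sets borel" "B \<in> sets borel"
  shows "emeasure lborel (R -` A) \<le> emeasure lborel (R -` B) \<longleftrightarrow> emeasure lborel A \<le> emeasure lborel B"
proof -
  have cR: "continuous_on UNIV R"
    using R by (simp add: linear_continuous_on linear_conv_bounded_linear)
  have [measurable]: "R \<in> borel_measurable borel"
    using cR by (auto intro: borel_measurable_continuous_onI)
  let ?U = "ball (0::'a) 1"
  have eq: "emeasure lborel (R -` S) * emeasure lborel ?U = emeasure lborel (R -` ?U) * emeasure lborel S"
    if [measurable]: "S \<in> sets borel" for S
  proof -
    have s: "R -` S \<in> sets borel" "R -` ?U \<in> sets borel" using measurable_sets_borel[of R borel] that by auto
    have "(\<integral>\<^sup>+x. indicator X (R x) \<partial>lborel) = emeasure lborel (R -` X)" if "R -` X \<in> sets borel" for X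
    proof -
      have "(\<integral>\<^sup>+x. indicator X (R x) \<partial>lborel) = (\<integral>\<^sup>+x. indicator (R -` X) x \<partial>lborel)"
        by (intro nn_integral_cong) (auto simp: indicator_def)
      then show ?thesis using that by simp
    qed
    note h = this
    have "(\<integral>\<^sup>+x. indicator S (R x) \<partial>lborel) * (\<integral>\<^sup>+x. indicator ?U x \<partial>lborel)
        = (\<integral>\<^sup>+x. indicator ?U (R x) \<partial>lborel) * (\<integral>\<^sup>+x. indicator S x \<partial>lborel)"
      by (rule nn_integral_linear_iso[OF T R RT TR]) (auto intro!: borel_measurable_indicator simp: that)
    then show ?thesis unfolding h[OF s(1)] h[OF s(2)] using that by (simp add: nn_integral_indicator)
  qed
  have "open (R -` ?U)" using cR by (intro open_vimage) auto
  moreover have "0 \<in> R -` ?U" using linear_0[OF R] by simp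
  ultimately have p1: "emeasure lborel (R -` ?U) \<noteq> 0"
    by (metis empty_iff emeasure_open_ne_0)
  have "R -` ?U \<subseteq> T ` ?U"
  proof
    fix x assume "x \<in> R -` ?U"
    then have "T (R x) \<in> T ` ?U" by blast
    then show "x \<in> T ` ?U" by (simp add: TR)
  qed
  moreover have "bounded (T ` ?U)" using bounded_linear_image[OF bounded_ball] T
    by (simp add: linear_conv_bounded_linear)
  ultimately have "bounded (R -` ?U)" by (rule bounded_subset[rotated])
  then have p2: "emeasure lborel (R -` ?U) \<noteq> top" using emeasure_bounded_finite[of "R -` ?U"] by (simp add: less_top)
  have p3: "emeasure lborel ?U \<noteq> 0"
    by (metis open_ball emeasure_open_ne_0 centre_in_ball empty_iff zero_less_one)
  have p4: "emeasure lborel ?U \<noteq> top" using emeasure_bounded_finite[OF bounded_ball] by (simp add: less_top)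
  have "emeasure lborel (R -` A) \<le> emeasure lborel (R -` B)
    \<longleftrightarrow> emeasure lborel (R -` ?U) * emeasure lborel A \<le> emeasure lborel (R -` ?U) * emeasure lborel B"
    unfolding eq[OF assms(5), symmetric] eq[OF assms(6), symmetric]
    by (simp add: mult.commute[of _ "emeasure lborel ?U"] ennreal_mult_le_mult_iff p3 p4)
  then show ?thesis by (simp add: ennreal_mult_le_mult_iff p1 p2)
qed

section \<open>Hermitian forms and their unit balls\<close>

lemma herm_add_left: "herm H (u + v) w = herm H u w + herm H v w"
  by (simp add: herm_def algebra_simps sum.distrib)
lemma herm_add_right: "herm H w (u + v) = herm H w u + herm H w v"
  by (simp add: herm_def algebra_simps sum.distrib)
lemma herm_scale_left: "herm H (c *s u) w = c * herm H u w"
  by (simp add: herm_def algebra_simps sum_distrib_left)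
lemma herm_scale_right: "herm H w (c *s u) = cnj c * herm H w u"
  by (simp add: herm_def algebra_simps sum_distrib_left)
lemma herm_zero_left [simp]: "herm H 0 w = 0"
  by (simp add: herm_def)
lemma herm_zero_right [simp]: "herm H w 0 = 0"
  by (simp add: herm_def)
lemma herm_sum_left: "herm H (\<Sum>i\<in>A. f i) w = (\<Sum>i\<in>A. herm H (f i) w)"
  by (induction A rule: infinite_finite_induct) (simp_all add: herm_add_left)
lemma herm_sum_right: "herm H w (\<Sum>i\<in>A. f i) = (\<Sum>i\<in>A. herm H w (f i))"
  by (induction A rule: infinite_finite_induct) (simp_all add: herm_add_right)
lemma herm_axis: "herm H (axis i a) (axis j b) = H $ i $ j * a * cnj b"
proof -
  have "herm H (axis i a) (axis j b) = (\<Sum>k\<in>UNIV. \<Sum>l\<in>UNIV. if k = i then (if l = j then H $ k $ l * a * cnj b else 0) else 0)"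
    unfolding herm_def by (intro sum.cong refl) (auto simp: axis_def)
  also have "\<dots> = (\<Sum>k\<in>UNIV. if k = i then (\<Sum>l\<in>UNIV. if l = j then H $ k $ l * a * cnj b else 0) else 0)"
    by (intro sum.cong refl) auto
  finally show ?thesis by simp
qed
lemma herm_diff_form: "herm (H - K) u v = herm H u v - herm K u v"
  by (simp add: herm_def algebra_simps sum_subtractf)
lemma herm_scaleR:
  fixes u v :: "complex ^ 'n::finite"
  shows "herm H (r *\<^sub>R u) (r *\<^sub>R v) = of_real (r\<^sup>2) * herm H u v"
proof -
  have "r *\<^sub>R w = of_real r *s w" for w :: "complex ^ 'n"
    by (simp add: vec_eq_iff) (simp add: scaleR_conv_of_real)
  then show ?thesis by (simp add: herm_scale_left herm_scale_right power2_eq_square)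
qed

lemma herm_mat_1: "herm (mat 1) v v = of_real ((norm v)\<^sup>2)"
proof -
  have "herm (mat 1) v v = (\<Sum>i\<in>UNIV. v $ i * cnj (v $ i))"
    by (simp add: herm_def mat_def if_distrib if_distribR cong: if_cong)
  also have "\<dots> = of_real (\<Sum>i\<in>UNIV. (cmod (v $ i))\<^sup>2)"
    by (simp add: complex_norm_square of_real_power del: of_real_power)
  also have "(\<Sum>i\<in>UNIV. (cmod (v $ i))\<^sup>2) = (norm v)\<^sup>2"
    by (simp add: norm_vec_def L2_set_def sum_nonneg)
  finally show ?thesis .
qed

lemma continuous_on_herm: "continuous_on UNIV (\<lambda>v. Re (herm H v v))"
  unfolding herm_def by (intro continuous_intros)

lemma open_herm_ball: "open (herm_ball H)"
  unfolding herm_ball_def using continuous_on_herm[of H]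
  by (auto intro!: open_Collect_less continuous_intros)

lemma hermitian_inner_productD: "hermitian_inner_product H \<Longrightarrow> H $ j $ i = cnj (H $ i $ j)"
  unfolding hermitian_inner_product_def by blast

lemma cmod_sq: "(cmod w)\<^sup>2 = Re w * Re w + Im w * Im w"
  unfolding cmod_power2 by (simp add: power2_eq_square)

text \<open>Polarization. With the diagonal known, e_i + e_j yields the real part of an entry and
  e_i + \<i> e_j its imaginary part.\<close>

lemma hermitian_quadratic_eqI:
  assumes H: "\<And>i j. H $ j $ i = cnj (H $ i $ j)" and K: "\<And>i j. K $ j $ i = cnj (K $ i $ j)"
    and eq: "\<And>v. Re (herm H v v) = Re (herm K v v)"
  shows "H = K"
proof -
  define D where "D = H - K"
  have D: "D $ j $ i = cnj (D $ i $ j)" for i j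
    using H[of i j] K[of i j] by (simp add: D_def)
  have z: "Re (herm D v v) = 0" for v
    using eq[of v] by (simp add: D_def herm_diff_form)
  have "D $ i $ j = 0" for i j
  proof -
    have *: "Re (D $ k $ k) = 0" for k
      using z[of "axis k 1"] by (simp add: herm_axis)
    have "Re (D $ i $ j) = 0"
      using z[of "axis i 1 + axis j 1"] D[of i j] * by (simp add: herm_add_left herm_add_right herm_axis)
    moreover have "Im (D $ i $ j) = 0"
      using z[of "axis i 1 + axis j \<i>"] D[of i j] * by (simp add: herm_add_left herm_add_right herm_axis)
    ultimately show ?thesis by (simp add: complex_eq_iff)
  qed
  then show ?thesis by (simp add: D_def vec_eq_iff)
qed

lemma hermitian_inner_product_coercive:
  fixes H :: "complex ^ 'n ^ 'n"
  assumes "hermitian_inner_product H"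
  obtains c where "c > 0" "\<And>v. Re (herm H v v) \<ge> c * (norm v)\<^sup>2"
proof -
  have ne: "sphere (0::complex^'n) 1 \<noteq> {}" using vector_choose_size[of 1] by (force simp: dist_norm)
  obtain u where u: "u \<in> sphere 0 1" and le: "\<And>v. v \<in> sphere 0 1 \<Longrightarrow> Re (herm H u u) \<le> Re (herm H v v)"
    using continuous_attains_inf[OF compact_sphere ne continuous_on_subset[OF continuous_on_herm[of H] subset_UNIV]] by auto
  have "u \<noteq> 0" using u by auto
  then have pos: "Re (herm H u u) > 0" using assms by (auto simp: hermitian_inner_product_def)
  have "Re (herm H v v) \<ge> Re (herm H u u) * (norm v)\<^sup>2" for v
  proof (cases "v = 0")
    case False
    define w where "w = (1 / norm v) *\<^sub>R v"
    have "norm w = 1" using False by (simp add: w_def)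
    then have "Re (herm H u u) \<le> Re (herm H w w)" using le by simp
    also have "\<dots> = Re (herm H v v) / (norm v)\<^sup>2"
      unfolding w_def herm_scaleR by (simp add: power_divide Re_divide_of_real flip: of_real_power)
    finally show ?thesis using False by (simp add: field_simps)
  qed simp
  then show ?thesis using that pos by blast
qed

lemma bounded_herm_ball:
  assumes "hermitian_inner_product H"
  shows "bounded (herm_ball H)"
proof -
  obtain c where c: "c > 0" "\<And>v. Re (herm H v v) \<ge> c * (norm v)\<^sup>2"
    using hermitian_inner_product_coercive[OF assms] by blast
  have "norm v \<le> sqrt (1/c)" if "v \<in> herm_ball H" for v
  proof (rule real_le_rsqrt)
    show "(norm v)\<^sup>2 \<le> 1/c" using c(1) c(2)[of v] that by (simp add: herm_ball_def field_simps)
  qed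
  then show ?thesis by (auto simp: bounded_iff)
qed

text \<open>Layer cake: the proportionality factor does not depend on the form.\<close>

lemma nn_integral_one_minus_herm:
  fixes H :: "complex ^ 'n::finite ^ 'n"
  assumes nonneg: "\<And>v. Re (herm H v v) \<ge> 0"
  shows "(\<integral>\<^sup>+v. ennreal (1 - Re (herm H v v)) \<partial>lborel)
    = (\<integral>\<^sup>+t. indicator {0<..<1} t * ennreal (sqrt t ^ DIM(complex^'n)) \<partial>lborel) * emeasure lborel (herm_ball H)"
proof -
  let ?q = "\<lambda>v. Re (herm H v v)"
  have [measurable]: "?q \<in> borel_measurable borel"
    using continuous_on_herm by (rule borel_measurable_continuous_onI)
  have "(\<integral>\<^sup>+v. ennreal (1 - ?q v) \<partial>lborel)
      = (\<integral>\<^sup>+v. (\<integral>\<^sup>+t. (if 0 < t \<and> t < 1 \<and> ?q v < t then 1 else 0) \<partial>lborel) \<partial>lborel)"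
  proof (rule nn_integral_cong)
    fix v
    have "(\<integral>\<^sup>+t. (if 0 < t \<and> t < 1 \<and> ?q v < t then 1 else 0) \<partial>lborel) = (\<integral>\<^sup>+t. indicator {?q v<..<1} t \<partial>lborel)"
      using nonneg[of v] by (intro nn_integral_cong) (auto simp: indicator_def)
    also have "\<dots> = ennreal (1 - ?q v)"
      by (cases "?q v \<le> 1") (auto simp: ennreal_neg)
    finally show "ennreal (1 - ?q v) = (\<integral>\<^sup>+t. (if 0 < t \<and> t < 1 \<and> ?q v < t then 1 else 0) \<partial>lborel)" by simp
  qed
  also have "\<dots> = (\<integral>\<^sup>+t. (\<integral>\<^sup>+v. (if 0 < t \<and> t < 1 \<and> ?q v < t then 1 else 0) \<partial>lborel) \<partial>lborel)"
    by (rule lborel_pair.Fubini') measurable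
  also have "\<dots> = (\<integral>\<^sup>+t. indicator {0<..<1} t * ennreal (sqrt t ^ DIM(complex^'n)) * emeasure lborel (herm_ball H) \<partial>lborel)"
  proof (rule nn_integral_cong)
    fix t :: real
    show "(\<integral>\<^sup>+v. (if 0 < t \<and> t < 1 \<and> ?q v < t then 1 else 0) \<partial>lborel)
      = indicator {0<..<1} t * ennreal (sqrt t ^ DIM(complex^'n)) * emeasure lborel (herm_ball H)"
    proof (cases "0 < t \<and> t < 1")
      case True
      have m: "{v. ?q v < t} \<in> sets borel" by measurable
      have "(\<integral>\<^sup>+v. (if 0 < t \<and> t < 1 \<and> ?q v < t then 1 else 0) \<partial>lborel) = (\<integral>\<^sup>+v. indicator {v. ?q v < t} v \<partial>lborel)"
        using True by (intro nn_integral_cong) (auto simp: indicator_def)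
      also have "\<dots> = (\<integral>\<^sup>+v. indicator {v. ?q v < t} v \<partial>density (distr lborel borel (\<lambda>x::complex^'n. 0 + sqrt t *\<^sub>R x)) (\<lambda>x. ennreal (\<bar>sqrt t\<bar> ^ DIM(complex^'n))))"
        using True by (subst lborel_affine[of "sqrt t" 0, symmetric]) auto
      also have "\<dots> = ennreal (sqrt t ^ DIM(complex^'n)) * (\<integral>\<^sup>+v. indicator {v. ?q v < t} (sqrt t *\<^sub>R v) \<partial>lborel)"
        using True m by (simp add: nn_integral_density nn_integral_distr nn_integral_cmult del: nn_integral_indicator)
      also have "(\<integral>\<^sup>+v. indicator {v. ?q v < t} (sqrt t *\<^sub>R v) \<partial>lborel) = (\<integral>\<^sup>+v. indicator (herm_ball H) v \<partial>lborel)"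
        using True by (intro nn_integral_cong) (auto simp: indicator_def herm_ball_def herm_scaleR field_simps simp flip: of_real_power)
      also have "\<dots> = emeasure lborel (herm_ball H)" using open_herm_ball[of H] by simp
      finally show ?thesis using True by simp
    qed auto
  qed
  also have "\<dots> = (\<integral>\<^sup>+t. indicator {0<..<1} t * ennreal (sqrt t ^ DIM(complex^'n)) \<partial>lborel) * emeasure lborel (herm_ball H)"
    by (rule nn_integral_multc) measurable
  finally show ?thesis .
qed

section \<open>Minimal volume and the diagonal of a Hermitian form\<close>

lemma herm_nonneg:
  assumes "hermitian_inner_product H"
  shows "0 \<le> Re (herm H v v)"
proof (cases "v = 0")
  case False
  then have "0 < Re (herm H v v)" using assms by (simp add: hermitian_inner_product_def)
  then show ?thesis by simp
qed simp

text \<open>One complex coordinate is two real ones; both are negated, so the real map is diagonal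
  with entries 1 and -1. It is the symmetry used against the off-diagonal terms.\<close>

lemma lborel_distr_flip:
  fixes i :: "'n::finite"
  defines "F \<equiv> (\<lambda>v::complex^'n. \<chi> j. if j = i then - v $ j else v $ j)"
  shows "distr lborel borel F = lborel"
proof -
  define c where "c = (\<lambda>b::complex^'n. if b = axis i 1 \<or> b = axis i \<i> then -1 else 1::real)"
  have F: "0 + (\<Sum>b\<in>Basis. (c b * (v \<bullet> b)) *\<^sub>R b) = F v" for v
  proof (rule euclidean_eqI)
    fix b :: "complex^'n" assume b: "b \<in> Basis"
    then obtain k u where ku: "b = axis k u" "u = 1 \<or> u = \<i>" by (auto simp: Basis_vec_def Basis_complex_def)
    have "(0 + (\<Sum>b\<in>Basis. (c b * (v \<bullet> b)) *\<^sub>R b)) \<bullet> b = c b * (v \<bullet> b)"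
      using b by simp
    also have "\<dots> = F v \<bullet> b"
      using ku by (auto simp: inner_axis F_def c_def axis_eq_axis)
    finally show "(0 + (\<Sum>b\<in>Basis. (c b * (v \<bullet> b)) *\<^sub>R b)) \<bullet> b = F v \<bullet> b" .
  qed
  have "lborel = density (distr lborel borel (\<lambda>v. 0 + (\<Sum>b\<in>Basis. (c b * (v \<bullet> b)) *\<^sub>R b))) (\<lambda>x. ennreal (\<Prod>b\<in>Basis. \<bar>c b\<bar>))"
    by (rule lborel_affine_euclidean) (auto simp: c_def)
  moreover have "(\<Prod>b\<in>Basis. \<bar>c b\<bar>) = 1" by (rule prod.neutral) (auto simp: c_def)
  ultimately show ?thesis unfolding F by (simp add: density_1)
qed

text \<open>The integrand is odd under the sign change of the i-th coordinate, which preserves both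
  the ball and the measure.\<close>

lemma set_integral_ball_cross_term:
  fixes i j :: "'n::finite"
  assumes "i \<noteq> j"
  shows "(LINT v:ball (0::complex^'n) 1|lborel. Re (a * v $ i * cnj (v $ j))) = 0"
proof -
  define F where "F = (\<lambda>v::complex^'n. \<chi> k. if k = i then - v $ k else v $ k)"
  define f where "f = (\<lambda>v::complex^'n. indicator (ball 0 1) v *\<^sub>R Re (a * v $ i * cnj (v $ j)))"
  have fm: "f \<in> borel_measurable borel" unfolding f_def
    by (intro borel_measurable_scaleR borel_measurable_indicator borel_measurable_continuous_onI continuous_intros) auto
  have "continuous_on UNIV F" unfolding F_def
  proof (rule continuous_on_vec_lambda)
    show "continuous_on UNIV (\<lambda>v::complex^'n. if k = i then - v $ k else v $ k)" for k
      by (cases "k = i") (auto intro!: continuous_intros)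
  qed
  then have Fm: "F \<in> borel_measurable borel" by (rule borel_measurable_continuous_onI)
  have nF: "norm (F v) = norm v" for v
    unfolding norm_vec_def L2_set_def by (intro arg_cong[of _ _ sqrt] sum.cong) (auto simp: F_def)
  have "a * F v $ i * cnj (F v $ j) = - (a * v $ i * cnj (v $ j))" for v
    using assms by (simp add: F_def)
  then have "Re (a * F v $ i * cnj (F v $ j)) = - Re (a * v $ i * cnj (v $ j))" for v
    by (simp only: uminus_complex.simps)
  then have fF: "f (F v) = - f v" for v
    unfolding f_def by (simp only: mem_ball_0 indicator_def nF scaleR_minus_right)
  have "integral\<^sup>L lborel f = integral\<^sup>L (distr lborel borel F) f"
    using lborel_distr_flip[of i] by (simp add: F_def)
  also have "\<dots> = (LINT v|lborel. f (F v))" using fm Fm by (simp add: integral_distr)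
  also have "\<dots> = - integral\<^sup>L lborel f" by (simp add: fF)
  finally show ?thesis unfolding f_def set_lebesgue_integral_def by simp
qed

lemma set_integrable_bounded_continuous:
  fixes f :: "'a::euclidean_space \<Rightarrow> real"
  assumes "continuous_on UNIV f" "bounded S" "S \<in> sets borel"
  shows "set_integrable lborel S f"
proof -
  obtain K where K: "S \<subseteq> K" "compact K"
    using assms(2) by (meson bounded_closure closure_subset compact_closure)
  have "set_integrable lborel K f" unfolding set_integrable_def
    by (rule borel_integrable_compact[OF K(2)]) (rule continuous_on_subset[OF assms(1)], simp)
  then show ?thesis by (rule set_integrable_subset) (use assms K in auto)
qed

lemma set_integral_sum_fun:
  fixes f :: "'i \<Rightarrow> 'a \<Rightarrow> real"
  assumes "\<And>i. i \<in> I \<Longrightarrow> set_integrable M A (f i)"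
  shows "(LINT x:A|M. (\<Sum>i\<in>I. f i x)) = (\<Sum>i\<in>I. LINT x:A|M. f i x)"
    and "set_integrable M A (\<lambda>x. \<Sum>i\<in>I. f i x)"
  using assms unfolding set_lebesgue_integral_def set_integrable_def scaleR_sum_right
  by (auto intro!: Bochner_Integration.integral_sum)

text \<open>Only the diagonal survives the integration, since each off-diagonal term is odd under a
  reflection. Conditions on single frame vectors thus control an integral of the whole form.\<close>

lemma set_integral_ball_herm_le:
  fixes H :: "complex ^ 'n::finite ^ 'n"
  assumes "\<And>i. Re (H $ i $ i) \<le> 1" and im: "\<And>i. Im (H $ i $ i) = 0"
  shows "(LINT v:ball (0::complex^'n) 1|lborel. Re (herm H v v)) \<le> (LINT v:ball (0::complex^'n) 1|lborel. (norm v)\<^sup>2)"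
proof -
  let ?B = "ball (0::complex^'n) 1"
  have int: "set_integrable lborel ?B (\<lambda>v. Re (a * v $ i * cnj (v $ j)))" for a i j
    by (intro set_integrable_bounded_continuous continuous_intros) auto
  have "(LINT v:?B|lborel. Re (herm H v v)) = (\<Sum>i\<in>UNIV. \<Sum>j\<in>UNIV. LINT v:?B|lborel. Re (H $ i $ j * v $ i * cnj (v $ j)))"
    unfolding herm_def Re_sum using int by (simp add: set_integral_sum_fun)
  also have "\<dots> = (\<Sum>i\<in>UNIV. LINT v:?B|lborel. Re (H $ i $ i * v $ i * cnj (v $ i)))"
  proof (rule sum.cong[OF refl])
    fix i
    have "(\<Sum>j\<in>UNIV. LINT v:?B|lborel. Re (H $ i $ j * v $ i * cnj (v $ j)))
       = (\<Sum>j\<in>UNIV. if j = i then (LINT v:?B|lborel. Re (H $ i $ i * v $ i * cnj (v $ i))) else 0)"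
    proof (intro sum.cong refl)
      fix j
      show "(LINT v:?B|lborel. Re (H $ i $ j * v $ i * cnj (v $ j)))
        = (if j = i then (LINT v:?B|lborel. Re (H $ i $ i * v $ i * cnj (v $ i))) else 0)"
      proof (cases "j = i")
        case False
        show ?thesis using False set_integral_ball_cross_term[OF not_sym[OF False], of "H $ i $ j"]
          by (simp only: if_False)
      qed (simp only: refl if_True)
    qed
    then show "(\<Sum>j\<in>UNIV. LINT v:?B|lborel. Re (H $ i $ j * v $ i * cnj (v $ j)))
       = (LINT v:?B|lborel. Re (H $ i $ i * v $ i * cnj (v $ i)))" by simp
  qed
  also have "\<dots> \<le> (\<Sum>i\<in>UNIV. LINT v:?B|lborel. Re (1 * v $ i * cnj (v $ i)))"
  proof (intro sum_mono set_integral_mono int)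
    fix i and v :: "complex^'n"
    have "Re (H $ i $ i * v $ i * cnj (v $ i)) = Re (H $ i $ i) * (cmod (v $ i))\<^sup>2"
      using im[of i] by (simp add: cmod_sq algebra_simps)
    also have "\<dots> \<le> 1 * (cmod (v $ i))\<^sup>2" by (intro mult_right_mono assms) auto
    finally show "Re (H $ i $ i * v $ i * cnj (v $ i)) \<le> Re (1 * v $ i * cnj (v $ i))"
      by (simp add: cmod_sq)
  qed
  also have "\<dots> = (LINT v:?B|lborel. (\<Sum>i\<in>UNIV. Re (1 * v $ i * cnj (v $ i))))"
    by (rule set_integral_sum_fun(1)[symmetric]) (rule int)
  also have "\<dots> = (LINT v:?B|lborel. (norm v)\<^sup>2)"
  proof (intro set_lebesgue_integral_cong allI impI)
    fix v :: "complex^'n"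
    show "(\<Sum>i\<in>UNIV. Re (1 * v $ i * cnj (v $ i))) = (norm v)\<^sup>2"
      by (simp add: norm_vec_def L2_set_def sum_nonneg cmod_sq)
  qed auto
  finally show ?thesis .
qed

lemma nn_integral_one_minus_herm_finite:
  fixes H :: "complex ^ 'n::finite ^ 'n"
  assumes hip: "hermitian_inner_product H"
  shows "(\<integral>\<^sup>+t. indicator {0<..<1} t * ennreal (sqrt t ^ DIM(complex^'n)) \<partial>lborel) * emeasure lborel (herm_ball H)
    = ennreal (LINT v:herm_ball H|lborel. 1 - Re (herm H v v))"
proof -
  let ?q = "\<lambda>v. Re (herm H v v)"
  have q0: "?q v \<ge> 0" for v by (rule herm_nonneg[OF hip])
  have cq: "continuous_on UNIV (\<lambda>v. 1 - ?q v)" by (intro continuous_on_diff continuous_on_const continuous_on_herm)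
  have hbm: "herm_ball H \<in> sets borel" by (simp add: borel_open open_herm_ball)
  have i1: "set_integrable lborel (herm_ball H) (\<lambda>v. 1 - ?q v)"
    by (intro set_integrable_bounded_continuous cq bounded_herm_ball hip hbm)
  have "(\<integral>\<^sup>+v. ennreal (1 - ?q v) \<partial>lborel) = (\<integral>\<^sup>+v. ennreal (indicator (herm_ball H) v *\<^sub>R (1 - ?q v)) \<partial>lborel)"
    by (intro nn_integral_cong) (auto simp: indicator_def herm_ball_def ennreal_neg)
  also have "\<dots> = ennreal (LINT v:herm_ball H|lborel. 1 - ?q v)" unfolding set_lebesgue_integral_def
    by (rule nn_integral_eq_integral) (use i1 in \<open>auto simp: set_integrable_def indicator_def herm_ball_def\<close>)
  finally show ?thesis using nn_integral_one_minus_herm[OF q0] by simp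
qed

lemma hermitian_inner_product_mat_1: "hermitian_inner_product (mat 1 :: complex ^ 'n::finite ^ 'n)"
  unfolding hermitian_inner_product_def herm_mat_1 by (auto simp: mat_def simp flip: of_real_power)

lemma herm_ball_mat_1: "herm_ball (mat 1 :: complex ^ 'n::finite ^ 'n) = ball 0 1"
  by (auto simp: herm_ball_def herm_mat_1 abs_square_less_1 simp flip: of_real_power)

text \<open>The integral of 1 - q is largest over \<open>herm_ball H\<close>, because the integrand
  is positive exactly there. The round ball is one competitor, and on it the diagonal bound applies.
  This gives the chain \<open>I3 \<le> I2 \<le> I1\<close>, whose ends are the two volumes up to the
  common factor \<open>C\<close>.\<close>

lemma hermitian_volume_ge_ball:
  fixes H :: "complex ^ 'n::finite ^ 'n"
  assumes hip: "hermitian_inner_product H" and diag: "\<And>i. Re (H $ i $ i) \<le> 1"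
  shows "emeasure lborel (ball (0::complex^'n) 1) \<le> emeasure lborel (herm_ball H)"
    and "emeasure lborel (herm_ball H) \<le> emeasure lborel (ball (0::complex^'n) 1) \<Longrightarrow> H = mat 1"
proof -
  let ?B = "ball (0::complex^'n) 1"
  let ?q = "\<lambda>v. Re (herm H v v)"
  have herm: "H $ j $ i = cnj (H $ i $ j)" for i j by (rule hermitian_inner_productD[OF hip])
  have im: "Im (H $ i $ i) = 0" for i using herm[of i i] by (simp add: complex_eq_iff)
  have q0: "?q v \<ge> 0" for v by (rule herm_nonneg[OF hip])
  define C where "C = (\<integral>\<^sup>+t. indicator {0<..<1} t * ennreal (sqrt t ^ DIM(complex^'n)) \<partial>lborel)"
  have cq: "continuous_on UNIV (\<lambda>v. 1 - ?q v)" by (intro continuous_on_diff continuous_on_const continuous_on_herm)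
  have hbm: "herm_ball H \<in> sets borel" by (simp add: borel_open open_herm_ball)
  have i1: "set_integrable lborel (herm_ball H) (\<lambda>v. 1 - ?q v)"
    by (intro set_integrable_bounded_continuous cq bounded_herm_ball hip hbm)
  have i2: "set_integrable lborel ?B (\<lambda>v. 1 - ?q v)"
    by (intro set_integrable_bounded_continuous cq) auto
  have i3: "set_integrable lborel ?B (\<lambda>v. 1 - (norm v)\<^sup>2)"
    by (rule set_integrable_bounded_continuous) (auto intro!: continuous_intros)
  have i4: "set_integrable lborel ?B ?q" "set_integrable lborel ?B (\<lambda>v. (norm v)\<^sup>2)" "set_integrable lborel ?B (\<lambda>v. 1::real)"
  proof -
    have B: "bounded ?B" "?B \<in> sets borel" by auto
    have c: "continuous_on UNIV (\<lambda>v::complex^'n. (norm v)\<^sup>2)" by (intro continuous_intros)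
    show "set_integrable lborel ?B ?q" by (rule set_integrable_bounded_continuous[OF continuous_on_herm B])
    show "set_integrable lborel ?B (\<lambda>v. (norm v)\<^sup>2)" by (rule set_integrable_bounded_continuous[OF c B])
    show "set_integrable lborel ?B (\<lambda>v. 1::real)" by (rule set_integrable_bounded_continuous[OF continuous_on_const B])
  qed
  define I1 where "I1 = (LINT v:herm_ball H|lborel. 1 - ?q v)"
  define I2 where "I2 = (LINT v:?B|lborel. 1 - ?q v)"
  define I3 where "I3 = (LINT v:?B|lborel. 1 - (norm v)\<^sup>2)"
  have Z': "C * emeasure lborel (herm_ball H) = ennreal I1"
    unfolding C_def I1_def by (rule nn_integral_one_minus_herm_finite[OF hip])
  have Z1': "C * emeasure lborel ?B = ennreal I3"
    using nn_integral_one_minus_herm_finite[OF hermitian_inner_product_mat_1, where 'n='n]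
    unfolding C_def I3_def herm_ball_mat_1 herm_mat_1 Re_complex_of_real .
  have I23: "I3 \<le> I2"
    using set_integral_ball_herm_le[of H, OF diag im] set_integral_diff(2)[OF i4(3,1)] set_integral_diff(2)[OF i4(3,2)]
    unfolding I2_def I3_def by linarith
  \<comment> \<open>Nonnegative because 1 - q is positive exactly on \<open>herm_ball H\<close>. In
    the case of equality its integral \<open>I1 - I2\<close> is zero, so \<psi> vanishes almost
    everywhere.\<close>
  define \<psi> where "\<psi> v = indicator (herm_ball H) v *\<^sub>R (1 - ?q v) - indicator ?B v *\<^sub>R (1 - ?q v)" for v
  have p0: "\<psi> v \<ge> 0" for v by (auto simp: \<psi>_def indicator_def herm_ball_def)
  have ip: "integrable lborel \<psi>" and Ip: "integral\<^sup>L lborel \<psi> = I1 - I2"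
    using i1 i2 unfolding \<psi>_def I1_def I2_def set_lebesgue_integral_def set_integrable_def
    by (auto simp: Bochner_Integration.integral_diff)
  have I12: "I2 \<le> I1" using Bochner_Integration.integral_nonneg[of lborel \<psi>] p0 Ip by simp
  have I30: "I3 \<ge> 0" unfolding I3_def set_lebesgue_integral_def
    by (rule Bochner_Integration.integral_nonneg) (auto simp: indicator_def power_le_one)
  have "emeasure lborel ?B \<noteq> 0" by (rule emeasure_open_ne_0) auto
  then have Cfin: "C \<noteq> top" using Z1' by (metis ennreal_neq_top ennreal_top_mult)
  have I3pos: "I3 \<noteq> 0"
  proof
    assume "I3 = 0"
    then have "AE v in lborel. indicator ?B v *\<^sub>R (1 - (norm v)\<^sup>2) = (0::real)"
      unfolding I3_def set_lebesgue_integral_def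
      by (subst (asm) integral_nonneg_eq_0_iff_AE) (use i3 in \<open>auto simp: set_integrable_def indicator_def power_le_one\<close>)
    then have "AE v in lborel. v \<notin> ?B"
      by (rule AE_mp) (auto simp: indicator_def abs_square_eq_1 intro!: AE_I2)
    moreover have "{v \<in> space lborel. \<not> v \<notin> ?B} = ?B" by auto
    ultimately have "emeasure lborel ?B = 0" by (subst (asm) AE_iff_measurable) auto
    then show False using \<open>emeasure lborel ?B \<noteq> 0\<close> by simp
  qed
  then have C0: "C \<noteq> 0" using Z1' I30 by auto
  have "C * emeasure lborel ?B \<le> C * emeasure lborel (herm_ball H)"
    unfolding Z' Z1' using I12 I23 by (intro ennreal_leI) simp
  then show "emeasure lborel ?B \<le> emeasure lborel (herm_ball H)"
    using ennreal_mult_le_mult_iff[OF C0 Cfin] by simp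
  assume "emeasure lborel (herm_ball H) \<le> emeasure lborel ?B"
  then have "ennreal I1 \<le> ennreal I3" unfolding Z'[symmetric] Z1'[symmetric] by (intro mult_left_mono) auto
  then have "I1 \<le> I3" using I30 by simp
  then have "integral\<^sup>L lborel \<psi> = 0" using Ip I12 I23 by simp
  then have "AE v in lborel. \<psi> v = 0"
    using integral_nonneg_eq_0_iff_AE[OF ip] p0 by simp
  moreover
  \<comment> \<open>The strict inequalities make this set open, and \<psi> is nonzero on it; an open
    null set is empty.\<close>
  define S where "S = {v. norm v < 1 \<and> ?q v > 1} \<union> {v. norm v > 1 \<and> ?q v < 1}"
  have oS: "open S" unfolding S_def
    by (intro open_Un open_Collect_conj open_Collect_less continuous_on_herm continuous_intros)
  have "v \<notin> S" if "\<psi> v = 0" for v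
    using that by (auto simp: S_def \<psi>_def indicator_def herm_ball_def)
  ultimately have "AE v in lborel. v \<notin> S" by auto
  then have "emeasure lborel S = 0"
    using oS by (subst (asm) AE_iff_measurable[OF _ refl]) auto
  then have Se: "S = {}" using emeasure_open_ne_0[OF oS] by auto
  have eq: "?q v = (norm v)\<^sup>2" for v
  proof (rule ccontr)
    assume ne: "?q v \<noteq> (norm v)\<^sup>2"
    \<comment> \<open>The mean of the two unequal values: after scaling by \<open>r\<close> one of
      them lies below 1 and the other above, which puts \<open>r *\<^sub>R v\<close> into
      \<open>S\<close>.\<close>
    define m where "m = (?q v + (norm v)\<^sup>2) / 2"
    have m0: "m > 0" 
    proof -
      have "?q v + (norm v)\<^sup>2 \<noteq> 0" using ne add_nonneg_eq_0_iff[OF q0[of v] zero_le_power2[of "norm v"]] by auto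
      moreover have "?q v + (norm v)\<^sup>2 \<ge> 0" using q0[of v] by simp
      ultimately show ?thesis unfolding m_def by (simp add: le_neq_trans)
    qed
    define r where "r = 1 / sqrt m"
    have r: "r\<^sup>2 = 1 / m" "r > 0" using m0 by (simp_all add: r_def power_divide)
    have 1: "?q (r *\<^sub>R v) = ?q v / m" unfolding herm_scaleR r by (simp flip: of_real_divide)
    have 2: "(norm (r *\<^sub>R v))\<^sup>2 = (norm v)\<^sup>2 / m" using r by (simp add: power_mult_distrib)
    have "x < 1 \<longleftrightarrow> x\<^sup>2 < 1" "x > 1 \<longleftrightarrow> x\<^sup>2 > 1" if "x \<ge> 0" for x :: real
      using abs_square_less_1[of x] abs_square_le_1[of x] that by auto
    note g = this[OF norm_ge_zero]
    have 3: "norm (r *\<^sub>R v) < 1 \<longleftrightarrow> (norm v)\<^sup>2 / m < 1" "norm (r *\<^sub>R v) > 1 \<longleftrightarrow> (norm v)\<^sup>2 / m > 1"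
      unfolding 2[symmetric] by (rule g)+
    have "r *\<^sub>R v \<in> S" unfolding S_def mem_Collect_eq Un_iff 3 1
      using ne m0 by (auto simp: m_def field_simps)
    then show False using Se by simp
  qed
  show "H = mat 1"
  proof (rule hermitian_quadratic_eqI)
    show "H $ j $ i = cnj (H $ i $ j)" for i j by (rule herm)
    show "(mat 1 :: complex^'n^'n) $ j $ i = cnj (mat 1 $ i $ j)" for i j by (simp add: mat_def)
    show "Re (herm H v v) = Re (herm (mat 1) v v)" for v
      by (simp only: eq herm_mat_1 Re_complex_of_real)
  qed
qed

text \<open>In the coordinates of the frame, H is the standard form. A competitor K satisfies K(E_i,
  E_i) \<le> 1, because its unit ball contains t E_i for all t < 1; asking only for such t lets E_i
  lie on the boundary of the indicatrix. The equality case of the volume estimate supplies the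
  uniqueness that the definite description in \<open>wu_metric\<close> requires.\<close>

theorem wu_metric_eqI:
  fixes H :: "complex ^ 'n::finite ^ 'n" and E :: "'n \<Rightarrow> complex ^ 'n"
  assumes hip: "hermitian_inner_product H"
    and sub: "kobayashi_indicatrix D z \<subseteq> herm_ball H"
    and orth: "\<And>i j. herm H (E i) (E j) = (if i = j then 1 else 0)"
    and mem: "\<And>i t. 0 \<le> t \<Longrightarrow> t < 1 \<Longrightarrow> of_real t *s E i \<in> kobayashi_indicatrix D z"
  shows "wu_metric D z = H"
proof -
  define T where "T c = (\<Sum>i\<in>UNIV. c $ i *s E i)" for c :: "complex^'n"
  define pb where "pb K = (\<chi> i j. herm K (E i) (E j))" for K :: "complex^'n^'n"
  have pbT: "herm (pb K) c d = herm K (T c) (T d)" for K c d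
  proof -
    have "herm K (T c) (T d) = (\<Sum>i\<in>UNIV. \<Sum>j\<in>UNIV. c $ i * (cnj (d $ j) * herm K (E i) (E j)))"
      unfolding T_def herm_sum_left herm_scale_left unfolding herm_sum_right herm_scale_right
      by (simp add: sum_distrib_left)
    then show ?thesis unfolding herm_def[of "pb K"] by (simp add: pb_def mult_ac)
  qed
  have pbH: "pb H = mat 1" by (simp add: pb_def mat_def orth vec_eq_iff)
  have linT: "linear T"
  proof (rule linearI)
    show "T (x + y) = T x + T y" for x y
      by (simp add: T_def vec.scale_left_distrib sum.distrib)
    have "(r *\<^sub>R x $ i) *s E i = r *\<^sub>R (x $ i *s E i)" for r and x :: "complex^'n" and i
      by (simp add: vec_eq_iff)
    then show "T (r *\<^sub>R x) = r *\<^sub>R T x" for r x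
      by (simp add: T_def scaleR_sum_right)
  qed
  have T0: "c = 0" if "T c = 0" for c
    using pbT[of H c c] that by (simp add: pbH herm_mat_1)
  then have "inj T" using linT by (simp add: linear_injective_0)
  then obtain R where R: "linear R" "\<And>x. R (T x) = x" "\<And>x. T (R x) = x"
    using linear_injective_isomorphism[OF linT] by blast
  have ball_pb: "herm_ball (pb K) = T -` herm_ball K" for K
    by (auto simp: herm_ball_def pbT)
  have vol: "emeasure lborel (herm_ball (pb K)) \<le> emeasure lborel (herm_ball (pb L))
      \<longleftrightarrow> emeasure lborel (herm_ball K) \<le> emeasure lborel (herm_ball L)" for K L
    unfolding ball_pb
    by (rule emeasure_linear_iso_mono_iff[OF R(1) linT R(3,2)]) (auto intro: borel_open open_herm_ball)
  have volH: "herm_ball (pb H) = ball 0 1"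
    by (auto simp: pbH herm_ball_def herm_mat_1 abs_square_less_1 simp flip: of_real_power)
  have other: "emeasure lborel (herm_ball H) \<le> emeasure lborel (herm_ball K)"
      "emeasure lborel (herm_ball K) \<le> emeasure lborel (herm_ball H) \<Longrightarrow> K = H"
    if K: "hermitian_inner_product K" "kobayashi_indicatrix D z \<subseteq> herm_ball K" for K
  proof -
    have sym: "herm K u v = cnj (herm K v u)" for u v
    proof -
      have "cnj (herm K v u) = (\<Sum>i\<in>UNIV. \<Sum>j\<in>UNIV. K $ j $ i * u $ j * cnj (v $ i))"
        by (simp add: herm_def hermitian_inner_productD[OF K(1), symmetric] mult_ac)
      also have "\<dots> = herm K u v" unfolding herm_def by (rule sum.swap)
      finally show ?thesis by simp
    qed
    have hipK: "hermitian_inner_product (pb K)"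
      unfolding hermitian_inner_product_def
    proof (intro conjI allI impI)
      show "pb K $ j $ i = cnj (pb K $ i $ j)" for i j unfolding pb_def vec_lambda_beta by (rule sym)
      show "0 < Re (herm (pb K) v v)" if "v \<noteq> 0" for v
        using T0[of v] that K(1) by (auto simp: pbT hermitian_inner_product_def)
    qed
    have diag: "Re (pb K $ i $ i) \<le> 1" for i
    proof (rule ccontr)
      let ?x = "Re (herm K (E i) (E i))"
      assume "\<not> Re (pb K $ i $ i) \<le> 1"
      then have x: "?x > 1" by (simp add: pb_def)
      \<comment> \<open>If the entry exceeded 1, this multiple of E_i would have K-length exactly 1
        and so miss the open ball.\<close>
      define t where "t = 1 / sqrt ?x"
      have t: "0 \<le> t" "t < 1" "t\<^sup>2 = 1 / ?x" using x by (simp_all add: t_def power_divide)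
      have "of_real t *s E i \<in> herm_ball K" using mem[OF t(1,2)] K(2) by blast
      then have "t\<^sup>2 * ?x < 1"
        by (simp add: herm_ball_def herm_scale_left herm_scale_right power2_eq_square)
      then show False using t(3) x by simp
    qed
    show "emeasure lborel (herm_ball H) \<le> emeasure lborel (herm_ball K)"
      unfolding vol[symmetric] volH by (rule hermitian_volume_ge_ball(1)[OF hipK diag])
    assume "emeasure lborel (herm_ball K) \<le> emeasure lborel (herm_ball H)"
    then have "pb K = mat 1" unfolding vol[symmetric] volH by (rule hermitian_volume_ge_ball(2)[OF hipK diag])
    then have "herm K (T (R v)) (T (R v)) = herm H (T (R v)) (T (R v))" for v
      unfolding pbT[symmetric] pbH by simp
    then have "herm K v v = herm H v v" for v by (simp only: R(3))
    then show "K = H"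
      by (intro hermitian_quadratic_eqI hermitian_inner_productD K(1) hip) simp
  qed
  show ?thesis unfolding wu_metric_def
  proof (rule the_equality)
    show "hermitian_inner_product H \<and> kobayashi_indicatrix D z \<subseteq> herm_ball H \<and>
      (\<forall>H'. hermitian_inner_product H' \<and> kobayashi_indicatrix D z \<subseteq> herm_ball H' \<longrightarrow>
        emeasure lborel (herm_ball H) \<le> emeasure lborel (herm_ball H'))"
      using hip sub other(1) by simp
    show "K = H" if "hermitian_inner_product K \<and> kobayashi_indicatrix D z \<subseteq> herm_ball K \<and>
      (\<forall>H'. hermitian_inner_product H' \<and> kobayashi_indicatrix D z \<subseteq> herm_ball H' \<longrightarrow>
        emeasure lborel (herm_ball K) \<le> emeasure lborel (herm_ball H'))" for K
    proof (rule other(2))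
      show "emeasure lborel (herm_ball K) \<le> emeasure lborel (herm_ball H)" using that hip sub by simp
    qed (use that in simp_all)
  qed
qed

section \<open>A Schwarz lemma\<close>

lemma sinh_scale_less:
  fixes m x :: real
  assumes "0 < m" "m < 1" "0 < x"
  shows "sinh (m * x) < m * sinh x"
proof -
  define f where "f x = m * sinh x - sinh (m * x)" for x
  have "f 0 < f x"
  proof (rule DERIV_pos_imp_increasing_open[OF assms(3)])
    fix y :: real assume y: "0 < y" "y < x"
    have "(f has_real_derivative (m * cosh y - cosh (m * y) * m)) (at y)"
      unfolding f_def by (auto intro!: derivative_eq_intros)
    moreover have "cosh (m * y) < cosh y"
      using assms y by (subst cosh_real_nonneg_less_iff) auto
    then have "m * cosh y - cosh (m * y) * m > 0" using assms by (simp add: mult.commute)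
    ultimately show "\<exists>l. DERIV f y :> l \<and> l > 0" by blast
  qed (auto simp: f_def intro!: continuous_intros)
  then show ?thesis by (simp add: f_def)
qed

text \<open>This is m tanh x \<le> tanh (m x) cleared of denominators. The derivative of the
  difference of the two sides collapses to (1 - m^2) sinh x sinh (m x).\<close>

lemma tanh_scale_le:
  fixes m x :: real
  assumes "0 < m" "m < 1" "0 < x"
  shows "m * cosh (m * x) * sinh x \<le> cosh x * sinh (m * x)"
proof -
  define f where "f x = cosh x * sinh (m * x) - m * cosh (m * x) * sinh x" for x
  have "f 0 \<le> f x"
  proof (rule DERIV_nonneg_imp_nondecreasing[OF less_imp_le[OF assms(3)]])
    fix y :: real assume y: "0 \<le> y" "y \<le> x"
    have "(f has_real_derivative (1 - m\<^sup>2) * sinh y * sinh (m * y)) (at y)"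
      unfolding f_def by (auto intro!: derivative_eq_intros simp: algebra_simps power2_eq_square)
    moreover have "(1 - m\<^sup>2) * sinh y * sinh (m * y) \<ge> 0"
      using assms y by (intro mult_nonneg_nonneg) (auto simp: power_le_one)
    ultimately show "\<exists>l. DERIV f y :> l \<and> l \<ge> 0" by blast
  qed
  then show ?thesis by (simp add: f_def)
qed

text \<open>The substitution E = exp (-2 x), under which a power of E only rescales x. Comparisons
  of E with \<open>E powr m\<close> become comparisons of hyperbolic functions at x and m x.\<close>

lemma powr_as_exp_sinh:
  fixes E :: real
  assumes "0 < E" "E < 1"
  obtains x where "0 < x" "\<And>m. E powr m = exp (- (m * x)) ^ 2"
    "\<And>m. 1 - E powr m = 2 * exp (- (m * x)) * sinh (m * x)"
    "\<And>m. 1 + E powr m = 2 * exp (- (m * x)) * cosh (m * x)"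
proof
  let ?x = "- ln E / 2"
  have e: "E powr m = exp (- (m * ?x)) ^ 2" for m
    using assms by (simp add: powr_def power2_eq_square flip: exp_add)
  show "0 < ?x" using assms by simp
  show "E powr m = exp (- (m * ?x)) ^ 2" for m by (rule e)
  show "1 - E powr m = 2 * exp (- (m * ?x)) * sinh (m * ?x)" for m
    unfolding e sinh_field_def by (simp add: power2_eq_square algebra_simps flip: exp_add)
  show "1 + E powr m = 2 * exp (- (m * ?x)) * cosh (m * ?x)" for m
    unfolding e cosh_field_def by (simp add: power2_eq_square algebra_simps flip: exp_add)
qed

lemma powr_less_one_of: "0 \<le> E \<Longrightarrow> E < 1 \<Longrightarrow> 0 < m \<Longrightarrow> E powr m < (1::real)"
  by (metis powr_0 powr_less_mono' powr_zero_eq_one powr_one_eq_one powr_less_mono2 powr_one_gt_zero_iff less_eq_real_def zero_less_one)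

text \<open>Under the substitution the left side is 1 / (4 sinh^2 x) and the right side m^2 / (4
  sinh^2 (m x)), so this is the square of sinh (m x) < m sinh x.\<close>

lemma Poincare_coeff_less:
  fixes m E :: real
  assumes m: "0 < m" "m < 1" and E: "0 < E" "E < 1"
  shows "E / (1 - E)\<^sup>2 < m\<^sup>2 * E powr m / (1 - E powr m)\<^sup>2"
proof -
  obtain x where x: "0 < x" and e: "\<And>m. E powr m = exp (- (m * x)) ^ 2"
    "\<And>m. 1 - E powr m = 2 * exp (- (m * x)) * sinh (m * x)"
    using powr_as_exp_sinh[OF E] by metis
  have *: "E powr k / (1 - E powr k)\<^sup>2 = 1 / (4 * (sinh (k * x))\<^sup>2)" if "k > 0" for k
    unfolding e(2) unfolding e(1) using that x by (simp add: power_mult_distrib field_simps)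
  have pos: "(sinh (m * x))\<^sup>2 > 0" "(sinh x)\<^sup>2 > 0" using m x by auto
  have s: "0 < sinh (m * x)" "sinh (m * x) < m * sinh x" "sinh x > 0"
    using sinh_scale_less[OF m x] m x by auto
  then have "(sinh (m * x))\<^sup>2 < (m * sinh x)\<^sup>2" by (intro power_strict_mono) auto
  then have "1 / (4 * (sinh x)\<^sup>2) < m\<^sup>2 / (4 * (sinh (m * x))\<^sup>2)"
    using pos by (simp add: field_simps power_mult_distrib)
  moreover have "m\<^sup>2 * E powr m / (1 - E powr m)\<^sup>2 = m\<^sup>2 / (4 * (sinh (m * x))\<^sup>2)"
    using *[OF m(1)] by (metis mult.right_neutral times_divide_eq_right)
  ultimately show ?thesis using *[of 1] E by simp
qed

lemma Poincare_coeff_le: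
  fixes m E :: real
  assumes "0 < m" "m < 1" "0 \<le> E" "E < 1"
  shows "E / (1 - E)\<^sup>2 \<le> m\<^sup>2 * E powr m / (1 - E powr m)\<^sup>2"
  using Poincare_coeff_less[of m E] assms by (cases "E = 0") auto

text \<open>The same substitution turns this into coth (m x) \<le> coth x / m. It later bounds from
  below the mixed normal-tangential term in the curvature along a curve.\<close>

lemma coth_powr_le:
  fixes m E :: real
  assumes m: "0 < m" "m < 1" and E: "0 \<le> E" "E < 1"
  shows "(1 + E powr m) / (1 - E powr m) \<le> (1 + E) / (1 - E) / m"
proof (cases "E = 0")
  case False
  then have E': "0 < E" using E by simp
  obtain x where x: "0 < x" and e:
    "\<And>m. 1 - E powr m = 2 * exp (- (m * x)) * sinh (m * x)"
    "\<And>m. 1 + E powr m = 2 * exp (- (m * x)) * cosh (m * x)"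
    using powr_as_exp_sinh[OF E' E(2)] by metis
  have *: "(1 + E powr k) / (1 - E powr k) = cosh (k * x) / sinh (k * x)" if "k > 0" for k
    unfolding e using that x by (simp add: field_simps)
  have "cosh (m * x) / sinh (m * x) \<le> cosh x / sinh x / m"
    using tanh_scale_le[OF m x] m x by (simp add: field_simps)
  then show ?thesis using *[of 1] *[of m] m E' by simp
qed (use m in auto)

lemma exp_scale_less:
  fixes m t :: real
  assumes "0 < m" "m < 1" "0 < t"
  shows "exp (m * t) - 1 < m * (exp t - 1)"
proof -
  define f where "f t = m * (exp t - 1) - (exp (m * t) - 1)" for t
  have "f 0 < f t"
  proof (rule DERIV_pos_imp_increasing_open[OF assms(3)])
    fix y :: real assume y: "0 < y" "y < t"
    have "(f has_real_derivative (m * exp y - exp (m * y) * m)) (at y)"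
      unfolding f_def by (auto intro!: derivative_eq_intros)
    moreover have "exp (m * y) < exp y" using assms y by simp
    then have "m * exp y - exp (m * y) * m > 0" using assms by (simp add: mult.commute)
    ultimately show "\<exists>l. DERIV f y :> l \<and> l > 0" by blast
  qed (auto simp: f_def intro!: continuous_intros)
  then show ?thesis by (simp add: f_def)
qed

text \<open>The function \<open>ln ((1 - x) / (1 - x powr m))\<close> is convex and increasing in \<open>ln x\<close>; the
  minorant is its tangent at \<open>ln x\<^sub>0\<close>.\<close>

lemma power_minorant:
  fixes m x0 :: real
  assumes m: "0 < m" "m < 1" and x0: "0 < x0" "x0 < 1"
  obtains C c where "0 < C" "0 < c" "C * x0 powr c = (1 - x0) / (1 - x0 powr m)"
    "\<And>x. 0 \<le> x \<Longrightarrow> x < 1 \<Longrightarrow> C * x powr c \<le> (1 - x) / (1 - x powr m)"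
proof -
  define g where "g t = ln (1 - exp t) - ln (1 - exp (m * t))" for t
  define g' where "g' t = - (exp t / (1 - exp t)) + m * (exp (m * t) / (1 - exp (m * t)))" for t :: real
  define g2 where "g2 t = - (exp t / (1 - exp t)\<^sup>2) + m\<^sup>2 * exp (m * t) / (1 - exp (m * t))\<^sup>2" for t :: real
  have mt: "m * t < 0" if "t < 0" for t using that m by (simp add: mult_pos_neg)
  have pos: "1 - exp t > 0" "1 - exp (m * t) > 0" if "t < 0" for t using that mt[OF that] by auto
  have d1: "(g has_real_derivative g' t) (at t)" if "t < 0" for t
    unfolding g_def g'_def by (rule derivative_eq_intros refl | use pos[OF that] in simp)+
  have d2: "(g' has_real_derivative g2 t) (at t)" if "t < 0" for t
  proof -
    have 1: "((\<lambda>t. exp (k * t) / (1 - exp (k * t))) has_real_derivative k * exp (k * t) / (1 - exp (k * t))\<^sup>2) (at t)"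
      if "1 - exp (k * t) > 0" for k
    proof -
      have "((\<lambda>t. exp (k * t) / (1 - exp (k * t))) has_real_derivative
         (k * exp (k * t) * (1 - exp (k * t)) - exp (k * t) * (- (k * exp (k * t)))) / ((1 - exp (k * t)) * (1 - exp (k * t)))) (at t)"
        by (rule DERIV_divide) (use that in \<open>auto intro!: derivative_eq_intros\<close>)
      then show ?thesis by (simp add: algebra_simps power2_eq_square)
    qed
    show ?thesis unfolding g'_def g2_def
      using DERIV_add[OF DERIV_minus[OF 1[of 1]] DERIV_cmult[OF 1[of m], of m]] pos[OF that]
      by (simp add: power2_eq_square mult.assoc)
  qed
  have g2: "g2 t \<ge> 0" if "t < 0" for t
    using Poincare_coeff_le[OF m, of "exp t"] that by (simp add: g2_def powr_def)
  \<comment> \<open>The second derivative \<open>g2\<close> is the difference of the two sides of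
    \<open>Poincare_coeff_le\<close> at E = exp t.\<close>
  have conv: "convex_on {..<0} g"
    by (rule f''_ge0_imp_convex[where f' = g' and f'' = g2]) (use d1 d2 g2 in auto)
  define t0 where "t0 = ln x0"
  have t0: "t0 < 0" "exp t0 = x0" "exp (m * t0) = x0 powr m" using x0 by (auto simp: t0_def powr_def)
  define c where "c = g' t0"
  define C where "C = exp (g t0 - c * t0)"
  have expg: "exp (g t) = (1 - exp t) / (1 - exp (m * t))" if "t < 0" for t
    unfolding g_def using pos[OF that] by (simp add: exp_diff)
  show ?thesis
  proof (rule that[of C c])
    show "C > 0" by (simp add: C_def)
    \<comment> \<open>The slope at \<open>t0\<close> is m / (exp (- m t0) - 1) - 1 / (exp (- t0) -
      1), positive by \<open>exp_scale_less\<close>. A positive exponent keeps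
      \<open>C * x powr c\<close> continuous at x = 0.\<close>
    have "exp (m * (- t0)) - 1 < m * (exp (- t0) - 1)" using exp_scale_less[OF m, of "- t0"] t0 by simp
    moreover have "m * (exp (m * t0) / (1 - exp (m * t0))) = m / (exp (- (m * t0)) - 1)"
      using pos[OF t0(1)] by (simp add: exp_minus field_simps)
    moreover have "exp t0 / (1 - exp t0) = 1 / (exp (- t0) - 1)"
      using pos[OF t0(1)] by (simp add: exp_minus field_simps)
    moreover have "exp (- t0) - 1 > 0" "exp (- (m * t0)) - 1 > 0" using t0 mt by auto
    moreover have "- (1 / a) + m / b > 0" if "b < m * a" "a > 0" "b > 0" for a b :: real
      using that by (simp add: field_simps)
    ultimately show "c > 0" unfolding c_def g'_def by simp
    have *: "C * x powr c = exp (g t0 + c * (ln x - t0))" if "x > 0" for x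
      using that by (simp add: C_def powr_def algebra_simps flip: exp_add)
    show "C * x0 powr c = (1 - x0) / (1 - x0 powr m)"
      using *[OF x0(1)] expg[OF t0(1)] t0 by (simp add: t0_def)
    fix x :: real assume x: "0 \<le> x" "x < 1"
    show "C * x powr c \<le> (1 - x) / (1 - x powr m)"
    proof (cases "x = 0")
      case True
      then show ?thesis by simp
    next
      case False
      then have x': "0 < x" using x by simp
      then have lx: "ln x < 0" using x by simp
      have "c * (ln x - t0) \<le> g (ln x) - g t0"
        unfolding c_def by (rule convex_on_imp_above_tangent[OF conv]) (use t0 lx d1 in \<open>auto intro: has_field_derivative_at_within simp: interior_open\<close>)
      then have "C * x powr c \<le> exp (g (ln x))" unfolding *[OF x'] by simp
      then show ?thesis using expg[OF lx] x' by (simp add: powr_def)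
    qed
  qed
qed

text \<open>A function that is supported from below by the squared norm of a holomorphic map at each
  point satisfies the maximum principle; adding \<open>\<epsilon> \<bar>\<zeta>\<bar>\<^sup>2\<close> makes interior maxima impossible.\<close>

lemma max_principle_support:
  fixes \<Phi> :: "complex \<Rightarrow> real" and I :: "'i set"
  assumes r: "r > 0" and cont: "continuous_on (cball 0 r) \<Phi>"
    and bd: "\<And>\<zeta>. cmod \<zeta> = r \<Longrightarrow> \<Phi> \<zeta> \<le> B" and I: "finite I"
    and supp: "\<And>\<zeta>0. \<zeta>0 \<in> ball 0 r \<Longrightarrow> \<exists>V d. d > 0 \<and> (\<forall>i\<in>I. V i holomorphic_on ball \<zeta>0 d) \<and>
      (\<forall>\<zeta>\<in>ball \<zeta>0 d \<inter> ball 0 r. (\<Sum>i\<in>I. (cmod (V i \<zeta>))\<^sup>2) \<le> \<Phi> \<zeta>) \<and> \<Phi> \<zeta>0 = (\<Sum>i\<in>I. (cmod (V i \<zeta>0))\<^sup>2)"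
  shows "\<Phi> 0 \<le> B"
proof (rule ccontr)
  assume "\<not> \<Phi> 0 \<le> B"
  \<comment> \<open>Half the excess over B, divided by r^2, so that the added term \<epsilon>
    |\<zeta>|^2 cannot lift the values on the circle to the value at 0.\<close>
  define \<epsilon> where "\<epsilon> = (\<Phi> 0 - B) / (2 * r\<^sup>2)"
  have \<epsilon>: "\<epsilon> > 0" "\<epsilon> * r\<^sup>2 < \<Phi> 0 - B" using \<open>\<not> \<Phi> 0 \<le> B\<close> r by (auto simp: \<epsilon>_def field_simps)
  define \<Psi> where "\<Psi> \<zeta> = \<Phi> \<zeta> + \<epsilon> * (cmod \<zeta>)\<^sup>2" for \<zeta>
  have "continuous_on (cball 0 r) \<Psi>" unfolding \<Psi>_def by (intro continuous_intros cont)
  then obtain \<zeta>0 where z0: "\<zeta>0 \<in> cball 0 r" and mx: "\<And>\<zeta>. \<zeta> \<in> cball 0 r \<Longrightarrow> \<Psi> \<zeta> \<le> \<Psi> \<zeta>0"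
    using continuous_attains_sup[of "cball 0 r" \<Psi>] r by auto
  have "\<Psi> \<zeta>0 \<ge> \<Phi> 0" using mx[of 0] r by (simp add: \<Psi>_def)
  then have "cmod \<zeta>0 \<noteq> r" using bd[of \<zeta>0] \<epsilon> by (auto simp: \<Psi>_def)
  then have z0': "\<zeta>0 \<in> ball 0 r" using z0 by simp
  obtain V d where d: "d > 0" and V: "\<And>i. i \<in> I \<Longrightarrow> V i holomorphic_on ball \<zeta>0 d"
    and le: "\<And>\<zeta>. \<zeta> \<in> ball \<zeta>0 d \<inter> ball 0 r \<Longrightarrow> (\<Sum>i\<in>I. (cmod (V i \<zeta>))\<^sup>2) \<le> \<Phi> \<zeta>"
    and eq: "\<Phi> \<zeta>0 = (\<Sum>i\<in>I. (cmod (V i \<zeta>0))\<^sup>2)" using supp[OF z0'] by blast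
  define \<delta> where "\<delta> = min (d/2) ((r - cmod \<zeta>0) / 2)"
  have \<delta>: "\<delta> > 0" "\<delta> < d" "\<delta> < r - cmod \<zeta>0" using d z0' by (auto simp: \<delta>_def min_less_iff_disj)
  have sub: "cball \<zeta>0 \<delta> \<subseteq> ball \<zeta>0 d \<inter> ball 0 r"
  proof
    fix \<zeta> assume "\<zeta> \<in> cball \<zeta>0 \<delta>"
    then have "dist \<zeta>0 \<zeta> \<le> \<delta>" by simp
    moreover have "cmod \<zeta> \<le> cmod \<zeta>0 + dist \<zeta>0 \<zeta>"
      by (metis dist_norm norm_minus_commute norm_triangle_sub)
    ultimately show "\<zeta> \<in> ball \<zeta>0 d \<inter> ball 0 r" using \<delta> by simp
  qed
  \<comment> \<open>The inner product of the vector (V, sqrt \<epsilon> \<zeta>) with its value at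
    \<zeta>0. It is holomorphic, and its real part at \<zeta>0 is the maximum of \<Psi>; expanding
    the squared distance of the two vectors puts its real part below that maximum by \<epsilon>
    \<delta>^2 / 2 on the circle of radius \<delta>. This contradicts the maximum principle for real
    parts.\<close>
  define l where "l \<zeta> = (\<Sum>i\<in>I. V i \<zeta> * cnj (V i \<zeta>0)) + of_real \<epsilon> * \<zeta> * cnj \<zeta>0" for \<zeta>
  have hol: "l holomorphic_on cball \<zeta>0 \<delta>"
    unfolding l_def using V sub by (intro holomorphic_intros) (auto intro: holomorphic_on_subset)
  have l0: "Re (l \<zeta>0) = \<Psi> \<zeta>0"
    by (simp add: l_def \<Psi>_def eq cmod_sq algebra_simps sum.distrib)
  have sq: "(cmod (a - b))\<^sup>2 = (cmod a)\<^sup>2 + (cmod b)\<^sup>2 - 2 * Re (a * cnj b)" for a b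
    by (simp add: cmod_sq algebra_simps)
  have "Re (l \<zeta>) \<le> \<Psi> \<zeta>0 - \<epsilon> * \<delta>\<^sup>2 / 2" if "\<zeta> \<in> frontier (ball \<zeta>0 \<delta>)" for \<zeta>
  proof -
    have dz: "dist \<zeta>0 \<zeta> = \<delta>" using that \<delta> by (simp add: frontier_ball)
    then have mem: "\<zeta> \<in> ball \<zeta>0 d \<inter> ball 0 r" using sub by auto
    have "\<epsilon> * \<delta>\<^sup>2 \<le> (\<Sum>i\<in>I. (cmod (V i \<zeta> - V i \<zeta>0))\<^sup>2) + \<epsilon> * (cmod (\<zeta> - \<zeta>0))\<^sup>2"
      using dz by (simp add: dist_norm norm_minus_commute sum_nonneg)
    also have "\<dots> = (\<Sum>i\<in>I. (cmod (V i \<zeta>))\<^sup>2) + \<epsilon> * (cmod \<zeta>)\<^sup>2 + ((\<Sum>i\<in>I. (cmod (V i \<zeta>0))\<^sup>2) + \<epsilon> * (cmod \<zeta>0)\<^sup>2) - 2 * Re (l \<zeta>)"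
    proof -
      have "(\<Sum>i\<in>I. (cmod (V i \<zeta> - V i \<zeta>0))\<^sup>2) = (\<Sum>i\<in>I. (cmod (V i \<zeta>))\<^sup>2) + (\<Sum>i\<in>I. (cmod (V i \<zeta>0))\<^sup>2)
          - 2 * Re (\<Sum>i\<in>I. V i \<zeta> * cnj (V i \<zeta>0))"
        unfolding Re_sum by (simp only: sq sum.distrib sum_subtractf sum_distrib_left)
      moreover have "\<epsilon> * (cmod (\<zeta> - \<zeta>0))\<^sup>2 = \<epsilon> * (cmod \<zeta>)\<^sup>2 + \<epsilon> * (cmod \<zeta>0)\<^sup>2 - 2 * Re (of_real \<epsilon> * \<zeta> * cnj \<zeta>0)"
        unfolding sq by (simp add: algebra_simps)
      ultimately show ?thesis unfolding l_def by simp
    qed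
    also have "\<dots> \<le> \<Psi> \<zeta> + \<Psi> \<zeta>0 - 2 * Re (l \<zeta>)" using le[OF mem] by (simp add: \<Psi>_def eq)
    also have "\<dots> \<le> 2 * \<Psi> \<zeta>0 - 2 * Re (l \<zeta>)" using mx[of \<zeta>] mem by simp
    finally show ?thesis by simp
  qed
  note fr = this
  have "Re (l \<zeta>0) \<le> \<Psi> \<zeta>0 - \<epsilon> * \<delta>\<^sup>2 / 2"
  proof (rule maximum_real_frontier[of l "ball \<zeta>0 \<delta>"])
    show "l holomorphic_on interior (ball \<zeta>0 \<delta>)"
      using hol by (rule holomorphic_on_subset) auto
    show "continuous_on (closure (ball \<zeta>0 \<delta>)) l"
      using holomorphic_on_imp_continuous_on[OF hol] \<delta> by (simp add: closure_ball)
  qed (use fr \<delta> in simp_all)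
  moreover have "\<epsilon> * \<delta>\<^sup>2 > 0" using \<epsilon> \<delta> by simp
  ultimately show False using l0 by simp
qed

section \<open>Discs centred on the axis of the ellipsoid\<close>

lemma powr_double: "a \<ge> 0 \<Longrightarrow> a powr (2 * m) = (a\<^sup>2) powr m" for a :: real
  by (cases "a = 0") (simp_all add: powr_powr flip: powr_numeral)

lemma Moebius_norm:
  fixes p w :: complex
  assumes "1 - cnj p * w \<noteq> 0"
  shows "1 - (cmod ((w - p) / (1 - cnj p * w)))\<^sup>2
    = (1 - (cmod p)\<^sup>2) * (1 - (cmod w)\<^sup>2) / (cmod (1 - cnj p * w))\<^sup>2"
proof -
  have "(cmod (1 - cnj p * w))\<^sup>2 - (cmod (w - p))\<^sup>2 = (1 - (cmod p)\<^sup>2) * (1 - (cmod w)\<^sup>2)"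
    by (simp add: cmod_sq algebra_simps)
  then show ?thesis using assms by (simp add: norm_divide power_divide field_simps)
qed

lemma one_minus_cnj_mult_ne_0:
  assumes "cmod p < 1" "cmod w < 1"
  shows "1 - cnj p * w \<noteq> 0"
proof
  assume "1 - cnj p * w = 0"
  then have "cmod p * cmod w = 1" by (metis complex_mod_cnj eq_iff_diff_eq_0 norm_mult norm_one)
  moreover have "cmod p * cmod w < 1" using assms
    by (metis dual_order.strict_trans2 less_eq_real_def mult.right_neutral mult_left_mono norm_ge_zero)
  ultimately show False by simp
qed

text \<open>The weight \<open>W\<close> is \<open>C \<bar>g\<bar>\<^sup>2\<^sup>c\<close> with the constants of the minorant at \<open>\<bar>g 0\<bar>\<^sup>2\<close>,
  and \<open>1\<close> if \<open>g 0 = 0\<close>.\<close>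

lemma holomorphic_weight:
  fixes g :: "complex \<Rightarrow> complex"
  assumes m: "0 < m" "m < 1" and g: "g holomorphic_on ball 0 1" "\<And>\<zeta>. \<zeta> \<in> ball 0 1 \<Longrightarrow> cmod (g \<zeta>) < 1"
  obtains W :: "complex \<Rightarrow> real" where "continuous_on (ball 0 1) W" "\<And>\<zeta>. W \<zeta> \<ge> 0"
    "\<And>\<zeta>. \<zeta> \<in> ball 0 1 \<Longrightarrow> W \<zeta> * (1 - cmod (g \<zeta>) powr (2 * m)) \<le> 1 - (cmod (g \<zeta>))\<^sup>2"
    "W 0 = (1 - (cmod (g 0))\<^sup>2) / (1 - cmod (g 0) powr (2 * m))"
    "\<And>\<zeta>0. \<zeta>0 \<in> ball 0 1 \<Longrightarrow> W \<zeta>0 = 0 \<or> (\<exists>d>0. \<exists>h. ball \<zeta>0 d \<subseteq> ball 0 1 \<and> h holomorphic_on ball \<zeta>0 d \<and> (\<forall>\<zeta>\<in>ball \<zeta>0 d. (cmod (h \<zeta>))\<^sup>2 = W \<zeta>))"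
proof (cases "g 0 = 0")
  case True
  show ?thesis
  proof (rule that[of "\<lambda>_. 1"])
    fix \<zeta> :: complex assume z: "\<zeta> \<in> ball 0 1"
    have "(cmod (g \<zeta>))\<^sup>2 < 1" using g(2)[OF z] by (simp add: abs_square_less_1)
    then have "((cmod (g \<zeta>))\<^sup>2) powr 1 \<le> ((cmod (g \<zeta>))\<^sup>2) powr m"
      using m by (intro powr_mono') auto
    then show "1 * (1 - cmod (g \<zeta>) powr (2 * m)) \<le> 1 - (cmod (g \<zeta>))\<^sup>2"
      by (simp add: powr_double)
    show "(1::real) = 0 \<or> (\<exists>d>0. \<exists>h. ball \<zeta> d \<subseteq> ball 0 1 \<and> h holomorphic_on ball \<zeta> d \<and> (\<forall>\<zeta>\<in>ball \<zeta> d. (cmod (h \<zeta>))\<^sup>2 = 1))"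
    proof (rule disjI2)
      obtain d where "d > 0" "ball \<zeta> d \<subseteq> ball 0 1" using z open_contains_ball open_ball by blast
      then show "\<exists>d>0. \<exists>h. ball \<zeta> d \<subseteq> ball 0 1 \<and> h holomorphic_on ball \<zeta> d \<and> (\<forall>\<zeta>\<in>ball \<zeta> d. (cmod (h \<zeta>))\<^sup>2 = 1)"
        by (intro exI[of _ d] conjI exI[of _ "\<lambda>_. 1"]) auto
    qed
  qed (use True in auto)
next
  case False
  have "cmod (g 0) < 1" using g(2)[of 0] by simp
  then have x0: "0 < (cmod (g 0))\<^sup>2" "(cmod (g 0))\<^sup>2 < 1" using False by (auto simp: abs_square_less_1)
  obtain C c where C: "0 < C" "0 < c" "C * ((cmod (g 0))\<^sup>2) powr c = (1 - (cmod (g 0))\<^sup>2) / (1 - ((cmod (g 0))\<^sup>2) powr m)"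
    and le: "\<And>x. 0 \<le> x \<Longrightarrow> x < 1 \<Longrightarrow> C * x powr c \<le> (1 - x) / (1 - x powr m)"
    using power_minorant[OF m x0] by blast
  define W where "W \<zeta> = C * ((cmod (g \<zeta>))\<^sup>2) powr c" for \<zeta>
  show ?thesis
  proof (rule that[of W])
    have "continuous_on (ball 0 1) g" using g(1) by (rule holomorphic_on_imp_continuous_on)
    then show "continuous_on (ball 0 1) W" unfolding W_def
      using C by (intro continuous_intros continuous_on_powr') auto
    show "W \<zeta> \<ge> 0" for \<zeta> using C by (simp add: W_def)
    show "W 0 = (1 - (cmod (g 0))\<^sup>2) / (1 - cmod (g 0) powr (2 * m))"
      using C by (simp add: W_def powr_double)
    fix \<zeta> :: complex assume z: "\<zeta> \<in> ball 0 1"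
    have x: "0 \<le> (cmod (g \<zeta>))\<^sup>2" "(cmod (g \<zeta>))\<^sup>2 < 1" using g(2)[OF z] by (auto simp: abs_square_less_1)
    have "((cmod (g \<zeta>))\<^sup>2) powr m < 1" by (rule powr_less_one_of[OF x m(1)])
    then show "W \<zeta> * (1 - cmod (g \<zeta>) powr (2 * m)) \<le> 1 - (cmod (g \<zeta>))\<^sup>2"
      using le[OF x] unfolding W_def powr_double[OF norm_ge_zero] by (simp add: field_simps)
    show "W \<zeta> = 0 \<or> (\<exists>d>0. \<exists>h. ball \<zeta> d \<subseteq> ball 0 1 \<and> h holomorphic_on ball \<zeta> d \<and> (\<forall>\<zeta>\<in>ball \<zeta> d. (cmod (h \<zeta>))\<^sup>2 = W \<zeta>))"
    proof (cases "g \<zeta> = 0")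
      case False
      have "open (ball 0 1 \<inter> g -` (- {0}))"
        using holomorphic_on_imp_continuous_on[OF g(1)] by (intro continuous_open_preimage) auto
      then obtain d where d: "d > 0" "ball \<zeta> d \<subseteq> ball 0 1 \<inter> g -` (- {0})"
        using z False open_contains_ball by (metis (no_types, lifting) ComplI IntI singletonD vimageI2)
      \<comment> \<open>On a disc without zeros of g a logarithm turns the real power into the
        squared modulus of \<open>sqrt C * exp (c * G)\<close>. At a zero of g the weight itself
        vanishes.\<close>
      obtain G where G: "G holomorphic_on ball \<zeta> d" "\<And>x. x \<in> ball \<zeta> d \<Longrightarrow> exp (G x) = g x"
        by (rule holomorphic_logarithm_exists[of "ball \<zeta> d" g \<zeta>]) (use d in \<open>auto intro: holomorphic_on_subset[OF g(1)]\<close>)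
      have "(cmod (of_real (sqrt C) * exp (of_real c * G x)))\<^sup>2 = W x" if "x \<in> ball \<zeta> d" for x
      proof -
        have "cmod (g x) = exp (Re (G x))" using G(2)[OF that] by (metis norm_exp_eq_Re)
        then have "W x = C * exp (Re (G x)) powr (2 * c)" unfolding W_def by (simp add: powr_double)
        also have "\<dots> = C * exp (2 * (c * Re (G x)))" by (simp add: powr_def mult_ac)
        finally show ?thesis using C
          by (simp add: norm_mult power_mult_distrib flip: exp_double)
      qed
      then show ?thesis
        using d G(1) by (intro disjI2 exI[of _ d] conjI exI[of _ "\<lambda>x. of_real (sqrt C) * exp (of_real c * G x)"] holomorphic_intros) auto
    qed (simp add: W_def)
  qed
qed

text \<open>As in the classical proof, \<open>F\<close> and the \<open>K i\<close> are quotients by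
  \<zeta>, here of the Moebius transform of g and of the \<open>k i\<close>. The function \<Phi>
  weights the \<open>K i\<close> so that its value at 0 is the left-hand side. On |\<zeta>| = r the
  minorant property of W bounds the weighted tangential part by 1 - |mob|^2, hence \<Phi> by 1 /
  r^2. A weight that is sharp at g 0 alone suffices, because the value of \<Phi> is wanted only at
  the centre.\<close>

lemma Schwarz_complex_ellipsoid:
  fixes g :: "complex \<Rightarrow> complex" and k :: "'i \<Rightarrow> complex \<Rightarrow> complex"
  assumes m: "0 < m" "m < 1" and g: "g holomorphic_on ball 0 1" and J: "finite J"
    and k: "\<And>i. i \<in> J \<Longrightarrow> k i holomorphic_on ball 0 1" "\<And>i. i \<in> J \<Longrightarrow> k i 0 = 0"
    and bd: "\<And>\<zeta>. \<zeta> \<in> ball 0 1 \<Longrightarrow> cmod (g \<zeta>) powr (2 * m) + (\<Sum>i\<in>J. (cmod (k i \<zeta>))\<^sup>2) < 1"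
  shows "(cmod (deriv g 0))\<^sup>2 / (1 - (cmod (g 0))\<^sup>2)\<^sup>2 + (\<Sum>i\<in>J. (cmod (deriv (k i) 0))\<^sup>2) / (1 - cmod (g 0) powr (2 * m)) \<le> 1"
proof -
  define p where "p = g 0"
  have g1: "cmod (g \<zeta>) < 1" if "\<zeta> \<in> ball 0 1" for \<zeta>
  proof (rule ccontr)
    assume "\<not> cmod (g \<zeta>) < 1"
    then have "cmod (g \<zeta>) powr (2 * m) \<ge> 1" using m by (intro ge_one_powr_ge_zero) auto
    moreover have "(\<Sum>i\<in>J. (cmod (k i \<zeta>))\<^sup>2) \<ge> 0" by (intro sum_nonneg) simp
    ultimately show False using bd[OF that] by linarith
  qed
  have p1: "cmod p < 1" using g1[of 0] by (simp add: p_def)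
  have pp: "1 - (cmod p)\<^sup>2 > 0" "1 - cmod p powr (2 * m) > 0"
    using p1 m powr_less_one_of[of "cmod p" "2 * m"] by (auto simp: abs_square_less_1)
  have nz: "1 - cnj p * g \<zeta> \<noteq> 0" if "\<zeta> \<in> ball 0 1" for \<zeta>
    by (rule one_minus_cnj_mult_ne_0[OF p1 g1[OF that]])
  define mob where "mob \<zeta> = (g \<zeta> - p) / (1 - cnj p * g \<zeta>)" for \<zeta>
  have "mob holomorphic_on ball 0 1" unfolding mob_def using nz by (intro holomorphic_intros g) auto
  moreover have "mob 0 = 0" by (simp add: mob_def p_def)
  ultimately obtain F where F: "F holomorphic_on ball 0 1" "\<And>\<zeta>. cmod \<zeta> < 1 \<Longrightarrow> mob \<zeta> = \<zeta> * F \<zeta>" "deriv mob 0 = F 0"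
    using Schwarz3[of mob 1] by metis
  have dg: "(g has_field_derivative deriv g 0) (at 0)"
    using g by (rule holomorphic_derivI) auto
  have "((\<lambda>\<zeta>. (g \<zeta> - p) / (1 - cnj p * g \<zeta>)) has_field_derivative
     (deriv g 0 * (1 - cnj p * g 0) - (g 0 - p) * (- (cnj p * deriv g 0))) / ((1 - cnj p * g 0) * (1 - cnj p * g 0))) (at 0)"
    by (rule DERIV_divide) (use nz[of 0] in \<open>auto intro!: derivative_eq_intros dg\<close>)
  then have "F 0 = (deriv g 0 * (1 - cnj p * g 0) - (g 0 - p) * (- (cnj p * deriv g 0))) / ((1 - cnj p * g 0) * (1 - cnj p * g 0))"
    unfolding F(3)[symmetric] mob_def[abs_def] by (rule DERIV_imp_deriv)
  then have "F 0 = deriv g 0 / (1 - cnj p * p)" using nz[of 0] by (simp add: p_def)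
  also have "1 - cnj p * p = of_real (1 - (cmod p)\<^sup>2)" by (simp add: complex_norm_square[symmetric] mult.commute)
  finally have F0: "(cmod (F 0))\<^sup>2 = (cmod (deriv g 0))\<^sup>2 / (1 - (cmod p)\<^sup>2)\<^sup>2"
    by (simp add: norm_divide power_divide flip: of_real_power of_real_diff)
  have "\<exists>K. K holomorphic_on ball 0 1 \<and> (\<forall>\<zeta>. cmod \<zeta> < 1 \<longrightarrow> k i \<zeta> = \<zeta> * K \<zeta>) \<and> deriv (k i) 0 = K 0" if "i \<in> J" for i
    using Schwarz3[OF k(1)[OF that] k(2)[OF that]] by metis
  then obtain K where K: "\<And>i. i \<in> J \<Longrightarrow> K i holomorphic_on ball 0 1"
    "\<And>i \<zeta>. i \<in> J \<Longrightarrow> cmod \<zeta> < 1 \<Longrightarrow> k i \<zeta> = \<zeta> * K i \<zeta>" "\<And>i. i \<in> J \<Longrightarrow> deriv (k i) 0 = K i 0"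
    by metis
  obtain W where W: "continuous_on (ball 0 1) W" "\<And>\<zeta>. W \<zeta> \<ge> (0::real)"
    "\<And>\<zeta>. \<zeta> \<in> ball 0 1 \<Longrightarrow> W \<zeta> * (1 - cmod (g \<zeta>) powr (2 * m)) \<le> 1 - (cmod (g \<zeta>))\<^sup>2"
    "W 0 = (1 - (cmod (g 0))\<^sup>2) / (1 - cmod (g 0) powr (2 * m))"
    "\<And>\<zeta>0. \<zeta>0 \<in> ball 0 1 \<Longrightarrow> W \<zeta>0 = 0 \<or> (\<exists>d>0. \<exists>h. ball \<zeta>0 d \<subseteq> ball 0 1 \<and> h holomorphic_on ball \<zeta>0 d \<and> (\<forall>\<zeta>\<in>ball \<zeta>0 d. (cmod (h \<zeta>))\<^sup>2 = W \<zeta>))"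
    using holomorphic_weight[OF m g g1] by metis
  define N where "N \<zeta> = (\<Sum>i\<in>J. (cmod (K i \<zeta>))\<^sup>2)" for \<zeta>
  define \<Phi> where "\<Phi> \<zeta> = (cmod (F \<zeta>))\<^sup>2 + (1 - (cmod p)\<^sup>2) * W \<zeta> * N \<zeta> / (cmod (1 - cnj p * g \<zeta>))\<^sup>2" for \<zeta>
  have N0: "N \<zeta> \<ge> 0" for \<zeta> by (simp add: N_def sum_nonneg)
  have cont: "continuous_on (ball 0 1) \<Phi>" unfolding \<Phi>_def N_def
    using nz by (intro continuous_intros holomorphic_on_imp_continuous_on F K W g) auto
  have sphere: "\<Phi> \<zeta> \<le> 1 / r\<^sup>2" if r: "cmod \<zeta> = r" "0 < r" "r < 1" for \<zeta> r
  proof -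
    have z: "\<zeta> \<in> ball 0 1" using r by simp
    let ?c = "(cmod (1 - cnj p * g \<zeta>))\<^sup>2"
    have c0: "?c > 0" using nz[OF z] by simp
    have kN: "r\<^sup>2 * N \<zeta> = (\<Sum>i\<in>J. (cmod (k i \<zeta>))\<^sup>2)"
      using K(2) r by (simp add: N_def sum_distrib_left norm_mult power_mult_distrib)
    have "W \<zeta> * (r\<^sup>2 * N \<zeta>) \<le> W \<zeta> * (1 - cmod (g \<zeta>) powr (2 * m))"
      using bd[OF z] W(2) unfolding kN by (intro mult_left_mono) auto
    also have "\<dots> \<le> 1 - (cmod (g \<zeta>))\<^sup>2" by (rule W(3)[OF z])
    finally have "(1 - (cmod p)\<^sup>2) * (W \<zeta> * (r\<^sup>2 * N \<zeta>)) / ?c \<le> (1 - (cmod p)\<^sup>2) * (1 - (cmod (g \<zeta>))\<^sup>2) / ?c"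
      using pp c0 by (intro divide_right_mono mult_left_mono) auto
    also have "\<dots> = 1 - (cmod (mob \<zeta>))\<^sup>2" unfolding mob_def by (rule Moebius_norm[OF nz[OF z], symmetric])
    also have "(cmod (mob \<zeta>))\<^sup>2 = r\<^sup>2 * (cmod (F \<zeta>))\<^sup>2" using F(2) r by (simp add: norm_mult power_mult_distrib)
    finally have "r\<^sup>2 * \<Phi> \<zeta> \<le> 1" by (simp add: \<Phi>_def algebra_simps)
    then show ?thesis using r by (simp add: field_simps)
  qed
  have bound: "\<Phi> 0 \<le> 1 / r\<^sup>2" if r: "0 < r" "r < 1" for r
  proof (rule max_principle_support[where I = "insert None (Some ` J)", OF r(1)])
    have rs: "cball 0 r \<subseteq> ball (0::complex) 1" using r by auto
    show "continuous_on (cball 0 r) \<Phi>" by (rule continuous_on_subset[OF cont rs])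
    show "finite (insert None (Some ` J))" using J by simp
    show "\<Phi> \<zeta> \<le> 1 / r\<^sup>2" if "cmod \<zeta> = r" for \<zeta> using sphere[OF that r] .
    fix \<zeta>0 assume "\<zeta>0 \<in> ball (0::complex) r"
    then have z0: "\<zeta>0 \<in> ball 0 1" using r by simp
    obtain d h where d: "d > 0" "ball \<zeta>0 d \<subseteq> ball 0 1" and h: "h holomorphic_on ball \<zeta>0 d"
      "\<And>\<zeta>. \<zeta> \<in> ball \<zeta>0 d \<Longrightarrow> (cmod (h \<zeta>))\<^sup>2 \<le> W \<zeta>" "(cmod (h \<zeta>0))\<^sup>2 = W \<zeta>0"
    proof (cases "W \<zeta>0 = 0")
      case True
      obtain d where "d > 0" "ball \<zeta>0 d \<subseteq> ball 0 1" using z0 open_contains_ball open_ball by blast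
      then show ?thesis using that[of d "\<lambda>_. 0"] True W(2) by simp
    next
      case False
      then show ?thesis using W(5)[OF z0] that by (metis centre_in_ball order_refl)
    qed
    \<comment> \<open>Roots of the summands of \<Phi>, with \<open>None\<close> for the normal one.
      Here \<open>h\<close> is a local holomorphic root of W, or the zero function around a zero of
      W, where it still supports W from below.\<close>
    define V where "V o' \<zeta> = (case o' of None \<Rightarrow> F \<zeta>
      | Some i \<Rightarrow> of_real (sqrt (1 - (cmod p)\<^sup>2)) * h \<zeta> * K i \<zeta> / (1 - cnj p * g \<zeta>))" for o' \<zeta>
    have eq: "(\<Sum>i\<in>insert None (Some ` J). (cmod (V i \<zeta>))\<^sup>2)
      = (cmod (F \<zeta>))\<^sup>2 + (1 - (cmod p)\<^sup>2) * (cmod (h \<zeta>))\<^sup>2 * N \<zeta> / (cmod (1 - cnj p * g \<zeta>))\<^sup>2" for \<zeta>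
    proof -
      have "(\<Sum>i\<in>insert None (Some ` J). (cmod (V i \<zeta>))\<^sup>2) = (cmod (V None \<zeta>))\<^sup>2 + (\<Sum>i\<in>J. (cmod (V (Some i) \<zeta>))\<^sup>2)"
        using J by (subst sum.insert) (auto simp: sum.reindex)
      also have "(\<Sum>i\<in>J. (cmod (V (Some i) \<zeta>))\<^sup>2) = (\<Sum>i\<in>J. (1 - (cmod p)\<^sup>2) * (cmod (h \<zeta>))\<^sup>2 * (cmod (K i \<zeta>))\<^sup>2 / (cmod (1 - cnj p * g \<zeta>))\<^sup>2)"
        using pp by (intro sum.cong refl) (simp add: V_def norm_mult norm_divide power_mult_distrib power_divide)
      finally show ?thesis by (simp add: V_def N_def sum_distrib_left sum_divide_distrib)
    qed
    show "\<exists>V d. d > 0 \<and> (\<forall>i\<in>insert None (Some ` J). V i holomorphic_on ball \<zeta>0 d) \<and>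
      (\<forall>\<zeta>\<in>ball \<zeta>0 d \<inter> ball 0 r. (\<Sum>i\<in>insert None (Some ` J). (cmod (V i \<zeta>))\<^sup>2) \<le> \<Phi> \<zeta>) \<and>
      \<Phi> \<zeta>0 = (\<Sum>i\<in>insert None (Some ` J). (cmod (V i \<zeta>0))\<^sup>2)"
    proof (intro exI[of _ V] exI[of _ d] conjI ballI)
      show "V i holomorphic_on ball \<zeta>0 d" if "i \<in> insert None (Some ` J)" for i
      proof (cases i)
        case None
        then have "V i = F" by (simp add: V_def fun_eq_iff)
        then show ?thesis using holomorphic_on_subset[OF F(1) d(2)] by simp
      next
        case (Some j)
        then have "j \<in> J" using that by auto
        have "V i = (\<lambda>\<zeta>. of_real (sqrt (1 - (cmod p)\<^sup>2)) * h \<zeta> * K j \<zeta> / (1 - cnj p * g \<zeta>))"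
          using Some by (simp add: V_def fun_eq_iff)
        moreover have "\<dots> holomorphic_on ball \<zeta>0 d"
          using nz d(2) by (intro holomorphic_intros h holomorphic_on_subset[OF K(1)[OF \<open>j \<in> J\<close>] d(2)] holomorphic_on_subset[OF g d(2)]) auto
        ultimately show ?thesis by simp
      qed
      show "(\<Sum>i\<in>insert None (Some ` J). (cmod (V i \<zeta>))\<^sup>2) \<le> \<Phi> \<zeta>" if "\<zeta> \<in> ball \<zeta>0 d \<inter> ball 0 r" for \<zeta>
        unfolding eq \<Phi>_def using h(2)[of \<zeta>] that pp N0[of \<zeta>]
        by (intro add_left_mono divide_right_mono mult_right_mono mult_left_mono) auto
    qed (use d in \<open>simp_all add: eq \<Phi>_def h\<close>)
  qed
  have "\<Phi> 0 \<le> 1"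
  proof (rule ccontr)
    assume n: "\<not> \<Phi> 0 \<le> 1"
    \<comment> \<open>Then 1 / r^2 is the mean of 1 and \<Phi> 0, so the bound at this radius
      contradicts \<Phi> 0 > 1.\<close>
    define r where "r = sqrt (2 / (1 + \<Phi> 0))"
    have "r\<^sup>2 = 2 / (1 + \<Phi> 0)" "0 < r" "r < 1" using n by (auto simp: r_def)
    moreover have "1 / (2 / (1 + \<Phi> 0)) = (1 + \<Phi> 0) / 2" by simp
    ultimately show False using bound[of r] n by simp
  qed
  moreover have "\<Phi> 0 = (cmod (deriv g 0))\<^sup>2 / (1 - (cmod (g 0))\<^sup>2)\<^sup>2 + (\<Sum>i\<in>J. (cmod (deriv (k i) 0))\<^sup>2) / (1 - cmod (g 0) powr (2 * m))"
  proof -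
    have "1 - cnj p * p = of_real (1 - (cmod p)\<^sup>2)" by (simp add: complex_norm_square[symmetric] mult.commute)
    then have "(cmod (1 - cnj p * p))\<^sup>2 = (1 - (cmod p)\<^sup>2)\<^sup>2" by (simp flip: of_real_diff of_real_power)
    moreover have "N 0 = (\<Sum>i\<in>J. (cmod (deriv (k i) 0))\<^sup>2)" using K(3) by (simp add: N_def)
    moreover have "b * (b / c) * n / b\<^sup>2 = n / c" if "b \<noteq> 0" for b c n :: real
      using that by (simp add: power2_eq_square)
    ultimately show ?thesis using pp unfolding \<Phi>_def F0 W(4) p_def[symmetric] by simp
  qed
  ultimately show ?thesis by simp
qed

section \<open>The Wu metric of the egg\<close>

definition hprod :: "'n::finite \<Rightarrow> complex ^ 'n \<Rightarrow> complex ^ 'n \<Rightarrow> complex" where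
  "hprod \<iota> x y = (\<Sum>i\<in>UNIV - {\<iota>}. x $ i * cnj (y $ i))"

definition gap :: "'n::finite \<Rightarrow> complex ^ 'n \<Rightarrow> real" where
  "gap \<iota> z = 1 - (\<Sum>i\<in>UNIV - {\<iota>}. (cmod (z $ i))\<^sup>2)"

definition normal_coeff :: "'n::finite \<Rightarrow> real \<Rightarrow> complex ^ 'n \<Rightarrow> real" where
  "normal_coeff \<iota> m z = gap \<iota> z powr (1/m) / (gap \<iota> z powr (1/m) - (cmod (z $ \<iota>))\<^sup>2)\<^sup>2"

definition tangent_coeff :: "'n::finite \<Rightarrow> real \<Rightarrow> complex ^ 'n \<Rightarrow> real" where
  "tangent_coeff \<iota> m z = gap \<iota> z / (gap \<iota> z - cmod (z $ \<iota>) powr (2 * m))"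

text \<open>With E = |z|^2 s^(-1/m), the form \<partial>E is cnj z s^(-1/m) times this one. Where z
  is nonzero, its kernel is therefore the complex tangent space of the level sets of E; unlike
  \<partial>E it does not degenerate at z = 0.\<close>

definition conn_form :: "'n::finite \<Rightarrow> real \<Rightarrow> complex ^ 'n \<Rightarrow> complex ^ 'n \<Rightarrow> complex" where
  "conn_form \<iota> m z u = u $ \<iota> + z $ \<iota> / of_real (m * gap \<iota> z) * hprod \<iota> u z"

text \<open>\<open>normal_coeff\<close> is \<open>\<bar>\<tau>/z\<bar>\<^sup>2 / (1 - E)\<^sup>2\<close> and \<open>tangent_coeff\<close> is \<open>1 / (1 - E powr m)\<close>; the
  last factor is the matrix of \<open>\<beta>\<close>.\<close>

definition egg_wu :: "'n::finite \<Rightarrow> real \<Rightarrow> complex ^ 'n \<Rightarrow> complex ^ 'n ^ 'n" where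
  "egg_wu \<iota> m z = (\<chi> i j.
     of_real (normal_coeff \<iota> m z) * conn_form \<iota> m z (axis i 1) * cnj (conn_form \<iota> m z (axis j 1))
     + of_real (tangent_coeff \<iota> m z) * (hprod \<iota> (axis i 1) (axis j 1) / of_real (gap \<iota> z)
        + hprod \<iota> (axis i 1) z * cnj (hprod \<iota> (axis j 1) z) / of_real ((gap \<iota> z)\<^sup>2)))"

section \<open>Algebra of the explicit metric\<close>

lemma hprod_add_left: "hprod \<iota> (x + y) v = hprod \<iota> x v + hprod \<iota> y v"
  by (simp add: hprod_def algebra_simps sum.distrib)
lemma hprod_diff_left: "hprod \<iota> (x - y) v = hprod \<iota> x v - hprod \<iota> y v"
  by (simp add: hprod_def algebra_simps sum_subtractf)
lemma hprod_scale_left: "hprod \<iota> (c *s x) v = c * hprod \<iota> x v"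
  by (simp add: hprod_def algebra_simps sum_distrib_left)
lemma hprod_cnj: "cnj (hprod \<iota> x y) = hprod \<iota> y x"
  by (simp add: hprod_def mult.commute)
lemma hprod_add_right: "hprod \<iota> v (x + y) = hprod \<iota> v x + hprod \<iota> v y"
  by (simp add: hprod_def algebra_simps sum.distrib)
lemma hprod_diff_right: "hprod \<iota> v (x - y) = hprod \<iota> v x - hprod \<iota> v y"
  by (simp add: hprod_def algebra_simps sum_subtractf)
lemma hprod_scale_right: "hprod \<iota> v (c *s x) = cnj c * hprod \<iota> v x"
  by (simp add: hprod_def algebra_simps sum_distrib_left)
lemma hprod_axis_left: "hprod \<iota> (axis i c) v = (if i = \<iota> then 0 else c * cnj (v $ i))"
proof -
  have "hprod \<iota> (axis i c) v = (\<Sum>k\<in>UNIV - {\<iota>}. if k = i then c * cnj (v $ i) else 0)"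
    unfolding hprod_def by (intro sum.cong) (auto simp: axis_def)
  then show ?thesis by simp
qed
lemma hprod_axis_right: "hprod \<iota> v (axis i c) = (if i = \<iota> then 0 else cnj c * v $ i)"
  using hprod_axis_left[of \<iota> i c v] hprod_cnj[of \<iota> "axis i c" v] by (auto split: if_splits)
lemma hprod_self: "hprod \<iota> z z = of_real (1 - gap \<iota> z)"
  by (simp add: hprod_def gap_def complex_norm_square of_real_power del: of_real_power)
lemma hprod_self_sum: "hprod \<iota> z z = of_real (\<Sum>i\<in>UNIV - {\<iota>}. (cmod (z $ i))\<^sup>2)"
  by (simp add: hprod_self gap_def)

lemmas hprod_simps = hprod_add_left hprod_add_right hprod_diff_left hprod_diff_right
  hprod_scale_left hprod_scale_right hprod_axis_left hprod_axis_right

lemma vec_eq_sum_axis: "(\<Sum>i\<in>UNIV. u $ i *s axis i 1) = (u :: complex ^ 'n)"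
  by (simp add: vec_eq_iff axis_def if_distrib cong: if_cong)

lemma hprod_sum_left: "hprod \<iota> (\<Sum>i\<in>A. f i) v = (\<Sum>i\<in>A. hprod \<iota> (f i) v)"
  by (induction A rule: infinite_finite_induct) (simp_all add: hprod_add_left, simp_all add: hprod_def)
lemma hprod_sum_right: "hprod \<iota> v (\<Sum>i\<in>A. f i) = (\<Sum>i\<in>A. hprod \<iota> v (f i))"
  by (induction A rule: infinite_finite_induct) (simp_all add: hprod_add_right, simp_all add: hprod_def)

lemma conn_form_expand: "conn_form \<iota> m z u = (\<Sum>i\<in>UNIV. u $ i * conn_form \<iota> m z (axis i 1))"
proof -
  have "(\<Sum>i\<in>UNIV. u $ i * conn_form \<iota> m z (axis i 1))
     = (\<Sum>i\<in>UNIV. u $ i * (axis i 1 $ \<iota>)) + z $ \<iota> / of_real (m * gap \<iota> z) * (\<Sum>i\<in>UNIV. u $ i * hprod \<iota> (axis i 1) z)"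
    by (simp add: conn_form_def algebra_simps sum.distrib sum_distrib_left)
  also have "(\<Sum>i\<in>UNIV. u $ i * (axis i 1 $ \<iota>)) = u $ \<iota>"
    by (simp add: axis_def if_distrib cong: if_cong)
  also have "(\<Sum>i\<in>UNIV. u $ i * hprod \<iota> (axis i 1) z) = hprod \<iota> (\<Sum>i\<in>UNIV. u $ i *s axis i 1) z"
    by (simp add: hprod_sum_left hprod_scale_left)
  finally show ?thesis by (simp add: conn_form_def vec_eq_sum_axis)
qed

lemma herm_egg_wu:
  "herm (egg_wu \<iota> m z) u v = of_real (normal_coeff \<iota> m z) * conn_form \<iota> m z u * cnj (conn_form \<iota> m z v)
     + of_real (tangent_coeff \<iota> m z) * (hprod \<iota> u v / of_real (gap \<iota> z)
        + hprod \<iota> u z * cnj (hprod \<iota> v z) / of_real ((gap \<iota> z)\<^sup>2))"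
proof -
  have "hprod \<iota> u v = hprod \<iota> (\<Sum>i\<in>UNIV. u $ i *s axis i 1) (\<Sum>j\<in>UNIV. v $ j *s axis j 1)"
    by (simp add: vec_eq_sum_axis)
  also have "\<dots> = (\<Sum>i\<in>UNIV. \<Sum>j\<in>UNIV. u $ i * cnj (v $ j) * hprod \<iota> (axis i 1) (axis j 1))"
    unfolding hprod_sum_left hprod_scale_left unfolding hprod_sum_right hprod_scale_right
    by (simp add: sum_distrib_left mult.assoc)
  finally have 1: "hprod \<iota> u v = \<dots>" .
  have e: "hprod \<iota> u z = (\<Sum>i\<in>UNIV. u $ i * hprod \<iota> (axis i 1) z)" for u
    using vec_eq_sum_axis[of u] hprod_sum_left[of \<iota> "\<lambda>i. u $ i *s axis i 1" UNIV z] by (simp add: hprod_scale_left)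
  have 2: "hprod \<iota> u z * cnj (hprod \<iota> v z) = (\<Sum>i\<in>UNIV. \<Sum>j\<in>UNIV. u $ i * cnj (v $ j) * (hprod \<iota> (axis i 1) z * cnj (hprod \<iota> (axis j 1) z)))"
    unfolding e[of u] e[of v] by (simp add: sum_product mult_ac)
  have 3: "conn_form \<iota> m z u * cnj (conn_form \<iota> m z v) = (\<Sum>i\<in>UNIV. \<Sum>j\<in>UNIV. u $ i * cnj (v $ j) * (conn_form \<iota> m z (axis i 1) * cnj (conn_form \<iota> m z (axis j 1))))"
    unfolding conn_form_expand[of \<iota> m z u] conn_form_expand[of \<iota> m z v] by (simp add: sum_product mult_ac)
  let ?N = "complex_of_real (normal_coeff \<iota> m z)" and ?T = "complex_of_real (tangent_coeff \<iota> m z)"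
    and ?s = "complex_of_real (gap \<iota> z)" and ?s2 = "complex_of_real ((gap \<iota> z)\<^sup>2)"
  have "herm (egg_wu \<iota> m z) u v = (\<Sum>i\<in>UNIV. \<Sum>j\<in>UNIV.
      ?N * (u $ i * cnj (v $ j) * (conn_form \<iota> m z (axis i 1) * cnj (conn_form \<iota> m z (axis j 1))))
      + ?T / ?s * (u $ i * cnj (v $ j) * hprod \<iota> (axis i 1) (axis j 1))
      + ?T / ?s2 * (u $ i * cnj (v $ j) * (hprod \<iota> (axis i 1) z * cnj (hprod \<iota> (axis j 1) z))))"
    unfolding herm_def egg_wu_def vec_lambda_beta
    by (intro sum.cong refl) (simp add: algebra_simps)
  also have "\<dots> = ?N * (conn_form \<iota> m z u * cnj (conn_form \<iota> m z v)) + ?T / ?s * hprod \<iota> u v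
      + ?T / ?s2 * (hprod \<iota> u z * cnj (hprod \<iota> v z))"
    unfolding 1 2 3 by (simp only: sum.distrib sum_distrib_left)
  finally show ?thesis by (simp add: algebra_simps)
qed

lemma Re_herm_egg_wu:
  "Re (herm (egg_wu \<iota> m z) u u) = normal_coeff \<iota> m z * (cmod (conn_form \<iota> m z u))\<^sup>2
     + tangent_coeff \<iota> m z * ((\<Sum>i\<in>UNIV - {\<iota>}. (cmod (u $ i))\<^sup>2) / gap \<iota> z
        + (cmod (hprod \<iota> u z))\<^sup>2 / (gap \<iota> z)\<^sup>2)"
proof -
  have "herm (egg_wu \<iota> m z) u u = of_real (normal_coeff \<iota> m z * (cmod (conn_form \<iota> m z u))\<^sup>2
     + tangent_coeff \<iota> m z * ((\<Sum>i\<in>UNIV - {\<iota>}. (cmod (u $ i))\<^sup>2) / gap \<iota> z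
        + (cmod (hprod \<iota> u z))\<^sup>2 / (gap \<iota> z)\<^sup>2))"
    unfolding herm_egg_wu hprod_self_sum by (simp only: mult.assoc complex_norm_square[symmetric]) simp
  then show ?thesis by (simp only: Re_complex_of_real)
qed

lemma egg_iff: "z \<in> egg \<iota> m \<longleftrightarrow> cmod (z $ \<iota>) powr (2 * m) < gap \<iota> z"
  by (auto simp: egg_def gap_def)

lemma egg_facts:
  assumes "0 < m" "z \<in> egg \<iota> m"
  shows "gap \<iota> z > 0" "gap \<iota> z \<le> 1" "cmod (z $ \<iota>) powr (2 * m) < gap \<iota> z" "(cmod (z $ \<iota>))\<^sup>2 < gap \<iota> z powr (1/m)"
proof -
  show 1: "cmod (z $ \<iota>) powr (2 * m) < gap \<iota> z" using assms by (simp add: egg_iff)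
  then show 2: "gap \<iota> z > 0" using powr_ge_zero[of "cmod (z $ \<iota>)" "2 * m"] by linarith
  show "gap \<iota> z \<le> 1" by (simp add: gap_def sum_nonneg)
  have "(cmod (z $ \<iota>) powr (2 * m)) powr (1/m) < gap \<iota> z powr (1/m)"
    using 1 assms by (intro powr_less_mono2) auto
  moreover have "(cmod (z $ \<iota>) powr (2 * m)) powr (1/m) = (cmod (z $ \<iota>))\<^sup>2"
    using assms by (cases "z $ \<iota> = 0") (auto simp: powr_powr)
  ultimately show "(cmod (z $ \<iota>))\<^sup>2 < gap \<iota> z powr (1/m)" by simp
qed

lemma open_egg:
  assumes "0 < m"
  shows "open (egg \<iota> m)"
  unfolding egg_def using assms
  by (intro open_Collect_less continuous_intros continuous_on_powr') auto

lemma normal_coeff_alt: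
  assumes "0 < m" "z \<in> egg \<iota> m"
  shows "normal_coeff \<iota> m z = gap \<iota> z powr (- 1/m) / (1 - (cmod (z $ \<iota>))\<^sup>2 * gap \<iota> z powr (- 1/m))\<^sup>2"
    and "1 - (cmod (z $ \<iota>))\<^sup>2 * gap \<iota> z powr (- 1/m) > 0"
proof -
  let ?S = "gap \<iota> z powr (1/m)"
  have S: "?S > 0" using egg_facts[OF assms] by simp
  have e: "gap \<iota> z powr (- 1/m) = 1 / ?S" using powr_minus_divide[of "gap \<iota> z" "1/m"] by simp
  show "1 - (cmod (z $ \<iota>))\<^sup>2 * gap \<iota> z powr (- 1/m) > 0" unfolding e using S egg_facts(4)[OF assms] by simp
  have "?S - (cmod (z $ \<iota>))\<^sup>2 = ?S * (1 - (cmod (z $ \<iota>))\<^sup>2 / ?S)" using S by (simp add: field_simps)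
  then show "normal_coeff \<iota> m z = gap \<iota> z powr (- 1/m) / (1 - (cmod (z $ \<iota>))\<^sup>2 * gap \<iota> z powr (- 1/m))\<^sup>2"
    unfolding normal_coeff_def e using S by (simp add: power_mult_distrib power2_eq_square)
qed

lemma egg_coeff_pos:
  assumes "0 < m" "z \<in> egg \<iota> m"
  shows "normal_coeff \<iota> m z > 0" "tangent_coeff \<iota> m z > 0"
  using egg_facts[OF assms] by (auto simp: normal_coeff_def tangent_coeff_def)

lemma hermitian_inner_product_egg_wu:
  assumes m: "0 < m" and z: "z \<in> egg \<iota> m"
  shows "hermitian_inner_product (egg_wu \<iota> m z)"
  unfolding hermitian_inner_product_def
proof (intro conjI allI impI)
  fix i j
  show "egg_wu \<iota> m z $ j $ i = cnj (egg_wu \<iota> m z $ i $ j)"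
  proof -
    have "cnj (of_real N * a * cnj b + of_real T * (h / of_real s + c * cnj d / of_real s2))
      = of_real N * b * cnj a + of_real T * (cnj h / of_real s + d * cnj c / of_real s2)" for N T s s2 a b h c d
      by simp
    then show ?thesis unfolding egg_wu_def vec_lambda_beta by (simp only: hprod_cnj[of \<iota> "axis i 1" "axis j 1"])
  qed
next
  fix v :: "complex ^ 'a" assume v: "v \<noteq> 0"
  note pos = egg_coeff_pos[OF m z] egg_facts(1)[OF m z]
  show "0 < Re (herm (egg_wu \<iota> m z) v v)"
  proof (cases "\<forall>i\<in>UNIV - {\<iota>}. v $ i = 0")
    case True
    then have "v $ \<iota> \<noteq> 0" using v by (auto simp: vec_eq_iff)
    moreover have "hprod \<iota> v z = 0" using True by (simp add: hprod_def)
    ultimately show ?thesis unfolding Re_herm_egg_wu using pos True by (simp add: conn_form_def)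
  next
    case False
    then obtain i where "i \<noteq> \<iota>" "v $ i \<noteq> 0" by auto
    then have "(\<Sum>i\<in>UNIV - {\<iota>}. (cmod (v $ i))\<^sup>2) > 0"
      by (intro sum_pos2[of _ i]) auto
    then show ?thesis unfolding Re_herm_egg_wu using pos
      by (intro add_nonneg_pos mult_pos_pos add_pos_nonneg divide_pos_pos) auto
  qed
qed

section \<open>The indicatrix lies in the unit ball of the metric\<close>

lemma indicatrixI:
  assumes "vec_holomorphic_on f (ball 0 1)" "f ` ball 0 1 \<subseteq> D" "f 0 = z" "l *s vec_deriv f 0 = v" "cmod l < 1"
  shows "v \<in> kobayashi_indicatrix D z"
proof -
  have "kobayashi D z v \<le> cmod l" unfolding kobayashi_def
    by (rule cInf_lower) (use assms in \<open>auto intro!: bdd_belowI[of _ 0]\<close>)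
  then show ?thesis using assms by (simp add: kobayashi_indicatrix_def)
qed

text \<open>An infimum over the empty set would say nothing, so the set of admissible lengths is
  first shown to be nonempty by a small affine disc through z in the direction v. Only then does an
  infimum below 1 produce a disc.\<close>

lemma indicatrixE:
  assumes "open D" "z \<in> D" "v \<in> kobayashi_indicatrix D z"
  obtains f l where "vec_holomorphic_on f (ball 0 1)" "f ` ball 0 1 \<subseteq> D" "f 0 = z" "l *s vec_deriv f 0 = v" "cmod l < 1"
proof -
  let ?X = "{cmod l |l. \<exists>f. vec_holomorphic_on f (ball 0 1) \<and> f ` ball 0 1 \<subseteq> D \<and> f 0 = z \<and> l *s vec_deriv f 0 = v}"
  have "continuous_on UNIV (\<lambda>\<zeta>. z + (\<chi> i. \<zeta> * v $ i))"
    by (intro continuous_intros continuous_on_vec_lambda)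
  then have "open ((\<lambda>\<zeta>. z + (\<chi> i. \<zeta> * v $ i)) -` D)" using assms(1) by (intro open_vimage) auto
  moreover have "0 \<in> (\<lambda>\<zeta>. z + (\<chi> i. \<zeta> * v $ i)) -` D" using assms(2) by (simp add: zero_vec_def[symmetric])
  ultimately obtain \<delta> where \<delta>: "\<delta> > 0" "ball 0 \<delta> \<subseteq> (\<lambda>\<zeta>. z + (\<chi> i. \<zeta> * v $ i)) -` D"
    using open_contains_ball by metis
  define f where "f \<zeta> = z + (\<chi> i. (\<zeta> * of_real \<delta>) * v $ i)" for \<zeta> :: complex
  have fi: "f \<zeta> $ i = z $ i + \<zeta> * (of_real \<delta> * v $ i)" for \<zeta> i by (simp add: f_def)
  have "vec_holomorphic_on f (ball 0 1)"
    unfolding vec_holomorphic_on_def fi by (intro allI holomorphic_intros)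
  moreover have "f ` ball 0 1 \<subseteq> D"
  proof
    fix w assume "w \<in> f ` ball 0 1"
    then obtain \<zeta> where \<zeta>: "w = f \<zeta>" "cmod \<zeta> < 1" by auto
    then have "\<zeta> * of_real \<delta> \<in> ball 0 \<delta>" using \<delta> by (simp add: norm_mult)
    then have "\<zeta> * of_real \<delta> \<in> (\<lambda>\<zeta>. z + (\<chi> i. \<zeta> * v $ i)) -` D" using \<delta> by blast
    then show "w \<in> D" using \<zeta> by (simp add: f_def)
  qed
  moreover have "f 0 = z" by (simp add: f_def vec_eq_iff)
  moreover have "of_real (1/\<delta>) *s vec_deriv f 0 = v"
  proof -
    have "deriv (\<lambda>\<zeta>. z $ i + \<zeta> * (of_real \<delta> * v $ i)) 0 = of_real \<delta> * v $ i" for i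
      by (rule DERIV_imp_deriv) (auto intro!: derivative_eq_intros)
    then show ?thesis using \<delta> by (simp add: vec_deriv_def fi vec_eq_iff)
  qed
  ultimately have "?X \<noteq> {}" by blast
  moreover have "Inf ?X < 1" using assms(3) by (simp add: kobayashi_indicatrix_def kobayashi_def)
  ultimately obtain x where "x \<in> ?X" "x < 1" by (meson cInf_lessD)
  then show ?thesis using that by blast
qed

lemma sum_cmod_lincomb:
  fixes x a :: "'i \<Rightarrow> complex"
  shows "(\<Sum>i\<in>J. (cmod (of_real \<alpha> * x i + \<tau> * a i))\<^sup>2)
    = \<alpha>\<^sup>2 * (\<Sum>i\<in>J. (cmod (x i))\<^sup>2) + 2 * \<alpha> * Re (cnj \<tau> * (\<Sum>i\<in>J. x i * cnj (a i))) + (cmod \<tau>)\<^sup>2 * (\<Sum>i\<in>J. (cmod (a i))\<^sup>2)"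
proof -
  have "(cmod (of_real \<alpha> * x i + \<tau> * a i))\<^sup>2 = \<alpha>\<^sup>2 * (cmod (x i))\<^sup>2 + 2 * \<alpha> * Re (cnj \<tau> * (x i * cnj (a i))) + (cmod \<tau>)\<^sup>2 * (cmod (a i))\<^sup>2" for i
    by (simp add: cmod_sq power2_eq_square[of \<alpha>] algebra_simps)
  then show ?thesis by (simp only: sum.distrib sum_distrib_left Re_sum)
qed

text \<open>The identity behind the automorphism of the ball that moves \<open>a\<close> to the origin.\<close>

lemma sum_cmod_ball_aut:
  fixes x a :: "'i \<Rightarrow> complex"
  assumes s: "s > 0" "(\<Sum>i\<in>J. (cmod (a i))\<^sup>2) = 1 - s"
  defines "t \<equiv> (\<Sum>i\<in>J. x i * cnj (a i))"
  shows "(\<Sum>i\<in>J. (cmod (of_real (sqrt s) * x i + t / of_real (1 + sqrt s) * a i))\<^sup>2) = s * (\<Sum>i\<in>J. (cmod (x i))\<^sup>2) + (cmod t)\<^sup>2"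
proof -
  let ?r = "sqrt s"
  have r: "?r\<^sup>2 = s" "1 + ?r > 0" using s by (simp_all add: add_pos_nonneg)
  have 1: "Re (cnj (t / of_real (1 + ?r)) * t) = (cmod t)\<^sup>2 / (1 + ?r)"
    using r(2) by (simp add: cmod_sq Re_divide_of_real divide_simps)
  have 2: "(cmod (t / of_real (1 + ?r)))\<^sup>2 = (cmod t)\<^sup>2 / (1 + ?r)\<^sup>2"
    by (simp add: norm_divide power_divide del: of_real_add)
  have "2 * ?r * (T / (1 + ?r)) + T / (1 + ?r)\<^sup>2 * (1 - ?r\<^sup>2) = T" for T
  proof -
    have "1 - ?r\<^sup>2 = (1 + ?r) * (1 - ?r)" by (simp add: algebra_simps power2_eq_square)
    then have "T / (1 + ?r)\<^sup>2 * (1 - ?r\<^sup>2) = T / (1 + ?r) * (1 - ?r)" using r(2) by (simp add: power2_eq_square)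
    moreover have "2 * r * (T / (1 + r)) + T / (1 + r) * (1 - r) = T" if "1 + r > 0" for r
    proof -
      define k where "k = 1 / (1 + r)"
      have "2 * r * (T * k) + T * k * (1 - r) = T * (k * (1 + r))" by (simp add: algebra_simps)
      moreover have "k * (1 + r) = 1" using that by (simp add: k_def)
      ultimately show ?thesis by (simp add: k_def)
    qed
    note this[OF r(2)]
    ultimately show ?thesis by (simp only:)
  qed
  then show ?thesis unfolding sum_cmod_lincomb t_def[symmetric] 1 2 s(2) by (simp add: r(1))
qed

lemma hprod_cmod_less_1:
  assumes "gap \<iota> x > 0" "gap \<iota> z > 0"
  shows "cmod (hprod \<iota> x z) < 1"
proof -
  let ?J = "UNIV - {\<iota>}"
  have "cmod (hprod \<iota> x z) \<le> (\<Sum>i\<in>?J. cmod (x $ i) * cmod (z $ i))"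
    unfolding hprod_def by (rule order_trans[OF norm_sum]) (simp add: norm_mult)
  also have "\<dots> \<le> (\<Sum>i\<in>?J. ((cmod (x $ i))\<^sup>2 + (cmod (z $ i))\<^sup>2) / 2)"
  proof (rule sum_mono)
    show "cmod (x $ i) * cmod (z $ i) \<le> ((cmod (x $ i))\<^sup>2 + (cmod (z $ i))\<^sup>2) / 2" for i
      using sum_squares_bound[of "cmod (x $ i)" "cmod (z $ i)"] by simp
  qed
  also have "\<dots> = ((1 - gap \<iota> x) + (1 - gap \<iota> z)) / 2"
    by (simp add: gap_def sum.distrib flip: sum_divide_distrib)
  also have "\<dots> < 1" using assms by simp
  finally show ?thesis .
qed

lemma norm_exp_Ln: "w \<noteq> 0 \<Longrightarrow> cmod (exp (of_real a * Ln w)) = cmod w powr a"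
  by (simp add: norm_exp_eq_Re powr_def)

text \<open>An automorphism of the egg, extending a ball automorphism that moves the tangential part
  of z to 0, carries the disc to (g, k) with k 0 = 0, where the Schwarz lemma applies. On the first
  coordinate it multiplies by the power 1/m of \<open>K\<close>. What remains is to express the
  derivatives of g and k at 0 through v.\<close>

lemma egg_disc_le:
  fixes f :: "complex \<Rightarrow> complex ^ 'n::finite"
  assumes m: "0 < m" "m < 1" and f: "vec_holomorphic_on f (ball 0 1)" "f ` ball 0 1 \<subseteq> egg \<iota> m"
  defines "z \<equiv> f 0" and "v \<equiv> vec_deriv f 0"
  shows "Re (herm (egg_wu \<iota> m z) v v) \<le> 1"
proof -
  let ?J = "UNIV - {\<iota>}"
  have hol: "(\<lambda>\<zeta>. f \<zeta> $ i) holomorphic_on ball 0 1" for i using f(1) by (simp add: vec_holomorphic_on_def)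
  have mem: "f \<zeta> \<in> egg \<iota> m" if "\<zeta> \<in> ball 0 1" for \<zeta> using f(2) that by blast
  have z: "z \<in> egg \<iota> m" unfolding z_def by (rule mem) simp
  define s where "s = gap \<iota> z"
  have s: "s > 0" "cmod (z $ \<iota>) powr (2 * m) < s" using egg_facts[OF m(1) z] by (auto simp: s_def)
  define sa where "sa = sqrt s"
  have sa: "sa > 0" "sa\<^sup>2 = s" using s by (auto simp: sa_def)
  have zz: "hprod \<iota> z z = of_real (1 - s)" "(\<Sum>i\<in>?J. (cmod (z $ i))\<^sup>2) = 1 - s" by (simp_all add: hprod_self s_def gap_def)
  define D where "D \<zeta> = 1 - hprod \<iota> (f \<zeta>) z" for \<zeta>
  have Dpos: "Re (D \<zeta>) > 0" if "\<zeta> \<in> ball 0 1" for \<zeta>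
  proof -
    have "cmod (hprod \<iota> (f \<zeta>) z) < 1"
      by (rule hprod_cmod_less_1) (use egg_facts[OF m(1) mem[OF that]] s in \<open>auto simp: s_def\<close>)
    then have "Re (hprod \<iota> (f \<zeta>) z) < 1" using complex_Re_le_cmod le_less_trans by blast
    then show ?thesis by (simp add: D_def)
  qed
  have D0: "D \<zeta> \<noteq> 0" if "\<zeta> \<in> ball 0 1" for \<zeta> using Dpos[OF that] by auto
  have holD: "D holomorphic_on ball 0 1" unfolding D_def hprod_def by (intro holomorphic_intros hol)
  have D00: "D 0 = of_real s" by (simp add: D_def z_def[symmetric] zz)
  define K where "K \<zeta> = of_real sa / D \<zeta>" for \<zeta>
  \<comment> \<open>A positive real part keeps \<open>K\<close> off the branch cut of
    \<open>Ln\<close>, so its power 1/m is holomorphic on the disc.\<close>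
  have Kpos: "Re (K \<zeta>) > 0" if "\<zeta> \<in> ball 0 1" for \<zeta>
    using Dpos[OF that] D0[OF that] sa by (simp add: K_def Re_divide flip: cmod_power2)
  have Kn: "K \<zeta> \<notin> \<real>\<^sub>\<le>\<^sub>0" "K \<zeta> \<noteq> 0" if "\<zeta> \<in> ball 0 1" for \<zeta> using Kpos[OF that] by (auto simp: complex_nonpos_Reals_iff)
  define g where "g \<zeta> = f \<zeta> $ \<iota> * exp (of_real (1/m) * Ln (K \<zeta>))" for \<zeta>
  define k where "k i \<zeta> = (of_real sa * (f \<zeta> - z) $ i + hprod \<iota> (f \<zeta> - z) z / of_real (1 + sa) * z $ i) / D \<zeta>" for i \<zeta>
  have holK: "K holomorphic_on ball 0 1" unfolding K_def using D0 by (intro holomorphic_intros holD) auto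
  have holg: "g holomorphic_on ball 0 1" unfolding g_def
    using Kn by (intro holomorphic_intros hol holK) auto
  have holk: "k i holomorphic_on ball 0 1" for i unfolding k_def hprod_def vector_minus_component
    using D0 sa by (intro holomorphic_intros hol holD) (auto simp del: of_real_add)
  have "cmod (g \<zeta>) powr (2 * m) + (\<Sum>i\<in>?J. (cmod (k i \<zeta>))\<^sup>2) < 1" if \<zeta>: "\<zeta> \<in> ball 0 1" for \<zeta>
  proof -
    let ?d = "(cmod (D \<zeta>))\<^sup>2"
    have d: "?d > 0" using D0[OF \<zeta>] by simp
    have "cmod (g \<zeta>) = cmod (f \<zeta> $ \<iota>) * (sa / cmod (D \<zeta>)) powr (1/m)"
      unfolding g_def using norm_exp_Ln[OF Kn(2)[OF \<zeta>], of "1/m"] sa by (simp add: norm_mult K_def norm_divide)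
    then have "cmod (g \<zeta>) powr (2 * m) = cmod (f \<zeta> $ \<iota>) powr (2 * m) * (sa / cmod (D \<zeta>)) powr (real 2)"
      using m by (simp add: powr_mult powr_powr)
    also have "(sa / cmod (D \<zeta>)) powr (real 2) = s / ?d"
      using sa D0[OF \<zeta>] by (subst powr_realpow) (auto simp: power_divide)
    finally have 1: "cmod (g \<zeta>) powr (2 * m) = cmod (f \<zeta> $ \<iota>) powr (2 * m) * s / ?d" by simp
    have "(\<Sum>i\<in>?J. (cmod (k i \<zeta>))\<^sup>2) = (\<Sum>i\<in>?J. (cmod (of_real (sqrt s) * (f \<zeta> - z) $ i + hprod \<iota> (f \<zeta> - z) z / of_real (1 + sqrt s) * z $ i))\<^sup>2) / ?d"
      unfolding k_def sa_def by (simp add: norm_divide power_divide sum_divide_distrib del: of_real_add)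
    also have "(\<Sum>i\<in>?J. (cmod (of_real (sqrt s) * (f \<zeta> - z) $ i + hprod \<iota> (f \<zeta> - z) z / of_real (1 + sqrt s) * z $ i))\<^sup>2)
       = s * (\<Sum>i\<in>?J. (cmod ((f \<zeta> - z) $ i))\<^sup>2) + (cmod (hprod \<iota> (f \<zeta> - z) z))\<^sup>2"
      unfolding hprod_def by (rule sum_cmod_ball_aut[OF s(1) zz(2)])
    also have "(\<Sum>i\<in>?J. (cmod ((f \<zeta> - z) $ i))\<^sup>2) = Re (hprod \<iota> (f \<zeta> - z) (f \<zeta> - z))"
      by (simp add: hprod_self_sum)
    also have "\<dots> = (1 - gap \<iota> (f \<zeta>)) - 2 * Re (hprod \<iota> (f \<zeta>) z) + (1 - s)"
    proof -
      have "Re (hprod \<iota> z (f \<zeta>)) = Re (hprod \<iota> (f \<zeta>) z)" by (metis hprod_cnj cnj.simps(1))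
      moreover have "hprod \<iota> (f \<zeta> - z) (f \<zeta> - z) = hprod \<iota> (f \<zeta>) (f \<zeta>) - hprod \<iota> (f \<zeta>) z - hprod \<iota> z (f \<zeta>) + hprod \<iota> z z"
        by (simp add: hprod_diff_left hprod_diff_right)
      ultimately show ?thesis
        by (simp add: hprod_self[of _ z] hprod_self[of _ "f \<zeta>"] s_def)
    qed
    also have "hprod \<iota> (f \<zeta> - z) z = hprod \<iota> (f \<zeta>) z - of_real (1 - s)" by (simp add: hprod_simps zz)
    also have "s * ((1 - gap \<iota> (f \<zeta>)) - 2 * Re (hprod \<iota> (f \<zeta>) z) + (1 - s)) + (cmod (hprod \<iota> (f \<zeta>) z - of_real (1 - s)))\<^sup>2
      = ?d - s * gap \<iota> (f \<zeta>)"
      unfolding D_def cmod_sq by (simp add: algebra_simps)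
    finally have 2: "(\<Sum>i\<in>?J. (cmod (k i \<zeta>))\<^sup>2) = 1 - s * gap \<iota> (f \<zeta>) / ?d" using d by (simp add: diff_divide_distrib)
    have "cmod (f \<zeta> $ \<iota>) powr (2 * m) * s < gap \<iota> (f \<zeta>) * s"
      using egg_facts(3)[OF m(1) mem[OF \<zeta>]] s by (intro mult_strict_right_mono) auto
    then show ?thesis unfolding 1 2 using d by (simp add: field_simps)
  qed
  moreover have k0: "k i 0 = 0" for i by (simp add: k_def z_def[symmetric]) (simp add: hprod_def)
  ultimately have main: "(cmod (deriv g 0))\<^sup>2 / (1 - (cmod (g 0))\<^sup>2)\<^sup>2 + (\<Sum>i\<in>?J. (cmod (deriv (k i) 0))\<^sup>2) / (1 - cmod (g 0) powr (2 * m)) \<le> 1"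
    by (intro Schwarz_complex_ellipsoid[OF m holg _ holk k0]) auto
  have df: "((\<lambda>\<zeta>. f \<zeta> $ i) has_field_derivative v $ i) (at 0)" for i
    using holomorphic_derivI[OF hol[of i], of 0] by (simp add: v_def vec_deriv_def)
  have dh: "((\<lambda>\<zeta>. hprod \<iota> (f \<zeta>) z) has_field_derivative hprod \<iota> v z) (at 0)"
    unfolding hprod_def by (auto intro!: derivative_eq_intros df)
  have dD: "(D has_field_derivative - hprod \<iota> v z) (at 0)"
    unfolding D_def by (auto intro!: derivative_eq_intros dh)
  have dK: "(K has_field_derivative of_real sa * hprod \<iota> v z / (of_real s)\<^sup>2) (at 0)"
    unfolding K_def using D00 s by (auto intro!: derivative_eq_intros dD simp: power2_eq_square)
  have K0: "K 0 = of_real (sa / s)" by (simp add: K_def D00)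
  \<comment> \<open>The multiplier of the first coordinate at the centre. Its squared modulus is
    s^(-1/m); hence |g 0|^2 is the value of E at z.\<close>
  define \<kappa> where "\<kappa> = exp (of_real (1/m) * Ln (K 0))"
  have "((\<lambda>\<zeta>. exp (of_real (1/m) * Ln (K \<zeta>))) has_field_derivative \<kappa> * (of_real (1/m) * (inverse (K 0) * (of_real sa * hprod \<iota> v z / (of_real s)\<^sup>2)))) (at 0)"
    unfolding \<kappa>_def by (intro DERIV_chain2[OF DERIV_exp] DERIV_cmult DERIV_chain2[OF has_field_derivative_Ln] dK) (use Kn(1)[of 0] in auto)
  moreover have "inverse (K 0) * (of_real sa * hprod \<iota> v z / (of_real s)\<^sup>2) = hprod \<iota> v z / of_real s"
    unfolding K0 using sa s by (simp add: field_simps power2_eq_square)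
  ultimately have dE: "((\<lambda>\<zeta>. exp (of_real (1/m) * Ln (K \<zeta>))) has_field_derivative \<kappa> * (of_real (1/m) * (hprod \<iota> v z / of_real s))) (at 0)"
    by (simp only:)
  have "(g has_field_derivative (v $ \<iota> * \<kappa> + \<kappa> * (of_real (1/m) * (hprod \<iota> v z / of_real s)) * z $ \<iota>)) (at 0)"
    unfolding g_def using DERIV_mult[OF df[of \<iota>] dE] by (simp add: \<kappa>_def z_def)
  then have "deriv g 0 = \<kappa> * conn_form \<iota> m z v"
    by (intro DERIV_imp_deriv) (simp add: conn_form_def s_def algebra_simps)
  then have g': "(cmod (deriv g 0))\<^sup>2 = (cmod \<kappa>)\<^sup>2 * (cmod (conn_form \<iota> m z v))\<^sup>2"
    by (simp add: norm_mult power_mult_distrib)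
  have k': "deriv (k i) 0 = (of_real (sqrt s) * v $ i + hprod \<iota> v z / of_real (1 + sqrt s) * z $ i) / of_real s" for i
  proof -
    define N where "N \<zeta> = of_real sa * (f \<zeta> $ i - z $ i) + (hprod \<iota> (f \<zeta>) z - hprod \<iota> z z) / of_real (1 + sa) * z $ i" for \<zeta>
    have "(N has_field_derivative of_real sa * v $ i + hprod \<iota> v z / of_real (1 + sa) * z $ i) (at 0)"
      unfolding N_def using sa
      by (auto intro!: derivative_eq_intros df dh simp del: of_real_add)
    moreover have "N 0 = 0" by (simp add: N_def z_def)
    ultimately have "((\<lambda>\<zeta>. N \<zeta> / D \<zeta>) has_field_derivative ((of_real sa * v $ i + hprod \<iota> v z / of_real (1 + sa) * z $ i) * D 0 - 0 * - hprod \<iota> v z) / (D 0 * D 0)) (at 0)"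
      using DERIV_divide[OF _ dD, of N] D0[of 0] by simp
    moreover have "(\<lambda>\<zeta>. N \<zeta> / D \<zeta>) = k i" by (simp add: fun_eq_iff N_def k_def hprod_diff_left)
    ultimately show ?thesis using D00 s by (simp add: DERIV_imp_deriv sa_def del: of_real_add)
  qed
  have "(\<Sum>i\<in>?J. (cmod (deriv (k i) 0))\<^sup>2) = (\<Sum>i\<in>?J. (cmod (of_real (sqrt s) * v $ i + hprod \<iota> v z / of_real (1 + sqrt s) * z $ i))\<^sup>2) / s\<^sup>2"
    unfolding k' by (simp add: norm_divide power_divide sum_divide_distrib del: of_real_add)
  also have "\<dots> = (s * (\<Sum>i\<in>?J. (cmod (v $ i))\<^sup>2) + (cmod (hprod \<iota> v z))\<^sup>2) / s\<^sup>2"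
    unfolding hprod_def by (subst sum_cmod_ball_aut[OF s(1) zz(2)]) simp
  finally have ks: "(\<Sum>i\<in>?J. (cmod (deriv (k i) 0))\<^sup>2) = (\<Sum>i\<in>?J. (cmod (v $ i))\<^sup>2) / s + (cmod (hprod \<iota> v z))\<^sup>2 / s\<^sup>2"
    using s by (simp add: add_divide_distrib power2_eq_square)
  have "cmod (K 0) = s powr (- 1/2)"
  proof -
    have "cmod (K 0) = sa / s" unfolding K0 using sa s by (simp add: norm_divide)
    also have "\<dots> = 1 / sa" using sa(1) by (simp add: power2_eq_square flip: sa(2))
    also have "\<dots> = s powr (- 1/2)" using s by (simp add: sa_def powr_minus_divide powr_half_sqrt)
    finally show ?thesis .
  qed
  then have kap: "cmod \<kappa> = s powr (- 1/(2*m))"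
    unfolding \<kappa>_def using norm_exp_Ln[OF Kn(2)[of 0], of "1/m"] by (simp add: powr_powr)
  then have kap2: "(cmod \<kappa>)\<^sup>2 = s powr (- 1/m)" using s by (simp add: powr_power)
  have g0: "(cmod (g 0))\<^sup>2 = (cmod (z $ \<iota>))\<^sup>2 * s powr (- 1/m)"
    unfolding kap2[symmetric] by (simp add: g_def \<kappa>_def z_def norm_mult power_mult_distrib)
  have "cmod (g 0) powr (2 * m) = cmod (z $ \<iota>) powr (2 * m) * (cmod \<kappa>) powr (2 * m)"
    by (simp add: g_def \<kappa>_def z_def norm_mult powr_mult)
  also have "(cmod \<kappa>) powr (2 * m) = s powr (- 1)" unfolding kap using m by (simp add: powr_powr del: powr_minus_divide)
  also have "\<dots> = 1 / s" using s by (simp add: powr_minus_divide)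
  finally have g0m: "1 - cmod (g 0) powr (2 * m) = 1 / tangent_coeff \<iota> m z"
    using s unfolding tangent_coeff_def s_def[symmetric] by (simp add: field_simps)
  have "(cmod (deriv g 0))\<^sup>2 / (1 - (cmod (g 0))\<^sup>2)\<^sup>2 = normal_coeff \<iota> m z * (cmod (conn_form \<iota> m z v))\<^sup>2"
    unfolding g' kap2 g0 normal_coeff_alt[OF m(1) z] s_def by simp
  then show ?thesis using main unfolding Re_herm_egg_wu ks g0m s_def[symmetric] by (simp add: mult.commute)
qed

lemma indicatrix_egg_subset:
  assumes m: "0 < m" "m < 1" and z: "z \<in> egg \<iota> m"
  shows "kobayashi_indicatrix (egg \<iota> m) z \<subseteq> herm_ball (egg_wu \<iota> m z)"
proof
  fix v assume "v \<in> kobayashi_indicatrix (egg \<iota> m) z"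
  then obtain f l where f: "vec_holomorphic_on f (ball 0 1)" "f ` ball 0 1 \<subseteq> egg \<iota> m" "f 0 = z" "l *s vec_deriv f 0 = v" "cmod l < 1"
    using indicatrixE[OF open_egg[OF m(1)] z] by metis
  let ?q = "Re (herm (egg_wu \<iota> m z) (vec_deriv f 0) (vec_deriv f 0))"
  have "Re (herm (egg_wu \<iota> m z) v v) = (cmod l)\<^sup>2 * ?q"
    unfolding f(4)[symmetric] herm_scale_left herm_scale_right mult.assoc[symmetric]
    by (simp add: cmod_sq)
  also have "\<dots> \<le> (cmod l)\<^sup>2 * 1"
    using egg_disc_le[OF m f(1,2)] f(3) by (intro mult_left_mono) auto
  also have "\<dots> < 1" using f(5) by (simp add: abs_square_less_1)
  finally show "v \<in> herm_ball (egg_wu \<iota> m z)" by (simp add: herm_ball_def)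
qed

text \<open>These are the velocities at 0 of the discs constructed below. In terms of E = |z|^2
  s^(-1/m), \<open>r\<close> is the root of 1 - \<open>E powr m\<close> and the normal entry is S (1
  - E). The multiple \<beta> of z comes from the ball automorphism, and the first coordinate of a
  tangential vector is the one that annihilates \<open>conn_form\<close>.\<close>

definition egg_frame :: "'n::finite \<Rightarrow> real \<Rightarrow> complex ^ 'n \<Rightarrow> 'n \<Rightarrow> complex ^ 'n" where
  "egg_frame \<iota> m z i =
     (let s = gap \<iota> z; S = s powr (1/(2*m)); r = sqrt (1 - cmod (z $ \<iota>) powr (2 * m) / s);
        \<beta> = of_real (r * sqrt s / (1 + sqrt s)) * cnj (z $ i) in
      if i = \<iota> then axis \<iota> (of_real (S - (cmod (z $ \<iota>))\<^sup>2 / S))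
      else axis \<iota> (\<beta> * z $ \<iota> - z $ \<iota> * of_real r * cnj (z $ i) / of_real m) + of_real (sqrt s * r) *s axis i 1 - \<beta> *s z)"

lemma egg_frame_orthonormal:
  assumes m: "0 < m" and z: "z \<in> egg \<iota> m"
  shows "herm (egg_wu \<iota> m z) (egg_frame \<iota> m z i) (egg_frame \<iota> m z j) = (if i = j then 1 else 0)"
proof -
  define s where "s = gap \<iota> z"
  define S where "S = s powr (1/(2*m))"
  define r where "r = sqrt (1 - cmod (z $ \<iota>) powr (2 * m) / s)"
  define sa where "sa = sqrt s"
  note f = egg_facts[OF m z, folded s_def]
  have S: "S > 0" "S\<^sup>2 = s powr (1/m)" using f by (simp_all add: S_def powr_power)
  have r: "r > 0" "r\<^sup>2 * tangent_coeff \<iota> m z = 1"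
    using f by (simp_all add: r_def tangent_coeff_def s_def[symmetric] field_simps)
  have sa: "sa > 0" "sa\<^sup>2 = s" using f by (simp_all add: sa_def)
  define \<beta> where "\<beta> i = of_real (r * sa / (1 + sa)) * cnj (z $ i)" for i
  have Ei: "egg_frame \<iota> m z \<iota> = axis \<iota> (of_real (S - (cmod (z $ \<iota>))\<^sup>2 / S))"
    by (simp add: egg_frame_def Let_def S_def s_def)
  have Ek: "egg_frame \<iota> m z i = axis \<iota> (\<beta> i * z $ \<iota> - z $ \<iota> * of_real r * cnj (z $ i) / of_real m) + of_real (sa * r) *s axis i 1 - \<beta> i *s z"
    if "i \<noteq> \<iota>" for i using that by (simp add: egg_frame_def Let_def r_def sa_def s_def \<beta>_def)
  have zz: "hprod \<iota> z z = of_real (1 - sa\<^sup>2)" by (simp add: hprod_self s_def sa)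
  have hE0: "hprod \<iota> (egg_frame \<iota> m z \<iota>) v = 0" "hprod \<iota> v (egg_frame \<iota> m z \<iota>) = 0" for v
    by (simp_all add: Ei hprod_simps)
  have key: "of_real (sa * r) - of_real (r * sa / (1 + sa)) * of_real (1 - sa\<^sup>2) = (of_real (r * s) :: complex)"
  proof -
    have "sa * r - r * sa / (1 + sa) * (1 - sa\<^sup>2) = r * sa\<^sup>2"
    proof -
      have "r * sa / (1 + sa) * (1 - sa\<^sup>2) = r * sa * (1 - sa)"
      proof -
        have "1 - sa\<^sup>2 = (1 + sa) * (1 - sa)" by (simp add: power2_eq_square algebra_simps)
        then show ?thesis using sa(1) by simp
      qed
      then show ?thesis by (simp add: power2_eq_square algebra_simps)
    qed
    then show ?thesis unfolding sa(2) by (simp only: of_real_diff[symmetric] of_real_mult[symmetric])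
  qed
  have hEz: "hprod \<iota> (egg_frame \<iota> m z i) z = of_real (r * s) * cnj (z $ i)" if "i \<noteq> \<iota>" for i
  proof -
    have "hprod \<iota> (egg_frame \<iota> m z i) z = cnj (z $ i) * (of_real (sa * r) - of_real (r * sa / (1 + sa)) * of_real (1 - sa\<^sup>2))"
      using that unfolding Ek[OF that] by (simp only: hprod_simps zz \<beta>_def if_False refl if_True) (simp add: algebra_simps)
    then show ?thesis unfolding key by (simp add: mult.commute)
  qed
  \<comment> \<open>The tangential vectors are annihilated by \<open>conn_form\<close> and the
    normal one by \<open>hprod\<close>, so the two parts of the metric decouple on the
    frame.\<close>
  have A0: "conn_form \<iota> m z (egg_frame \<iota> m z i) = 0" if "i \<noteq> \<iota>" for i
  proof -
    have "egg_frame \<iota> m z i $ \<iota> = - (z $ \<iota> * of_real r * cnj (z $ i) / of_real m)"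
      using that unfolding Ek[OF that] by (simp add: axis_def)
    then show ?thesis unfolding conn_form_def hEz[OF that] using f m by (simp add: s_def[symmetric])
  qed
  show ?thesis
  proof (cases "i = \<iota>")
    case True
    show ?thesis
    proof (cases "j = \<iota>")
      case True
      have "conn_form \<iota> m z (egg_frame \<iota> m z \<iota>) = of_real (S - (cmod (z $ \<iota>))\<^sup>2 / S)"
        unfolding conn_form_def hE0 by (simp add: Ei)
      moreover have "normal_coeff \<iota> m z * (S - (cmod (z $ \<iota>))\<^sup>2 / S) * (S - (cmod (z $ \<iota>))\<^sup>2 / S) = 1"
      proof -
        have "S - (cmod (z $ \<iota>))\<^sup>2 / S = (S\<^sup>2 - (cmod (z $ \<iota>))\<^sup>2) / S"
          using S(1) by (simp add: field_simps power2_eq_square)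
        moreover have "S\<^sup>2 - (cmod (z $ \<iota>))\<^sup>2 > 0" using f S by simp
        ultimately show ?thesis using S(1) unfolding normal_coeff_def s_def[symmetric] S(2)[symmetric]
          by (simp add: power2_eq_square)
      qed
      ultimately show ?thesis unfolding herm_egg_wu True \<open>i = \<iota>\<close> hE0
        by (simp only: complex_cnj_complex_of_real of_real_mult[symmetric]) simp
    next
      case False
      then show ?thesis unfolding herm_egg_wu \<open>i = \<iota>\<close> hE0 A0[OF False] by simp
    qed
  next
    case ii: False
    show ?thesis
    proof (cases "j = \<iota>")
      case True
      then show ?thesis unfolding herm_egg_wu True hE0 A0[OF ii] using ii by simp
    next
      case jj: False
      have "hprod \<iota> (egg_frame \<iota> m z i) (egg_frame \<iota> m z j)
         = of_real (sa * r) * hprod \<iota> (egg_frame \<iota> m z i) (axis j 1) - cnj (\<beta> j) * hprod \<iota> (egg_frame \<iota> m z i) z"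
        unfolding Ek[OF jj] using jj by (simp add: hprod_simps)
      also have "hprod \<iota> (egg_frame \<iota> m z i) (axis j 1) = of_real (sa * r) * (if i = j then 1 else 0) - \<beta> i * z $ j"
        unfolding Ek[OF ii] using ii jj by (simp add: hprod_simps) (auto simp: axis_def)
      also have "of_real (sa * r) * (of_real (sa * r) * (if i = j then 1 else 0) - \<beta> i * z $ j) - cnj (\<beta> j) * hprod \<iota> (egg_frame \<iota> m z i) z
         = of_real (r\<^sup>2 * s) * (if i = j then 1 else 0) - of_real (r\<^sup>2 * s) * cnj (z $ i) * z $ j"
      proof -
        have "sa * r * (r * sa / (1 + sa)) + r * sa / (1 + sa) * (r * s) = r\<^sup>2 * s"
        proof -
          define k where "k = 1 / (1 + sa)"
          have "sa * r * (r * sa * k) + r * sa * k * (r * sa\<^sup>2) = r\<^sup>2 * sa\<^sup>2 * (k * (1 + sa))"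
            by (simp add: algebra_simps power2_eq_square)
          moreover have "k * (1 + sa) = 1" using sa(1) by (simp add: k_def)
          ultimately show ?thesis unfolding sa(2)[symmetric] by (simp add: k_def)
        qed
        then have e: "of_real (sa * r) * of_real (r * sa / (1 + sa)) + of_real (r * sa / (1 + sa)) * of_real (r * s) = (of_real (r\<^sup>2 * s) :: complex)"
          by (simp only: of_real_mult[symmetric] of_real_add[symmetric])
        have e2: "of_real (sa * r) * of_real (sa * r) = (of_real (r\<^sup>2 * s) :: complex)"
          unfolding sa(2)[symmetric] by (simp add: power2_eq_square)
        have "of_real (sa * r) * (of_real (sa * r) * (if i = j then 1 else 0) - \<beta> i * z $ j) - cnj (\<beta> j) * hprod \<iota> (egg_frame \<iota> m z i) z
           = of_real (sa * r) * of_real (sa * r) * (if i = j then 1 else 0)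
             - (of_real (sa * r) * of_real (r * sa / (1 + sa)) + of_real (r * sa / (1 + sa)) * of_real (r * s)) * cnj (z $ i) * z $ j"
          unfolding hEz[OF ii] \<beta>_def complex_cnj_mult complex_cnj_cnj complex_cnj_complex_of_real by (simp only: algebra_simps)
        then show ?thesis unfolding e e2 .
      qed
      finally have hE: "hprod \<iota> (egg_frame \<iota> m z i) (egg_frame \<iota> m z j)
         = of_real (r\<^sup>2 * s) * (if i = j then 1 else 0) - of_real (r\<^sup>2 * s) * cnj (z $ i) * z $ j" .
      have "hprod \<iota> (egg_frame \<iota> m z i) (egg_frame \<iota> m z j) / of_real s
        + hprod \<iota> (egg_frame \<iota> m z i) z * cnj (hprod \<iota> (egg_frame \<iota> m z j) z) / of_real (s\<^sup>2) = of_real (r\<^sup>2) * (if i = j then 1 else 0)"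
        unfolding hE hEz[OF ii] hEz[OF jj] using f by (simp add: field_simps power2_eq_square)
      then have "herm (egg_wu \<iota> m z) (egg_frame \<iota> m z i) (egg_frame \<iota> m z j)
        = of_real (tangent_coeff \<iota> m z) * (of_real (r\<^sup>2) * (if i = j then 1 else 0))"
        unfolding herm_egg_wu A0[OF ii] s_def[symmetric] by simp
      also have "\<dots> = of_real (r\<^sup>2 * tangent_coeff \<iota> m z) * (if i = j then 1 else 0)" by simp
      finally show ?thesis unfolding r(2) by simp
    qed
  qed
qed

text \<open>The slice of the egg through z with all other coordinates fixed is a disc of radius S;
  the map is its Moebius parametrization with centre z.\<close>

lemma egg_normal_disc:
  fixes z :: "complex ^ 'n::finite"
  assumes m: "0 < m" and z: "z \<in> egg \<iota> m"
  obtains f where "vec_holomorphic_on f (ball 0 1)" "f ` ball 0 1 \<subseteq> egg \<iota> m" "f 0 = z"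
    "vec_deriv f 0 = egg_frame \<iota> m z \<iota>"
proof -
  define s where "s = gap \<iota> z"
  define S where "S = s powr (1/(2*m))"
  note fc = egg_facts[OF m z, folded s_def]
  have S: "S > 0" "S\<^sup>2 = s powr (1/m)" "S powr (2 * m) = s" using fc m by (simp_all add: S_def powr_power powr_powr)
  define p where "p = z $ \<iota> / of_real S"
  have p: "cmod p < 1"
  proof -
    have "(cmod (z $ \<iota>))\<^sup>2 < S\<^sup>2" using fc S by simp
    then have "cmod (z $ \<iota>) < S" using S(1) by (simp add: power_less_imp_less_base)
    then show ?thesis using S(1) by (simp add: p_def norm_divide)
  qed
  have nz: "1 + cnj p * \<zeta> \<noteq> 0" if "\<zeta> \<in> ball 0 1" for \<zeta>
    using one_minus_cnj_mult_ne_0[of "- p" \<zeta>] p that by simp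
  define f where "f \<zeta> = (\<chi> j. if j = \<iota> then of_real S * ((\<zeta> + p) / (1 + cnj p * \<zeta>)) else z $ j)" for \<zeta>
  have fi: "(\<lambda>\<zeta>. f \<zeta> $ j) = (if j = \<iota> then (\<lambda>\<zeta>. of_real S * ((\<zeta> + p) / (1 + cnj p * \<zeta>))) else (\<lambda>\<zeta>. z $ j))" for j
    by (auto simp: f_def)
  show ?thesis
  proof (rule that)
    show "vec_holomorphic_on f (ball 0 1)" unfolding vec_holomorphic_on_def fi
      using nz by (auto intro!: holomorphic_intros)
    show "f 0 = z" using S by (auto simp: f_def vec_eq_iff p_def)
    show "f ` ball 0 1 \<subseteq> egg \<iota> m"
    proof (rule image_subsetI)
      fix \<zeta> :: complex assume \<zeta>: "\<zeta> \<in> ball 0 1"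
      have n: "1 - cnj (- p) * \<zeta> \<noteq> 0" using nz[OF \<zeta>] by simp
      have "1 - (cmod ((\<zeta> + p) / (1 + cnj p * \<zeta>)))\<^sup>2 > 0"
        using Moebius_norm[OF n] nz[OF \<zeta>] p \<zeta> by (simp add: abs_square_less_1)
      then have "cmod ((\<zeta> + p) / (1 + cnj p * \<zeta>)) < 1" by (simp add: abs_square_less_1)
      then have "S * cmod ((\<zeta> + p) / (1 + cnj p * \<zeta>)) < S * 1" using S(1) by (intro mult_strict_left_mono)
      moreover have "cmod (f \<zeta> $ \<iota>) = S * cmod ((\<zeta> + p) / (1 + cnj p * \<zeta>))"
        using S(1) unfolding f_def by (simp add: norm_mult norm_divide)
      ultimately have "cmod (f \<zeta> $ \<iota>) < S" by simp
      then have "cmod (f \<zeta> $ \<iota>) powr (2 * m) < S powr (2 * m)" using m by (intro powr_less_mono2) auto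
      moreover have "gap \<iota> (f \<zeta>) = s" unfolding s_def gap_def by (simp add: f_def)
      ultimately show "f \<zeta> \<in> egg \<iota> m" by (simp add: egg_iff S)
    qed
    have "((\<lambda>\<zeta>. of_real S * ((\<zeta> + p) / (1 + cnj p * \<zeta>))) has_field_derivative of_real S * (1 - p * cnj p)) (at 0)"
      by (auto intro!: derivative_eq_intros simp: algebra_simps)
    then have d: "deriv (\<lambda>\<zeta>. of_real S * ((\<zeta> + p) / (1 + cnj p * \<zeta>))) 0 = of_real S * (1 - p * cnj p)" by (rule DERIV_imp_deriv)
    have e: "of_real S * (1 - p * cnj p) = of_real (S - (cmod (z $ \<iota>))\<^sup>2 / S)"
      unfolding complex_norm_square[symmetric] p_def using S(1)
      by (simp add: norm_divide power_divide field_simps power2_eq_square)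
    show "vec_deriv f 0 = egg_frame \<iota> m z \<iota>"
      unfolding vec_deriv_def fi using d e by (auto simp: vec_eq_iff egg_frame_def Let_def axis_def S_def s_def)
  qed
qed

text \<open>Over w = 0 this is the disc \<zeta> \<mapsto> (z, r \<zeta> e_i), which reaches the
  boundary because r^2 = 1 - |z|^(2m) there. In general it is the image of such a disc under an
  automorphism taking 0 to the given w: the tangential coordinates acquire the denominator
  \<open>D\<close>, the first one the factor D^(-1/m).\<close>

lemma egg_tangent_disc:
  fixes z :: "complex ^ 'n::finite"
  assumes m: "0 < m" and z: "z \<in> egg \<iota> m" and i: "i \<noteq> \<iota>"
  obtains f where "vec_holomorphic_on f (ball 0 1)" "f ` ball 0 1 \<subseteq> egg \<iota> m" "f 0 = z"
    "vec_deriv f 0 = egg_frame \<iota> m z i"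
proof -
  let ?J = "UNIV - {\<iota>}"
  define s where "s = gap \<iota> z"
  define r where "r = sqrt (1 - cmod (z $ \<iota>) powr (2 * m) / s)"
  define sa where "sa = sqrt s"
  note fc = egg_facts[OF m z, folded s_def]
  have r: "r > 0" "r\<^sup>2 = 1 - cmod (z $ \<iota>) powr (2 * m) / s" "r \<le> 1"
    using fc by (simp_all add: r_def)
  have sa: "sa > 0" "sa\<^sup>2 = s" using fc by (simp_all add: sa_def)
  define b where "b = of_real r * cnj (z $ i)"
  have "(cmod (z $ i))\<^sup>2 \<le> (\<Sum>i\<in>?J. (cmod (z $ i))\<^sup>2)" using i by (intro member_le_sum) auto
  then have "(cmod (z $ i))\<^sup>2 < 1" using fc by (simp add: s_def gap_def)
  then have zi: "cmod (z $ i) < 1" by (simp add: abs_square_less_1)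
  have b: "cmod b < 1" using mult_le_less_imp_less[OF r(3) zi] zi r
    by (simp add: b_def norm_mult)
  define D where "D \<zeta> = 1 + b * \<zeta>" for \<zeta>
  have Dpos: "Re (D \<zeta>) > 0" if "\<zeta> \<in> ball 0 1" for \<zeta>
  proof -
    have "cmod (b * \<zeta>) < 1" using b that
      by (simp add: norm_mult) (metis le_less_trans mult.right_neutral mult_left_mono norm_ge_zero less_eq_real_def)
    then have "- Re (b * \<zeta>) < 1" using abs_Re_le_cmod[of "b * \<zeta>"] by linarith
    then show ?thesis by (simp add: D_def)
  qed
  have D0: "D \<zeta> \<noteq> 0" "D \<zeta> \<notin> \<real>\<^sub>\<le>\<^sub>0" if "\<zeta> \<in> ball 0 1" for \<zeta> using Dpos[OF that] by (auto simp: complex_nonpos_Reals_iff)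
  have holD: "D holomorphic_on ball 0 1" unfolding D_def by (intro holomorphic_intros)
  define n where "n j \<zeta> = of_real sa * (of_real r * \<zeta> * axis i 1 $ j) + (1 + b * \<zeta> / of_real (1 + sa)) * z $ j" for j \<zeta>
  define f where "f \<zeta> = (\<chi> j. if j = \<iota> then z $ \<iota> * exp (of_real (- 1/m) * Ln (D \<zeta>)) else n j \<zeta> / D \<zeta>)" for \<zeta>
  have fi: "(\<lambda>\<zeta>. f \<zeta> $ j) = (if j = \<iota> then (\<lambda>\<zeta>. z $ \<iota> * exp (of_real (- 1/m) * Ln (D \<zeta>))) else (\<lambda>\<zeta>. n j \<zeta> / D \<zeta>))" for j
    by (auto simp: f_def)
  have holn: "n j holomorphic_on ball 0 1" for j unfolding n_def using sa
    by (intro holomorphic_intros) (auto simp del: of_real_add)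
  show ?thesis
  proof (rule that)
    show "vec_holomorphic_on f (ball 0 1)" unfolding vec_holomorphic_on_def fi
      using D0 by (auto intro!: holomorphic_intros holD holn)
    show "f 0 = z" by (auto simp: f_def vec_eq_iff n_def D_def)
    show "f ` ball 0 1 \<subseteq> egg \<iota> m"
    proof (rule image_subsetI)
      fix \<zeta> :: complex assume \<zeta>: "\<zeta> \<in> ball 0 1"
      let ?d = "(cmod (D \<zeta>))\<^sup>2"
      have d: "?d > 0" using D0[OF \<zeta>] by simp
      have "cmod (f \<zeta> $ \<iota>) = cmod (z $ \<iota>) * cmod (D \<zeta>) powr (- 1/m)"
        unfolding f_def using norm_exp_Ln[OF D0(1)[OF \<zeta>], of "- 1/m"] by (simp add: norm_mult)
      then have "cmod (f \<zeta> $ \<iota>) powr (2 * m) = cmod (z $ \<iota>) powr (2 * m) * cmod (D \<zeta>) powr (- 2)"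
        using m by (simp add: powr_mult powr_powr)
      also have "cmod (D \<zeta>) powr (- 2) = 1 / ?d"
        using D0[OF \<zeta>] by (simp add: powr_minus_divide)
      finally have 1: "cmod (f \<zeta> $ \<iota>) powr (2 * m) = cmod (z $ \<iota>) powr (2 * m) / ?d" by simp
      let ?\<tau> = "1 + b * \<zeta> / of_real (1 + sa)"
      have "(\<Sum>j\<in>?J. (cmod (n j \<zeta>))\<^sup>2) = sa\<^sup>2 * (\<Sum>j\<in>?J. (cmod (of_real r * \<zeta> * axis i 1 $ j))\<^sup>2)
         + 2 * sa * Re (cnj ?\<tau> * (\<Sum>j\<in>?J. of_real r * \<zeta> * axis i 1 $ j * cnj (z $ j))) + (cmod ?\<tau>)\<^sup>2 * (\<Sum>j\<in>?J. (cmod (z $ j))\<^sup>2)"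
        unfolding n_def by (rule sum_cmod_lincomb)
      also have "(\<Sum>j\<in>?J. (cmod (of_real r * \<zeta> * axis i 1 $ j))\<^sup>2) = (\<Sum>j\<in>?J. if j = i then r\<^sup>2 * (cmod \<zeta>)\<^sup>2 else 0)"
        by (intro sum.cong refl) (auto simp: axis_def norm_mult power_mult_distrib)
      also have "\<dots> = r\<^sup>2 * (cmod \<zeta>)\<^sup>2" using i by simp
      also have "(\<Sum>j\<in>?J. of_real r * \<zeta> * axis i 1 $ j * cnj (z $ j)) = (\<Sum>j\<in>?J. if j = i then b * \<zeta> else 0)"
        by (intro sum.cong refl) (auto simp: axis_def b_def)
      also have "\<dots> = b * \<zeta>" using i by simp
      also have "(\<Sum>j\<in>?J. (cmod (z $ j))\<^sup>2) = 1 - sa\<^sup>2" by (simp add: sa s_def gap_def)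
      also have "sa\<^sup>2 * (r\<^sup>2 * (cmod \<zeta>)\<^sup>2) + 2 * sa * Re (cnj ?\<tau> * (b * \<zeta>)) + (cmod ?\<tau>)\<^sup>2 * (1 - sa\<^sup>2)
        = ?d - s + s * r\<^sup>2 * (cmod \<zeta>)\<^sup>2"
      proof -
        define y where "y = b * \<zeta>"
        define k where "k = 1 / (1 + sa)"
        have k: "k * (1 + sa) = 1" using sa(1) by (simp add: k_def)
        have t: "1 + y / of_real (1 + sa) = 1 + of_real k * y" by (simp add: k_def)
        have R: "Re (cnj (1 + of_real k * y) * y) = Re y + k * (cmod y)\<^sup>2" unfolding cmod_sq by (simp add: algebra_simps)
        have N: "(cmod (1 + of_real k * y))\<^sup>2 = 1 + 2 * k * Re y + k\<^sup>2 * (cmod y)\<^sup>2" unfolding cmod_sq by (simp add: algebra_simps power2_eq_square)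
        have "2 * sa * (Y + k * T) + (1 + 2 * k * Y + k\<^sup>2 * T) * (1 - sa\<^sup>2) = 1 + 2 * Y + T - sa\<^sup>2" for Y T
        proof -
          have k1: "k * (1 - sa\<^sup>2) = 1 - sa"
          proof -
            have "k * (1 - sa\<^sup>2) = (k * (1 + sa)) * (1 - sa)" by (simp add: algebra_simps power2_eq_square)
            then show ?thesis unfolding k by simp
          qed
          have "2 * sa * (Y + k * T) + (1 + 2 * k * Y + k\<^sup>2 * T) * (1 - sa\<^sup>2)
            = 2 * sa * Y + 2 * sa * k * T + (1 - sa\<^sup>2) + 2 * Y * (k * (1 - sa\<^sup>2)) + k * T * (k * (1 - sa\<^sup>2))"
            by (simp add: algebra_simps power2_eq_square)
          also have "\<dots> = 1 + 2 * Y + T * (k * (1 + sa)) - sa\<^sup>2" unfolding k1 by (simp add: algebra_simps)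
          finally show ?thesis unfolding k by simp
        qed
        moreover have "?d = 1 + 2 * Re y + (cmod y)\<^sup>2" unfolding D_def y_def[symmetric] cmod_sq by (simp add: algebra_simps)
        ultimately show ?thesis unfolding y_def[symmetric] t R N sa(2)[symmetric] by simp
      qed
      finally have "(\<Sum>j\<in>?J. (cmod (n j \<zeta>))\<^sup>2) = ?d - s + s * r\<^sup>2 * (cmod \<zeta>)\<^sup>2" .
      moreover have "(\<Sum>j\<in>?J. (cmod (f \<zeta> $ j))\<^sup>2) = (\<Sum>j\<in>?J. (cmod (n j \<zeta>))\<^sup>2) / ?d"
        unfolding sum_divide_distrib by (intro sum.cong refl) (auto simp: f_def norm_divide power_divide)
      ultimately have 2: "gap \<iota> (f \<zeta>) = (s - s * r\<^sup>2 * (cmod \<zeta>)\<^sup>2) / ?d"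
        unfolding gap_def using d by (simp add: field_simps)
      have sr: "s * r\<^sup>2 = s - cmod (z $ \<iota>) powr (2 * m)" unfolding r(2) using fc by (simp add: field_simps)
      have "(s * r\<^sup>2) * (cmod \<zeta>)\<^sup>2 < (s * r\<^sup>2) * 1"
        using \<zeta> r fc by (intro mult_strict_left_mono) (auto simp: abs_square_less_1)
      then show "f \<zeta> \<in> egg \<iota> m" unfolding egg_iff 1 2 using d sr by (simp add: divide_strict_right_mono)
    qed
    have dD: "(D has_field_derivative b) (at 0)" unfolding D_def by (auto intro!: derivative_eq_intros)
    have D00: "D 0 = 1" by (simp add: D_def)
    have "((\<lambda>\<zeta>. z $ \<iota> * exp (of_real (- 1/m) * Ln (D \<zeta>))) has_field_derivative z $ \<iota> * (exp (of_real (- 1/m) * Ln (D 0)) * (of_real (- 1/m) * (inverse (D 0) * b)))) (at 0)"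
      by (intro DERIV_cmult DERIV_chain2[OF DERIV_exp] DERIV_chain2[OF has_field_derivative_Ln] dD) (use D0(2)[of 0] in auto)
    then have d1: "deriv (\<lambda>\<zeta>. z $ \<iota> * exp (of_real (- 1/m) * Ln (D \<zeta>))) 0 = - (z $ \<iota> * b / of_real m)"
      unfolding D00 by (intro DERIV_imp_deriv) simp
    have d2: "deriv (\<lambda>\<zeta>. n j \<zeta> / D \<zeta>) 0 = of_real (sa * r) * axis i 1 $ j - b * of_real (sa / (1 + sa)) * z $ j" for j
    proof -
      have "(n j has_field_derivative of_real (sa * r) * axis i 1 $ j + b / of_real (1 + sa) * z $ j) (at 0)"
        unfolding n_def using sa(1) by (auto intro!: derivative_eq_intros simp del: of_real_add)
      then have "((\<lambda>\<zeta>. n j \<zeta> / D \<zeta>) has_field_derivative ((of_real (sa * r) * axis i 1 $ j + b / of_real (1 + sa) * z $ j) * D 0 - n j 0 * b) / (D 0 * D 0)) (at 0)"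
        by (rule DERIV_divide[OF _ dD]) (simp add: D00)
      then have "deriv (\<lambda>\<zeta>. n j \<zeta> / D \<zeta>) 0 = of_real (sa * r) * axis i 1 $ j + b / of_real (1 + sa) * z $ j - z $ j * b"
        by (intro DERIV_imp_deriv) (simp add: D00 n_def)
      moreover have "b / of_real (1 + sa) - b = - (b * of_real (sa / (1 + sa)))"
        using sa(1) by (simp add: divide_simps del: of_real_add) (simp add: algebra_simps)
      then have "b / of_real (1 + sa) * z $ j - z $ j * b = - (b * of_real (sa / (1 + sa)) * z $ j)"
        by (metis (no_types, lifting) left_diff_distrib minus_mult_left mult.commute)
      ultimately show ?thesis by simp
    qed
    show "vec_deriv f 0 = egg_frame \<iota> m z i"
      unfolding vec_deriv_def fi using d1 d2 i
      by (auto simp: vec_eq_iff egg_frame_def Let_def axis_def b_def r_def sa_def s_def)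
  qed
qed

theorem wu_metric_egg:
  fixes z :: "complex ^ 'n::finite"
  assumes m: "0 < m" "m < 1" and z: "z \<in> egg \<iota> m"
  shows "wu_metric (egg \<iota> m) z = egg_wu \<iota> m z"
proof (rule wu_metric_eqI[where E = "egg_frame \<iota> m z"])
  show "hermitian_inner_product (egg_wu \<iota> m z)" by (rule hermitian_inner_product_egg_wu[OF m(1) z])
  show "kobayashi_indicatrix (egg \<iota> m) z \<subseteq> herm_ball (egg_wu \<iota> m z)" by (rule indicatrix_egg_subset[OF m z])
  show "herm (egg_wu \<iota> m z) (egg_frame \<iota> m z i) (egg_frame \<iota> m z j) = (if i = j then 1 else 0)" for i j
    by (rule egg_frame_orthonormal[OF m(1) z])
  fix i and t :: real assume t: "0 \<le> t" "t < 1"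
  obtain f where "vec_holomorphic_on f (ball 0 1)" "f ` ball 0 1 \<subseteq> egg \<iota> m" "f 0 = z" "vec_deriv f 0 = egg_frame \<iota> m z i"
  proof (cases "i = \<iota>")
    case True
    then show ?thesis using egg_normal_disc[OF m(1) z] that by metis
  next
    case False
    then show ?thesis using egg_tangent_disc[OF m(1) z False] that by metis
  qed
  then show "of_real t *s egg_frame \<iota> m z i \<in> kobayashi_indicatrix (egg \<iota> m) z"
    using t by (intro indicatrixI[of f _ _ "of_real t"]) auto
qed

section \<open>Wirtinger calculus\<close>

text \<open>\<open>f1\<close> and \<open>f2\<close> are the derivatives of f with respect to \<zeta>
  and to cnj \<zeta>, carried as explicit functions together with their continuity. Second
  derivatives arise by applying the same rules to \<open>f1\<close> or \<open>f2\<close>, and the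
  regularity that integration by parts asks for comes along.\<close>

definition wirt :: "complex set \<Rightarrow> (complex \<Rightarrow> complex) \<Rightarrow> (complex \<Rightarrow> complex) \<Rightarrow> (complex \<Rightarrow> complex) \<Rightarrow> bool" where
  "wirt S f f1 f2 \<longleftrightarrow> (\<forall>\<zeta>\<in>S. (f has_derivative (\<lambda>d. f1 \<zeta> * d + f2 \<zeta> * cnj d)) (at \<zeta>)) \<and>
     continuous_on S f1 \<and> continuous_on S f2"

lemma wirtD: "wirt S f f1 f2 \<Longrightarrow> \<zeta> \<in> S \<Longrightarrow> (f has_derivative (\<lambda>d. f1 \<zeta> * d + f2 \<zeta> * cnj d)) (at \<zeta>)"
  and wirt_cont1: "wirt S f f1 f2 \<Longrightarrow> continuous_on S f1"
  and wirt_cont2: "wirt S f f1 f2 \<Longrightarrow> continuous_on S f2"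
  by (auto simp: wirt_def)

lemma wirt_cont: "wirt S f f1 f2 \<Longrightarrow> continuous_on S f"
  unfolding wirt_def by (metis continuous_at_imp_continuous_on has_derivative_continuous)

lemma wirt_subset: "wirt S f f1 f2 \<Longrightarrow> T \<subseteq> S \<Longrightarrow> wirt T f f1 f2"
  by (auto simp: wirt_def intro: continuous_on_subset)

lemma wirt_cong:
  assumes "wirt S f f1 f2" "\<And>\<zeta>. \<zeta> \<in> S \<Longrightarrow> f1 \<zeta> = g1 \<zeta>" "\<And>\<zeta>. \<zeta> \<in> S \<Longrightarrow> f2 \<zeta> = g2 \<zeta>"
  shows "wirt S f g1 g2"
  using assms by (simp add: wirt_def cong: continuous_on_cong)

lemma wirt_cong_fun:
  assumes "wirt S g f1 f2" "open S" "\<And>\<zeta>. \<zeta> \<in> S \<Longrightarrow> f \<zeta> = g \<zeta>"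
  shows "wirt S f f1 f2"
  unfolding wirt_def
proof (intro conjI ballI)
  fix \<zeta> assume "\<zeta> \<in> S"
  then show "(f has_derivative (\<lambda>d. f1 \<zeta> * d + f2 \<zeta> * cnj d)) (at \<zeta>)"
    using has_derivative_transform_within_open[OF wirtD[OF assms(1)] assms(2)] assms(3) by metis
qed (use assms wirt_def in auto)

lemma wirt_const: "wirt S (\<lambda>_. c) (\<lambda>_. 0) (\<lambda>_. 0)"
  by (simp add: wirt_def)

lemma wirt_holomorphic:
  assumes "f holomorphic_on S" "open S"
  shows "wirt S f (deriv f) (\<lambda>_. 0)"
proof -
  have "(f has_derivative (\<lambda>d. deriv f \<zeta> * d + 0 * cnj d)) (at \<zeta>)" if "\<zeta> \<in> S" for \<zeta>
    using holomorphic_derivI[OF assms(1,2) that] by (simp add: has_field_derivative_def)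
  then show ?thesis using assms by (auto simp: wirt_def intro!: holomorphic_on_imp_continuous_on holomorphic_deriv)
qed

lemma wirt_cnj:
  assumes "wirt S f f1 f2"
  shows "wirt S (\<lambda>\<zeta>. cnj (f \<zeta>)) (\<lambda>\<zeta>. cnj (f2 \<zeta>)) (\<lambda>\<zeta>. cnj (f1 \<zeta>))"
proof -
  have "((\<lambda>\<zeta>. cnj (f \<zeta>)) has_derivative (\<lambda>d. cnj (f2 \<zeta>) * d + cnj (f1 \<zeta>) * cnj d)) (at \<zeta>)" if "\<zeta> \<in> S" for \<zeta>
    using has_derivative_cnj[OF wirtD[OF assms that]] by (simp add: add.commute)
  then show ?thesis using assms by (auto simp: wirt_def intro!: continuous_intros)
qed

lemma wirt_add:
  assumes "wirt S f f1 f2" "wirt S g g1 g2"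
  shows "wirt S (\<lambda>\<zeta>. f \<zeta> + g \<zeta>) (\<lambda>\<zeta>. f1 \<zeta> + g1 \<zeta>) (\<lambda>\<zeta>. f2 \<zeta> + g2 \<zeta>)"
proof -
  have "((\<lambda>\<zeta>. f \<zeta> + g \<zeta>) has_derivative (\<lambda>d. (f1 \<zeta> + g1 \<zeta>) * d + (f2 \<zeta> + g2 \<zeta>) * cnj d)) (at \<zeta>)" if "\<zeta> \<in> S" for \<zeta>
    by (rule has_derivative_eq_rhs[OF has_derivative_add[OF wirtD[OF assms(1) that] wirtD[OF assms(2) that]]])
       (simp add: algebra_simps)
  then show ?thesis using assms by (auto simp: wirt_def intro!: continuous_intros)
qed

lemma wirt_mult:
  assumes "wirt S f f1 f2" "wirt S g g1 g2"
  shows "wirt S (\<lambda>\<zeta>. f \<zeta> * g \<zeta>) (\<lambda>\<zeta>. f1 \<zeta> * g \<zeta> + f \<zeta> * g1 \<zeta>) (\<lambda>\<zeta>. f2 \<zeta> * g \<zeta> + f \<zeta> * g2 \<zeta>)"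
proof -
  have "((\<lambda>\<zeta>. f \<zeta> * g \<zeta>) has_derivative (\<lambda>d. (f1 \<zeta> * g \<zeta> + f \<zeta> * g1 \<zeta>) * d + (f2 \<zeta> * g \<zeta> + f \<zeta> * g2 \<zeta>) * cnj d)) (at \<zeta>)" if "\<zeta> \<in> S" for \<zeta>
    by (rule has_derivative_eq_rhs[OF has_derivative_mult[OF wirtD[OF assms(1) that] wirtD[OF assms(2) that]]])
       (simp add: algebra_simps)
  then show ?thesis using assms wirt_cont[OF assms(1)] wirt_cont[OF assms(2)] by (auto simp: wirt_def intro!: continuous_intros)
qed

lemma wirt_chain:
  assumes "wirt S f f1 f2" and F: "F holomorphic_on T" "open T" "\<And>\<zeta>. \<zeta> \<in> S \<Longrightarrow> f \<zeta> \<in> T"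
  shows "wirt S (\<lambda>\<zeta>. F (f \<zeta>)) (\<lambda>\<zeta>. deriv F (f \<zeta>) * f1 \<zeta>) (\<lambda>\<zeta>. deriv F (f \<zeta>) * f2 \<zeta>)"
proof -
  have "((\<lambda>\<zeta>. F (f \<zeta>)) has_derivative (\<lambda>d. (deriv F (f \<zeta>) * f1 \<zeta>) * d + (deriv F (f \<zeta>) * f2 \<zeta>) * cnj d)) (at \<zeta>)" if "\<zeta> \<in> S" for \<zeta>
  proof -
    have "(F has_derivative (*) (deriv F (f \<zeta>))) (at (f \<zeta>))"
      using holomorphic_derivI[OF F(1,2) F(3)[OF that]] by (simp add: has_field_derivative_def)
    from has_derivative_compose[OF wirtD[OF assms(1) that] this]
    show ?thesis by (rule has_derivative_eq_rhs) (simp add: algebra_simps)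
  qed
  moreover have "continuous_on S (\<lambda>\<zeta>. deriv F (f \<zeta>))"
    by (rule continuous_on_compose2[OF holomorphic_on_imp_continuous_on[OF holomorphic_deriv[OF F(1,2)]] wirt_cont[OF assms(1)]]) (use F(3) in auto)
  ultimately show ?thesis using assms by (auto simp: wirt_def intro!: continuous_intros)
qed

lemma wirt_uminus: "wirt S f f1 f2 \<Longrightarrow> wirt S (\<lambda>\<zeta>. - f \<zeta>) (\<lambda>\<zeta>. - f1 \<zeta>) (\<lambda>\<zeta>. - f2 \<zeta>)"
  using wirt_mult[OF wirt_const[of S "-1"], of f f1 f2] by simp

lemma wirt_diff:
  assumes "wirt S f f1 f2" "wirt S g g1 g2"
  shows "wirt S (\<lambda>\<zeta>. f \<zeta> - g \<zeta>) (\<lambda>\<zeta>. f1 \<zeta> - g1 \<zeta>) (\<lambda>\<zeta>. f2 \<zeta> - g2 \<zeta>)"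
  using wirt_add[OF assms(1) wirt_uminus[OF assms(2)]] by simp

lemma wirt_cmult: "wirt S f f1 f2 \<Longrightarrow> wirt S (\<lambda>\<zeta>. c * f \<zeta>) (\<lambda>\<zeta>. c * f1 \<zeta>) (\<lambda>\<zeta>. c * f2 \<zeta>)"
  using wirt_mult[OF wirt_const[of S c], of f f1 f2] by simp

lemma wirt_sum:
  assumes "\<And>i. i \<in> I \<Longrightarrow> wirt S (f i) (f1 i) (f2 i)"
  shows "wirt S (\<lambda>\<zeta>. \<Sum>i\<in>I. f i \<zeta>) (\<lambda>\<zeta>. \<Sum>i\<in>I. f1 i \<zeta>) (\<lambda>\<zeta>. \<Sum>i\<in>I. f2 i \<zeta>)"
  using assms by (induction I rule: infinite_finite_induct) (auto intro: wirt_const wirt_add)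

lemma wirt_inverse:
  assumes "wirt S f f1 f2" "\<And>\<zeta>. \<zeta> \<in> S \<Longrightarrow> f \<zeta> \<noteq> 0"
  shows "wirt S (\<lambda>\<zeta>. inverse (f \<zeta>)) (\<lambda>\<zeta>. - (inverse (f \<zeta>) * inverse (f \<zeta>)) * f1 \<zeta>) (\<lambda>\<zeta>. - (inverse (f \<zeta>) * inverse (f \<zeta>)) * f2 \<zeta>)"
proof -
  have h: "inverse holomorphic_on - {0::complex}" by (intro holomorphic_intros) auto
  have d: "deriv inverse w = - (inverse w * inverse w)" if "w \<noteq> 0" for w :: complex
    using DERIV_inverse[OF that] by (intro DERIV_imp_deriv) (simp add: numeral_2_eq_2 power_inverse)
  show ?thesis
    by (rule wirt_cong[OF wirt_chain[OF assms(1) h]]) (use assms(2) d in auto)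
qed

lemma wirt_powr:
  assumes "wirt S f f1 f2" "\<And>\<zeta>. \<zeta> \<in> S \<Longrightarrow> Re (f \<zeta>) > 0"
  shows "wirt S (\<lambda>\<zeta>. f \<zeta> powr a) (\<lambda>\<zeta>. a * (f \<zeta> powr a) * inverse (f \<zeta>) * f1 \<zeta>) (\<lambda>\<zeta>. a * (f \<zeta> powr a) * inverse (f \<zeta>) * f2 \<zeta>)"
proof -
  have h: "(\<lambda>w. w powr a) holomorphic_on {w. Re w > 0}"
    by (intro holomorphic_intros) (auto simp: complex_nonpos_Reals_iff)
  have d: "deriv (\<lambda>w. w powr a) w = a * (w powr a) * inverse w" if "Re w > 0" for w
  proof -
    have "w \<noteq> 0" "w \<notin> \<real>\<^sub>\<le>\<^sub>0" using that by (auto simp: complex_nonpos_Reals_iff)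
    then show ?thesis
      by (intro DERIV_imp_deriv) (auto intro!: derivative_eq_intros has_field_derivative_powr simp: powr_diff field_simps)
  qed
  show ?thesis
    by (rule wirt_cong[OF wirt_chain[OF assms(1) h open_halfspace_Re_gt]]) (use assms(2) d in auto)
qed

lemma wirt_dz:
  assumes "wirt S f f1 f2" "\<zeta> \<in> S"
  shows "dz f \<zeta> = f1 \<zeta>" "dzbar f \<zeta> = f2 \<zeta>"
proof -
  have "frechet_derivative f (at \<zeta>) = (\<lambda>d. f1 \<zeta> * d + f2 \<zeta> * cnj d)"
    using frechet_derivative_at[OF wirtD[OF assms]] by simp
  then show "dz f \<zeta> = f1 \<zeta>" "dzbar f \<zeta> = f2 \<zeta>"
    by (simp_all add: dz_def dzbar_def algebra_simps)
qed

lemma wirt_unique: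
  assumes "wirt S f f1 f2" "wirt S f g1 g2" "\<zeta> \<in> S"
  shows "f1 \<zeta> = g1 \<zeta>" "f2 \<zeta> = g2 \<zeta>"
  using wirt_dz[OF assms(1,3)] wirt_dz[OF assms(2,3)] by auto

text \<open>S and the complement of K are open and cover the plane. Products of a test function with
  a function defined only on S, such as the logarithm of the metric, thereby become global.\<close>

lemma wirt_extend_zero:
  assumes "wirt S f f1 f2" "open S" "compact K" "K \<subseteq> S" "\<And>\<zeta>. \<zeta> \<notin> K \<Longrightarrow> f \<zeta> = 0"
    "\<And>\<zeta>. \<zeta> \<notin> K \<Longrightarrow> f1 \<zeta> = 0" "\<And>\<zeta>. \<zeta> \<notin> K \<Longrightarrow> f2 \<zeta> = 0"
  shows "wirt UNIV f f1 f2"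
proof -
  have oK: "open (- K)" using assms(3) by (simp add: compact_imp_closed open_Compl)
  have "wirt (- K) f f1 f2"
    by (rule wirt_cong_fun[OF wirt_cong[OF wirt_const[of "- K" 0]] oK]) (use assms in auto)
  note wK = this
  have "S \<union> - K = UNIV" using assms(4) by auto
  then have "continuous_on UNIV f1" "continuous_on UNIV f2"
    using continuous_on_open_Un[OF assms(2) oK wirt_cont1[OF assms(1)] wirt_cont1[OF wK]]
      continuous_on_open_Un[OF assms(2) oK wirt_cont2[OF assms(1)] wirt_cont2[OF wK]] by simp_all
  moreover have "(f has_derivative (\<lambda>d. f1 \<zeta> * d + f2 \<zeta> * cnj d)) (at \<zeta>)" for \<zeta>
    using wirtD[OF assms(1), of \<zeta>] wirtD[OF wK, of \<zeta>] assms(4) by (cases "\<zeta> \<in> S") auto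
  ultimately show ?thesis by (simp add: wirt_def)
qed

section \<open>Integration by parts against compactly supported functions\<close>

lemma integrable_compact_support:
  fixes f :: "'a::euclidean_space \<Rightarrow> 'b::{banach, second_countable_topology}"
  assumes "continuous_on S f" "compact K" "K \<subseteq> S" "\<And>x. x \<notin> K \<Longrightarrow> f x = 0"
  shows "integrable lborel f"
proof -
  have "integrable lborel (\<lambda>x. indicator K x *\<^sub>R f x)"
    by (rule borel_integrable_compact[OF assms(2) continuous_on_subset[OF assms(1,3)]])
  moreover have "(\<lambda>x. indicator K x *\<^sub>R f x) = f" using assms(4) by (auto simp: indicator_def)
  ultimately show ?thesis by simp
qed

text \<open>Difference quotients integrate to zero by translation invariance.\<close>

lemma integral_directional_derivative_zero:
  fixes G :: "complex \<Rightarrow> complex"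
  assumes G: "wirt UNIV G G1 G2" and K: "compact K" "\<And>\<zeta>. \<zeta> \<notin> K \<Longrightarrow> G \<zeta> = 0"
    "\<And>\<zeta>. \<zeta> \<notin> K \<Longrightarrow> G1 \<zeta> = 0" "\<And>\<zeta>. \<zeta> \<notin> K \<Longrightarrow> G2 \<zeta> = 0"
  shows "(LINT \<zeta>|lborel. G1 \<zeta> * e + G2 \<zeta> * cnj e) = 0"
proof -
  have intG: "integrable lborel G"
    by (rule integrable_compact_support[OF wirt_cont[OF G] K(1) _ K(2)]) auto
  obtain R where R: "K \<subseteq> ball 0 R" using K(1) by (meson bounded_subset_ballD compact_imp_bounded)
  obtain M1 where M1: "\<And>\<zeta>. \<zeta> \<in> K \<Longrightarrow> cmod (G1 \<zeta>) \<le> M1"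
    using compact_imp_bounded[OF compact_continuous_image[OF continuous_on_subset[OF wirt_cont1[OF G] subset_UNIV] K(1)]]
    by (auto simp: bounded_iff)
  obtain M2 where M2: "\<And>\<zeta>. \<zeta> \<in> K \<Longrightarrow> cmod (G2 \<zeta>) \<le> M2"
    using compact_imp_bounded[OF compact_continuous_image[OF continuous_on_subset[OF wirt_cont2[OF G] subset_UNIV] K(1)]]
    by (auto simp: bounded_iff)
  define M where "M = \<bar>M1\<bar> + \<bar>M2\<bar>"
  have bd: "cmod (G1 \<zeta>) + cmod (G2 \<zeta>) \<le> M" for \<zeta>
    using M1[of \<zeta>] M2[of \<zeta>] K(3)[of \<zeta>] K(4)[of \<zeta>] unfolding M_def by (cases "\<zeta> \<in> K") auto
  have lip: "cmod (G x - G y) \<le> M * cmod (x - y)" for x y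
  proof (rule differentiable_bound[of UNIV G "\<lambda>\<zeta> d. G1 \<zeta> * d + G2 \<zeta> * cnj d"])
    show "(G has_derivative (\<lambda>d. G1 \<zeta> * d + G2 \<zeta> * cnj d)) (at \<zeta> within UNIV)" for \<zeta>
      using wirtD[OF G] by simp
    show "onorm (\<lambda>d. G1 \<zeta> * d + G2 \<zeta> * cnj d) \<le> M" for \<zeta>
    proof (rule onorm_le)
      fix d
      have "cmod (G1 \<zeta> * d + G2 \<zeta> * cnj d) \<le> cmod (G1 \<zeta>) * cmod d + cmod (G2 \<zeta>) * cmod d"
        by (rule order_trans[OF norm_triangle_ineq]) (simp add: norm_mult)
      also have "\<dots> \<le> M * cmod d" using mult_right_mono[OF bd[of \<zeta>] norm_ge_zero[of d]] by (simp add: algebra_simps)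
      finally show "cmod (G1 \<zeta> * d + G2 \<zeta> * cnj d) \<le> M * cmod d" .
    qed
  qed auto
  define t where "t n = inverse (real (Suc n))" for n
  have t: "0 < t n" "t n \<le> 1" for n by (auto simp: t_def field_simps)
  have t0: "t \<longlonglongrightarrow> 0" unfolding t_def by (rule LIMSEQ_inverse_real_of_nat)
  define q where "q n \<zeta> = (G (\<zeta> + of_real (t n) * e) - G \<zeta>) / of_real (t n)" for n \<zeta>
  \<comment> \<open>The Lipschitz bound of the difference quotients. Since
    \<open>t n \<le> 1\<close>, they vanish outside the ball of radius R + |e|.\<close>
  define w where "w \<zeta> = M * cmod e * indicator (cball (0::complex) (R + cmod e)) \<zeta>" for \<zeta>
  have Gm: "G \<in> borel_measurable borel" using wirt_cont[OF G] by (rule borel_measurable_continuous_onI)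
  have qint: "integral\<^sup>L lborel (q n) = 0" for n
  proof -
    have eq: "integral\<^sup>L lborel G = (LINT \<zeta>|lborel. G (of_real (t n) * e + \<zeta>))"
    proof -
      have "integral\<^sup>L lborel G = integral\<^sup>L (distr lborel borel ((+) (of_real (t n) * e))) G"
        by (simp add: lborel_distr_plus)
      also have "\<dots> = (LINT \<zeta>|lborel. G (of_real (t n) * e + \<zeta>))"
        using Gm by (subst integral_distr) auto
      finally show ?thesis .
    qed
    have "integrable (distr lborel borel ((+) (of_real (t n) * e))) G"
      using intG by (simp add: lborel_distr_plus)
    then have "integrable lborel (\<lambda>\<zeta>. G (of_real (t n) * e + \<zeta>))"
      using Gm by (subst (asm) integrable_distr_eq) auto
    then show ?thesis using eq intG unfolding q_def
      by (simp add: add.commute Bochner_Integration.integral_diff)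
  qed
  have conv: "(\<lambda>n. q n \<zeta>) \<longlonglongrightarrow> G1 \<zeta> * e + G2 \<zeta> * cnj e" for \<zeta>
  proof -
    define D where "D d = G1 \<zeta> * d + G2 \<zeta> * cnj d" for d
    have Dd: "(G has_derivative D) (at \<zeta>)" using wirtD[OF G, of \<zeta>] by (simp add: D_def[abs_def])
    have "((\<lambda>x. G (\<zeta> + of_real x * e)) has_derivative (\<lambda>x. D (of_real x * e))) (at (0::real))"
    proof -
      have "((\<lambda>x. \<zeta> + of_real x * e) has_derivative (\<lambda>x. of_real x * e)) (at (0::real))"
        by (auto intro!: derivative_eq_intros)
      from has_derivative_compose[OF this, of G D] Dd show ?thesis by simp
    qed
    moreover have "(\<lambda>x. D (of_real x * e)) = (\<lambda>x. x *\<^sub>R D e)"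
      by (auto simp: D_def scaleR_conv_of_real algebra_simps)
    ultimately have "((\<lambda>x. G (\<zeta> + of_real x * e)) has_vector_derivative D e) (at (0::real))"
      by (simp add: has_vector_derivative_def)
    then have lim: "((\<lambda>h. cmod (G (\<zeta> + of_real h * e) - G \<zeta> - h *\<^sub>R D e) / \<bar>h\<bar>) \<longlongrightarrow> 0) (at 0)"
      unfolding has_vector_derivative_def by (subst (asm) has_derivative_at) simp
    have "((\<lambda>h. cmod ((G (\<zeta> + of_real h * e) - G \<zeta>) /\<^sub>R h - D e)) \<longlongrightarrow> 0) (at 0)"
    proof (rule Lim_transform_eventually[OF lim])
      show "eventually (\<lambda>h. cmod (G (\<zeta> + of_real h * e) - G \<zeta> - h *\<^sub>R D e) / \<bar>h\<bar> = cmod ((G (\<zeta> + of_real h * e) - G \<zeta>) /\<^sub>R h - D e)) (at 0)"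
      proof (rule eventually_mono[OF eventually_neq_at_within[of 0 0]])
        fix h :: real assume "h \<noteq> 0"
        then have "(G (\<zeta> + of_real h * e) - G \<zeta>) /\<^sub>R h - D e = (G (\<zeta> + of_real h * e) - G \<zeta> - h *\<^sub>R D e) /\<^sub>R h"
          by (simp add: scaleR_right_diff_distrib)
        then show "cmod (G (\<zeta> + of_real h * e) - G \<zeta> - h *\<^sub>R D e) / \<bar>h\<bar> = cmod ((G (\<zeta> + of_real h * e) - G \<zeta>) /\<^sub>R h - D e)"
          by (simp only: norm_scaleR) (simp add: divide_inverse mult.commute)
      qed
    qed
    then have "((\<lambda>h. (G (\<zeta> + of_real h * e) - G \<zeta>) /\<^sub>R h) \<longlongrightarrow> D e) (at 0)"
      by (rule LIM_zero_cancel[OF tendsto_norm_zero_cancel])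
    moreover have "filterlim t (at 0) sequentially"
      using t0 t by (auto simp: filterlim_at intro!: always_eventually) (metis less_irrefl)
    ultimately have "((\<lambda>n. (G (\<zeta> + of_real (t n) * e) - G \<zeta>) /\<^sub>R t n) \<longlongrightarrow> D e) sequentially"
      by (rule filterlim_compose)
    then show ?thesis by (simp add: q_def D_def scaleR_conv_of_real divide_inverse mult.commute)
  qed
  have dom: "cmod (q n \<zeta>) \<le> w \<zeta>" for n \<zeta>
  proof (cases "cmod \<zeta> \<le> R + cmod e")
    case True
    have "cmod (q n \<zeta>) \<le> M * cmod (of_real (t n) * e) / t n"
      unfolding q_def norm_divide using lip[of "\<zeta> + of_real (t n) * e" \<zeta>] t(1)[of n]
      by (simp add: divide_right_mono)
    also have "\<dots> = M * cmod e" using t(1)[of n] by (simp add: norm_mult)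
    finally show ?thesis using True by (simp add: w_def)
  next
    case False
    have "cmod (of_real (t n) * e) \<le> cmod e" using t[of n] by (simp add: norm_mult mult_left_le_one_le)
    then have "cmod (\<zeta> + of_real (t n) * e) > R" "cmod \<zeta> > R"
      using False norm_triangle_ineq4[of "\<zeta> + of_real (t n) * e" "of_real (t n) * e"] norm_ge_zero[of e]
      unfolding add_diff_cancel_right' by linarith+
    then have "\<zeta> + of_real (t n) * e \<notin> K" "\<zeta> \<notin> K" using R by auto
    then show ?thesis using K(2) by (simp add: q_def w_def indicator_def False)
  qed
  have "(\<lambda>n. integral\<^sup>L lborel (q n)) \<longlonglongrightarrow> (LINT \<zeta>|lborel. G1 \<zeta> * e + G2 \<zeta> * cnj e)"
  proof (rule integral_dominated_convergence)
    show "integrable lborel w" unfolding w_def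
      using integrable_real_indicator[of "cball (0::complex) (R + cmod e)" lborel] emeasure_lborel_cball_finite[of "0::complex" "R + cmod e"]
      by (auto intro!: integrable_mult_right)
    show "(\<lambda>\<zeta>. G1 \<zeta> * e + G2 \<zeta> * cnj e) \<in> borel_measurable lborel"
      using wirt_cont1[OF G] wirt_cont2[OF G] by (auto intro!: borel_measurable_continuous_onI continuous_intros)
    show "q n \<in> borel_measurable lborel" for n
      unfolding q_def using wirt_cont[OF G] t(1)[of n]
      by (auto intro!: borel_measurable_continuous_onI continuous_intros continuous_on_compose2[OF wirt_cont[OF G]])
  qed (use conv dom in auto)
  then show ?thesis unfolding qint using LIMSEQ_unique tendsto_const by metis
qed

text \<open>The direction 1 gives the sum of the two integrals and the direction \<i> a multiple of
  their difference.\<close>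

lemma integral_wirt_zero:
  fixes G :: "complex \<Rightarrow> complex"
  assumes G: "wirt UNIV G G1 G2" and K: "compact K" "\<And>\<zeta>. \<zeta> \<notin> K \<Longrightarrow> G \<zeta> = 0"
    "\<And>\<zeta>. \<zeta> \<notin> K \<Longrightarrow> G1 \<zeta> = 0" "\<And>\<zeta>. \<zeta> \<notin> K \<Longrightarrow> G2 \<zeta> = 0"
  shows "integral\<^sup>L lborel G1 = 0" "integral\<^sup>L lborel G2 = 0"
proof -
  have i: "integrable lborel G1" "integrable lborel G2"
    using integrable_compact_support[OF wirt_cont1[OF G] K(1) _ K(3)] integrable_compact_support[OF wirt_cont2[OF G] K(1) _ K(4)] by auto
  have "integral\<^sup>L lborel G1 * e + integral\<^sup>L lborel G2 * cnj e = 0" for e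
    using integral_directional_derivative_zero[OF G K, of e] i by simp
  from this[of 1] this[of \<i>] show "integral\<^sup>L lborel G1 = 0" "integral\<^sup>L lborel G2 = 0"
    by (auto simp: complex_eq_iff)
qed

text \<open>The \<zeta>-derivative of v r2 and the cnj \<zeta>-derivative of r v1 both integrate to
  zero, and they share the term v1 r2. On r the derivative in cnj \<zeta> is taken first, on v the
  one in \<zeta>; in this way no commutation of derivatives is invoked.\<close>

lemma wirt_integration_by_parts:
  assumes S: "open S" and v: "wirt S v v1 v2" "wirt S v1 v11 v12"
    and r: "wirt UNIV r r1 r2" "wirt UNIV r2 r21 r22" and K: "compact K" "K \<subseteq> S" "\<And>\<zeta>. \<zeta> \<notin> K \<Longrightarrow> r \<zeta> = 0"
  shows "(LINT \<zeta>|lborel. v \<zeta> * r21 \<zeta>) = (LINT \<zeta>|lborel. r \<zeta> * v12 \<zeta>)"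
    "integrable lborel (\<lambda>\<zeta>. v \<zeta> * r21 \<zeta>)" "integrable lborel (\<lambda>\<zeta>. r \<zeta> * v12 \<zeta>)"
proof -
  have oK: "open (- K)" using K(1) by (simp add: compact_imp_closed open_Compl)
  have z1: "r1 \<zeta> = 0" "r2 \<zeta> = 0" if "\<zeta> \<notin> K" for \<zeta>
    using wirt_unique[OF wirt_subset[OF r(1)] wirt_cong_fun[OF wirt_const[of _ 0] oK], of \<zeta>] K(3) that by auto
  have z2: "r21 \<zeta> = 0" "r22 \<zeta> = 0" if "\<zeta> \<notin> K" for \<zeta>
    using wirt_unique[OF wirt_subset[OF r(2)] wirt_cong_fun[OF wirt_const[of _ 0] oK], of \<zeta>] z1 that by auto
  have a: "wirt UNIV (\<lambda>\<zeta>. v \<zeta> * r2 \<zeta>) (\<lambda>\<zeta>. v1 \<zeta> * r2 \<zeta> + v \<zeta> * r21 \<zeta>) (\<lambda>\<zeta>. v2 \<zeta> * r2 \<zeta> + v \<zeta> * r22 \<zeta>)"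
    by (rule wirt_extend_zero[OF wirt_mult[OF v(1) wirt_subset[OF r(2)]] S K(1,2)]) (use z1 z2 in auto)
  have b: "wirt UNIV (\<lambda>\<zeta>. r \<zeta> * v1 \<zeta>) (\<lambda>\<zeta>. r1 \<zeta> * v1 \<zeta> + r \<zeta> * v11 \<zeta>) (\<lambda>\<zeta>. r2 \<zeta> * v1 \<zeta> + r \<zeta> * v12 \<zeta>)"
    by (rule wirt_extend_zero[OF wirt_mult[OF wirt_subset[OF r(1)] v(2)] S K(1,2)]) (use z1 z2 K(3) in auto)
  have ia: "(LINT \<zeta>|lborel. v1 \<zeta> * r2 \<zeta> + v \<zeta> * r21 \<zeta>) = 0"
    by (rule integral_wirt_zero(1)[OF a K(1)]) (use z1 z2 in auto)
  have ib: "(LINT \<zeta>|lborel. r2 \<zeta> * v1 \<zeta> + r \<zeta> * v12 \<zeta>) = 0"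
    by (rule integral_wirt_zero(2)[OF b K(1)]) (use z1 K(3) in auto)
  have S': "continuous_on S r" "continuous_on S r2" "continuous_on S r21"
    using wirt_cont[OF r(1)] wirt_cont[OF r(2)] wirt_cont1[OF r(2)] continuous_on_subset by blast+
  have i1: "integrable lborel (\<lambda>\<zeta>. v1 \<zeta> * r2 \<zeta>)"
    by (rule integrable_compact_support[OF _ K(1,2)]) (use z1 S' wirt_cont[OF v(2)] in \<open>auto intro!: continuous_intros\<close>)
  show i2: "integrable lborel (\<lambda>\<zeta>. v \<zeta> * r21 \<zeta>)"
    by (rule integrable_compact_support[OF _ K(1,2)]) (use z2 S' wirt_cont[OF v(1)] in \<open>auto intro!: continuous_intros\<close>)
  show i3: "integrable lborel (\<lambda>\<zeta>. r \<zeta> * v12 \<zeta>)"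
    by (rule integrable_compact_support[OF _ K(1,2)]) (use K(3) S' wirt_cont2[OF v(2)] in \<open>auto intro!: continuous_intros\<close>)
  have "(LINT \<zeta>|lborel. v1 \<zeta> * r2 \<zeta>) + (LINT \<zeta>|lborel. v \<zeta> * r21 \<zeta>) = 0"
    using ia i1 i2 by simp
  moreover have "(LINT \<zeta>|lborel. v1 \<zeta> * r2 \<zeta>) + (LINT \<zeta>|lborel. r \<zeta> * v12 \<zeta>) = 0"
    using ib i1 i3 by (simp add: mult.commute)
  ultimately show "(LINT \<zeta>|lborel. v \<zeta> * r21 \<zeta>) = (LINT \<zeta>|lborel. r \<zeta> * v12 \<zeta>)"
    by (metis add_left_cancel)
qed

lemma wirt_of_real:
  fixes f :: "complex \<Rightarrow> real"
  assumes "\<And>x. f differentiable (at x)" "\<And>v. continuous_on UNIV (\<lambda>x. frechet_derivative f (at x) v)"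
  shows "wirt UNIV (\<lambda>\<zeta>. of_real (f \<zeta>))
    (\<lambda>\<zeta>. (of_real (frechet_derivative f (at \<zeta>) 1) - \<i> * of_real (frechet_derivative f (at \<zeta>) \<i>)) / 2)
    (\<lambda>\<zeta>. (of_real (frechet_derivative f (at \<zeta>) 1) + \<i> * of_real (frechet_derivative f (at \<zeta>) \<i>)) / 2)"
proof -
  let ?D = "\<lambda>\<zeta>. frechet_derivative f (at \<zeta>)"
  have "((\<lambda>\<zeta>. complex_of_real (f \<zeta>)) has_derivative (\<lambda>d. (of_real (?D \<zeta> 1) - \<i> * of_real (?D \<zeta> \<i>)) / 2 * d + (of_real (?D \<zeta> 1) + \<i> * of_real (?D \<zeta> \<i>)) / 2 * cnj d)) (at \<zeta>)" for \<zeta>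
  proof -
    have D: "(f has_derivative ?D \<zeta>) (at \<zeta>)" using assms(1) frechet_derivative_works by blast
    have lin: "?D \<zeta> d = Re d * ?D \<zeta> 1 + Im d * ?D \<zeta> \<i>" for d
    proof -
      have l: "linear (?D \<zeta>)" using D has_derivative_linear by blast
      have "d = Re d *\<^sub>R 1 + Im d *\<^sub>R \<i>" by (simp add: complex_eq_iff)
      then have "?D \<zeta> d = ?D \<zeta> (Re d *\<^sub>R 1 + Im d *\<^sub>R \<i>)" by simp
      then show ?thesis using l by (simp add: linear_add linear_scale)
    qed
    have "((\<lambda>\<zeta>. complex_of_real (f \<zeta>)) has_derivative (\<lambda>d. of_real (?D \<zeta> d))) (at \<zeta>)"
      by (rule has_derivative_of_real[OF D])
    then show ?thesis by (rule has_derivative_eq_rhs) (subst lin, auto simp: complex_eq_iff field_simps)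
  qed
  then show ?thesis using assms(2) by (auto simp: wirt_def intro!: continuous_intros)
qed

lemma smooth_wirt:
  assumes "smooth_on UNIV (\<rho> :: complex \<Rightarrow> real)"
  obtains r1 r2 r21 r22 where "wirt UNIV (\<lambda>\<zeta>. of_real (\<rho> \<zeta>)) r1 r2" "wirt UNIV r2 r21 r22"
proof -
  have C: "Ck_on 2 UNIV \<rho>" using assms by (simp add: smooth_on_def)
  define p where "p v x = frechet_derivative \<rho> (at x) v" for v x
  have 1: "\<rho> differentiable (at x)" for x using C by (simp add: numeral_2_eq_2)
  have 2: "p v differentiable (at x)" "continuous_on UNIV (\<lambda>x. frechet_derivative (p v) (at x) u)" for x v u
    using C unfolding p_def by (simp_all add: numeral_2_eq_2)
  have 3: "continuous_on UNIV (p v)" for v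
    using 2(1) by (intro differentiable_imp_continuous_on differentiable_at_imp_differentiable_on) auto
  note w = wirt_of_real[OF 1, folded p_def, OF 3]
  have "\<exists>f1 f2. wirt UNIV (\<lambda>\<zeta>. (of_real (p 1 \<zeta>) + \<i> * of_real (p \<i> \<zeta>)) / 2) f1 f2"
    using wirt_cmult[OF wirt_add[OF wirt_of_real[OF 2] wirt_cmult[OF wirt_of_real[OF 2], of \<i>]], of "1/2"]
    by (auto simp: field_simps)
  then show ?thesis using that w by blast
qed

section \<open>Curvature along holomorphic curves\<close>

text \<open>Cauchy-Schwarz for (sqrt X, sqrt Y) and (sqrt p, sqrt t), without roots or quotients so
  that X or Y may be zero.\<close>

lemma cauchy_schwarz_weighted:
  fixes x y :: complex
  assumes "(cmod x)\<^sup>2 = X * p" "(cmod y)\<^sup>2 = Y * t" "X \<ge> 0" "Y \<ge> 0" "p \<ge> 0" "t \<ge> 0"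
  shows "(cmod (x + y))\<^sup>2 \<le> (X + Y) * (p + t)"
proof -
  have "4 * (X * t * (Y * p)) \<le> (X * t + Y * p)\<^sup>2"
    using sum_squares_bound[of "X * t" "Y * p"] by (simp add: power2_sum mult_ac)
  then have "(2 * (cmod x * cmod y))\<^sup>2 \<le> (X * t + Y * p)\<^sup>2"
    by (simp add: power_mult_distrib assms(1,2) mult_ac)
  then have "2 * (cmod x * cmod y) \<le> X * t + Y * p"
    using assms(3-6) by (intro power2_le_imp_le[of "2 * (cmod x * cmod y)"]) auto
  moreover have "(cmod (x + y))\<^sup>2 \<le> (cmod x + cmod y)\<^sup>2"
    by (intro power_mono norm_triangle_ineq norm_ge_zero)
  ultimately show ?thesis by (simp add: power2_sum assms(1,2) algebra_simps)
qed

text \<open>With h = X + Q b and hz its derivative this reads h^3 \<le> H h - |hz|^2, which says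
  that the mixed derivative of ln h is at least h. The terms of H in y are completed to t =
  |\<tau>|^2 / (Q b), where \<tau> is hz without its term in u. Then \<open>T\<close> supplies 2 Q X
  b and \<open>R\<close> supplies Q^2 b^2, so that H \<ge> p + t + h^2, while Cauchy-Schwarz bounds
  |hz|^2 by h (p + t).\<close>

lemma curvature_algebra:
  fixes A u y \<sigma> :: complex and P Q b E k i W W' B m :: real
  assumes P: "P = k * i\<^sup>2" "P \<ge> 0" and i: "i \<noteq> 0" and Q: "Q > 0" and b: "b \<ge> 0"
    and \<sigma>: "(cmod \<sigma>)\<^sup>2 = E * k * (cmod A)\<^sup>2"
    and B: "B * b \<ge> (cmod y)\<^sup>2 + 2 * b ^ 3" "B \<ge> 0"
    and T: "2 / m * ((1 + E) * i) + (W + E * W') / i\<^sup>2 - E * W\<^sup>2 / (i\<^sup>2 * Q) \<ge> 2 * Q"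
    and R: "E * W / m + 2 * Q \<ge> Q\<^sup>2"
  defines "X \<equiv> P * (cmod A)\<^sup>2"
  defines "H \<equiv> P * (cmod u)\<^sup>2 + 2 * X\<^sup>2 + 2 / m * X * b * ((1 + E) * i) + 2 * W * Re (cnj \<sigma> * y)
      + b * k * (cmod A)\<^sup>2 * (W + E * W') + E * W * b\<^sup>2 / m + Q * B"
  shows "(X + Q * b) ^ 3 \<le> H * (X + Q * b) - (cmod (cnj A * of_real P * u + of_real b * \<sigma> * of_real W + of_real Q * y))\<^sup>2"
proof -
  have X0: "X \<ge> 0" using P(2) by (simp add: X_def)
  define p where "p = P * (cmod u)\<^sup>2"
  have p0: "p \<ge> 0" using P(2) by (simp add: p_def)
  have x2: "(cmod (cnj A * of_real P * u))\<^sup>2 = X * p"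
    by (simp add: norm_mult power_mult_distrib X_def p_def) (simp add: power2_eq_square)
  have kA: "k * (cmod A)\<^sup>2 = X / i\<^sup>2" using i by (simp add: X_def P(1))
  show ?thesis
  proof (cases "b = 0")
    \<comment> \<open>Division by b is impossible here, but then y = 0 and only the normal part is
      left.\<close>
    case True
    then have y: "y = 0" using B(1) by simp
    have "p + 2 * X\<^sup>2 \<le> H" using True y Q B(2) by (simp add: H_def p_def)
    then have "(p + 2 * X\<^sup>2) * X \<le> H * X" using X0 by (rule mult_right_mono)
    moreover have "X ^ 3 \<ge> 0" using X0 by simp
    ultimately show ?thesis using True y x2 by (simp add: algebra_simps power2_eq_square power3_eq_cube)
  next
    case False
    then have b: "b > 0" using b by simp
    define \<tau> where "\<tau> = of_real b * \<sigma> * of_real W + of_real Q * y"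
    define t where "t = (cmod \<tau>)\<^sup>2 / (Q * b)"
    have t0: "t \<ge> 0" using Q b by (simp add: t_def)
    have t2: "(cmod \<tau>)\<^sup>2 = Q * b * t" using Q b by (simp add: t_def)
    have tau: "(cmod \<tau>)\<^sup>2 = b\<^sup>2 * W\<^sup>2 * (E * k * (cmod A)\<^sup>2) + 2 * b * W * Q * Re (cnj \<sigma> * y) + Q\<^sup>2 * (cmod y)\<^sup>2"
    proof -
      have "(cmod \<tau>)\<^sup>2 = b\<^sup>2 * W\<^sup>2 * (cmod \<sigma>)\<^sup>2 + 2 * b * W * Q * Re (cnj \<sigma> * y) + Q\<^sup>2 * (cmod y)\<^sup>2"
        unfolding \<tau>_def cmod_sq by (simp add: algebra_simps power2_eq_square)
      then show ?thesis unfolding \<sigma> .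
    qed
    have "Q * b * t - b * W\<^sup>2 * E * (b * (k * (cmod A)\<^sup>2)) = b * (2 * W * Q * Re (cnj \<sigma> * y)) + Q * (Q * (cmod y)\<^sup>2)"
      unfolding t2[symmetric] tau by (simp add: algebra_simps power2_eq_square)
    moreover have "Q * (Q * (cmod y)\<^sup>2) \<le> Q * (Q * (B * b - 2 * b ^ 3))"
      using B(1) Q by (intro mult_left_mono) auto
    ultimately have "Q * b * t - b * W\<^sup>2 * E * (b * (k * (cmod A)\<^sup>2)) \<le> Q * b * (2 * W * Re (cnj \<sigma> * y) + Q * B - 2 * Q * b\<^sup>2)"
      by (simp add: algebra_simps power2_eq_square power3_eq_cube)
    then have "(Q * b * t - b * W\<^sup>2 * E * (b * (k * (cmod A)\<^sup>2))) / (Q * b) \<le> 2 * W * Re (cnj \<sigma> * y) + Q * B - 2 * Q * b\<^sup>2"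
      using Q b by (simp add: pos_divide_le_eq mult.commute)
    moreover have "(Q * b * t - b * W\<^sup>2 * E * (b * (k * (cmod A)\<^sup>2))) / (Q * b) = t - b * (E * W\<^sup>2 / (i\<^sup>2 * Q)) * X"
      unfolding kA using Q b by (simp add: field_simps power2_eq_square)
    ultimately have 1: "t - b * (E * W\<^sup>2 / (i\<^sup>2 * Q)) * X + 2 * Q * b\<^sup>2 \<le> 2 * W * Re (cnj \<sigma> * y) + Q * B" by simp
    define TT where "TT = 2 / m * ((1 + E) * i) + (W + E * W') / i\<^sup>2 - E * W\<^sup>2 / (i\<^sup>2 * Q)"
    have "H = p + 2 * X\<^sup>2 + X * b * (2 / m * ((1 + E) * i) + (W + E * W') / i\<^sup>2) + E * W / m * b\<^sup>2 + (2 * W * Re (cnj \<sigma> * y) + Q * B)"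
    proof -
      have "b * k * (cmod A)\<^sup>2 * (W + E * W') = X * b * ((W + E * W') / i\<^sup>2)"
        using kA by (simp add: mult.assoc mult.left_commute)
      then show ?thesis unfolding H_def p_def by (simp add: algebra_simps)
    qed
    then have "H \<ge> p + 2 * X\<^sup>2 + X * b * TT + (E * W / m + 2 * Q) * b\<^sup>2 + t"
      using 1 unfolding TT_def by (simp add: algebra_simps)
    moreover have "X * b * TT \<ge> X * b * (2 * Q)" using T X0 b unfolding TT_def by (intro mult_left_mono) auto
    moreover have "(E * W / m + 2 * Q) * b\<^sup>2 \<ge> Q\<^sup>2 * b\<^sup>2" using R by (intro mult_right_mono) auto
    moreover have "2 * X\<^sup>2 + X * b * (2 * Q) + Q\<^sup>2 * b\<^sup>2 = X\<^sup>2 + (X + Q * b)\<^sup>2" by (simp add: power2_eq_square algebra_simps)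
    ultimately have Hge: "H \<ge> p + t + (X + Q * b)\<^sup>2" using zero_le_power2[of X] by linarith
    have "(cmod (cnj A * of_real P * u + \<tau>))\<^sup>2 \<le> (X + Q * b) * (p + t)"
      by (rule cauchy_schwarz_weighted[OF x2 t2]) (use X0 Q b p0 t0 in auto)
    moreover have "(p + t + (X + Q * b)\<^sup>2) * (X + Q * b) \<le> H * (X + Q * b)"
      using Hge X0 Q b by (intro mult_right_mono) auto
    ultimately show ?thesis unfolding \<tau>_def by (simp add: algebra_simps power2_eq_square power3_eq_cube)
  qed
qed

text \<open>The first expression is 3 K plus two nonnegative terms minus c, with K = (1 + E) i / m
  \<ge> 2 Q0 - 1 from the coth comparison and c \<le> 2 (Q - 1) from the Poincare comparison. It is
  thus at least 6 Q0 - 1 - 2 Q. If Q - Q0 \<le> 1/4, this is at least 2 Q precisely because Q0 \<ge>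
  1; that is the origin of 1/4. The second inequality expands Q^2 = Q + Q^2 (E + \<epsilon>)^m, and
  the condition on Q \<epsilon>^m absorbs the error of the regularization.\<close>

lemma curvature_coefficients:
  fixes m E \<epsilon> :: real
  assumes m: "0 < m" "m < 1" and E: "0 \<le> E" "E < 1" and \<epsilon>: "0 < \<epsilon>" and g: "(E + \<epsilon>) powr m < 1"
  defines "Q \<equiv> 1 / (1 - (E + \<epsilon>) powr m)" and "Q0 \<equiv> 1 / (1 - E powr m)"
  assumes small: "Q - Q0 \<le> 1/4" "Q * \<epsilon> powr m \<le> 1"
  defines "g1 \<equiv> m * (E + \<epsilon>) powr m / (E + \<epsilon>)" and "i \<equiv> 1 / (1 - E)"
  defines "g2 \<equiv> (m - 1) * g1 / (E + \<epsilon>)"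
  defines "W \<equiv> i\<^sup>2 / m + Q\<^sup>2 * g1" and "W' \<equiv> 2 * i ^ 3 / m + 2 * Q ^ 3 * g1\<^sup>2 + Q\<^sup>2 * g2"
  shows "2 / m * ((1 + E) * i) + (W + E * W') / i\<^sup>2 - E * W\<^sup>2 / (i\<^sup>2 * Q) \<ge> 2 * Q"
    and "E * W / m + 2 * Q \<ge> Q\<^sup>2"
proof -
  let ?g = "(E + \<epsilon>) powr m"
  have Q: "Q > 0" "Q * (1 - ?g) = 1" using g by (auto simp: Q_def)
  have i: "i > 0" "i * (1 - E) = 1" using E by (auto simp: i_def)
  have Ee: "E + \<epsilon> > 0" using E \<epsilon> by simp
  have M: "E powr m < 1" by (rule powr_less_one_of[OF E m(1)])
  have Q0: "Q0 \<ge> 1" "Q0 * (1 - E powr m) = 1" using M by (auto simp: Q0_def)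
  have QQ: "Q0 \<le> Q" unfolding Q_def Q0_def using g M E \<epsilon> m
    by (intro divide_left_mono) (auto intro!: powr_mono2)
  have g1: "g1 \<ge> 0" using m Ee by (simp add: g1_def)
  \<comment> \<open>This is the derivative of E g1 with respect to E; the numerator simplifies to
    \<epsilon> + m E.\<close>
  have "g1 + E * g2 = g1 * ((E + \<epsilon> + (m - 1) * E) / (E + \<epsilon>))"
    using Ee by (simp add: g2_def field_simps)
  also have "\<dots> \<ge> 0" using g1 Ee E m \<epsilon> by (intro mult_nonneg_nonneg divide_nonneg_nonneg) (auto simp: algebra_simps)
  finally have g12: "g1 + E * g2 \<ge> 0" .
  have kap: "(1 + E) * i / m \<ge> 2 * Q0 - 1"
  proof -
    have "2 * Q0 - 1 = (1 + E powr m) / (1 - E powr m)" using M by (simp add: Q0_def field_simps)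
    then show ?thesis using coth_powr_le[OF m E] by (simp add: i_def)
  qed
  have Pc: "E * i\<^sup>2 \<le> m\<^sup>2 * (Q * (Q - 1))"
  proof -
    have "E * i\<^sup>2 \<le> m\<^sup>2 * (Q0 * (Q0 - 1))"
      using Poincare_coeff_le[OF m E] M unfolding i_def Q0_def by (simp add: power_divide field_simps power2_eq_square)
    also have "\<dots> \<le> m\<^sup>2 * (Q * (Q - 1))" using QQ Q0 by (intro mult_left_mono mult_mono) auto
    finally show ?thesis .
  qed
  have "2 / m * ((1 + E) * i) + (W + E * W') / i\<^sup>2 - E * W\<^sup>2 / (i\<^sup>2 * Q)
    = 3 * ((1 + E) * i / m) + Q\<^sup>2 * (g1 + E * g2) / i\<^sup>2 + E / Q * (Q\<^sup>2 * g1 - i\<^sup>2 / m)\<^sup>2 / i\<^sup>2 - 2 * (E * i\<^sup>2) / (m\<^sup>2 * Q)"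
  proof -
    have e1: "1 / m + 2 * E * i / m = (1 + E) * i / m"
    proof -
      have "1 + 2 * E * i = i * (1 - E) + 2 * E * i" by (simp only: i(2))
      then show ?thesis by (simp add: add_divide_distrib[symmetric] algebra_simps)
    qed
    have "(W + E * W') / i\<^sup>2 = 1 / m + 2 * E * i / m + (Q\<^sup>2 * (g1 + E * g2) + 2 * E * Q ^ 3 * g1\<^sup>2) / i\<^sup>2"
      unfolding W_def W'_def using i(1) m by (simp add: field_simps power2_eq_square power3_eq_cube)
    \<comment> \<open>The identity W^2 = 2 a^2 + 2 b^2 - (a - b)^2 with a = Q^2 g1 and b = i^2 / m.
      The term in a^2 cancels against one from W'.\<close>
    moreover have "E * W\<^sup>2 / (i\<^sup>2 * Q) = 2 * E * Q ^ 3 * g1\<^sup>2 / i\<^sup>2 - E / Q * (Q\<^sup>2 * g1 - i\<^sup>2 / m)\<^sup>2 / i\<^sup>2 + 2 * (E * i\<^sup>2) / (m\<^sup>2 * Q)"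
      unfolding W_def using i(1) m Q(1) by (simp add: field_simps power2_eq_square power3_eq_cube)
    moreover have "2 / m * ((1 + E) * i) = 2 * ((1 + E) * i / m)" by simp
    moreover have "(a + c) / i\<^sup>2 = a / i\<^sup>2 + c / i\<^sup>2" for a c by (rule add_divide_distrib)
    moreover have "T = 3 * K + a + b - c" if "A1 = 1/m + e + (a + d)" "A2 = d - b + c" "1/m + e = K" "T = 2 * K + A1 - A2"
      for T K A1 A2 a b c d e :: real using that by linarith
    ultimately show ?thesis using e1 by metis
  qed
  moreover have "Q\<^sup>2 * (g1 + E * g2) / i\<^sup>2 \<ge> 0" using g12 by simp
  moreover have "E / Q * (Q\<^sup>2 * g1 - i\<^sup>2 / m)\<^sup>2 / i\<^sup>2 \<ge> 0" using E Q by simp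
  moreover have "2 * (E * i\<^sup>2) / (m\<^sup>2 * Q) \<le> 2 * (Q - 1)"
  proof -
    have "E * i\<^sup>2 / (m\<^sup>2 * Q) \<le> Q - 1"
      using Pc m Q(1) by (subst pos_divide_le_eq) (auto simp: algebra_simps)
    then show ?thesis by simp
  qed
  ultimately show "2 / m * ((1 + E) * i) + (W + E * W') / i\<^sup>2 - E * W\<^sup>2 / (i\<^sup>2 * Q) \<ge> 2 * Q"
  proof -
    have gen: "T \<ge> 2 * Q" if "T = 3 * K + a + b - c" "a \<ge> 0" "b \<ge> 0" "c \<le> 2 * (Q - 1)" "K \<ge> 2 * Q0 - 1" for T K a b c
    proof -
      have "4 * Q \<le> 4 * Q0 + 1" "c \<le> 2 * Q - 2" using small(1) that(4) by simp_all
      then show ?thesis using that Q0(1) by linarith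
    qed
    assume *: "2 / m * ((1 + E) * i) + (W + E * W') / i\<^sup>2 - E * W\<^sup>2 / (i\<^sup>2 * Q)
      = 3 * ((1 + E) * i / m) + Q\<^sup>2 * (g1 + E * g2) / i\<^sup>2 + E / Q * (Q\<^sup>2 * g1 - i\<^sup>2 / m)\<^sup>2 / i\<^sup>2 - 2 * (E * i\<^sup>2) / (m\<^sup>2 * Q)"
      "Q\<^sup>2 * (g1 + E * g2) / i\<^sup>2 \<ge> 0" "E / Q * (Q\<^sup>2 * g1 - i\<^sup>2 / m)\<^sup>2 / i\<^sup>2 \<ge> 0"
      "2 * (E * i\<^sup>2) / (m\<^sup>2 * Q) \<le> 2 * (Q - 1)"
    show ?thesis by (rule gen[OF * kap])
  qed
  \<comment> \<open>The exponent m - 1 is negative, so the power (E + \<epsilon>)^(m - 1) is largest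
    at E = 0.\<close>
  have "\<epsilon> * ?g / (E + \<epsilon>) \<le> \<epsilon> powr m"
  proof -
    have "?g / (E + \<epsilon>) = (E + \<epsilon>) powr (m - 1)" using Ee by (simp add: powr_diff)
    also have "\<dots> \<le> \<epsilon> powr (m - 1)" using m E \<epsilon> by (intro powr_mono2') auto
    also have "\<dots> = \<epsilon> powr m / \<epsilon>" using \<epsilon> by (simp add: powr_diff)
    finally have "\<epsilon> * (?g / (E + \<epsilon>)) \<le> \<epsilon> * (\<epsilon> powr m / \<epsilon>)" using \<epsilon> by (intro mult_left_mono) auto
    then show ?thesis using \<epsilon> by simp
  qed
  then have "Q * (Q * (\<epsilon> * ?g / (E + \<epsilon>))) \<le> Q * (Q * \<epsilon> powr m)" using Q by (intro mult_left_mono) auto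
  also have "\<dots> \<le> Q * 1" using small(2) Q by (intro mult_left_mono) auto
  finally have r: "Q\<^sup>2 * (\<epsilon> * ?g / (E + \<epsilon>)) \<le> Q" by (simp add: power2_eq_square mult.assoc)
  have "Q\<^sup>2 = Q + Q\<^sup>2 * ?g" using Q(2) by (simp add: power2_eq_square algebra_simps) (metis distrib_left mult.right_neutral)
  also have "?g = E * g1 / m + \<epsilon> * ?g / (E + \<epsilon>)" 
  proof -
    have "E * g1 / m = E * ?g / (E + \<epsilon>)" using m by (simp add: g1_def)
    then show ?thesis using Ee by (simp add: add_divide_distrib[symmetric] distrib_right[symmetric])
  qed
  finally have "Q\<^sup>2 \<le> Q + Q\<^sup>2 * (E * g1 / m) + Q" using r by (simp add: algebra_simps)
  also have "\<dots> \<le> E * W / m + 2 * Q"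
  proof -
    have "E * W / m = E * i\<^sup>2 / m\<^sup>2 + Q\<^sup>2 * (E * g1 / m)" unfolding W_def using m by (simp add: field_simps power2_eq_square)
    moreover have "E * i\<^sup>2 / m\<^sup>2 \<ge> 0" using E by simp
    ultimately show ?thesis by linarith
  qed
  finally show "E * W / m + 2 * Q \<ge> Q\<^sup>2" .
qed

text \<open>Fixing one curve turns every ingredient of the metric into a function of a single
  complex variable, so that the curvature is computed with the rules for \<open>wirt\<close> instead
  of with the curvature tensor.\<close>

locale egg_curve =
  fixes \<iota> :: "'n::finite" and m :: real and U :: "complex set" and \<phi> :: "complex \<Rightarrow> complex ^ 'n"
  assumes m: "0 < m" "m < 1" and U: "open U" and hol: "vec_holomorphic_on \<phi> U"
    and mem: "\<And>\<zeta>. \<zeta> \<in> U \<Longrightarrow> \<phi> \<zeta> \<in> egg \<iota> m"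
begin

section \<open>The ball part of the metric along a curve\<close>

definition w where "w i \<zeta> = \<phi> \<zeta> $ i"
definition w1 where "w1 i = deriv (w i)"
definition w2 where "w2 i = deriv (w1 i)"

lemma wirt_w: "wirt U (w i) (w1 i) (\<lambda>_. 0)" "wirt U (w1 i) (w2 i) (\<lambda>_. 0)" "wirt U (w2 i) (deriv (w2 i)) (\<lambda>_. 0)"
proof -
  have "w i holomorphic_on U" using hol unfolding vec_holomorphic_on_def w_def[abs_def] by auto
  moreover from this have "w1 i holomorphic_on U" unfolding w1_def using U by (rule holomorphic_deriv)
  moreover from this have "w2 i holomorphic_on U" unfolding w2_def using U by (rule holomorphic_deriv)
  ultimately show "wirt U (w i) (w1 i) (\<lambda>_. 0)" "wirt U (w1 i) (w2 i) (\<lambda>_. 0)" "wirt U (w2 i) (deriv (w2 i)) (\<lambda>_. 0)"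
    unfolding w1_def w2_def using wirt_holomorphic[OF _ U] by auto
qed

definition s where "s \<zeta> = 1 - (\<Sum>i\<in>UNIV - {\<iota>}. w i \<zeta> * cnj (w i \<zeta>))"
definition c where "c \<zeta> = (\<Sum>i\<in>UNIV - {\<iota>}. w1 i \<zeta> * cnj (w i \<zeta>))"
definition N where "N \<zeta> = (\<Sum>i\<in>UNIV - {\<iota>}. w1 i \<zeta> * cnj (w1 i \<zeta>))"
definition d where "d \<zeta> = (\<Sum>i\<in>UNIV - {\<iota>}. w2 i \<zeta> * cnj (w i \<zeta>))"
definition g where "g \<zeta> = (\<Sum>i\<in>UNIV - {\<iota>}. w2 i \<zeta> * cnj (w1 i \<zeta>))"
definition M where "M \<zeta> = (\<Sum>i\<in>UNIV - {\<iota>}. w2 i \<zeta> * cnj (w2 i \<zeta>))"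

lemma s_gap: "s \<zeta> = of_real (gap \<iota> (\<phi> \<zeta>))"
  by (simp add: s_def gap_def w_def complex_norm_square of_real_power del: of_real_power)
lemma s_pos: "\<zeta> \<in> U \<Longrightarrow> Re (s \<zeta>) > 0" "\<zeta> \<in> U \<Longrightarrow> s \<zeta> \<noteq> 0"
  using egg_facts(1)[OF m(1) mem] by (auto simp: s_gap) fastforce
lemma cnj_s: "cnj (s \<zeta>) = s \<zeta>" by (simp add: s_gap)
lemma cnj_N: "cnj (N \<zeta>) = N \<zeta>" by (simp add: N_def mult.commute)
lemma cnj_M: "cnj (M \<zeta>) = M \<zeta>" by (simp add: M_def mult.commute)

lemma wirt_s: "wirt U s (\<lambda>\<zeta>. - c \<zeta>) (\<lambda>\<zeta>. - cnj (c \<zeta>))"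
  unfolding s_def[abs_def]
  by (rule wirt_cong[OF wirt_diff[OF wirt_const wirt_sum[OF wirt_mult[OF wirt_w(1) wirt_cnj[OF wirt_w(1)]]]]])
     (simp_all add: c_def mult.commute)
lemma wirt_c: "wirt U c d N"
  unfolding c_def[abs_def]
  by (rule wirt_cong[OF wirt_sum[OF wirt_mult[OF wirt_w(2) wirt_cnj[OF wirt_w(1)]]]])
     (simp_all add: d_def N_def)
lemma wirt_N: "wirt U N g (\<lambda>\<zeta>. cnj (g \<zeta>))"
  unfolding N_def[abs_def]
  by (rule wirt_cong[OF wirt_sum[OF wirt_mult[OF wirt_w(2) wirt_cnj[OF wirt_w(2)]]]])
     (simp_all add: g_def mult.commute)
lemma wirt_d: "\<exists>x. wirt U d x g"
  unfolding d_def[abs_def]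
  by (rule exI, rule wirt_cong[OF wirt_sum[OF wirt_mult[OF wirt_w(3) wirt_cnj[OF wirt_w(1)]]]])
     (rule refl, simp add: g_def)
lemma wirt_g: "\<exists>x. wirt U g x M"
  unfolding g_def[abs_def]
  by (rule exI, rule wirt_cong[OF wirt_sum[OF wirt_mult[OF wirt_w(3) wirt_cnj[OF wirt_w(2)]]]])
     (rule refl, simp add: M_def)

definition r where "r \<zeta> = inverse (s \<zeta>)"
lemma wirt_r: "wirt U r (\<lambda>\<zeta>. r \<zeta> * r \<zeta> * c \<zeta>) (\<lambda>\<zeta>. r \<zeta> * r \<zeta> * cnj (c \<zeta>))"
  unfolding r_def[abs_def] by (rule wirt_cong[OF wirt_inverse[OF wirt_s]]) (auto simp: s_pos)
lemma cnj_r: "cnj (r \<zeta>) = r \<zeta>" by (simp add: r_def cnj_s)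

text \<open>\<open>b\<close> is the pullback of the ball metric, \<open>y\<close> its
  \<zeta>-derivative and \<open>B\<close> the cnj \<zeta>-derivative of y, all written out by the
  product rule.\<close>

definition b where "b \<zeta> = N \<zeta> * r \<zeta> + c \<zeta> * cnj (c \<zeta>) * (r \<zeta> * r \<zeta>)"
definition y where "y \<zeta> = g \<zeta> * r \<zeta> + d \<zeta> * cnj (c \<zeta>) * (r \<zeta> * r \<zeta>) + 2 * c \<zeta> * b \<zeta> * r \<zeta>"
definition B where "B \<zeta> = M \<zeta> * r \<zeta> + g \<zeta> * (r \<zeta> * r \<zeta>) * cnj (c \<zeta>)
   + g \<zeta> * cnj (c \<zeta>) * (r \<zeta> * r \<zeta>) + d \<zeta> * cnj (d \<zeta>) * (r \<zeta> * r \<zeta>) + 2 * d \<zeta> * cnj (c \<zeta>) * cnj (c \<zeta>) * (r \<zeta> * r \<zeta> * r \<zeta>)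
   + 2 * N \<zeta> * b \<zeta> * r \<zeta> + 2 * c \<zeta> * cnj (y \<zeta>) * r \<zeta> + 2 * c \<zeta> * b \<zeta> * (r \<zeta> * r \<zeta>) * cnj (c \<zeta>)"

lemma cnj_b: "cnj (b \<zeta>) = b \<zeta>" by (simp add: b_def cnj_N cnj_r mult_ac)

lemma wirt_b: "wirt U b y (\<lambda>\<zeta>. cnj (y \<zeta>))"
  unfolding b_def[abs_def]
  by (rule wirt_cong[OF wirt_add[OF wirt_mult[OF wirt_N wirt_r] wirt_mult[OF wirt_mult[OF wirt_c wirt_cnj[OF wirt_c]] wirt_mult[OF wirt_r wirt_r]]]])
     (simp_all add: y_def b_def cnj_N cnj_r algebra_simps)

lemma wirt_y: "\<exists>x. wirt U y x B"
proof -
  obtain dx gx where dg: "wirt U d dx g" "wirt U g gx M" using wirt_d wirt_g by blast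
  show ?thesis unfolding y_def[abs_def]
    by (rule exI, rule wirt_cong[OF wirt_add[OF wirt_add[OF wirt_mult[OF dg(2) wirt_r]
      wirt_mult[OF wirt_mult[OF dg(1) wirt_cnj[OF wirt_c]] wirt_mult[OF wirt_r wirt_r]]]
      wirt_mult[OF wirt_mult[OF wirt_cmult[OF wirt_c] wirt_b] wirt_r]]])
      (rule refl, simp add: B_def algebra_simps)
qed

text \<open>The Hermitian form \<open>\<beta>\<close> of the ball, on \<open>p w'' + q w'\<close>.\<close>

lemma ball_form_nonneg:
  "0 \<le> Re (r \<zeta> * (p * cnj p * M \<zeta> + p * cnj q * g \<zeta> + q * cnj p * cnj (g \<zeta>) + q * cnj q * N \<zeta>)
      + r \<zeta> * r \<zeta> * ((p * d \<zeta> + q * c \<zeta>) * cnj (p * d \<zeta> + q * c \<zeta>)))" if \<zeta>: "\<zeta> \<in> U" for p q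
proof -
  let ?J = "UNIV - {\<iota>}"
  have "p * cnj p * M \<zeta> + p * cnj q * g \<zeta> + q * cnj p * cnj (g \<zeta>) + q * cnj q * N \<zeta>
    = (\<Sum>i\<in>?J. (p * w2 i \<zeta> + q * w1 i \<zeta>) * cnj (p * w2 i \<zeta> + q * w1 i \<zeta>))"
    by (simp add: M_def g_def N_def sum_distrib_left sum.distrib[symmetric] algebra_simps)
  also have "\<dots> = of_real (\<Sum>i\<in>?J. (cmod (p * w2 i \<zeta> + q * w1 i \<zeta>))\<^sup>2)"
    by (simp only: complex_norm_square of_real_sum)
  finally have 1: "p * cnj p * M \<zeta> + p * cnj q * g \<zeta> + q * cnj p * cnj (g \<zeta>) + q * cnj q * N \<zeta> = \<dots>" .
  have 2: "r \<zeta> = of_real (inverse (gap \<iota> (\<phi> \<zeta>)))" by (simp add: r_def s_gap)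
  have "0 < gap \<iota> (\<phi> \<zeta>)" using egg_facts(1)[OF m(1) mem[OF \<zeta>]] .
  then have "0 \<le> inverse (gap \<iota> (\<phi> \<zeta>)) * (\<Sum>i\<in>?J. (cmod (p * w2 i \<zeta> + q * w1 i \<zeta>))\<^sup>2)
     + inverse (gap \<iota> (\<phi> \<zeta>)) * inverse (gap \<iota> (\<phi> \<zeta>)) * (cmod (p * d \<zeta> + q * c \<zeta>))\<^sup>2"
    by (intro add_nonneg_nonneg mult_nonneg_nonneg sum_nonneg) auto
  also have "\<dots> = Re (of_real (inverse (gap \<iota> (\<phi> \<zeta>)) * (\<Sum>i\<in>?J. (cmod (p * w2 i \<zeta> + q * w1 i \<zeta>))\<^sup>2)
     + inverse (gap \<iota> (\<phi> \<zeta>)) * inverse (gap \<iota> (\<phi> \<zeta>)) * (cmod (p * d \<zeta> + q * c \<zeta>))\<^sup>2))" by (simp only: Re_complex_of_real)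
  finally show ?thesis unfolding 1 2 unfolding complex_norm_square[symmetric]
    by (simp only: of_real_add of_real_mult)
qed

lemma b_nonneg: "\<zeta> \<in> U \<Longrightarrow> 0 \<le> Re (b \<zeta>)"
  using ball_form_nonneg[of \<zeta> 0 1] by (simp add: b_def algebra_simps)

lemma b_real: "b \<zeta> = of_real (Re (b \<zeta>))"
  using cnj_b[of \<zeta>] by (simp add: complex_eq_iff)

text \<open>The ball has constant holomorphic curvature: \<open>B = \<beta>(D, D) + 2 b\<^sup>2\<close> with
  \<open>D = w'' + 2 c r w'\<close>, and \<open>y = \<beta>(D, w')\<close>.\<close>

lemma B_eq: "B \<zeta> = r \<zeta> * (M \<zeta> + cnj (2 * c \<zeta> * r \<zeta>) * g \<zeta> + (2 * c \<zeta> * r \<zeta>) * cnj (g \<zeta>) + (2 * c \<zeta> * r \<zeta>) * cnj (2 * c \<zeta> * r \<zeta>) * N \<zeta>)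
      + r \<zeta> * r \<zeta> * ((d \<zeta> + (2 * c \<zeta> * r \<zeta>) * c \<zeta>) * cnj (d \<zeta> + (2 * c \<zeta> * r \<zeta>) * c \<zeta>)) + 2 * b \<zeta> * b \<zeta>"
  by (simp add: B_def y_def b_def cnj_N cnj_r algebra_simps)

lemma B_nonneg: "\<zeta> \<in> U \<Longrightarrow> 2 * (Re (b \<zeta>))\<^sup>2 \<le> Re (B \<zeta>)"
  using ball_form_nonneg[of \<zeta> 1 "2 * c \<zeta> * r \<zeta>"] unfolding B_eq
  by (subst (2) b_real, subst (2) b_real) (simp add: power2_eq_square)

lemma B_real: "B \<zeta> = of_real (Re (B \<zeta>))"
proof -
  have "cnj (B \<zeta>) = B \<zeta>" unfolding B_eq by (simp add: cnj_N cnj_r cnj_M cnj_b algebra_simps)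
  then show ?thesis by (simp add: complex_eq_iff)
qed

text \<open>Cauchy-Schwarz for \<beta> between D and w': evaluating \<beta> at b D - y w' gives b (b
  \<beta>(D, D) - |y|^2) \<ge> 0. If b = 0 the factor cannot be cancelled; in that case w' = 0 and
  therefore y = 0.\<close>

lemma B_ineq:
  assumes \<zeta>: "\<zeta> \<in> U"
  shows "(cmod (y \<zeta>))\<^sup>2 + 2 * Re (b \<zeta>) ^ 3 \<le> Re (B \<zeta>) * Re (b \<zeta>)"
proof -
  let ?b = "Re (b \<zeta>)" and ?t = "2 * c \<zeta> * r \<zeta>"
  have main: "b \<zeta> * (b \<zeta> * (B \<zeta> - 2 * b \<zeta> * b \<zeta>) - y \<zeta> * cnj (y \<zeta>))
    = r \<zeta> * (b \<zeta> * cnj (b \<zeta>) * M \<zeta> + b \<zeta> * cnj (?t * b \<zeta> - y \<zeta>) * g \<zeta> + (?t * b \<zeta> - y \<zeta>) * cnj (b \<zeta>) * cnj (g \<zeta>) + (?t * b \<zeta> - y \<zeta>) * cnj (?t * b \<zeta> - y \<zeta>) * N \<zeta>)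
      + r \<zeta> * r \<zeta> * ((b \<zeta> * d \<zeta> + (?t * b \<zeta> - y \<zeta>) * c \<zeta>) * cnj (b \<zeta> * d \<zeta> + (?t * b \<zeta> - y \<zeta>) * c \<zeta>))"
  proof -
    define q where "q = g \<zeta> * r \<zeta> + d \<zeta> * cnj (c \<zeta>) * (r \<zeta> * r \<zeta>)"
    define bb where "bb = r \<zeta> * M \<zeta> + r \<zeta> * r \<zeta> * (d \<zeta> * cnj (d \<zeta>))"
    have y: "y \<zeta> = q + ?t * b \<zeta>" by (simp add: y_def q_def algebra_simps)
    have form: "r \<zeta> * (p * cnj p * M \<zeta> + p * cnj x * g \<zeta> + x * cnj p * cnj (g \<zeta>) + x * cnj x * N \<zeta>)
      + r \<zeta> * r \<zeta> * ((p * d \<zeta> + x * c \<zeta>) * cnj (p * d \<zeta> + x * c \<zeta>))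
      = p * cnj p * bb + p * cnj x * q + x * cnj p * cnj q + x * cnj x * b \<zeta>" for p x
      by (simp add: bb_def q_def b_def cnj_r algebra_simps)
    have "B \<zeta> - 2 * b \<zeta> * b \<zeta> = bb + cnj ?t * q + ?t * cnj q + ?t * cnj ?t * b \<zeta>"
      unfolding B_eq using form[of 1 ?t] by simp
    moreover have "?t * b \<zeta> - y \<zeta> = - q" using y by simp
    ultimately show ?thesis unfolding form by (simp add: y cnj_b algebra_simps)
  qed
  have "0 \<le> Re (b \<zeta> * (b \<zeta> * (B \<zeta> - 2 * b \<zeta> * b \<zeta>) - y \<zeta> * cnj (y \<zeta>)))"
    unfolding main by (rule ball_form_nonneg[OF \<zeta>])
  also have "b \<zeta> * (b \<zeta> * (B \<zeta> - 2 * b \<zeta> * b \<zeta>) - y \<zeta> * cnj (y \<zeta>)) = of_real (?b * (?b * (Re (B \<zeta>) - 2 * ?b * ?b) - (cmod (y \<zeta>))\<^sup>2))"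
    unfolding complex_norm_square[symmetric] by (subst (1 2 3 4) b_real, subst B_real) simp
  finally have ge: "0 \<le> ?b * (?b * (Re (B \<zeta>) - 2 * ?b * ?b) - (cmod (y \<zeta>))\<^sup>2)" by simp
  show ?thesis
  proof (cases "?b = 0")
    case True
    then have b0: "b \<zeta> = 0" using b_real[of \<zeta>] by simp
    have "0 < gap \<iota> (\<phi> \<zeta>)" using egg_facts(1)[OF m(1) mem[OF \<zeta>]] .
    moreover have "b \<zeta> = of_real (inverse (gap \<iota> (\<phi> \<zeta>)) * (\<Sum>i\<in>UNIV - {\<iota>}. (cmod (w1 i \<zeta>))\<^sup>2) + (inverse (gap \<iota> (\<phi> \<zeta>)))\<^sup>2 * (cmod (c \<zeta>))\<^sup>2)"
      unfolding b_def N_def r_def s_gap by (simp add: complex_norm_square power2_eq_square of_real_power del: of_real_power)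
        (simp add: complex_norm_square[symmetric] power2_eq_square)
    ultimately have "inverse (gap \<iota> (\<phi> \<zeta>)) * (\<Sum>i\<in>UNIV - {\<iota>}. (cmod (w1 i \<zeta>))\<^sup>2) + (inverse (gap \<iota> (\<phi> \<zeta>)))\<^sup>2 * (cmod (c \<zeta>))\<^sup>2 = 0"
      using b0 by (metis of_real_eq_0_iff)
    moreover have "inverse (gap \<iota> (\<phi> \<zeta>)) * (\<Sum>i\<in>UNIV - {\<iota>}. (cmod (w1 i \<zeta>))\<^sup>2) \<ge> 0" "(inverse (gap \<iota> (\<phi> \<zeta>)))\<^sup>2 * (cmod (c \<zeta>))\<^sup>2 \<ge> 0"
      using \<open>0 < gap \<iota> (\<phi> \<zeta>)\<close> by (auto intro!: mult_nonneg_nonneg sum_nonneg)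
    ultimately have "inverse (gap \<iota> (\<phi> \<zeta>)) * (\<Sum>i\<in>UNIV - {\<iota>}. (cmod (w1 i \<zeta>))\<^sup>2) = 0" by linarith
    then have "(\<Sum>i\<in>UNIV - {\<iota>}. (cmod (w1 i \<zeta>))\<^sup>2) = 0" using \<open>0 < gap \<iota> (\<phi> \<zeta>)\<close> by simp
    then have w0: "w1 i \<zeta> = 0" if "i \<noteq> \<iota>" for i
      using that by (subst (asm) sum_nonneg_eq_0_iff) auto
    then have "g \<zeta> = 0" "c \<zeta> = 0" by (simp_all add: g_def c_def)
    then have "y \<zeta> = 0" by (simp add: y_def)
    then show ?thesis using True by simp
  next
    case False
    then have "?b > 0" using b_nonneg[OF \<zeta>] by simp
    then have "0 \<le> ?b * (Re (B \<zeta>) - 2 * ?b * ?b) - (cmod (y \<zeta>))\<^sup>2" using ge by (simp add: zero_le_mult_iff)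
    then show ?thesis by (simp add: algebra_simps power3_eq_cube)
  qed
qed


text \<open>Dictionary for the normal part: k = s^(-1/m), l is its logarithmic derivative and l1 the
  \<zeta>-derivative of l; A is \<open>conn_form\<close> at the velocity and e its
  \<zeta>-derivative; \<sigma> is the \<zeta>-derivative of E and \<sigma>b the cnj
  \<zeta>-derivative of \<sigma>; P is the normal coefficient. Normal and ball part interact because
  the cnj \<zeta>-derivative of l is b / m.\<close>

definition z where "z = w \<iota>"
definition z1 where "z1 = w1 \<iota>"
definition z2 where "z2 = w2 \<iota>"
definition k where "k \<zeta> = s \<zeta> powr (- 1 / of_real m)"
definition l where "l \<zeta> = c \<zeta> * r \<zeta> / of_real m"
definition l1 where "l1 \<zeta> = (d \<zeta> * r \<zeta> + c \<zeta> * c \<zeta> * (r \<zeta> * r \<zeta>)) / of_real m"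
definition A where "A \<zeta> = z1 \<zeta> + z \<zeta> * l \<zeta>"
definition e where "e \<zeta> = z2 \<zeta> + (z1 \<zeta> * l \<zeta> + z \<zeta> * l1 \<zeta>)"
definition E where "E \<zeta> = k \<zeta> * (z \<zeta> * cnj (z \<zeta>))"
definition \<sigma> where "\<sigma> \<zeta> = k \<zeta> * cnj (z \<zeta>) * A \<zeta>"
definition \<sigma>b where "\<sigma>b \<zeta> = k \<zeta> * A \<zeta> * cnj (A \<zeta>) + E \<zeta> * b \<zeta> / of_real m"
definition i where "i \<zeta> = inverse (1 - E \<zeta>)"
definition P where "P \<zeta> = k \<zeta> * (i \<zeta> * i \<zeta>)"

lemma wirt_z: "wirt U z z1 (\<lambda>_. 0)" "wirt U z1 z2 (\<lambda>_. 0)" "\<exists>x. wirt U z2 x (\<lambda>_. 0)"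
  unfolding z_def z1_def z2_def using wirt_w by blast+

lemma k_real: "\<zeta> \<in> U \<Longrightarrow> k \<zeta> = of_real (gap \<iota> (\<phi> \<zeta>) powr (- 1 / m))"
  using powr_of_real[OF less_imp_le[OF egg_facts(1)[OF m(1) mem]], of \<zeta> "- 1 / m"] by (simp add: k_def s_gap)
lemma cnj_k: "\<zeta> \<in> U \<Longrightarrow> cnj (k \<zeta>) = k \<zeta>" by (simp add: k_real)

lemma wirt_k: "wirt U k (\<lambda>\<zeta>. k \<zeta> * l \<zeta>) (\<lambda>\<zeta>. k \<zeta> * cnj (l \<zeta>))"
  unfolding k_def[abs_def]
  by (rule wirt_cong[OF wirt_powr[OF wirt_s s_pos(1)]]) (simp_all add: l_def r_def cnj_s)

lemma wirt_l: "wirt U l l1 (\<lambda>\<zeta>. b \<zeta> / of_real m)"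
proof -
  have "wirt U (\<lambda>\<zeta>. 1 / of_real m * (c \<zeta> * r \<zeta>)) l1 (\<lambda>\<zeta>. b \<zeta> / of_real m)"
    by (rule wirt_cong[OF wirt_cmult[OF wirt_mult[OF wirt_c wirt_r]]]) (use m in \<open>simp_all add: l1_def b_def field_simps\<close>)
  moreover have "(\<lambda>\<zeta>. 1 / of_real m * (c \<zeta> * r \<zeta>)) = l" by (simp add: fun_eq_iff l_def)
  ultimately show ?thesis by simp
qed

lemma wirt_l1: "\<exists>x. wirt U l1 x (\<lambda>\<zeta>. y \<zeta> / of_real m)"
proof -
  obtain dx where dx: "wirt U d dx g" using wirt_d by blast
  have "\<exists>x. wirt U (\<lambda>\<zeta>. 1 / of_real m * (d \<zeta> * r \<zeta> + c \<zeta> * c \<zeta> * (r \<zeta> * r \<zeta>))) x (\<lambda>\<zeta>. y \<zeta> / of_real m)"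
    by (rule exI, rule wirt_cong[OF wirt_cmult[OF wirt_add[OF wirt_mult[OF dx wirt_r] wirt_mult[OF wirt_mult[OF wirt_c wirt_c] wirt_mult[OF wirt_r wirt_r]]]]])
      (rule refl, use m in \<open>simp add: y_def b_def field_simps\<close>)
  moreover have "(\<lambda>\<zeta>. 1 / of_real m * (d \<zeta> * r \<zeta> + c \<zeta> * c \<zeta> * (r \<zeta> * r \<zeta>))) = l1" by (simp add: fun_eq_iff l1_def)
  ultimately show ?thesis by simp
qed

lemma wirt_A: "wirt U A e (\<lambda>\<zeta>. z \<zeta> * b \<zeta> / of_real m)"
  unfolding A_def[abs_def]
  by (rule wirt_cong[OF wirt_add[OF wirt_z(2) wirt_mult[OF wirt_z(1) wirt_l]]]) (simp_all add: e_def)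

lemma wirt_e: "\<exists>x. wirt U e x (\<lambda>\<zeta>. (z1 \<zeta> * b \<zeta> + z \<zeta> * y \<zeta>) / of_real m)"
proof -
  obtain x1 x2 where x: "wirt U z2 x1 (\<lambda>_. 0)" "wirt U l1 x2 (\<lambda>\<zeta>. y \<zeta> / of_real m)" using wirt_z(3) wirt_l1 by blast
  show ?thesis unfolding e_def[abs_def]
    by (rule exI, rule wirt_cong[OF wirt_add[OF x(1) wirt_add[OF wirt_mult[OF wirt_z(2) wirt_l] wirt_mult[OF wirt_z(1) x(2)]]]])
      (rule refl, simp add: add_divide_distrib)
qed

lemma wirt_E: "wirt U E \<sigma> (\<lambda>\<zeta>. cnj (\<sigma> \<zeta>))"
  unfolding E_def[abs_def]
  by (rule wirt_cong[OF wirt_mult[OF wirt_k wirt_mult[OF wirt_z(1) wirt_cnj[OF wirt_z(1)]]]])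
    (simp_all add: \<sigma>_def A_def cnj_k algebra_simps)

lemma wirt_\<sigma>: "\<exists>x. wirt U \<sigma> x \<sigma>b"
  unfolding \<sigma>_def[abs_def]
  by (rule exI, rule wirt_cong[OF wirt_mult[OF wirt_mult[OF wirt_k wirt_cnj[OF wirt_z(1)]] wirt_A]])
    (rule refl, simp add: \<sigma>b_def E_def A_def algebra_simps add_divide_distrib)

lemma E_real: "\<zeta> \<in> U \<Longrightarrow> E \<zeta> = of_real ((cmod (\<phi> \<zeta> $ \<iota>))\<^sup>2 * gap \<iota> (\<phi> \<zeta>) powr (- 1 / m))"
  by (simp add: E_def k_real z_def w_def complex_norm_square[symmetric] mult.commute)
lemma E_bounds: "\<zeta> \<in> U \<Longrightarrow> 0 \<le> Re (E \<zeta>)" "\<zeta> \<in> U \<Longrightarrow> Re (E \<zeta>) < 1" "\<zeta> \<in> U \<Longrightarrow> E \<zeta> = of_real (Re (E \<zeta>))"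
  using normal_coeff_alt(2)[OF m(1) mem, of \<zeta>] by (simp_all add: E_real)
lemma E_ne_1: "\<zeta> \<in> U \<Longrightarrow> 1 - E \<zeta> \<noteq> 0"
  using E_bounds(2)[of \<zeta>] by auto
lemma i_eq: "\<zeta> \<in> U \<Longrightarrow> i \<zeta> = of_real (1 / (1 - Re (E \<zeta>)))"
  by (simp add: i_def inverse_eq_divide flip: E_bounds(3))
lemma cnj_E: "\<zeta> \<in> U \<Longrightarrow> cnj (E \<zeta>) = E \<zeta>" and cnj_i: "\<zeta> \<in> U \<Longrightarrow> cnj (i \<zeta>) = i \<zeta>"
  by (simp_all add: E_real i_eq)

lemma wirt_i: "wirt U i (\<lambda>\<zeta>. i \<zeta> * i \<zeta> * \<sigma> \<zeta>) (\<lambda>\<zeta>. i \<zeta> * i \<zeta> * cnj (\<sigma> \<zeta>))"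
  unfolding i_def[abs_def]
  by (rule wirt_cong[OF wirt_inverse[OF wirt_diff[OF wirt_const[of _ 1] wirt_E] E_ne_1]]) simp_all

lemma wirt_P: "wirt U P (\<lambda>\<zeta>. P \<zeta> * (l \<zeta> + 2 * \<sigma> \<zeta> * i \<zeta>)) (\<lambda>\<zeta>. P \<zeta> * cnj (l \<zeta> + 2 * \<sigma> \<zeta> * i \<zeta>))"
  unfolding P_def[abs_def]
  by (rule wirt_cong[OF wirt_mult[OF wirt_k wirt_mult[OF wirt_i wirt_i]]]) (simp_all add: cnj_i algebra_simps)

text \<open>\<open>u1\<close> is the covariant derivative of A for the weight P, that is, e plus A
  times the logarithmic derivative of P; \<open>u1b\<close> is its cnj \<zeta>-derivative. With it P
  |u1|^2 appears in the second derivative of the metric as a single square.\<close>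

definition u1 where "u1 \<zeta> = e \<zeta> + (l \<zeta> + 2 * \<sigma> \<zeta> * i \<zeta>) * A \<zeta>"
definition u1b where "u1b \<zeta> = (z1 \<zeta> * b \<zeta> + z \<zeta> * y \<zeta>) / of_real m
    + (b \<zeta> / of_real m + 2 * \<sigma>b \<zeta> * i \<zeta> + 2 * \<sigma> \<zeta> * i \<zeta> * i \<zeta> * cnj (\<sigma> \<zeta>)) * A \<zeta>
    + (l \<zeta> + 2 * \<sigma> \<zeta> * i \<zeta>) * (z \<zeta> * b \<zeta> / of_real m)"

lemma wirt_u1: "\<exists>x. wirt U u1 x u1b"
proof -
  obtain x1 x2 where x: "wirt U e x1 (\<lambda>\<zeta>. (z1 \<zeta> * b \<zeta> + z \<zeta> * y \<zeta>) / of_real m)" "wirt U \<sigma> x2 \<sigma>b"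
    using wirt_e wirt_\<sigma> by blast
  show ?thesis unfolding u1_def[abs_def]
    by (rule exI, rule wirt_cong[OF wirt_add[OF x(1) wirt_mult[OF wirt_add[OF wirt_l wirt_mult[OF wirt_cmult[OF x(2)] wirt_i]] wirt_A]]])
      (rule refl, simp add: u1b_def algebra_simps)
qed

lemma wirt_PA: "wirt U (\<lambda>\<zeta>. cnj (A \<zeta>) * P \<zeta>)
    (\<lambda>\<zeta>. cnj (z \<zeta> * b \<zeta> / of_real m) * P \<zeta> + cnj (A \<zeta>) * (P \<zeta> * (l \<zeta> + 2 * \<sigma> \<zeta> * i \<zeta>))) (\<lambda>\<zeta>. P \<zeta> * cnj (u1 \<zeta>))"
  by (rule wirt_cong[OF wirt_mult[OF wirt_cnj[OF wirt_A] wirt_P]]) (simp_all add: u1_def algebra_simps)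

text \<open>The summand with factor 2 reflects the constant negative curvature of the Poincare
  metric in the normal direction. The computation rests on \<sigma> z = E A, |\<sigma>|^2 = E k
  |A|^2 and i = 1 + E i, which allow all powers of i to be collected.\<close>

lemma APu1b:
  assumes \<zeta>: "\<zeta> \<in> U"
  shows "cnj (A \<zeta>) * P \<zeta> * u1b \<zeta> = 2 * (P \<zeta> * (A \<zeta> * cnj (A \<zeta>)))\<^sup>2
    + 2 / of_real m * (P \<zeta> * (A \<zeta> * cnj (A \<zeta>))) * b \<zeta> * ((1 + E \<zeta>) * i \<zeta>) + cnj (\<sigma> \<zeta>) * y \<zeta> * (i \<zeta> * i \<zeta>) / of_real m"
proof -
  let ?A = "A \<zeta>" and ?i = "i \<zeta>" and ?k = "k \<zeta>" and ?b = "b \<zeta>" and ?E = "E \<zeta>"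
  have i1: "?i = 1 + ?E * ?i" using E_ne_1[OF \<zeta>] by (simp add: i_def field_simps)
  have ii: "?i * ?i = ?i + ?E * ?i * ?i" by (subst (1) i1) (simp add: algebra_simps)
  have s: "\<sigma> \<zeta> * z \<zeta> = ?E * ?A" "\<sigma> \<zeta> * cnj (\<sigma> \<zeta>) = ?E * ?k * (?A * cnj ?A)"
    by (simp_all add: \<sigma>_def E_def cnj_k[OF \<zeta>] mult_ac)
  have z1: "z1 \<zeta> = ?A - z \<zeta> * l \<zeta>" by (simp add: A_def)
  have "u1b \<zeta> = (?A * ?b + z \<zeta> * y \<zeta>) / of_real m + (?b / of_real m + 2 * \<sigma>b \<zeta> * ?i) * ?A
      + 2 * ?i * ?i * ?A * (\<sigma> \<zeta> * cnj (\<sigma> \<zeta>)) + 2 * (\<sigma> \<zeta> * z \<zeta>) * ?i * ?b / of_real m"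
    unfolding u1b_def z1 using m by (simp add: field_simps)
  also have "\<dots> = 2 * ?A * ?b * (1 + 2 * (?E * ?i)) / of_real m + z \<zeta> * y \<zeta> / of_real m + 2 * ?k * (?A * cnj ?A) * ?A * (?i + ?E * ?i * ?i)"
    unfolding s \<sigma>b_def using m by (simp add: field_simps)
  also have "1 + 2 * (?E * ?i) = (1 + ?E) * ?i"
  proof -
    have "1 + 2 * (?E * ?i) = (1 + ?E * ?i) + ?E * ?i" by simp
    also have "\<dots> = ?i + ?E * ?i" by (simp only: i1[symmetric])
    finally show ?thesis by (simp add: algebra_simps)
  qed
  also have "?i + ?E * ?i * ?i = ?i * ?i" by (rule ii[symmetric])
  finally have u: "u1b \<zeta> = 2 * ?A * ?b * ((1 + ?E) * ?i) / of_real m + z \<zeta> * y \<zeta> / of_real m + 2 * ?k * (?A * cnj ?A) * ?A * (?i * ?i)" .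
  have sz: "cnj (\<sigma> \<zeta>) = ?k * z \<zeta> * cnj ?A" by (simp add: \<sigma>_def cnj_k[OF \<zeta>])
  show ?thesis unfolding u sz P_def by (simp add: algebra_simps power2_eq_square)
qed

end

text \<open>The regularization replaces \<open>E powr m\<close>, which is singular where the curve meets \<open>Z\<close>, by
  \<open>(E + \<epsilon>) powr m\<close>.\<close>

locale egg_curve_reg = egg_curve \<iota> m U \<phi> for \<iota> :: "'n::finite" and m U \<phi> +
  fixes \<epsilon> :: real
  assumes \<epsilon>: "0 < \<epsilon>"
begin

text \<open>S is the set where the regularized tangential coefficient Q is positive and finite; g1
  and g2 are the first two derivatives of the power \<open>gm\<close> in E. W collects what
  multiplies b \<sigma> in the derivative of h: i^2 / m comes from the cnj \<zeta>-derivative of A,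
  and Q^2 g1 is the derivative of Q in E. W' is the derivative of W in E; \<open>hz\<close> is the
  \<zeta>-derivative of h and \<open>H\<close> the cnj \<zeta>-derivative of hz.\<close>

definition S where "S = {\<zeta> \<in> U. (Re (E \<zeta>) + \<epsilon>) powr m < 1}"
definition gm where "gm \<zeta> = (E \<zeta> + of_real \<epsilon>) powr of_real m"
definition j where "j \<zeta> = inverse (E \<zeta> + of_real \<epsilon>)"
definition g1 where "g1 \<zeta> = of_real m * gm \<zeta> * j \<zeta>"
definition g2 where "g2 \<zeta> = of_real (m - 1) * g1 \<zeta> * j \<zeta>"
definition Q where "Q \<zeta> = inverse (1 - gm \<zeta>)"
definition W where "W \<zeta> = i \<zeta> * i \<zeta> / of_real m + Q \<zeta> * Q \<zeta> * g1 \<zeta>"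
definition W' where "W' \<zeta> = 2 * i \<zeta> * i \<zeta> * i \<zeta> / of_real m + 2 * Q \<zeta> * Q \<zeta> * Q \<zeta> * g1 \<zeta> * g1 \<zeta> + Q \<zeta> * Q \<zeta> * g2 \<zeta>"
definition h where "h \<zeta> = P \<zeta> * (A \<zeta> * cnj (A \<zeta>)) + Q \<zeta> * b \<zeta>"
definition hz where "hz \<zeta> = cnj (A \<zeta>) * P \<zeta> * u1 \<zeta> + (b \<zeta> * \<sigma> \<zeta> * W \<zeta> + Q \<zeta> * y \<zeta>)"
definition H where "H \<zeta> = P \<zeta> * cnj (u1 \<zeta>) * u1 \<zeta> + cnj (A \<zeta>) * P \<zeta> * u1b \<zeta>
   + (cnj (y \<zeta>) * \<sigma> \<zeta> * W \<zeta> + b \<zeta> * \<sigma>b \<zeta> * W \<zeta> + b \<zeta> * \<sigma> \<zeta> * (W' \<zeta> * cnj (\<sigma> \<zeta>)))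
   + (Q \<zeta> * Q \<zeta> * g1 \<zeta> * cnj (\<sigma> \<zeta>) * y \<zeta> + Q \<zeta> * B \<zeta>)"

lemma E\<epsilon>_pos: "\<zeta> \<in> U \<Longrightarrow> Re (E \<zeta> + of_real \<epsilon>) > 0" "\<zeta> \<in> U \<Longrightarrow> E \<zeta> + of_real \<epsilon> \<noteq> 0"
  using E_bounds(1)[of \<zeta>] \<epsilon> by (auto simp: complex_eq_iff)

lemma gm_real: "\<zeta> \<in> U \<Longrightarrow> gm \<zeta> = of_real ((Re (E \<zeta>) + \<epsilon>) powr m)"
proof -
  assume \<zeta>: "\<zeta> \<in> U"
  have "gm \<zeta> = of_real (Re (E \<zeta>) + \<epsilon>) powr of_real m" unfolding gm_def by (subst E_bounds(3)[OF \<zeta>]) simp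
  then show ?thesis using E_bounds(1)[OF \<zeta>] \<epsilon> by (simp add: powr_of_real del: of_real_add)
qed

lemma S_sub: "S \<subseteq> U" by (auto simp: S_def)
lemma open_S: "open S"
proof -
  have "continuous_on U (\<lambda>\<zeta>. (Re (E \<zeta>) + \<epsilon>) powr m)"
    using wirt_cont[OF wirt_E] E\<epsilon>_pos(2) \<epsilon> E_bounds(1) by (intro continuous_intros) (auto simp: add_nonneg_eq_0_iff)
  moreover have "S = U \<inter> (\<lambda>\<zeta>. (Re (E \<zeta>) + \<epsilon>) powr m) -` {..<1}" by (auto simp: S_def)
  ultimately show ?thesis using U by (simp add: continuous_open_preimage)
qed

lemma wirt_E\<epsilon>: "wirt U (\<lambda>\<zeta>. E \<zeta> + of_real \<epsilon>) \<sigma> (\<lambda>\<zeta>. cnj (\<sigma> \<zeta>))"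
  by (rule wirt_cong[OF wirt_add[OF wirt_E wirt_const]]) simp_all
lemma wirt_gm: "wirt U gm (\<lambda>\<zeta>. g1 \<zeta> * \<sigma> \<zeta>) (\<lambda>\<zeta>. g1 \<zeta> * cnj (\<sigma> \<zeta>))"
  unfolding gm_def[abs_def]
  by (rule wirt_cong[OF wirt_powr[OF wirt_E\<epsilon> E\<epsilon>_pos(1)]]) (simp_all add: g1_def gm_def j_def)
lemma wirt_j: "wirt U j (\<lambda>\<zeta>. - j \<zeta> * j \<zeta> * \<sigma> \<zeta>) (\<lambda>\<zeta>. - j \<zeta> * j \<zeta> * cnj (\<sigma> \<zeta>))"
  unfolding j_def[abs_def]
  by (rule wirt_cong[OF wirt_inverse[OF wirt_E\<epsilon> E\<epsilon>_pos(2)]]) simp_all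
lemma wirt_g1: "wirt U g1 (\<lambda>\<zeta>. g2 \<zeta> * \<sigma> \<zeta>) (\<lambda>\<zeta>. g2 \<zeta> * cnj (\<sigma> \<zeta>))"
  unfolding g1_def[abs_def]
  by (rule wirt_cong[OF wirt_mult[OF wirt_cmult[OF wirt_gm] wirt_j]]) (simp_all add: g2_def g1_def algebra_simps)
lemma gm_ne: "\<zeta> \<in> S \<Longrightarrow> 1 - gm \<zeta> \<noteq> 0"
proof -
  assume \<zeta>: "\<zeta> \<in> S"
  then have "1 - gm \<zeta> = of_real (1 - (Re (E \<zeta>) + \<epsilon>) powr m)" using S_sub by (auto simp: gm_real)
  then show ?thesis using \<zeta> unfolding S_def by (simp del: of_real_diff)
qed
lemma wirt_Q: "wirt S Q (\<lambda>\<zeta>. Q \<zeta> * Q \<zeta> * g1 \<zeta> * \<sigma> \<zeta>) (\<lambda>\<zeta>. Q \<zeta> * Q \<zeta> * g1 \<zeta> * cnj (\<sigma> \<zeta>))"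
  unfolding Q_def[abs_def]
  by (rule wirt_cong[OF wirt_inverse[OF wirt_diff[OF wirt_const[of _ 1] wirt_subset[OF wirt_gm S_sub]] gm_ne]]) simp_all

lemmas wirtS = wirt_P[THEN wirt_subset, OF S_sub] wirt_A[THEN wirt_subset, OF S_sub]
  wirt_b[THEN wirt_subset, OF S_sub] wirt_i[THEN wirt_subset, OF S_sub] wirt_g1[THEN wirt_subset, OF S_sub]
  wirt_PA[THEN wirt_subset, OF S_sub]

lemma wirt_W: "wirt S W (\<lambda>\<zeta>. W' \<zeta> * \<sigma> \<zeta>) (\<lambda>\<zeta>. W' \<zeta> * cnj (\<sigma> \<zeta>))"
proof -
  have "wirt S (\<lambda>\<zeta>. 1 / of_real m * (i \<zeta> * i \<zeta>) + Q \<zeta> * Q \<zeta> * g1 \<zeta>) (\<lambda>\<zeta>. W' \<zeta> * \<sigma> \<zeta>) (\<lambda>\<zeta>. W' \<zeta> * cnj (\<sigma> \<zeta>))"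
    by (rule wirt_cong[OF wirt_add[OF wirt_cmult[OF wirt_mult[OF wirtS(4,4)]] wirt_mult[OF wirt_mult[OF wirt_Q wirt_Q] wirtS(5)]]])
      (use m in \<open>simp_all add: W'_def field_simps\<close>)
  moreover have "(\<lambda>\<zeta>. 1 / of_real m * (i \<zeta> * i \<zeta>) + Q \<zeta> * Q \<zeta> * g1 \<zeta>) = W" by (simp add: fun_eq_iff W_def)
  ultimately show ?thesis by simp
qed

lemma S_reals:
  assumes "\<zeta> \<in> S"
  shows "cnj (P \<zeta>) = P \<zeta>" "cnj (W \<zeta>) = W \<zeta>" "cnj (Q \<zeta>) = Q \<zeta>"
proof -
  have \<zeta>: "\<zeta> \<in> U" using assms S_sub by auto
  have g: "cnj (gm \<zeta>) = gm \<zeta>" "cnj (j \<zeta>) = j \<zeta>" by (simp_all add: gm_real[OF \<zeta>] j_def cnj_E[OF \<zeta>])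
  then show "cnj (Q \<zeta>) = Q \<zeta>" by (simp add: Q_def)
  then show "cnj (W \<zeta>) = W \<zeta>" using g by (simp add: W_def g1_def cnj_i[OF \<zeta>])
  show "cnj (P \<zeta>) = P \<zeta>" by (simp add: P_def cnj_k[OF \<zeta>] cnj_i[OF \<zeta>])
qed

lemma PAz: "P \<zeta> * A \<zeta> * cnj (z \<zeta>) = \<sigma> \<zeta> * (i \<zeta> * i \<zeta>)"
  by (simp add: P_def \<sigma>_def mult_ac)

lemma wirt_h: "wirt S h hz (\<lambda>\<zeta>. cnj (hz \<zeta>))"
proof -
  have e1: "P \<zeta> * (l \<zeta> + 2 * \<sigma> \<zeta> * i \<zeta>) * (A \<zeta> * cnj (A \<zeta>)) + P \<zeta> * (e \<zeta> * cnj (A \<zeta>) + A \<zeta> * cnj (z \<zeta> * b \<zeta> / of_real m))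
      + (Q \<zeta> * Q \<zeta> * g1 \<zeta> * \<sigma> \<zeta> * b \<zeta> + Q \<zeta> * y \<zeta>) = hz \<zeta>" for \<zeta>
  proof -
    have "P \<zeta> * (A \<zeta> * cnj (z \<zeta> * b \<zeta> / of_real m)) = \<sigma> \<zeta> * (i \<zeta> * i \<zeta>) * b \<zeta> / of_real m"
      using PAz[of \<zeta>] by (simp add: cnj_b) (metis mult.assoc mult.commute)
    then show ?thesis by (simp add: hz_def u1_def W_def algebra_simps)
  qed
  have e2: "P \<zeta> * cnj (l \<zeta> + 2 * \<sigma> \<zeta> * i \<zeta>) * (A \<zeta> * cnj (A \<zeta>)) + P \<zeta> * (z \<zeta> * b \<zeta> / of_real m * cnj (A \<zeta>) + A \<zeta> * cnj (e \<zeta>))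
      + (Q \<zeta> * Q \<zeta> * g1 \<zeta> * cnj (\<sigma> \<zeta>) * b \<zeta> + Q \<zeta> * cnj (y \<zeta>)) = cnj (hz \<zeta>)" if "\<zeta> \<in> S" for \<zeta>
  proof -
    have \<zeta>: "\<zeta> \<in> U" using that S_sub by auto
    have "cnj (g1 \<zeta>) = g1 \<zeta>" by (simp add: g1_def gm_real[OF \<zeta>] j_def cnj_E[OF \<zeta>])
    then show ?thesis unfolding e1[symmetric] using S_reals[OF that] by (simp add: cnj_b algebra_simps)
  qed
  show ?thesis unfolding h_def[abs_def]
    by (rule wirt_cong[OF wirt_add[OF wirt_mult[OF wirtS(1) wirt_mult[OF wirtS(2) wirt_cnj[OF wirtS(2)]]] wirt_mult[OF wirt_Q wirtS(3)]]])
      (use e1 e2 in auto)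
qed

lemma wirt_hz: "\<exists>x. wirt S hz x H"
proof -
  obtain x1 x2 x3 where x: "wirt S u1 x1 u1b" "wirt S \<sigma> x2 \<sigma>b" "wirt S y x3 B"
    using wirt_u1 wirt_\<sigma> wirt_y wirt_subset[OF _ S_sub] by blast
  show ?thesis unfolding hz_def[abs_def]
    by (rule exI, rule wirt_cong[OF wirt_add[OF wirt_mult[OF wirtS(6) x(1)] wirt_add[OF wirt_mult[OF wirt_mult[OF wirtS(3) x(2)] wirt_W] wirt_mult[OF wirt_Q x(3)]]]])
      (rule refl, simp add: H_def algebra_simps)
qed

text \<open>This brings H into the shape expected by \<open>curvature_algebra\<close>: every
  coefficient is real on S, and y enters only through a sum of conjugates.\<close>

lemma H_alt:
  assumes "\<zeta> \<in> S"
  shows "H \<zeta> = P \<zeta> * (u1 \<zeta> * cnj (u1 \<zeta>)) + 2 * (P \<zeta> * (A \<zeta> * cnj (A \<zeta>)))\<^sup>2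
    + 2 / of_real m * (P \<zeta> * (A \<zeta> * cnj (A \<zeta>))) * b \<zeta> * ((1 + E \<zeta>) * i \<zeta>)
    + W \<zeta> * (cnj (\<sigma> \<zeta>) * y \<zeta> + \<sigma> \<zeta> * cnj (y \<zeta>))
    + b \<zeta> * k \<zeta> * (A \<zeta> * cnj (A \<zeta>)) * (W \<zeta> + E \<zeta> * W' \<zeta>) + E \<zeta> * W \<zeta> * (b \<zeta>)\<^sup>2 / of_real m + Q \<zeta> * B \<zeta>"
proof -
  have \<zeta>: "\<zeta> \<in> U" using assms S_sub by auto
  have s: "\<sigma> \<zeta> * cnj (\<sigma> \<zeta>) = E \<zeta> * k \<zeta> * (A \<zeta> * cnj (A \<zeta>))"
    by (simp add: \<sigma>_def E_def cnj_k[OF \<zeta>] mult_ac)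
  have "b \<zeta> * \<sigma> \<zeta> * (W' \<zeta> * cnj (\<sigma> \<zeta>)) = b \<zeta> * W' \<zeta> * (\<sigma> \<zeta> * cnj (\<sigma> \<zeta>))" by (simp add: mult_ac)
  then have e3: "b \<zeta> * \<sigma> \<zeta> * (W' \<zeta> * cnj (\<sigma> \<zeta>)) = b \<zeta> * W' \<zeta> * (E \<zeta> * k \<zeta> * (A \<zeta> * cnj (A \<zeta>)))" unfolding s .
  have e4: "cnj (\<sigma> \<zeta>) * y \<zeta> * (i \<zeta> * i \<zeta>) / of_real m + Q \<zeta> * Q \<zeta> * g1 \<zeta> * cnj (\<sigma> \<zeta>) * y \<zeta> = W \<zeta> * (cnj (\<sigma> \<zeta>) * y \<zeta>)"
    by (simp add: W_def algebra_simps)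
  show ?thesis unfolding H_def APu1b[OF \<zeta>] e3 using e4 by (simp add: \<sigma>b_def algebra_simps power2_eq_square)
qed

end

section \<open>The restricted Wu metric without regularization\<close>

context egg_curve
begin

definition h0 where "h0 \<zeta> = restricted_metric (egg_wu \<iota> m) \<phi> \<zeta>"
definition Q0 where "Q0 \<zeta> = 1 / (1 - Re (E \<zeta>) powr m)"
definition P' where "P' \<zeta> = Re (P \<zeta>)"

lemma P_real: "\<zeta> \<in> U \<Longrightarrow> P \<zeta> = of_real (normal_coeff \<iota> m (\<phi> \<zeta>))"
  unfolding P_def k_real i_eq normal_coeff_alt(1)[OF m(1) mem]
  by (simp add: E_real power2_eq_square)

lemma E_powr: "\<zeta> \<in> U \<Longrightarrow> Re (E \<zeta>) powr m = cmod (\<phi> \<zeta> $ \<iota>) powr (2 * m) / gap \<iota> (\<phi> \<zeta>)"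
proof -
  assume \<zeta>: "\<zeta> \<in> U"
  have "Re (E \<zeta>) powr m = ((cmod (\<phi> \<zeta> $ \<iota>))\<^sup>2) powr m * (gap \<iota> (\<phi> \<zeta>) powr (- 1 / m)) powr m"
    unfolding E_real[OF \<zeta>] Re_complex_of_real by (simp add: powr_mult)
  also have "(gap \<iota> (\<phi> \<zeta>) powr (- 1 / m)) powr m = gap \<iota> (\<phi> \<zeta>) powr (- 1)"
    using m by (simp only: powr_powr) simp
  also have "\<dots> = 1 / gap \<iota> (\<phi> \<zeta>)" using egg_facts(1)[OF m(1) mem[OF \<zeta>]] by (simp add: powr_minus_divide)
  finally show ?thesis by (simp add: powr_double)
qed

lemma E_powr_less: "\<zeta> \<in> U \<Longrightarrow> Re (E \<zeta>) powr m < 1"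
  by (rule powr_less_one_of[OF E_bounds(1,2) m(1)])

lemma Q0_eq: "\<zeta> \<in> U \<Longrightarrow> Q0 \<zeta> = tangent_coeff \<iota> m (\<phi> \<zeta>)"
proof -
  assume \<zeta>: "\<zeta> \<in> U"
  note egg_facts(1,3)[OF m(1) mem[OF \<zeta>]]
  then show ?thesis unfolding Q0_def tangent_coeff_def E_powr[OF \<zeta>] by (simp add: field_simps)
qed

lemma h0_eq:
  assumes \<zeta>: "\<zeta> \<in> U"
  shows "h0 \<zeta> = P' \<zeta> * (cmod (A \<zeta>))\<^sup>2 + Q0 \<zeta> * Re (b \<zeta>)"
proof -
  let ?v = "vec_deriv \<phi> \<zeta>"
  have vi: "?v $ i = w1 i \<zeta>" for i by (simp add: vec_deriv_def w1_def w_def[abs_def])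
  have 1: "hprod \<iota> ?v (\<phi> \<zeta>) = c \<zeta>" by (simp add: hprod_def c_def vi w_def)
  have 2: "conn_form \<iota> m (\<phi> \<zeta>) ?v = A \<zeta>"
    unfolding conn_form_def 1 by (simp add: vi A_def z1_def z_def l_def r_def s_gap w_def divide_inverse mult_ac)
  have "b \<zeta> = of_real ((\<Sum>i\<in>UNIV - {\<iota>}. (cmod (?v $ i))\<^sup>2) / gap \<iota> (\<phi> \<zeta>) + (cmod (hprod \<iota> ?v (\<phi> \<zeta>)))\<^sup>2 / (gap \<iota> (\<phi> \<zeta>))\<^sup>2)"
    unfolding 1 b_def N_def r_def s_gap vi complex_norm_square[symmetric] by (simp add: divide_inverse power2_eq_square)
  then have 3: "Re (b \<zeta>) = (\<Sum>i\<in>UNIV - {\<iota>}. (cmod (?v $ i))\<^sup>2) / gap \<iota> (\<phi> \<zeta>) + (cmod (hprod \<iota> ?v (\<phi> \<zeta>)))\<^sup>2 / (gap \<iota> (\<phi> \<zeta>))\<^sup>2"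
    by (simp only: Re_complex_of_real)
  show ?thesis unfolding h0_def restricted_metric_def Re_herm_egg_wu 2 3[symmetric] P'_def P_real[OF \<zeta>] Q0_eq[OF \<zeta>] by simp
qed

lemma continuous_parts: "continuous_on U P'" "continuous_on U A" "continuous_on U (\<lambda>\<zeta>. Re (b \<zeta>))" "continuous_on U (\<lambda>\<zeta>. Re (E \<zeta>))"
  using wirt_cont[OF wirt_P] wirt_cont[OF wirt_A] wirt_cont[OF wirt_b] wirt_cont[OF wirt_E]
  by (auto simp: P'_def intro!: continuous_intros)

lemma continuous_Epowr: "continuous_on U (\<lambda>\<zeta>. Re (E \<zeta>) powr m)"
  using m E_bounds by (intro continuous_on_powr' continuous_parts continuous_on_const) auto

lemma continuous_h0: "continuous_on U h0"
proof -
  have "continuous_on U (\<lambda>\<zeta>. P' \<zeta> * (cmod (A \<zeta>))\<^sup>2 + 1 / (1 - Re (E \<zeta>) powr m) * Re (b \<zeta>))"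
    using E_powr_less by (intro continuous_intros continuous_parts continuous_Epowr) force+
  then show ?thesis using h0_eq by (simp add: Q0_def cong: continuous_on_cong)
qed

lemma h0_pos: "\<zeta> \<in> U \<Longrightarrow> vec_deriv \<phi> \<zeta> \<noteq> 0 \<Longrightarrow> h0 \<zeta> > 0"
  using hermitian_inner_product_egg_wu[OF m(1) mem] unfolding h0_def restricted_metric_def hermitian_inner_product_def by blast

end

text \<open>As m < 1, the power m - 1 is decreasing, so each of the two shares of (a + b)^m grows
  when its own base is used. The regularization error is thus at most \<epsilon>^m, uniformly down
  to E = 0.\<close>

lemma powr_add_le:
  fixes a b m :: real
  assumes "0 \<le> a" "0 < b" "0 < m" "m < 1"
  shows "(a + b) powr m \<le> a powr m + b powr m"
proof (cases "a = 0")
  case False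
  then have a: "a > 0" using assms by simp
  have e: "x powr m = x * x powr (m - 1)" if "x > 0" for x :: real using that by (simp add: powr_diff)
  have "(a + b) powr m = a * (a + b) powr (m - 1) + b * (a + b) powr (m - 1)"
    using e[of "a + b"] a assms by (simp add: distrib_right)
  also have "\<dots> \<le> a * a powr (m - 1) + b * b powr (m - 1)"
    using a assms by (intro add_mono mult_left_mono powr_mono2') auto
  finally show ?thesis using e a assms by simp
qed simp

section \<open>Curvature of the regularized metric\<close>

context egg_curve_reg
begin

definition Q' where "Q' \<zeta> = 1 / (1 - (Re (E \<zeta>) + \<epsilon>) powr m)"

lemma Q_real: "\<zeta> \<in> U \<Longrightarrow> Q \<zeta> = of_real (Q' \<zeta>)"
  by (simp add: Q_def Q'_def gm_real inverse_eq_divide)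

lemma h_real: "\<zeta> \<in> U \<Longrightarrow> h \<zeta> = of_real (P' \<zeta> * (cmod (A \<zeta>))\<^sup>2 + Q' \<zeta> * Re (b \<zeta>))"
  unfolding h_def P'_def complex_norm_square[symmetric] Q_real by (subst b_real) (simp add: P_real)

text \<open>On S all coefficients are real, so the complex formulas for h, hz and H translate into
  the real quantities of \<open>curvature_algebra\<close>. Its two scalar hypotheses come from
  \<open>curvature_coefficients\<close>, and the one on y and B is \<open>B_ineq\<close>.\<close>

lemma curvature_point:
  assumes S: "\<zeta> \<in> S" and small: "Q' \<zeta> - Q0 \<zeta> \<le> 1/4" "Q' \<zeta> * \<epsilon> powr m \<le> 1"
  shows "Re (h \<zeta>) ^ 3 \<le> Re (H \<zeta>) * Re (h \<zeta>) - (cmod (hz \<zeta>))\<^sup>2"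
proof -
  have \<zeta>: "\<zeta> \<in> U" and g: "(Re (E \<zeta>) + \<epsilon>) powr m < 1" using S by (auto simp: S_def)
  define e0 where "e0 = Re (E \<zeta>)"
  have e0: "0 \<le> e0" "e0 < 1" and E: "E \<zeta> = of_real e0" using E_bounds[OF \<zeta>] by (auto simp: e0_def)
  define k' where "k' = gap \<iota> (\<phi> \<zeta>) powr (- 1 / m)"
  define i' where "i' = 1 / (1 - e0)"
  define g' where "g' = m * (e0 + \<epsilon>) powr m / (e0 + \<epsilon>)"
  define g'' where "g'' = (m - 1) * g' / (e0 + \<epsilon>)"
  define w' where "w' = i'\<^sup>2 / m + (Q' \<zeta>)\<^sup>2 * g'"
  define w'' where "w'' = 2 * i' ^ 3 / m + 2 * (Q' \<zeta>) ^ 3 * g'\<^sup>2 + (Q' \<zeta>)\<^sup>2 * g''"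
  have k: "k \<zeta> = of_real k'" by (simp add: k_real[OF \<zeta>] k'_def)
  have i: "i \<zeta> = of_real i'" by (simp add: i_eq[OF \<zeta>] i'_def e0_def)
  have Pr: "P \<zeta> = of_real (k' * i'\<^sup>2)" by (simp add: P_def k i power2_eq_square)
  have j: "j \<zeta> = of_real (1 / (e0 + \<epsilon>))" by (simp add: j_def E inverse_eq_divide)
  have g1: "g1 \<zeta> = of_real g'" by (simp add: g1_def gm_real[OF \<zeta>] j g'_def e0_def)
  have g2: "g2 \<zeta> = of_real g''" by (simp add: g2_def g1 j g''_def)
  have Wr: "W \<zeta> = of_real w'" by (simp add: W_def i Q_real[OF \<zeta>] g1 w'_def power2_eq_square)
  have W'r: "W' \<zeta> = of_real w''" by (simp add: W'_def i Q_real[OF \<zeta>] g1 g2 w''_def power2_eq_square power3_eq_cube mult_ac)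
  have br: "b \<zeta> = of_real (Re (b \<zeta>))" and Br: "B \<zeta> = of_real (Re (B \<zeta>))" by (rule b_real B_real)+
  have cc: "a * cnj a = of_real ((cmod a)\<^sup>2)" for a by (rule complex_norm_square[symmetric])
  have sy: "cnj (\<sigma> \<zeta>) * y \<zeta> + \<sigma> \<zeta> * cnj (y \<zeta>) = of_real (2 * Re (cnj (\<sigma> \<zeta>) * y \<zeta>))"
    by (simp add: complex_eq_iff)
  note coeffs = curvature_coefficients[OF m e0 \<epsilon>, folded e0_def, OF g[folded e0_def], folded Q'_def[of \<zeta>, folded e0_def] Q0_def[of \<zeta>, folded e0_def], OF small, folded i'_def g'_def, folded g''_def w'_def w''_def]
  have "(k' * i'\<^sup>2 * (cmod (A \<zeta>))\<^sup>2 + Q' \<zeta> * Re (b \<zeta>)) ^ 3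
    \<le> (k' * i'\<^sup>2 * (cmod (u1 \<zeta>))\<^sup>2 + 2 * (k' * i'\<^sup>2 * (cmod (A \<zeta>))\<^sup>2)\<^sup>2 + 2 / m * (k' * i'\<^sup>2 * (cmod (A \<zeta>))\<^sup>2) * Re (b \<zeta>) * ((1 + e0) * i')
       + 2 * w' * Re (cnj (\<sigma> \<zeta>) * y \<zeta>) + Re (b \<zeta>) * k' * (cmod (A \<zeta>))\<^sup>2 * (w' + e0 * w'') + e0 * w' * (Re (b \<zeta>))\<^sup>2 / m + Q' \<zeta> * Re (B \<zeta>))
       * (k' * i'\<^sup>2 * (cmod (A \<zeta>))\<^sup>2 + Q' \<zeta> * Re (b \<zeta>))
      - (cmod (cnj (A \<zeta>) * of_real (k' * i'\<^sup>2) * u1 \<zeta> + of_real (Re (b \<zeta>)) * \<sigma> \<zeta> * of_real w' + of_real (Q' \<zeta>) * y \<zeta>))\<^sup>2"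
  proof (rule curvature_algebra[OF refl, where E = e0 and W' = w'' and B = "Re (B \<zeta>)"])
    show "0 \<le> k' * i'\<^sup>2" "i' \<noteq> 0" using e0 by (auto simp: k'_def i'_def)
    show "0 < Q' \<zeta>" using g by (simp add: Q'_def)
    show "0 \<le> Re (b \<zeta>)" by (rule b_nonneg[OF \<zeta>])
    have "of_real ((cmod (\<sigma> \<zeta>))\<^sup>2) = (of_real (e0 * k' * (cmod (A \<zeta>))\<^sup>2) :: complex)"
      unfolding of_real_mult of_real_diff complex_norm_square by (simp add: \<sigma>_def E[symmetric] E_def k cnj_k[OF \<zeta>] mult_ac)
    then show "(cmod (\<sigma> \<zeta>))\<^sup>2 = e0 * k' * (cmod (A \<zeta>))\<^sup>2" by (simp only: of_real_eq_iff)
    show "(cmod (y \<zeta>))\<^sup>2 + 2 * Re (b \<zeta>) ^ 3 \<le> Re (B \<zeta>) * Re (b \<zeta>)" by (rule B_ineq[OF \<zeta>])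
    show "0 \<le> Re (B \<zeta>)" using B_nonneg[OF \<zeta>] zero_le_power2[of "Re (b \<zeta>)"] by linarith
    show "2 * Q' \<zeta> \<le> 2 / m * ((1 + e0) * i') + (w' + e0 * w'') / i'\<^sup>2 - e0 * w'\<^sup>2 / (i'\<^sup>2 * Q' \<zeta>)"
      unfolding w''_def by (rule coeffs(1))
    show "(Q' \<zeta>)\<^sup>2 \<le> e0 * w' / m + 2 * Q' \<zeta>" by (rule coeffs(2))
  qed
  moreover have "Re (h \<zeta>) = k' * i'\<^sup>2 * (cmod (A \<zeta>))\<^sup>2 + Q' \<zeta> * Re (b \<zeta>)"
    unfolding h_real[OF \<zeta>] Re_complex_of_real P'_def Pr ..
  moreover have "H \<zeta> = of_real (k' * i'\<^sup>2 * (cmod (u1 \<zeta>))\<^sup>2 + 2 * (k' * i'\<^sup>2 * (cmod (A \<zeta>))\<^sup>2)\<^sup>2 + 2 / m * (k' * i'\<^sup>2 * (cmod (A \<zeta>))\<^sup>2) * Re (b \<zeta>) * ((1 + e0) * i')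
       + 2 * w' * Re (cnj (\<sigma> \<zeta>) * y \<zeta>) + Re (b \<zeta>) * k' * (cmod (A \<zeta>))\<^sup>2 * (w' + e0 * w'') + e0 * w' * (Re (b \<zeta>))\<^sup>2 / m + Q' \<zeta> * Re (B \<zeta>))"
    unfolding H_alt[OF S] sy cc Pr Wr W'r i k E Q_real[OF \<zeta>] by (subst (1 2 3) br, subst Br) (simp add: mult_ac)
  then have "Re (H \<zeta>) = k' * i'\<^sup>2 * (cmod (u1 \<zeta>))\<^sup>2 + 2 * (k' * i'\<^sup>2 * (cmod (A \<zeta>))\<^sup>2)\<^sup>2 + 2 / m * (k' * i'\<^sup>2 * (cmod (A \<zeta>))\<^sup>2) * Re (b \<zeta>) * ((1 + e0) * i')
       + 2 * w' * Re (cnj (\<sigma> \<zeta>) * y \<zeta>) + Re (b \<zeta>) * k' * (cmod (A \<zeta>))\<^sup>2 * (w' + e0 * w'') + e0 * w' * (Re (b \<zeta>))\<^sup>2 / m + Q' \<zeta> * Re (B \<zeta>)"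
    by (simp only: Re_complex_of_real)
  moreover have "hz \<zeta> = cnj (A \<zeta>) * of_real (k' * i'\<^sup>2) * u1 \<zeta> + of_real (Re (b \<zeta>)) * \<sigma> \<zeta> * of_real w' + of_real (Q' \<zeta>) * y \<zeta>"
    unfolding hz_def Pr Wr Q_real[OF \<zeta>] by (subst br) simp
  ultimately show ?thesis by (simp only:)
qed

text \<open>Integration by parts against \<open>\<rho>\<close>, for the regularized metric.\<close>

lemma regularized_current:
  assumes \<rho>: "wirt UNIV (\<lambda>\<zeta>. of_real (\<rho> \<zeta>)) r1 r2" "wirt UNIV r2 r21 r22"
    and K: "compact K" "K \<subseteq> S" "\<And>\<zeta>. \<zeta> \<notin> K \<Longrightarrow> \<rho> \<zeta> = (0::real)" "\<And>\<zeta>. \<rho> \<zeta> \<ge> 0"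
    and pos: "\<And>\<zeta>. \<zeta> \<in> U \<Longrightarrow> h0 \<zeta> > 0"
    and small: "\<And>\<zeta>. \<zeta> \<in> K \<Longrightarrow> Q' \<zeta> - Q0 \<zeta> \<le> 1/4" "\<And>\<zeta>. \<zeta> \<in> K \<Longrightarrow> Q' \<zeta> * \<epsilon> powr m \<le> 1"
  shows "(LINT \<zeta>|lborel. \<rho> \<zeta> * h0 \<zeta>) \<le> (LINT \<zeta>|lborel. indicator K \<zeta> *\<^sub>R (ln (P' \<zeta> * (cmod (A \<zeta>))\<^sup>2 + Q' \<zeta> * Re (b \<zeta>)) * Re (r21 \<zeta>)))"
proof -
  have Qge: "Q0 \<zeta> \<le> Q' \<zeta>" if "\<zeta> \<in> S" for \<zeta>
  proof -
    have \<zeta>: "\<zeta> \<in> U" "(Re (E \<zeta>) + \<epsilon>) powr m < 1" using that by (auto simp: S_def)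
    have "Re (E \<zeta>) powr m \<le> (Re (E \<zeta>) + \<epsilon>) powr m" using E_bounds[OF \<zeta>(1)] \<epsilon> m by (intro powr_mono2) auto
    then show ?thesis unfolding Q0_def Q'_def using \<zeta> E_powr_less[OF \<zeta>(1)] by (intro divide_left_mono) auto
  qed
  have hge: "h0 \<zeta> \<le> Re (h \<zeta>)" if "\<zeta> \<in> S" for \<zeta>
  proof -
    have \<zeta>: "\<zeta> \<in> U" using that S_sub by auto
    show ?thesis unfolding h_real[OF \<zeta>] h0_eq[OF \<zeta>] Re_complex_of_real
      using mult_right_mono[OF Qge[OF that] b_nonneg[OF \<zeta>]] by simp
  qed
  have hpos: "Re (h \<zeta>) > 0" if "\<zeta> \<in> S" for \<zeta> using hge[OF that] pos[of \<zeta>] that S_sub by fastforce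
  have hre: "h \<zeta> = of_real (Re (h \<zeta>))" if "\<zeta> \<in> S" for \<zeta>
  proof -
    have "\<zeta> \<in> U" using that S_sub by auto
    from h_real[OF this] show ?thesis by (simp only: Re_complex_of_real)
  qed
  have Lnh: "Ln holomorphic_on {w. Re w > 0}" by (intro holomorphic_on_Ln) (auto simp: complex_nonpos_Reals_iff)
  have dLn: "deriv Ln w = inverse w" if "Re w > 0" for w
    using that by (intro DERIV_imp_deriv has_field_derivative_Ln) (auto simp: complex_nonpos_Reals_iff)
  have h0': "h \<zeta> \<noteq> 0" if "\<zeta> \<in> S" for \<zeta> using hpos[OF that] by auto
  obtain x where x: "wirt S hz x H" using wirt_hz by blast
  have v: "wirt S (\<lambda>\<zeta>. Ln (h \<zeta>)) (\<lambda>\<zeta>. hz \<zeta> * inverse (h \<zeta>)) (\<lambda>\<zeta>. cnj (hz \<zeta>) * inverse (h \<zeta>))"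
    by (rule wirt_cong[OF wirt_chain[OF wirt_h Lnh open_halfspace_Re_gt]]) (use hpos dLn in auto)
  have v1: "wirt S (\<lambda>\<zeta>. hz \<zeta> * inverse (h \<zeta>)) (\<lambda>\<zeta>. x \<zeta> * inverse (h \<zeta>) + hz \<zeta> * (- (inverse (h \<zeta>) * inverse (h \<zeta>)) * hz \<zeta>))
     (\<lambda>\<zeta>. H \<zeta> * inverse (h \<zeta>) + hz \<zeta> * (- (inverse (h \<zeta>) * inverse (h \<zeta>)) * cnj (hz \<zeta>)))"
    by (rule wirt_mult[OF x wirt_inverse[OF wirt_h h0']])
  let ?v12 = "\<lambda>\<zeta>. H \<zeta> * inverse (h \<zeta>) + hz \<zeta> * (- (inverse (h \<zeta>) * inverse (h \<zeta>)) * cnj (hz \<zeta>))"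
  have K3: "\<And>\<zeta>. \<zeta> \<notin> K \<Longrightarrow> complex_of_real (\<rho> \<zeta>) = 0" using K(3) by simp
  have ibp: "(LINT \<zeta>|lborel. Ln (h \<zeta>) * r21 \<zeta>) = (LINT \<zeta>|lborel. of_real (\<rho> \<zeta>) * ?v12 \<zeta>)"
    "integrable lborel (\<lambda>\<zeta>. Ln (h \<zeta>) * r21 \<zeta>)" "integrable lborel (\<lambda>\<zeta>. of_real (\<rho> \<zeta>) * ?v12 \<zeta>)"
    by (rule wirt_integration_by_parts[OF open_S v v1 \<rho> K(1,2)], rule K3, assumption)+
  \<comment> \<open>The mixed derivative of Ln h is (H h - |hz|^2) / h^2, at least h by
    \<open>curvature_point\<close>; and h is at least h0, because the regularization only enlarges
    the tangential coefficient.\<close>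
  have ineq: "h0 \<zeta> \<le> Re (?v12 \<zeta>)" if "\<zeta> \<in> K" for \<zeta>
  proof -
    have S: "\<zeta> \<in> S" using that K(2) by auto
    let ?h = "Re (h \<zeta>)"
    have "?v12 \<zeta> = H \<zeta> * inverse (h \<zeta>) - hz \<zeta> * cnj (hz \<zeta>) * (inverse (h \<zeta>) * inverse (h \<zeta>))"
      by (simp add: algebra_simps)
    also have "\<dots> = H \<zeta> * of_real (1 / ?h) - of_real ((cmod (hz \<zeta>))\<^sup>2) * (of_real (1 / ?h) * of_real (1 / ?h))"
      by (subst (1 2 3) hre[OF S]) (simp only: complex_norm_square[symmetric] inverse_eq_divide of_real_divide of_real_1)
    finally have "Re (?v12 \<zeta>) = (Re (H \<zeta>) * ?h - (cmod (hz \<zeta>))\<^sup>2) / (?h * ?h)"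
      using hpos[OF S] by (simp add: diff_divide_distrib)
    also have "\<dots> \<ge> ?h ^ 3 / (?h * ?h)"
      using curvature_point[OF S small[OF that]] hpos[OF S] by (intro divide_right_mono) auto
    finally have "?h \<le> Re (?v12 \<zeta>)" using hpos[OF S] by (simp add: power3_eq_cube)
    then show ?thesis using hge[OF S] by simp
  qed
  have r21: "r21 \<zeta> = 0" if "\<zeta> \<notin> K" for \<zeta>
  proof -
    have oK: "open (- K)" using K(1) by (simp add: compact_imp_closed open_Compl)
    have "r2 \<zeta> = 0" if "\<zeta> \<notin> K" for \<zeta>
      using wirt_unique(2)[OF wirt_subset[OF \<rho>(1)] wirt_cong_fun[OF wirt_const[of _ 0] oK], of \<zeta>] K3 that by auto
    then show ?thesis
      using wirt_unique(1)[OF wirt_subset[OF \<rho>(2)] wirt_cong_fun[OF wirt_const[of _ 0] oK], of \<zeta>] that by auto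
  qed
  have int0: "integrable lborel (\<lambda>\<zeta>. \<rho> \<zeta> * h0 \<zeta>)"
  proof (rule integrable_compact_support[OF _ K(1)])
    have "continuous_on UNIV (\<lambda>\<zeta>. Re (of_real (\<rho> \<zeta>)))" by (intro continuous_intros wirt_cont[OF \<rho>(1)])
    then show "continuous_on U (\<lambda>\<zeta>. \<rho> \<zeta> * h0 \<zeta>)"
      using continuous_on_subset by (auto intro!: continuous_intros continuous_h0)
  qed (use K S_sub in auto)
  have "(LINT \<zeta>|lborel. \<rho> \<zeta> * h0 \<zeta>) \<le> (LINT \<zeta>|lborel. Re (of_real (\<rho> \<zeta>) * ?v12 \<zeta>))"
  proof (rule integral_mono[OF int0])
    show "integrable lborel (\<lambda>\<zeta>. Re (of_real (\<rho> \<zeta>) * ?v12 \<zeta>))" by (rule integrable_Re[OF ibp(3)])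
    show "\<rho> \<zeta> * h0 \<zeta> \<le> Re (of_real (\<rho> \<zeta>) * ?v12 \<zeta>)" for \<zeta>
    proof (cases "\<zeta> \<in> K")
      case True
      have "Re (of_real a * w) = a * Re w" for a w by simp
      then show ?thesis using mult_left_mono[OF ineq[OF True] K(4)] by (simp only:)
    qed (simp add: K(3))
  qed
  also have "\<dots> = Re (LINT \<zeta>|lborel. Ln (h \<zeta>) * r21 \<zeta>)"
    unfolding ibp(1) by (rule integral_Re[OF ibp(3)])
  also have "\<dots> = (LINT \<zeta>|lborel. Re (Ln (h \<zeta>) * r21 \<zeta>))" by (rule integral_Re[OF ibp(2), symmetric])
  also have "\<dots> = (LINT \<zeta>|lborel. indicator K \<zeta> *\<^sub>R (ln (P' \<zeta> * (cmod (A \<zeta>))\<^sup>2 + Q' \<zeta> * Re (b \<zeta>)) * Re (r21 \<zeta>)))"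
  proof (rule Bochner_Integration.integral_cong[OF refl])
    fix \<zeta>
    show "Re (Ln (h \<zeta>) * r21 \<zeta>) = indicator K \<zeta> *\<^sub>R (ln (P' \<zeta> * (cmod (A \<zeta>))\<^sup>2 + Q' \<zeta> * Re (b \<zeta>)) * Re (r21 \<zeta>))"
    proof (cases "\<zeta> \<in> K")
      case True
      then have S: "\<zeta> \<in> S" and U: "\<zeta> \<in> U" using K(2) S_sub by auto
      have "Ln (h \<zeta>) = of_real (ln (Re (h \<zeta>)))" by (subst hre[OF S]) (rule Ln_of_real[OF hpos[OF S]])
      then show ?thesis using True h_real[OF U] by simp
    qed (simp add: r21)
  qed
  finally show ?thesis .
qed

end

text \<open>The regularized inequalities already have the true metric on the left, so only the
  logarithm on the right has to converge. On the compact set K the quantity \<open>E powr m\<close>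
  stays away from 1, which makes the regularized coefficient converge uniformly there. Points where
  the curve meets Z, or a curve inside Z, are covered by the same limit.\<close>

theorem curvature_current_egg_wu:
  assumes egg: "egg_curve \<iota> m U \<phi>" and nz: "\<And>\<zeta>. \<zeta> \<in> U \<Longrightarrow> vec_deriv \<phi> \<zeta> \<noteq> 0"
    and \<rho>: "wirt UNIV (\<lambda>\<zeta>. of_real (\<rho> \<zeta>)) r1 r2" "wirt UNIV r2 r21 r22"
    and K: "compact K" "K \<subseteq> U" "\<And>\<zeta>. \<zeta> \<notin> K \<Longrightarrow> \<rho> \<zeta> = (0::real)" "\<And>\<zeta>. \<rho> \<zeta> \<ge> 0"
  shows "(LINT \<zeta>|lborel. \<rho> \<zeta> * restricted_metric (egg_wu \<iota> m) \<phi> \<zeta>)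
    \<le> (LINT \<zeta>|lborel. indicator K \<zeta> *\<^sub>R (ln (restricted_metric (egg_wu \<iota> m) \<phi> \<zeta>) * Re (r21 \<zeta>)))"
proof -
  interpret egg_curve \<iota> m U \<phi> by (rule egg)
  have pos: "\<zeta> \<in> U \<Longrightarrow> h0 \<zeta> > 0" for \<zeta> using h0_pos nz by blast
  obtain \<delta> where \<delta>: "0 < \<delta>" "\<delta> \<le> 1" "\<And>\<zeta>. \<zeta> \<in> K \<Longrightarrow> Re (E \<zeta>) powr m \<le> 1 - \<delta>"
  proof (cases "K = {}")
    case True
    then show ?thesis using that[of 1] by simp
  next
    case False
    obtain \<zeta>0 where "\<zeta>0 \<in> K" "\<And>\<zeta>. \<zeta> \<in> K \<Longrightarrow> Re (E \<zeta>) powr m \<le> Re (E \<zeta>0) powr m"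
      using continuous_attains_sup[OF K(1) False continuous_on_subset[OF continuous_Epowr K(2)]] by auto
    moreover have "Re (E \<zeta>0) powr m < 1" using E_powr_less[of \<zeta>0] \<open>\<zeta>0 \<in> K\<close> K(2) by auto
    ultimately show ?thesis using that[of "1 - Re (E \<zeta>0) powr m"] by simp
  qed
  \<comment> \<open>The future value of \<epsilon>^m. The bound \<delta>^2 / 8 keeps (E +
    \<epsilon>)^m below 1 - \<delta> / 2 and yields the smallness conditions: the coefficients
    differ by at most 2 \<eta> / \<delta>^2 \<le> 1/4, and Q' \<epsilon>^m \<le> (2 / \<delta>)
    \<eta> \<le> 1.\<close>
  define \<eta> where "\<eta> n = \<delta>\<^sup>2 / 8 * inverse (real (Suc n))" for n
  have \<eta>: "0 < \<eta> n" "\<eta> n \<le> \<delta>\<^sup>2 / 8" for n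
    using \<delta> by (auto simp: \<eta>_def field_simps)
  have \<eta>0: "\<eta> \<longlonglongrightarrow> 0" unfolding \<eta>_def using tendsto_mult_right_zero[OF LIMSEQ_inverse_real_of_nat] .
  define \<epsilon> where "\<epsilon> n = \<eta> n powr (1/m)" for n
  have \<epsilon>: "0 < \<epsilon> n" "\<epsilon> n powr m = \<eta> n" for n using \<eta>(1)[of n] m by (simp_all add: \<epsilon>_def powr_powr)
  define q where "q n \<zeta> = 1 / (1 - (Re (E \<zeta>) + \<epsilon> n) powr m)" for n \<zeta>
  have d2: "\<delta>\<^sup>2 \<le> \<delta>" using \<delta> by (simp add: power2_eq_square mult_left_le)
  have gle: "(Re (E \<zeta>) + \<epsilon> n) powr m \<le> Re (E \<zeta>) powr m + \<eta> n" "Re (E \<zeta>) powr m \<le> (Re (E \<zeta>) + \<epsilon> n) powr m" if "\<zeta> \<in> K" for n \<zeta>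
    using powr_add_le[OF E_bounds(1)[of \<zeta>] \<epsilon>(1) m, of n] that K(2) E_bounds(1)[of \<zeta>] \<epsilon>(1)[of n] m
    by (auto simp: \<epsilon>(2) intro!: powr_mono2)
  have gup: "(Re (E \<zeta>) + \<epsilon> n) powr m \<le> 1 - \<delta> / 2" if "\<zeta> \<in> K" for n \<zeta>
  proof -
    have "(Re (E \<zeta>) + \<epsilon> n) powr m \<le> (1 - \<delta>) + \<delta>\<^sup>2 / 8" using gle(1)[OF that, of n] \<delta>(3)[OF that] \<eta>(2)[of n] by linarith
    then show ?thesis using d2 \<delta> by linarith
  qed
  have qle: "q n \<zeta> \<le> 2 / \<delta>" "0 < q n \<zeta>" if "\<zeta> \<in> K" for n \<zeta>
  proof -
    have "1 - (Re (E \<zeta>) + \<epsilon> n) powr m \<ge> \<delta> / 2" using gup[OF that, of n] by simp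
    then show "q n \<zeta> \<le> 2 / \<delta>" "0 < q n \<zeta>" using \<delta>(1) unfolding q_def
      by (simp_all add: field_simps)
  qed
  have Q0le: "Q0 \<zeta> \<le> 1 / \<delta>" "0 < Q0 \<zeta>" if "\<zeta> \<in> K" for \<zeta>
    using \<delta>(3)[OF that] \<delta>(1) unfolding Q0_def by (simp_all add: field_simps)
  have qdiff: "q n \<zeta> - Q0 \<zeta> \<le> 2 / \<delta>\<^sup>2 * \<eta> n" "Q0 \<zeta> \<le> q n \<zeta>" if "\<zeta> \<in> K" for n \<zeta>
  proof -
    let ?g = "(Re (E \<zeta>) + \<epsilon> n) powr m" and ?M = "Re (E \<zeta>) powr m"
    have ne: "1 - ?g > 0" "1 - ?M > 0" using gup[OF that, of n] \<delta>(3)[OF that] \<delta>(1) by linarith+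
    have e: "q n \<zeta> - Q0 \<zeta> = (?g - ?M) * (q n \<zeta> * Q0 \<zeta>)" using ne by (simp add: q_def Q0_def field_simps)
    also have "\<dots> \<le> \<eta> n * (2 / \<delta> * (1 / \<delta>))"
      using gle[OF that, of n] qle[OF that, of n] Q0le[OF that] \<eta>(1)[of n] \<delta>(1) by (intro mult_mono) auto
    finally show "q n \<zeta> - Q0 \<zeta> \<le> 2 / \<delta>\<^sup>2 * \<eta> n" by (simp add: power2_eq_square field_simps)
    have "(?g - ?M) * (q n \<zeta> * Q0 \<zeta>) \<ge> 0"
      using gle[OF that, of n] qle[OF that, of n] Q0le[OF that] by (intro mult_nonneg_nonneg) auto
    then show "Q0 \<zeta> \<le> q n \<zeta>" using e by simp
  qed
  have qsmall: "q n \<zeta> - Q0 \<zeta> \<le> 1/4" "q n \<zeta> * \<epsilon> n powr m \<le> 1" if "\<zeta> \<in> K" for n \<zeta>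
  proof -
    have "2 / \<delta>\<^sup>2 * \<eta> n \<le> 2 / \<delta>\<^sup>2 * (\<delta>\<^sup>2 / 8)" using \<eta>(2)[of n] by (intro mult_left_mono) auto
    moreover have "2 / \<delta>\<^sup>2 * (\<delta>\<^sup>2 / 8) = 1 / 4" using \<delta>(1) by simp
    ultimately show "q n \<zeta> - Q0 \<zeta> \<le> 1/4" using qdiff(1)[OF that, of n] by linarith
    have "q n \<zeta> * \<eta> n \<le> 2 / \<delta> * (\<delta>\<^sup>2 / 8)" using qle[OF that, of n] \<eta>[of n] \<delta> by (intro mult_mono) auto
    also have "\<dots> \<le> 1" using \<delta> by (simp add: power2_eq_square)
    finally show "q n \<zeta> * \<epsilon> n powr m \<le> 1" by (simp add: \<epsilon>)
  qed
  have qlim: "(\<lambda>n. q n \<zeta>) \<longlonglongrightarrow> Q0 \<zeta>" if "\<zeta> \<in> K" for \<zeta>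
  proof (rule tendsto_sandwich[where f = "\<lambda>_. Q0 \<zeta>" and h = "\<lambda>n. Q0 \<zeta> + 2 / \<delta>\<^sup>2 * \<eta> n"])
    show "(\<lambda>n. Q0 \<zeta> + 2 / \<delta>\<^sup>2 * \<eta> n) \<longlonglongrightarrow> Q0 \<zeta>"
      using tendsto_add[OF tendsto_const[of "Q0 \<zeta>"] tendsto_mult_right_zero[OF \<eta>0, of "2 / \<delta>\<^sup>2"]] by simp
    show "\<forall>\<^sub>F n in sequentially. q n \<zeta> \<le> Q0 \<zeta> + 2 / \<delta>\<^sup>2 * \<eta> n"
      using qdiff(1)[OF that] by (auto intro!: always_eventually simp: algebra_simps)
    show "\<forall>\<^sub>F n in sequentially. Q0 \<zeta> \<le> q n \<zeta>" using qdiff(2)[OF that] by simp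
  qed simp
  define hn where "hn n \<zeta> = P' \<zeta> * (cmod (A \<zeta>))\<^sup>2 + q n \<zeta> * Re (b \<zeta>)" for n \<zeta>
  have le: "(LINT \<zeta>|lborel. \<rho> \<zeta> * h0 \<zeta>) \<le> (LINT \<zeta>|lborel. indicator K \<zeta> *\<^sub>R (ln (hn n \<zeta>) * Re (r21 \<zeta>)))" for n
  proof -
    interpret reg: egg_curve_reg \<iota> m U \<phi> "\<epsilon> n" by unfold_locales (rule \<epsilon>)
    have Q': "reg.Q' = q n" by (simp add: fun_eq_iff reg.Q'_def q_def)
    show ?thesis
    proof (rule reg.regularized_current[OF \<rho> K(1) _ K(3,4) pos, unfolded Q', folded hn_def])
      show "K \<subseteq> reg.S"
      proof
        fix \<zeta> assume "\<zeta> \<in> K"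
        then show "\<zeta> \<in> reg.S" using gup[of \<zeta> n] \<delta>(1) K(2) unfolding reg.S_def by auto
      qed
    qed (use qsmall in auto)
  qed
  have hb: "h0 \<zeta> \<le> hn n \<zeta>" "hn n \<zeta> \<le> h0 \<zeta> + Re (b \<zeta>) / 4" if "\<zeta> \<in> K" for n \<zeta>
  proof -
    have \<zeta>: "\<zeta> \<in> U" using that K(2) by auto
    show "h0 \<zeta> \<le> hn n \<zeta>" unfolding hn_def h0_eq[OF \<zeta>] using mult_right_mono[OF qdiff(2)[OF that] b_nonneg[OF \<zeta>]] by simp
    have "q n \<zeta> * Re (b \<zeta>) \<le> (Q0 \<zeta> + 1/4) * Re (b \<zeta>)" using qsmall(1)[OF that, of n] b_nonneg[OF \<zeta>] by (intro mult_right_mono) auto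
    then show "hn n \<zeta> \<le> h0 \<zeta> + Re (b \<zeta>) / 4" unfolding hn_def h0_eq[OF \<zeta>] by (simp add: algebra_simps)
  qed
  have cr: "continuous_on U (\<lambda>\<zeta>. Re (r21 \<zeta>))"
    by (intro continuous_intros continuous_on_subset[OF wirt_cont1[OF \<rho>(2)]]) auto
  have hp: "h0 \<zeta> + Re (b \<zeta>) / 4 > 0" if "\<zeta> \<in> U" for \<zeta> using pos[OF that] b_nonneg[OF that] by simp
  have "(\<lambda>n. LINT \<zeta>|lborel. indicator K \<zeta> *\<^sub>R (ln (hn n \<zeta>) * Re (r21 \<zeta>)))
      \<longlonglongrightarrow> (LINT \<zeta>|lborel. indicator K \<zeta> *\<^sub>R (ln (h0 \<zeta>) * Re (r21 \<zeta>)))"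
  \<comment> \<open>On K one has h0 \<le> hn \<le> h0 + b / 4 with both ends continuous and
    positive, so |ln hn| is at most the sum of the absolute logarithms of the ends.\<close>
  proof (rule integral_dominated_convergence[where w = "\<lambda>\<zeta>. indicator K \<zeta> *\<^sub>R ((\<bar>ln (h0 \<zeta>)\<bar> + \<bar>ln (h0 \<zeta> + Re (b \<zeta>) / 4)\<bar>) * \<bar>Re (r21 \<zeta>)\<bar>)"])
    have KU: "continuous_on K f" if "continuous_on U f" for f :: "complex \<Rightarrow> real" using that K(2) by (rule continuous_on_subset)
    have Kb: "K \<in> sets borel" using K(1) by (simp add: borel_compact)
    have c0: "continuous_on U (\<lambda>\<zeta>. ln (h0 \<zeta>))" using pos by (intro continuous_intros continuous_h0) force
    have c1: "continuous_on U (\<lambda>\<zeta>. ln (h0 \<zeta> + Re (b \<zeta>) / 4))" using hp by (intro continuous_intros continuous_h0 continuous_parts) force+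
    show "(\<lambda>\<zeta>. indicator K \<zeta> *\<^sub>R (ln (h0 \<zeta>) * Re (r21 \<zeta>))) \<in> borel_measurable lborel"
      using borel_measurable_continuous_on_indicator[OF Kb KU[OF continuous_on_mult[OF c0 cr]]] by simp
    show "integrable lborel (\<lambda>\<zeta>. indicator K \<zeta> *\<^sub>R ((\<bar>ln (h0 \<zeta>)\<bar> + \<bar>ln (h0 \<zeta> + Re (b \<zeta>) / 4)\<bar>) * \<bar>Re (r21 \<zeta>)\<bar>))"
      by (rule borel_integrable_compact[OF K(1) KU]) (intro continuous_intros c0 c1 cr)
    show "(\<lambda>\<zeta>. indicator K \<zeta> *\<^sub>R (ln (hn n \<zeta>) * Re (r21 \<zeta>))) \<in> borel_measurable lborel" for n
    proof -
      have "continuous_on K (\<lambda>\<zeta>. (Re (E \<zeta>) + \<epsilon> n) powr m)"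
        using m \<epsilon>(1)[of n] E_bounds(1) K(2) by (intro continuous_on_powr' continuous_intros KU continuous_parts) (auto intro: add_nonneg_nonneg)
      moreover have "1 - (Re (E \<zeta>) + \<epsilon> n) powr m \<noteq> 0" if "\<zeta> \<in> K" for \<zeta> using gup[OF that, of n] \<delta>(1) by linarith
      ultimately have cq: "continuous_on K (q n)" unfolding q_def
        by (intro continuous_on_divide[OF continuous_on_const continuous_on_diff[OF continuous_on_const]]) auto
      have cA: "continuous_on K A" using continuous_parts(2) K(2) by (rule continuous_on_subset)
      have ch: "continuous_on K (hn n)" unfolding hn_def
        by (intro continuous_on_add continuous_on_mult continuous_on_power continuous_on_norm cq cA KU[OF continuous_parts(1)] KU[OF continuous_parts(3)])
      have "hn n \<zeta> \<noteq> 0" if "\<zeta> \<in> K" for \<zeta> using hb(1)[OF that, of n] pos[of \<zeta>] that K(2) by auto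
      then have "continuous_on K (\<lambda>\<zeta>. ln (hn n \<zeta>) * Re (r21 \<zeta>))"
        by (intro continuous_on_mult continuous_on_ln ch KU[OF cr]) auto
      from borel_measurable_continuous_on_indicator[OF Kb this] show ?thesis by simp
    qed
    show "AE \<zeta> in lborel. (\<lambda>n. indicator K \<zeta> *\<^sub>R (ln (hn n \<zeta>) * Re (r21 \<zeta>))) \<longlonglongrightarrow> indicator K \<zeta> *\<^sub>R (ln (h0 \<zeta>) * Re (r21 \<zeta>))"
    proof (rule AE_I2)
      fix \<zeta>
      show "(\<lambda>n. indicator K \<zeta> *\<^sub>R (ln (hn n \<zeta>) * Re (r21 \<zeta>))) \<longlonglongrightarrow> indicator K \<zeta> *\<^sub>R (ln (h0 \<zeta>) * Re (r21 \<zeta>))"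
      proof (cases "\<zeta> \<in> K")
        case True
        then have \<zeta>: "\<zeta> \<in> U" using K(2) by auto
        have "(\<lambda>n. hn n \<zeta>) \<longlonglongrightarrow> h0 \<zeta>" unfolding hn_def h0_eq[OF \<zeta>] by (intro tendsto_intros qlim[OF True])
        then show ?thesis using pos[OF \<zeta>] by (intro tendsto_intros) auto
      qed simp
    qed
    show "AE \<zeta> in lborel. norm (indicator K \<zeta> *\<^sub>R (ln (hn n \<zeta>) * Re (r21 \<zeta>))) \<le> indicator K \<zeta> *\<^sub>R ((\<bar>ln (h0 \<zeta>)\<bar> + \<bar>ln (h0 \<zeta> + Re (b \<zeta>) / 4)\<bar>) * \<bar>Re (r21 \<zeta>)\<bar>)" for n
    proof (rule AE_I2)
      fix \<zeta>
      show "norm (indicator K \<zeta> *\<^sub>R (ln (hn n \<zeta>) * Re (r21 \<zeta>))) \<le> indicator K \<zeta> *\<^sub>R ((\<bar>ln (h0 \<zeta>)\<bar> + \<bar>ln (h0 \<zeta> + Re (b \<zeta>) / 4)\<bar>) * \<bar>Re (r21 \<zeta>)\<bar>)"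
      proof (cases "\<zeta> \<in> K")
        case True
        then have p: "h0 \<zeta> > 0" using K(2) pos by auto
        then have "ln (h0 \<zeta>) \<le> ln (hn n \<zeta>)" "ln (hn n \<zeta>) \<le> ln (h0 \<zeta> + Re (b \<zeta>) / 4)"
          using hb[OF True, of n] by (auto intro!: ln_mono)
        then have "\<bar>ln (hn n \<zeta>)\<bar> \<le> \<bar>ln (h0 \<zeta>)\<bar> + \<bar>ln (h0 \<zeta> + Re (b \<zeta>) / 4)\<bar>" by linarith
        then show ?thesis using True by (simp add: abs_mult mult_right_mono)
      qed simp
    qed
  qed
  then have "(LINT \<zeta>|lborel. \<rho> \<zeta> * h0 \<zeta>) \<le> (LINT \<zeta>|lborel. indicator K \<zeta> *\<^sub>R (ln (h0 \<zeta>) * Re (r21 \<zeta>)))"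
    by (rule LIMSEQ_le_const) (use le in auto)
  then show ?thesis unfolding h0_def .
qed

text \<open>The preceding estimate is weak and has the factor 1. With the factor 1/2 half of the
  integral of \<rho> h0 remains as a margin, and that integral is positive.\<close>

theorem curvature_bounded_currents_egg:
  fixes \<iota> :: "'n::finite"
  assumes m: "0 < m" "m < 1"
  shows "curvature_bounded_above_currents (egg \<iota> m) (wu_metric (egg \<iota> m)) (- 1/2)"
  unfolding curvature_bounded_above_currents_def
proof (intro allI impI)
  fix S U \<phi> \<rho>
  assume as: "S \<subseteq> egg \<iota> m \<and> embedded_riemann_surface S \<and> local_parametrization S U \<phi> \<and> nonneg_test_function U \<rho>"
  then have U: "open U" "vec_holomorphic_on \<phi> U" and nz: "\<And>\<zeta>. \<zeta> \<in> U \<Longrightarrow> vec_deriv \<phi> \<zeta> \<noteq> 0"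
    and "openin (top_of_set S) (\<phi> ` U)"
    by (auto simp: local_parametrization_def)
  then have sub: "\<phi> ` U \<subseteq> S" using openin_imp_subset by blast
  have mem: "\<phi> \<zeta> \<in> egg \<iota> m" if "\<zeta> \<in> U" for \<zeta> using that sub as by auto
  interpret egg_curve \<iota> m U \<phi> by unfold_locales (use m U mem in auto)
  define K where "K = closure {\<zeta>. \<rho> \<zeta> \<noteq> 0}"
  have \<rho>: "smooth_on UNIV \<rho>" "compact K" "K \<subseteq> U" "\<And>\<zeta>. 0 \<le> \<rho> \<zeta>" "\<exists>\<zeta>. \<rho> \<zeta> \<noteq> 0"
    using as by (auto simp: nonneg_test_function_def K_def)
  have \<rho>0: "\<rho> \<zeta> = 0" if "\<zeta> \<notin> K" for \<zeta> using that closure_subset[of "{\<zeta>. \<rho> \<zeta> \<noteq> 0}"] by (auto simp: K_def)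
  obtain r1 r2 r21 r22 where r: "wirt UNIV (\<lambda>\<zeta>. of_real (\<rho> \<zeta>)) r1 r2" "wirt UNIV r2 r21 r22"
    using smooth_wirt[OF \<rho>(1)] by blast
  have "dzbar (\<lambda>w. of_real (\<rho> w)) = r2" using wirt_dz(2)[OF r(1)] by (simp add: fun_eq_iff)
  then have dd: "dz (dzbar (\<lambda>w. of_real (\<rho> w))) \<zeta> = r21 \<zeta>" for \<zeta> using wirt_dz(1)[OF r(2)] by simp
  have oK: "open (- K)" using \<rho>(2) by (simp add: compact_imp_closed open_Compl)
  have r21: "r21 \<zeta> = 0" if "\<zeta> \<notin> K" for \<zeta>
  proof -
    have "r2 \<zeta> = 0" if "\<zeta> \<notin> K" for \<zeta>
      using wirt_unique(2)[OF wirt_subset[OF r(1)] wirt_cong_fun[OF wirt_const[of _ 0] oK], of \<zeta>] \<rho>0 that by auto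
    then show ?thesis
      using wirt_unique(1)[OF wirt_subset[OF r(2)] wirt_cong_fun[OF wirt_const[of _ 0] oK], of \<zeta>] that by auto
  qed
  have eqm: "restricted_metric (wu_metric (egg \<iota> m)) \<phi> \<zeta> = h0 \<zeta>" if "\<zeta> \<in> U" for \<zeta>
    using wu_metric_egg[OF m mem[OF that]] by (simp add: h0_def restricted_metric_def)
  have lhs: "(LINT \<zeta>:U|lborel. ln (restricted_metric (wu_metric (egg \<iota> m)) \<phi> \<zeta>) * Re (dz (dzbar (\<lambda>w. of_real (\<rho> w))) \<zeta>))
    = (LINT \<zeta>|lborel. indicator K \<zeta> *\<^sub>R (ln (h0 \<zeta>) * Re (r21 \<zeta>)))"
    unfolding set_lebesgue_integral_def dd
    by (rule Bochner_Integration.integral_cong[OF refl]) (use \<rho>(3) r21 eqm in \<open>auto simp: indicator_def\<close>)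
  have rhs: "(LINT \<zeta>:U|lborel. - (- 1/2) * restricted_metric (wu_metric (egg \<iota> m)) \<phi> \<zeta> * \<rho> \<zeta>) = 1/2 * (LINT \<zeta>|lborel. \<rho> \<zeta> * h0 \<zeta>)"
    unfolding set_lebesgue_integral_def Bochner_Integration.integral_mult_right_zero[symmetric]
    by (rule Bochner_Integration.integral_cong[OF refl]) (use \<rho>(3) \<rho>0 eqm in \<open>auto simp: indicator_def\<close>)
  have main: "(LINT \<zeta>|lborel. \<rho> \<zeta> * h0 \<zeta>) \<le> (LINT \<zeta>|lborel. indicator K \<zeta> *\<^sub>R (ln (h0 \<zeta>) * Re (r21 \<zeta>)))"
    using curvature_current_egg_wu[OF egg_curve_axioms nz r \<rho>(2,3) \<rho>0 \<rho>(4)] unfolding h0_def by simp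
  have "continuous_on UNIV (\<lambda>\<zeta>. Re (of_real (\<rho> \<zeta>)))" by (intro continuous_intros wirt_cont[OF r(1)])
  then have c\<rho>: "continuous_on UNIV \<rho>" by simp
  have int: "integrable lborel (\<lambda>\<zeta>. \<rho> \<zeta> * h0 \<zeta>)"
    by (rule integrable_compact_support[OF _ \<rho>(2,3)])
      (use \<rho>0 continuous_on_subset[OF c\<rho>] in \<open>auto intro!: continuous_intros continuous_h0\<close>)
  have h0p: "h0 \<zeta> > 0" if "\<zeta> \<in> U" for \<zeta> using h0_pos[OF that nz[OF that]] .
  have nn: "\<rho> \<zeta> * h0 \<zeta> \<ge> 0" for \<zeta> 
  proof (cases "\<zeta> \<in> K")
    case True
    then have "h0 \<zeta> > 0" using \<rho>(3) h0p by auto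
    then show ?thesis using \<rho>(4)[of \<zeta>] by simp
  qed (simp add: \<rho>0)
  \<comment> \<open>The integrand is positive on the nonempty open set where \<rho> is nonzero, and
    such a set is not null.\<close>
  have "(LINT \<zeta>|lborel. \<rho> \<zeta> * h0 \<zeta>) \<noteq> 0"
  proof
    assume "(LINT \<zeta>|lborel. \<rho> \<zeta> * h0 \<zeta>) = 0"
    then have "AE \<zeta> in lborel. \<rho> \<zeta> * h0 \<zeta> = 0" using integral_nonneg_eq_0_iff_AE[OF int] nn by simp
    moreover have "\<rho> \<zeta> * h0 \<zeta> \<noteq> 0" if "\<rho> \<zeta> \<noteq> 0" for \<zeta> using that h0p[of \<zeta>] \<rho>0[of \<zeta>] \<rho>(3) by force
    ultimately have ae: "AE \<zeta> in lborel. \<zeta> \<notin> {\<zeta>. \<rho> \<zeta> \<noteq> 0}" by (auto elim!: eventually_mono)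
    have op: "open {\<zeta>. \<rho> \<zeta> \<noteq> 0}" using c\<rho> by (intro open_Collect_neq) auto
    have "emeasure lborel {\<zeta>. \<rho> \<zeta> \<noteq> 0} = 0"
      using ae op by (subst (asm) AE_iff_measurable[OF _ refl]) auto
    then show False using emeasure_open_ne_0[OF op] \<rho>(5) by auto
  qed
  moreover have "(LINT \<zeta>|lborel. \<rho> \<zeta> * h0 \<zeta>) \<ge> 0" by (rule Bochner_Integration.integral_nonneg) (rule nn)
  ultimately have "(LINT \<zeta>|lborel. \<rho> \<zeta> * h0 \<zeta>) > 0" by simp
  then show "(LINT \<zeta>:U|lborel. ln (restricted_metric (wu_metric (egg \<iota> m)) \<phi> \<zeta>) * Re (dz (dzbar (\<lambda>w. of_real (\<rho> w))) \<zeta>))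
    > (LINT \<zeta>:U|lborel. - (- 1/2) * restricted_metric (wu_metric (egg \<iota> m)) \<phi> \<zeta> * \<rho> \<zeta>)"
    unfolding lhs rhs using main by simp
qed

section \<open>Real analyticity\<close>

definition multi_idx :: "('a::euclidean_space \<Rightarrow> nat) set" where
  "multi_idx = Basis \<rightarrow>\<^sub>E UNIV"

definition mon :: "'a::euclidean_space \<Rightarrow> 'a \<Rightarrow> ('a \<Rightarrow> nat) \<Rightarrow> real" where
  "mon p x \<alpha> = (\<Prod>b\<in>Basis. ((x - p) \<bullet> b) ^ \<alpha> b)"

definition wt :: "('a::euclidean_space \<Rightarrow> nat) \<Rightarrow> nat" where
  "wt \<alpha> = (\<Sum>b\<in>Basis. \<alpha> b)"

definition polydisc :: "'a::euclidean_space \<Rightarrow> real \<Rightarrow> 'a set" where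
  "polydisc p r = {x. \<forall>b\<in>Basis. \<bar>(x - p) \<bullet> b\<bar> \<le> r}"

text \<open>N bounds the weighted coefficient sum of |a \<alpha>| r^|\<alpha>|. This norm is
  submultiplicative and complete, so sums, products and series of analytic functions are handled by
  arithmetic on N; it also dominates the function on the polydisc.\<close>

definition ana_with :: "'a::euclidean_space \<Rightarrow> real \<Rightarrow> real \<Rightarrow> ('a \<Rightarrow> complex) \<Rightarrow> bool" where
  "ana_with p r N f \<longleftrightarrow> (\<exists>a. (\<lambda>\<alpha>. cmod (a \<alpha>) * r ^ wt \<alpha>) summable_on multi_idx \<and>
     (\<Sum>\<^sub>\<infinity>\<alpha>\<in>multi_idx. cmod (a \<alpha>) * r ^ wt \<alpha>) \<le> N \<and>
     (\<forall>x\<in>polydisc p r. ((\<lambda>\<alpha>. mon p x \<alpha> *\<^sub>R a \<alpha>) has_sum f x) multi_idx))"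

lemma mon_bound: "x \<in> polydisc p r \<Longrightarrow> \<bar>mon p x \<alpha>\<bar> \<le> r ^ wt \<alpha>"
  unfolding mon_def wt_def abs_prod power_sum power_abs polydisc_def
  by (intro prod_mono) (auto intro!: power_mono)

lemma ball_subset_polydisc: "ball p r \<subseteq> polydisc p r"
proof
  fix x assume "x \<in> ball p r"
  then have "norm (x - p) \<le> r" by (simp add: dist_norm norm_minus_commute)
  then show "x \<in> polydisc p r" unfolding polydisc_def
    using Basis_le_norm order_trans by (auto simp: inner_commute) blast
qed

lemma polydisc_mono: "r \<le> s \<Longrightarrow> polydisc p r \<subseteq> polydisc p s"
  by (force simp: polydisc_def)

text \<open>Monomials indexed by an arbitrary set are collected along the fibres of d; absolute
  summability at radius r permits the regrouping, which does not increase the norm. Constants,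
  linear maps, shifted series and series of series are all instances for a suitable J.\<close>

lemma ana_regroup:
  fixes c :: "'j \<Rightarrow> complex" and d :: "'j \<Rightarrow> 'a::euclidean_space \<Rightarrow> nat"
  assumes r: "0 < r" and sm: "(\<lambda>j. cmod (c j) * r ^ wt (d j)) summable_on J"
    and N: "(\<Sum>\<^sub>\<infinity>j\<in>J. cmod (c j) * r ^ wt (d j)) \<le> N" and d: "\<And>j. j \<in> J \<Longrightarrow> d j \<in> multi_idx"
    and f: "\<And>x. x \<in> polydisc p r \<Longrightarrow> ((\<lambda>j. mon p x (d j) *\<^sub>R c j) has_sum f x) J"
  shows "ana_with p r N f"
proof -
  define F where "F \<alpha> = {j \<in> J. d j = \<alpha>}" for \<alpha>
  define a where "a \<alpha> = infsum c (F \<alpha>)" for \<alpha>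
  have bij: "bij_betw snd (Sigma multi_idx F) J"
    by (rule bij_betwI[where g = "\<lambda>j. (d j, j)"]) (use d in \<open>auto simp: F_def\<close>)
  have cs: "(\<lambda>j. cmod (c j)) summable_on F \<alpha>" for \<alpha>
  proof -
    have "(\<lambda>j. cmod (c j) * r ^ wt (d j)) summable_on F \<alpha>"
      by (rule summable_on_subset_banach[OF sm]) (auto simp: F_def)
    then have "(\<lambda>j. cmod (c j) * r ^ wt \<alpha>) summable_on F \<alpha>"
      by (rule summable_on_cong[THEN iffD1, rotated]) (auto simp: F_def)
    then have "(\<lambda>j. cmod (c j) * r ^ wt \<alpha> * inverse (r ^ wt \<alpha>)) summable_on F \<alpha>"
      by (rule summable_on_cmult_left)
    then show ?thesis using r by (simp add: field_simps)
  qed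
  have hs: "(\<lambda>x. (case x of (\<alpha>, j) \<Rightarrow> cmod (c j) * r ^ wt (d j))) summable_on Sigma multi_idx F"
    using summable_on_reindex_bij_betw[OF bij, of "\<lambda>j. cmod (c j) * r ^ wt (d j)"] sm by (simp add: case_prod_unfold)
  have "(\<lambda>x. norm (case x of (\<alpha>, j) \<Rightarrow> cmod (c j) * r ^ wt (d j))) summable_on Sigma multi_idx F"
    using hs r by (simp add: case_prod_unfold)
  then have out: "(\<lambda>\<alpha>. \<Sum>\<^sub>\<infinity>j\<in>F \<alpha>. cmod (c j) * r ^ wt (d j)) summable_on multi_idx"
    using r by (subst (asm) Infinite_Sum.abs_summable_on_Sigma_iff) (auto simp: abs_of_nonneg infsum_nonneg)
  have an: "cmod (a \<alpha>) * r ^ wt \<alpha> \<le> (\<Sum>\<^sub>\<infinity>j\<in>F \<alpha>. cmod (c j) * r ^ wt (d j))" for \<alpha>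
  proof -
    have "cmod (a \<alpha>) * r ^ wt \<alpha> \<le> (\<Sum>\<^sub>\<infinity>j\<in>F \<alpha>. cmod (c j)) * r ^ wt \<alpha>"
      unfolding a_def using r by (intro mult_right_mono norm_infsum_bound cs) auto
    also have "\<dots> = (\<Sum>\<^sub>\<infinity>j\<in>F \<alpha>. cmod (c j) * r ^ wt \<alpha>)" by (rule infsum_cmult_left[symmetric]) (use cs in auto)
    also have "\<dots> = (\<Sum>\<^sub>\<infinity>j\<in>F \<alpha>. cmod (c j) * r ^ wt (d j))" by (rule infsum_cong) (auto simp: F_def)
    finally show ?thesis .
  qed
  have s1: "(\<lambda>\<alpha>. cmod (a \<alpha>) * r ^ wt \<alpha>) summable_on multi_idx"
    by (rule summable_on_comparison_test[OF out an]) (use r in auto)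
  have "(\<Sum>\<^sub>\<infinity>\<alpha>\<in>multi_idx. cmod (a \<alpha>) * r ^ wt \<alpha>) \<le> (\<Sum>\<^sub>\<infinity>\<alpha>\<in>multi_idx. \<Sum>\<^sub>\<infinity>j\<in>F \<alpha>. cmod (c j) * r ^ wt (d j))"
    by (rule infsum_mono[OF s1 out an])
  also have "\<dots> = (\<Sum>\<^sub>\<infinity>x\<in>Sigma multi_idx F. case x of (\<alpha>, j) \<Rightarrow> cmod (c j) * r ^ wt (d j))"
    using infsum_Sigma_banach[OF hs] by simp
  also have "\<dots> = (\<Sum>\<^sub>\<infinity>j\<in>J. cmod (c j) * r ^ wt (d j))"
    using infsum_reindex_bij_betw[OF bij, of "\<lambda>j. cmod (c j) * r ^ wt (d j)"] by (simp add: case_prod_unfold)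
  finally have s2: "(\<Sum>\<^sub>\<infinity>\<alpha>\<in>multi_idx. cmod (a \<alpha>) * r ^ wt \<alpha>) \<le> N" using N by simp
  have "((\<lambda>\<alpha>. mon p x \<alpha> *\<^sub>R a \<alpha>) has_sum f x) multi_idx" if x: "x \<in> polydisc p r" for x
  proof (rule has_sum_SigmaD)
    show "((\<lambda>y. mon p x (d (snd y)) *\<^sub>R c (snd y)) has_sum f x) (Sigma multi_idx F)"
      using has_sum_reindex_bij_betw[OF bij, of "\<lambda>j. mon p x (d j) *\<^sub>R c j"] f[OF x] by simp
    fix \<alpha> assume "\<alpha> \<in> (multi_idx :: ('a \<Rightarrow> nat) set)"
    have "(c has_sum a \<alpha>) (F \<alpha>)" unfolding a_def using Infinite_Sum.abs_summable_summable[OF cs] by (rule has_sum_infsum)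
    then have "((\<lambda>j. mon p x \<alpha> *\<^sub>R c j) has_sum mon p x \<alpha> *\<^sub>R a \<alpha>) (F \<alpha>)"
      by (rule has_sum_bounded_linear[OF bounded_linear_scaleR_right])
    then show "((\<lambda>j. mon p x (d (snd (\<alpha>, j))) *\<^sub>R c (snd (\<alpha>, j))) has_sum mon p x \<alpha> *\<^sub>R a \<alpha>) (F \<alpha>)"
      by (rule has_sum_cong[THEN iffD1, rotated]) (auto simp: F_def)
  qed
  then show ?thesis unfolding ana_with_def using s1 s2 by blast
qed

lemma ana_with_mono:
  assumes "ana_with p r N f" "0 < s" "s \<le> r" "N \<le> M"
  shows "ana_with p s M f"
proof -
  obtain a where a: "(\<lambda>\<alpha>. cmod (a \<alpha>) * r ^ wt \<alpha>) summable_on multi_idx" "(\<Sum>\<^sub>\<infinity>\<alpha>\<in>multi_idx. cmod (a \<alpha>) * r ^ wt \<alpha>) \<le> N"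
    "\<And>x. x \<in> polydisc p r \<Longrightarrow> ((\<lambda>\<alpha>. mon p x \<alpha> *\<^sub>R a \<alpha>) has_sum f x) multi_idx"
    using assms(1) unfolding ana_with_def by blast
  have le: "cmod (a \<alpha>) * s ^ wt \<alpha> \<le> cmod (a \<alpha>) * r ^ wt \<alpha>" for \<alpha>
    using assms by (intro mult_left_mono power_mono) auto
  have s: "(\<lambda>\<alpha>. cmod (a \<alpha>) * s ^ wt \<alpha>) summable_on multi_idx"
    by (rule summable_on_comparison_test[OF a(1) le]) (use assms in auto)
  have "(\<Sum>\<^sub>\<infinity>\<alpha>\<in>multi_idx. cmod (a \<alpha>) * s ^ wt \<alpha>) \<le> M"
    using infsum_mono[OF s a(1) le] a(2) assms(4) by simp
  then show ?thesis unfolding ana_with_def using s a(3) polydisc_mono[OF assms(3), of p] by blast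
qed

lemma ana_with_bound:
  assumes "ana_with p r N f" "x \<in> polydisc p r"
  shows "cmod (f x) \<le> N"
proof -
  obtain a where a: "(\<lambda>\<alpha>. cmod (a \<alpha>) * r ^ wt \<alpha>) summable_on multi_idx" "(\<Sum>\<^sub>\<infinity>\<alpha>\<in>multi_idx. cmod (a \<alpha>) * r ^ wt \<alpha>) \<le> N"
    "((\<lambda>\<alpha>. mon p x \<alpha> *\<^sub>R a \<alpha>) has_sum f x) multi_idx"
    using assms unfolding ana_with_def by blast
  have le: "norm (mon p x \<alpha> *\<^sub>R a \<alpha>) \<le> cmod (a \<alpha>) * r ^ wt \<alpha>" for \<alpha>
    using mult_right_mono[OF mon_bound[OF assms(2), of \<alpha>] norm_ge_zero[of "a \<alpha>"]] by (simp add: mult.commute)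
  have s: "(\<lambda>\<alpha>. norm (mon p x \<alpha> *\<^sub>R a \<alpha>)) summable_on multi_idx"
    by (rule summable_on_comparison_test[OF a(1) le]) auto
  have "f x = (\<Sum>\<^sub>\<infinity>\<alpha>\<in>multi_idx. mon p x \<alpha> *\<^sub>R a \<alpha>)" using a(3) by (simp add: infsumI)
  then have "cmod (f x) \<le> (\<Sum>\<^sub>\<infinity>\<alpha>\<in>multi_idx. norm (mon p x \<alpha> *\<^sub>R a \<alpha>))" using norm_infsum_bound[OF s] by simp
  also have "\<dots> \<le> (\<Sum>\<^sub>\<infinity>\<alpha>\<in>multi_idx. cmod (a \<alpha>) * r ^ wt \<alpha>)" by (rule infsum_mono[OF s a(1) le])
  finally show ?thesis using a(2) by simp
qed

lemma ana_with_nonneg: "0 < r \<Longrightarrow> ana_with p r N f \<Longrightarrow> 0 \<le> N"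
  using order_trans[OF norm_ge_zero ana_with_bound[of p r N f p]] by (auto simp: polydisc_def)

text \<open>Completeness of the norm: a series converges in it as soon as the bounds N do. The index
  set K has two elements for sums, is the set of multi-indices for products, and is the set of
  naturals for compositions.\<close>

lemma ana_with_has_sum:
  assumes r: "0 < r" and g: "\<And>k. k \<in> K \<Longrightarrow> ana_with p r (N k) (g k)"
    and N: "(N has_sum M) K" and f: "\<And>x. x \<in> polydisc p r \<Longrightarrow> ((\<lambda>k. g k x) has_sum f x) K"
  shows "ana_with p r M f"
proof -
  have "\<forall>k\<in>K. \<exists>a. (\<lambda>\<alpha>. cmod (a \<alpha>) * r ^ wt \<alpha>) summable_on multi_idx \<and> (\<Sum>\<^sub>\<infinity>\<alpha>\<in>multi_idx. cmod (a \<alpha>) * r ^ wt \<alpha>) \<le> N k \<and>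
    (\<forall>x\<in>polydisc p r. ((\<lambda>\<alpha>. mon p x \<alpha> *\<^sub>R a \<alpha>) has_sum g k x) multi_idx)"
    using g unfolding ana_with_def by blast
  from bchoice[OF this] obtain a where a: "\<And>k. k \<in> K \<Longrightarrow> (\<lambda>\<alpha>. cmod (a k \<alpha>) * r ^ wt \<alpha>) summable_on multi_idx"
    "\<And>k. k \<in> K \<Longrightarrow> (\<Sum>\<^sub>\<infinity>\<alpha>\<in>multi_idx. cmod (a k \<alpha>) * r ^ wt \<alpha>) \<le> N k"
    "\<And>k x. k \<in> K \<Longrightarrow> x \<in> polydisc p r \<Longrightarrow> ((\<lambda>\<alpha>. mon p x \<alpha> *\<^sub>R a k \<alpha>) has_sum g k x) multi_idx"
    by blast
  define T where "T k = (\<Sum>\<^sub>\<infinity>\<alpha>\<in>multi_idx. cmod (a k \<alpha>) * r ^ wt \<alpha>)" for k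
  have T0: "0 \<le> T k" for k unfolding T_def by (rule infsum_nonneg) (use r in auto)
  have Ts: "T summable_on K"
  proof (rule summable_on_comparison_test[OF has_sum_imp_summable[OF N]])
    show "T k \<le> N k" if "k \<in> K" for k using a(2)[OF that] by (simp only: T_def)
  qed (rule T0)
  have sm: "(\<lambda>y. cmod (a (fst y) (snd y)) * r ^ wt (snd y)) summable_on K \<times> multi_idx"
    by (rule summable_on_SigmaI[where g = T]) (use a(1) r Ts in \<open>auto simp: T_def intro!: has_sum_infsum\<close>)
  show ?thesis
  proof (rule ana_regroup[OF r sm])
    have "(\<Sum>\<^sub>\<infinity>y\<in>K \<times> multi_idx. cmod (a (fst y) (snd y)) * r ^ wt (snd y)) = infsum T K"
      using infsum_Sigma_banach[OF sm] by (simp only: T_def[abs_def] fst_conv snd_conv)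
    also have "\<dots> \<le> infsum N K" by (rule infsum_mono[OF Ts has_sum_imp_summable[OF N]]) (use a(2) in \<open>auto simp: T_def\<close>)
    also have "\<dots> = M" using N by (rule infsumI)
    finally show "(\<Sum>\<^sub>\<infinity>y\<in>K \<times> multi_idx. cmod (a (fst y) (snd y)) * r ^ wt (snd y)) \<le> M" .
    fix x assume x: "x \<in> polydisc p r"
    have "(\<lambda>y. norm (mon p x (snd y) *\<^sub>R a (fst y) (snd y))) summable_on K \<times> multi_idx"
    proof (rule summable_on_comparison_test[OF sm])
      fix y show "norm (mon p x (snd y) *\<^sub>R a (fst y) (snd y)) \<le> cmod (a (fst y) (snd y)) * r ^ wt (snd y)"
        using mult_right_mono[OF mon_bound[OF x, of "snd y"] norm_ge_zero[of "a (fst y) (snd y)"]] by (simp add: mult.commute)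
    qed auto
    from Infinite_Sum.abs_summable_summable[OF this]
    show "((\<lambda>y. mon p x (snd y) *\<^sub>R a (fst y) (snd y)) has_sum f x) (K \<times> multi_idx)"
      by (intro has_sum_SigmaI[where g = "\<lambda>k. g k x"]) (use a(3) x f in auto)
  qed auto
qed

lemma mon_zero: "mon p x (\<lambda>b\<in>Basis. 0) = 1" and wt_zero: "wt (\<lambda>b\<in>Basis. 0) = 0"
  by (simp_all add: mon_def wt_def)

lemma mon_add: "mon p x (\<lambda>b\<in>Basis. \<alpha> b + \<beta> b) = mon p x \<alpha> * mon p x \<beta>"
  and wt_add: "wt (\<lambda>b\<in>Basis. \<alpha> b + \<beta> b) = wt \<alpha> + wt \<beta>"
  by (simp_all add: mon_def wt_def power_add prod.distrib sum.distrib)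

lemma mon_unit: "b0 \<in> Basis \<Longrightarrow> mon p x (\<lambda>b\<in>Basis. if b = b0 then 1 else 0) = (x - p) \<bullet> b0"
  and wt_unit: "b0 \<in> Basis \<Longrightarrow> wt (\<lambda>b\<in>Basis. if b = b0 then 1 else 0) = 1"
proof -
  assume b: "b0 \<in> Basis"
  have "mon p x (\<lambda>b\<in>Basis. if b = b0 then 1 else 0) = (\<Prod>b\<in>Basis. if b = b0 then (x - p) \<bullet> b0 else 1)"
    unfolding mon_def by (intro prod.cong) auto
  then show "mon p x (\<lambda>b\<in>Basis. if b = b0 then 1 else 0) = (x - p) \<bullet> b0" using b by simp
  show "wt (\<lambda>b\<in>Basis. if b = b0 then 1 else 0) = 1" using b by (simp add: wt_def)
qed

lemma ana_with_const: "0 < r \<Longrightarrow> ana_with p r (cmod c) (\<lambda>_. c)"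
  by (rule ana_regroup[where J = "{()}" and c = "\<lambda>_. c" and d = "\<lambda>_. \<lambda>b\<in>Basis. 0"])
     (auto simp: mon_zero wt_zero multi_idx_def has_sum_finite_iff)

lemma ana_with_linear:
  fixes L :: "'a::euclidean_space \<Rightarrow> complex"
  assumes r: "0 < r" and L: "linear L"
  shows "ana_with p r (\<Sum>b\<in>Basis. cmod (L b) * r) (\<lambda>x. L (x - p))"
proof (rule ana_regroup[where J = Basis and c = L and d = "\<lambda>b0. \<lambda>b\<in>Basis. if b = b0 then 1 else 0", OF r])
  fix x assume "x \<in> polydisc p r"
  have "L (x - p) = L (\<Sum>b\<in>Basis. ((x - p) \<bullet> b) *\<^sub>R b)" by (simp add: euclidean_representation)
  also have "\<dots> = (\<Sum>b\<in>Basis. ((x - p) \<bullet> b) *\<^sub>R L b)" by (simp add: linear_sum[OF L] linear_scale[OF L])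
  also have "\<dots> = (\<Sum>b\<in>Basis. mon p x (\<lambda>b'\<in>Basis. if b' = b then 1 else 0) *\<^sub>R L b)"
    by (intro sum.cong) (simp_all add: mon_unit)
  finally show "((\<lambda>b. mon p x (\<lambda>b'\<in>Basis. if b' = b then 1 else 0) *\<^sub>R L b) has_sum L (x - p)) Basis"
    by (intro has_sum_finiteI) auto
qed (auto simp: multi_idx_def wt_unit)

lemma ana_with_add:
  assumes r: "0 < r" and "ana_with p r N f" "ana_with p r M g"
  shows "ana_with p r (N + M) (\<lambda>x. f x + g x)"
  by (rule ana_with_has_sum[where K = "UNIV :: bool set" and g = "\<lambda>b. if b then f else g" and N = "\<lambda>b. if b then N else M", OF r])
     (use assms in \<open>auto intro!: has_sum_finiteI simp: UNIV_bool\<close>)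

lemma ana_with_mult:
  assumes r: "0 < r" and f: "ana_with p r N f" and g: "ana_with p r M g"
  shows "ana_with p r (N * M) (\<lambda>x. f x * g x)"
proof -
  obtain a where a: "(\<lambda>\<alpha>. cmod (a \<alpha>) * r ^ wt \<alpha>) summable_on multi_idx" "(\<Sum>\<^sub>\<infinity>\<alpha>\<in>multi_idx. cmod (a \<alpha>) * r ^ wt \<alpha>) \<le> N"
    "\<And>x. x \<in> polydisc p r \<Longrightarrow> ((\<lambda>\<alpha>. mon p x \<alpha> *\<^sub>R a \<alpha>) has_sum f x) multi_idx"
    using f unfolding ana_with_def by blast
  \<comment> \<open>Multiplying g by one monomial of f merely shifts the multi-indices of g; the
    product f g is the series of these over \<alpha>.\<close>
  have "ana_with p r (cmod (a \<alpha>) * r ^ wt \<alpha> * M) (\<lambda>x. (mon p x \<alpha> *\<^sub>R a \<alpha>) * g x)" if "\<alpha> \<in> multi_idx" for \<alpha>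
  proof -
    obtain e where e: "(\<lambda>\<beta>. cmod (e \<beta>) * r ^ wt \<beta>) summable_on multi_idx" "(\<Sum>\<^sub>\<infinity>\<beta>\<in>multi_idx. cmod (e \<beta>) * r ^ wt \<beta>) \<le> M"
      "\<And>x. x \<in> polydisc p r \<Longrightarrow> ((\<lambda>\<beta>. mon p x \<beta> *\<^sub>R e \<beta>) has_sum g x) multi_idx"
      using g unfolding ana_with_def by blast
    have eq: "cmod (a \<alpha> * e \<beta>) * r ^ wt (\<lambda>b\<in>Basis. \<alpha> b + \<beta> b) = (cmod (a \<alpha>) * r ^ wt \<alpha>) * (cmod (e \<beta>) * r ^ wt \<beta>)" for \<beta>
      by (simp add: wt_add power_add norm_mult)
    show ?thesis
    proof (rule ana_regroup[where J = multi_idx and c = "\<lambda>\<beta>. a \<alpha> * e \<beta>" and d = "\<lambda>\<beta>. \<lambda>b\<in>Basis. \<alpha> b + \<beta> b", OF r])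
      show "(\<lambda>\<beta>. cmod (a \<alpha> * e \<beta>) * r ^ wt (\<lambda>b\<in>Basis. \<alpha> b + \<beta> b)) summable_on multi_idx"
        unfolding eq by (rule summable_on_cmult_right[OF e(1)])
      have "(\<Sum>\<^sub>\<infinity>\<beta>\<in>multi_idx. (cmod (a \<alpha>) * r ^ wt \<alpha>) * (cmod (e \<beta>) * r ^ wt \<beta>)) = (cmod (a \<alpha>) * r ^ wt \<alpha>) * (\<Sum>\<^sub>\<infinity>\<beta>\<in>multi_idx. cmod (e \<beta>) * r ^ wt \<beta>)"
        by (rule infsum_cmult_right) (rule e(1))
      then show "(\<Sum>\<^sub>\<infinity>\<beta>\<in>multi_idx. cmod (a \<alpha> * e \<beta>) * r ^ wt (\<lambda>b\<in>Basis. \<alpha> b + \<beta> b)) \<le> cmod (a \<alpha>) * r ^ wt \<alpha> * M"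
        unfolding eq using e(2) r by (simp add: mult_left_mono)
      fix x assume "x \<in> polydisc p r"
      from has_sum_cmult_right[OF e(3)[OF this], of "mon p x \<alpha> *\<^sub>R a \<alpha>"]
      show "((\<lambda>\<beta>. mon p x (\<lambda>b\<in>Basis. \<alpha> b + \<beta> b) *\<^sub>R (a \<alpha> * e \<beta>)) has_sum mon p x \<alpha> *\<^sub>R a \<alpha> * g x) multi_idx"
        by (simp add: mon_add scaleR_conv_of_real mult_ac)
    qed (auto simp: multi_idx_def)
  qed
  moreover have "0 \<le> M" by (rule ana_with_nonneg[OF r g])
  ultimately have "ana_with p r ((\<Sum>\<^sub>\<infinity>\<alpha>\<in>multi_idx. cmod (a \<alpha>) * r ^ wt \<alpha>) * M) (\<lambda>x. f x * g x)"
    by - (rule ana_with_has_sum[OF r, where K = multi_idx and N = "\<lambda>\<alpha>. cmod (a \<alpha>) * r ^ wt \<alpha> * M" and g = "\<lambda>\<alpha> x. (mon p x \<alpha> *\<^sub>R a \<alpha>) * g x"],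
      assumption, rule has_sum_cmult_left[OF has_sum_infsum[OF a(1)]], rule has_sum_cmult_left[OF a(3)])
  then show ?thesis
    by (rule ana_with_mono[OF _ r order_refl]) (rule mult_right_mono[OF a(2) \<open>0 \<le> M\<close>])
qed

lemma ana_with_power:
  assumes "0 < r" "ana_with p r N f"
  shows "ana_with p r (N ^ n) (\<lambda>x. f x ^ n)"
proof (induction n)
  case 0
  then show ?case using ana_with_const[OF assms(1), of p 1] by simp
next
  case (Suc n)
  then show ?case using ana_with_mult[OF assms(1) assms(2) Suc] by simp
qed

text \<open>Since f p = 0 the constant coefficient vanishes, so every remaining monomial gains at
  least one factor t when the radius is multiplied by t.\<close>

lemma ana_with_shrink:
  assumes r: "0 < r" and f: "ana_with p r N f" "f p = 0" and t: "0 < t" "t \<le> 1"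
  shows "ana_with p (t * r) (t * N) f"
proof -
  obtain a where a: "(\<lambda>\<alpha>. cmod (a \<alpha>) * r ^ wt \<alpha>) summable_on multi_idx" "(\<Sum>\<^sub>\<infinity>\<alpha>\<in>multi_idx. cmod (a \<alpha>) * r ^ wt \<alpha>) \<le> N"
    "\<And>x. x \<in> polydisc p r \<Longrightarrow> ((\<lambda>\<alpha>. mon p x \<alpha> *\<^sub>R a \<alpha>) has_sum f x) multi_idx"
    using f(1) unfolding ana_with_def by blast
  define \<zeta> where "\<zeta> = (\<lambda>b\<in>(Basis::'a set). 0::nat)"
  have \<zeta>: "\<zeta> \<in> multi_idx" by (simp add: \<zeta>_def multi_idx_def)
  have m0: "mon p p \<alpha> = 0" if \<alpha>: "\<alpha> \<in> multi_idx" "\<alpha> \<noteq> \<zeta>" for \<alpha>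
  proof -
    have "\<exists>b\<in>Basis. \<alpha> b \<noteq> 0"
    proof (rule ccontr)
      assume "\<not> (\<exists>b\<in>Basis. \<alpha> b \<noteq> 0)"
      then have "\<alpha> = \<zeta>" using \<alpha>(1) by (auto simp: fun_eq_iff multi_idx_def \<zeta>_def PiE_def extensional_def)
      then show False using \<alpha>(2) by simp
    qed
    then show ?thesis by (auto simp: mon_def)
  qed
  have "((\<lambda>\<alpha>. mon p p \<alpha> *\<^sub>R a \<alpha>) has_sum a \<zeta>) multi_idx"
    by (rule has_sum_finite_neutralI[of "{\<zeta>}"]) (use \<zeta> m0 in \<open>auto simp: \<zeta>_def mon_zero\<close>)
  moreover have "((\<lambda>\<alpha>. mon p p \<alpha> *\<^sub>R a \<alpha>) has_sum 0) multi_idx" using a(3)[of p] f(2) r by (simp add: polydisc_def)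
  ultimately have a0: "a \<zeta> = 0" by (rule has_sum_unique)
  have le: "cmod (a \<alpha>) * (t * r) ^ wt \<alpha> \<le> t * (cmod (a \<alpha>) * r ^ wt \<alpha>)" if \<alpha>: "\<alpha> \<in> multi_idx" for \<alpha>
  proof (cases "\<alpha> = \<zeta>")
    case False
    have "wt \<alpha> \<noteq> 0"
    proof
      assume "wt \<alpha> = 0"
      then have "\<forall>b\<in>Basis. \<alpha> b = 0" by (simp add: wt_def)
      then have "\<alpha> = \<zeta>" using \<alpha> by (auto simp: fun_eq_iff multi_idx_def \<zeta>_def PiE_def extensional_def)
      then show False using False by simp
    qed
    then have "t ^ wt \<alpha> \<le> t ^ 1" using t by (intro power_decreasing) auto
    then have "t ^ wt \<alpha> * (cmod (a \<alpha>) * r ^ wt \<alpha>) \<le> t * (cmod (a \<alpha>) * r ^ wt \<alpha>)" using r by (intro mult_right_mono) auto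
    then show ?thesis by (simp add: power_mult_distrib mult_ac)
  qed (simp add: a0)
  have ts: "(\<lambda>\<alpha>. t * (cmod (a \<alpha>) * r ^ wt \<alpha>)) summable_on multi_idx" by (rule summable_on_cmult_right[OF a(1)])
  have s: "(\<lambda>\<alpha>. cmod (a \<alpha>) * (t * r) ^ wt \<alpha>) summable_on multi_idx"
    by (rule summable_on_comparison_test[OF ts le]) (use r t in auto)
  have "(\<Sum>\<^sub>\<infinity>\<alpha>\<in>multi_idx. cmod (a \<alpha>) * (t * r) ^ wt \<alpha>) \<le> (\<Sum>\<^sub>\<infinity>\<alpha>\<in>multi_idx. t * (cmod (a \<alpha>) * r ^ wt \<alpha>))"
    by (rule infsum_mono[OF s ts le])
  also have "\<dots> = t * (\<Sum>\<^sub>\<infinity>\<alpha>\<in>multi_idx. cmod (a \<alpha>) * r ^ wt \<alpha>)" by (rule infsum_cmult_right) (rule a(1))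
  also have "\<dots> \<le> t * N" using a(2) t by simp
  finally have "(\<Sum>\<^sub>\<infinity>\<alpha>\<in>multi_idx. cmod (a \<alpha>) * (t * r) ^ wt \<alpha>) \<le> t * N" .
  moreover have "polydisc p (t * r) \<subseteq> polydisc p r" by (rule polydisc_mono) (use r t in auto)
  ultimately show ?thesis unfolding ana_with_def using s a(3) by blast
qed

definition ana :: "'a::euclidean_space \<Rightarrow> ('a \<Rightarrow> complex) \<Rightarrow> bool" where
  "ana p f \<longleftrightarrow> (\<exists>r>0. \<exists>N. ana_with p r N f)"

lemma ana_const: "ana p (\<lambda>_. c)"
  unfolding ana_def using ana_with_const[of 1] by (intro exI[of _ 1]) auto

lemma ana_common:
  assumes "ana p f" "ana p g"
  obtains r N M where "0 < r" "ana_with p r N f" "ana_with p r M g"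
proof -
  obtain r s N M where rs: "0 < r" "ana_with p r N f" "0 < s" "ana_with p s M g"
    using assms unfolding ana_def by blast
  have "ana_with p (min r s) N f" by (rule ana_with_mono[OF rs(2)]) (use rs in auto)
  moreover have "ana_with p (min r s) M g" by (rule ana_with_mono[OF rs(4)]) (use rs in auto)
  ultimately show ?thesis using that[of "min r s"] rs by simp
qed

lemma ana_add: "ana p f \<Longrightarrow> ana p g \<Longrightarrow> ana p (\<lambda>x. f x + g x)"
  by (erule (1) ana_common) (use ana_with_add in \<open>unfold ana_def, blast\<close>)
lemma ana_mult: "ana p f \<Longrightarrow> ana p g \<Longrightarrow> ana p (\<lambda>x. f x * g x)"
  by (erule (1) ana_common) (use ana_with_mult in \<open>unfold ana_def, blast\<close>)
lemma ana_linear: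
  assumes "linear L"
  shows "ana p L"
proof -
  have "ana p (\<lambda>x. L p + L (x - p))"
    by (rule ana_add[OF ana_const]) (use ana_with_linear[OF zero_less_one assms] zero_less_one in \<open>unfold ana_def, blast\<close>)
  then show ?thesis by (simp add: linear_diff[OF assms])
qed
lemma ana_uminus: "ana p f \<Longrightarrow> ana p (\<lambda>x. - f x)"
  using ana_mult[OF ana_const[of p "-1"], of f] by simp
lemma ana_diff: "ana p f \<Longrightarrow> ana p g \<Longrightarrow> ana p (\<lambda>x. f x - g x)"
  using ana_add[OF _ ana_uminus, of p f g] by simp
lemma ana_sum: "(\<And>i. i \<in> I \<Longrightarrow> ana p (f i)) \<Longrightarrow> ana p (\<lambda>x. \<Sum>i\<in>I. f i x)"
  by (induction I rule: infinite_finite_induct) (auto intro: ana_const ana_add)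

text \<open>The power series of F at g p is applied to g - g p. Shrinking the polydisc brings the
  norm of this difference down to \<rho> / 2, well inside the disc of convergence, and then the
  series of its powers converges in norm.\<close>

lemma ana_compose:
  assumes g: "ana p g" and F: "F holomorphic_on S" "open S" "g p \<in> S"
  shows "ana p (\<lambda>x. F (g x))"
proof -
  define y where "y = g p"
  obtain \<rho> where \<rho>: "\<rho> > 0" "ball y \<rho> \<subseteq> S" using F(2,3) open_contains_ball unfolding y_def by blast
  have hol: "F holomorphic_on ball y \<rho>" using F(1) \<rho>(2) by (rule holomorphic_on_subset)
  define c where "c n = (deriv ^^ n) F y / fact n" for n
  have c: "(\<lambda>n. c n * (w - y) ^ n) sums F w" if "w \<in> ball y \<rho>" for w
    unfolding c_def by (rule holomorphic_power_series[OF hol that])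
  obtain r N where rN: "0 < r" "ana_with p r N (\<lambda>x. g x - y)"
    using ana_diff[OF g ana_const[of p y]] unfolding ana_def by blast
  have N0: "0 \<le> N" by (rule ana_with_nonneg[OF rN])
  define t where "t = min 1 (\<rho> / (2 * (N + 1)))"
  have t: "0 < t" "t \<le> 1" "t * N \<le> \<rho> / 2"
  proof -
    show "0 < t" "t \<le> 1" using \<rho>(1) N0 unfolding t_def by simp_all
    have "t * N \<le> \<rho> / (2 * (N + 1)) * N" using N0 by (intro mult_right_mono) (auto simp: t_def)
    also have "\<dots> \<le> \<rho> / 2" using N0 \<rho>(1) by (simp add: field_simps)
    finally show "t * N \<le> \<rho> / 2" .
  qed
  have tr: "0 < t * r" using t rN by simp
  have sh: "ana_with p (t * r) (t * N) (\<lambda>x. g x - y)"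
    by (rule ana_with_shrink[OF rN _ t(1,2)]) (simp add: y_def)
  have sh': "ana_with p (t * r) (\<rho> / 2) (\<lambda>x. g x - y)"
    by (rule ana_with_mono[OF sh tr order_refl t(3)])
  \<comment> \<open>Convergence at the larger radius 3 \<rho> / 4 gives absolute convergence at
    \<rho> / 2.\<close>
  have smm: "summable (\<lambda>n. norm (c n * (of_real (\<rho> / 2)) ^ n))"
  proof (rule powser_insidea)
    have "y + of_real (3 * \<rho> / 4) \<in> ball y \<rho>" using \<rho>(1) by (simp add: dist_norm)
    from sums_summable[OF c[OF this]] show "summable (\<lambda>n. c n * (of_real (3 * \<rho> / 4)) ^ n)" by simp
    show "norm (of_real (\<rho> / 2) :: complex) < norm (of_real (3 * \<rho> / 4) :: complex)" using \<rho>(1) by (simp only: norm_of_real)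
  qed
  then have cs: "summable (\<lambda>n. cmod (c n) * (\<rho> / 2) ^ n)" using \<rho>(1) by (simp add: norm_mult norm_power)
  have "ana_with p (t * r) (\<Sum>n. cmod (c n) * (\<rho> / 2) ^ n) (\<lambda>x. F (g x))"
  proof (rule ana_with_has_sum[OF tr, where K = UNIV and g = "\<lambda>n x. c n * (g x - y) ^ n" and N = "\<lambda>n. cmod (c n) * (\<rho> / 2) ^ n"])
    show "ana_with p (t * r) (cmod (c n) * (\<rho> / 2) ^ n) (\<lambda>x. c n * (g x - y) ^ n)" for n
      by (rule ana_with_mult[OF tr ana_with_const[OF tr] ana_with_power[OF tr sh']])
    show "((\<lambda>n. cmod (c n) * (\<rho> / 2) ^ n) has_sum (\<Sum>n. cmod (c n) * (\<rho> / 2) ^ n)) UNIV"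
      by (rule norm_summable_imp_has_sum) (use cs \<rho>(1) in \<open>auto simp: abs_mult summable_sums\<close>)
    fix x assume x: "x \<in> polydisc p (t * r)"
    have b: "cmod (g x - y) \<le> \<rho> / 2" by (rule ana_with_bound[OF sh' x])
    then have "g x \<in> ball y \<rho>" using \<rho>(1) by (simp add: dist_norm norm_minus_commute)
    from c[OF this] show "((\<lambda>n. c n * (g x - y) ^ n) has_sum F (g x)) UNIV"
    proof (rule norm_summable_imp_has_sum[rotated])
      show "summable (\<lambda>n. norm (c n * (g x - y) ^ n))"
        by (rule summable_comparison_test'[OF cs, of 0]) (use b in \<open>auto simp: norm_mult norm_power intro!: mult_left_mono power_mono\<close>)
    qed
  qed
  then show ?thesis unfolding ana_def using tr by blast
qed

lemma ana_inverse: "ana p f \<Longrightarrow> f p \<noteq> 0 \<Longrightarrow> ana p (\<lambda>x. inverse (f x))"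
  by (rule ana_compose[where F = inverse and S = "- {0}"]) (auto intro!: holomorphic_intros)

lemma ana_powr: "ana p f \<Longrightarrow> Re (f p) > 0 \<Longrightarrow> ana p (\<lambda>x. f x powr a)"
  by (rule ana_compose[where F = "\<lambda>w. w powr a" and S = "{w. Re w > 0}"])
     (auto intro!: holomorphic_intros simp: complex_nonpos_Reals_iff open_halfspace_Re_gt)

lemma ana_component: "ana p (\<lambda>x. x $ i)" for p :: "complex ^ 'n::finite"
  by (rule ana_linear) (auto intro!: linearI)
lemma ana_cnj_component: "ana p (\<lambda>x. cnj (x $ i))" for p :: "complex ^ 'n::finite"
  by (rule ana_linear) (auto intro!: linearI)

lemma has_sum_finite_sum:
  fixes f :: "'i \<Rightarrow> 'j \<Rightarrow> 'b::topological_ab_group_add"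
  assumes "\<And>i. i \<in> I \<Longrightarrow> (f i has_sum S i) A"
  shows "((\<lambda>\<alpha>. \<Sum>i\<in>I. f i \<alpha>) has_sum (\<Sum>i\<in>I. S i)) A"
  using assms by (induction I rule: infinite_finite_induct) (auto intro: has_sum_add)

text \<open>The entries may have different radii; as there are finitely many, their minimum serves
  all of them, and the coefficient matrices are assembled entry by entry.\<close>

lemma real_analytic_matrixI:
  fixes F :: "complex ^ 'n::finite \<Rightarrow> complex ^ 'n ^ 'n"
  assumes "\<And>p. p \<in> S \<Longrightarrow> \<exists>e>0. \<exists>G. (\<forall>i j. ana p (G i j)) \<and> (\<forall>x\<in>ball p e. \<forall>i j. F x $ i $ j = G i j x)"
  shows "real_analytic_on S F"
  unfolding real_analytic_on_def
proof
  fix p assume "p \<in> S"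
  then obtain e G where e: "e > 0" and G: "\<And>i j. ana p (G i j)" "\<And>x i j. x \<in> ball p e \<Longrightarrow> F x $ i $ j = G i j x"
    using assms by metis
  have "\<exists>r N. 0 < r \<and> ana_with p r N (G i j)" for i j using G(1) unfolding ana_def by blast
  then obtain r N where r: "\<And>i j. 0 < r i j" "\<And>i j. ana_with p (r i j) (N i j) (G i j)" by metis
  define s where "s = Min (insert e (range (\<lambda>(i, j). r i j)))"
  have s: "0 < s" "s \<le> e" unfolding s_def using e r(1) by (auto simp: Min_gr_iff)
  have s3: "s \<le> r i j" for i j
    unfolding s_def by (rule Min_le) (auto intro: image_eqI[of _ _ "(i, j)"])
  have "\<exists>a. \<forall>x\<in>polydisc p (r i j). ((\<lambda>\<alpha>. mon p x \<alpha> *\<^sub>R a \<alpha>) has_sum G i j x) multi_idx" for i j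
    using r(2)[of i j] unfolding ana_with_def by blast
  then obtain a where a: "\<And>i j x. x \<in> polydisc p (r i j) \<Longrightarrow> ((\<lambda>\<alpha>. mon p x \<alpha> *\<^sub>R a i j \<alpha>) has_sum G i j x) multi_idx" by metis
  define b where "b \<alpha> = (\<Sum>i\<in>UNIV. \<Sum>j\<in>UNIV. axis i (axis j (a i j \<alpha>)))" for \<alpha>
  have lin: "bounded_linear (\<lambda>c::complex. axis i (axis j c) :: complex ^ 'n ^ 'n)" for i j
    by (rule linear_conv_bounded_linear[THEN iffD1], rule linearI) (auto simp: axis_def vec_eq_iff)
  show "\<exists>r>0. \<exists>a. \<forall>x\<in>ball p r. ((\<lambda>\<alpha>. (\<Prod>b\<in>Basis. ((x - p) \<bullet> b) ^ \<alpha> b) *\<^sub>R a \<alpha>) has_sum F x) (Basis \<rightarrow>\<^sub>E UNIV)"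
  proof (intro exI[of _ s] conjI exI[of _ b] ballI s(1))
    fix x assume x: "x \<in> ball p s"
    have xi: "x \<in> polydisc p (r i j)" for i j
    proof -
      have "x \<in> ball p (r i j)" using x s3[of i j] by simp
      then show ?thesis using ball_subset_polydisc by blast
    qed
    have "((\<lambda>\<alpha>. \<Sum>i\<in>UNIV. \<Sum>j\<in>UNIV. axis i (axis j (mon p x \<alpha> *\<^sub>R a i j \<alpha>))) has_sum (\<Sum>i\<in>UNIV. \<Sum>j\<in>UNIV. axis i (axis j (G i j x)))) multi_idx"
      by (intro has_sum_finite_sum has_sum_bounded_linear[OF lin a[OF xi]])
    moreover have ax: "axis i (axis j c) $ k $ l = (if l = j then if k = i then c else 0 else 0)" for i j k l :: 'n and c :: complex
      by (simp add: axis_def)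
    have "(\<Sum>i\<in>UNIV. \<Sum>j\<in>UNIV. axis i (axis j (M $ i $ j))) = M" for M :: "complex ^ 'n ^ 'n"
      by (simp add: vec_eq_iff ax)
    from this[of "F x"] have "(\<Sum>i\<in>UNIV. \<Sum>j\<in>UNIV. axis i (axis j (G i j x))) = F x"
      using G(2)[of x] x s(2) by simp
    moreover have "(\<Sum>i\<in>UNIV. \<Sum>j\<in>UNIV. axis i (axis j (mon p x \<alpha> *\<^sub>R a i j \<alpha>))) = mon p x \<alpha> *\<^sub>R b \<alpha>" for \<alpha>
      unfolding b_def scaleR_sum_right using linear_scale[OF bounded_linear.linear[OF lin]] by simp
    ultimately show "((\<lambda>\<alpha>. (\<Prod>b\<in>Basis. ((x - p) \<bullet> b) ^ \<alpha> b) *\<^sub>R b \<alpha>) has_sum F x) (Basis \<rightarrow>\<^sub>E UNIV)"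
      unfolding mon_def multi_idx_def by simp
  qed
qed

section \<open>Analyticity of the Wu metric off the slice\<close>

lemma open_egg_minus_slice:
  assumes "0 < m"
  shows "open (egg \<iota> m - egg_slice \<iota> m)"
proof -
  have "egg \<iota> m - egg_slice \<iota> m = egg \<iota> m \<inter> {z. z $ \<iota> \<noteq> 0}" by (auto simp: egg_slice_def)
  moreover have "open {z :: complex ^ 'a. z $ \<iota> \<noteq> 0}" by (intro open_Collect_neq continuous_intros)
  ultimately show ?thesis using open_egg[OF assms] by auto
qed

text \<open>Real powers become complex ones, and |z|^2 becomes z cnj z, so that the coefficient is
  visibly composed of holomorphic functions and polynomials in z and cnj z.\<close>

lemma normal_coeff_complex:
  assumes "0 < m" "z \<in> egg \<iota> m"
  shows "of_real (normal_coeff \<iota> m z) = of_real (gap \<iota> z) powr of_real (1/m)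
     * inverse ((of_real (gap \<iota> z) powr of_real (1/m) - z $ \<iota> * cnj (z $ \<iota>)) * (of_real (gap \<iota> z) powr of_real (1/m) - z $ \<iota> * cnj (z $ \<iota>)))"
proof -
  have "of_real (gap \<iota> z) powr of_real (1/m) = complex_of_real (gap \<iota> z powr (1/m))"
    using egg_facts(1)[OF assms] by (intro powr_of_real) simp
  then show ?thesis unfolding complex_norm_square[symmetric] normal_coeff_def
    by (simp add: divide_inverse power2_eq_square)
qed

lemma tangent_coeff_complex:
  assumes "0 < m" "z \<in> egg \<iota> m" "z $ \<iota> \<noteq> 0"
  shows "of_real (tangent_coeff \<iota> m z) = of_real (gap \<iota> z) * inverse (of_real (gap \<iota> z) - (z $ \<iota> * cnj (z $ \<iota>)) powr of_real m)"
proof -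
  have "(z $ \<iota> * cnj (z $ \<iota>)) powr of_real m = complex_of_real (((cmod (z $ \<iota>))\<^sup>2) powr m)"
    unfolding complex_norm_square[symmetric] by (intro powr_of_real) simp
  then show ?thesis unfolding tangent_coeff_def by (simp add: divide_inverse powr_double)
qed

theorem real_analytic_wu_egg:
  assumes m: "0 < m" "m < 1"
  shows "real_analytic_on (egg \<iota> m - egg_slice \<iota> m) (wu_metric (egg \<iota> m))"
proof (rule real_analytic_matrixI)
  fix p :: "complex ^ 'a" assume p: "p \<in> egg \<iota> m - egg_slice \<iota> m"
  then have pe: "p \<in> egg \<iota> m" and p0: "p $ \<iota> \<noteq> 0" by (auto simp: egg_slice_def)
  obtain e where e: "e > 0" "ball p e \<subseteq> egg \<iota> m - egg_slice \<iota> m"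
    using open_egg_minus_slice[OF m(1)] p open_contains_ball by blast
  note f = egg_facts[OF m(1) pe]
  let ?s = "\<lambda>z. complex_of_real (gap \<iota> z)" and ?q = "\<lambda>z :: complex ^ 'a. z $ \<iota> * cnj (z $ \<iota>)"
  have s: "ana p ?s"
  proof -
    have "?s = (\<lambda>z. 1 - (\<Sum>i\<in>UNIV - {\<iota>}. z $ i * cnj (z $ i)))"
      by (simp add: fun_eq_iff gap_def complex_norm_square of_real_power del: of_real_power)
    then show ?thesis by (simp only:) (intro ana_diff ana_const ana_sum ana_mult ana_component ana_cnj_component)
  qed
  have q: "ana p ?q" by (rule ana_mult[OF ana_component ana_cnj_component])
  have k: "ana p (\<lambda>z. ?s z powr of_real (1/m))" by (rule ana_powr[OF s]) (use f in simp)
  \<comment> \<open>Here p must lie off the slice: the base is then positive at p, and the power m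
    is holomorphic in the right half-plane.\<close>
  have rq: "ana p (\<lambda>z. ?q z powr of_real m)"
    by (rule ana_powr[OF q]) (use p0 in \<open>simp add: complex_norm_square[symmetric] del: of_real_power\<close>)
  have kp: "?s p powr of_real (1/m) = complex_of_real (gap \<iota> p powr (1/m))"
    using f by (intro powr_of_real) simp
  have qp: "?q p = of_real ((cmod (p $ \<iota>))\<^sup>2)" by (rule complex_norm_square[symmetric])
  have rqp: "?q p powr of_real m = of_real (cmod (p $ \<iota>) powr (2 * m))"
    unfolding qp by (subst powr_of_real) (auto simp: powr_double)
  have N: "ana p (\<lambda>z. ?s z powr of_real (1/m) * inverse ((?s z powr of_real (1/m) - ?q z) * (?s z powr of_real (1/m) - ?q z)))"
  proof (intro ana_mult[OF k ana_inverse] ana_mult[OF ana_diff[OF k q] ana_diff[OF k q]])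
    have "?s p powr of_real (1/m) - ?q p = of_real (gap \<iota> p powr (1/m) - (cmod (p $ \<iota>))\<^sup>2)" unfolding kp qp by simp
    then show "(?s p powr of_real (1/m) - ?q p) * (?s p powr of_real (1/m) - ?q p) \<noteq> 0" using f by (simp del: of_real_diff)
  qed
  have T: "ana p (\<lambda>z. ?s z * inverse (?s z - ?q z powr of_real m))"
  proof (intro ana_mult[OF s ana_inverse] ana_diff[OF s rq])
    show "?s p - ?q p powr of_real m \<noteq> 0" unfolding rqp using f by (simp flip: of_real_diff)
  qed
  have is1: "ana p (\<lambda>z. inverse (?s z))" by (rule ana_inverse[OF s]) (use f in simp)
  have h1: "ana p (\<lambda>z. hprod \<iota> (axis i 1) z)" for i
    by (cases "i = \<iota>") (simp_all add: hprod_axis_left ana_const ana_cnj_component)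
  have h2: "ana p (\<lambda>z. cnj (hprod \<iota> (axis i 1) z))" for i
    by (cases "i = \<iota>") (simp_all add: hprod_axis_left ana_const ana_component)
  have A: "ana p (\<lambda>z. conn_form \<iota> m z (axis i 1))" for i
  proof -
    have "(\<lambda>z. conn_form \<iota> m z (axis i 1)) = (\<lambda>z. axis i 1 $ \<iota> + of_real (1/m) * (z $ \<iota> * inverse (?s z) * hprod \<iota> (axis i 1) z))"
      by (simp add: conn_form_def fun_eq_iff divide_inverse mult_ac)
    then show ?thesis by (simp only:) (intro ana_add ana_mult ana_const ana_component is1 h1)
  qed
  have cA: "ana p (\<lambda>z. cnj (conn_form \<iota> m z (axis i 1)))" for i
  proof -
    have "(\<lambda>z. cnj (conn_form \<iota> m z (axis i 1))) = (\<lambda>z. cnj (axis i 1 $ \<iota>) + of_real (1/m) * (cnj (z $ \<iota>) * inverse (?s z) * cnj (hprod \<iota> (axis i 1) z)))"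
      by (simp add: conn_form_def fun_eq_iff divide_inverse mult_ac)
    then show ?thesis by (simp only:) (intro ana_add ana_mult ana_const ana_cnj_component is1 h2)
  qed
  define G where "G i j z = ?s z powr of_real (1/m) * inverse ((?s z powr of_real (1/m) - ?q z) * (?s z powr of_real (1/m) - ?q z))
      * conn_form \<iota> m z (axis i 1) * cnj (conn_form \<iota> m z (axis j 1))
    + ?s z * inverse (?s z - ?q z powr of_real m) * (hprod \<iota> (axis i 1) (axis j 1) * inverse (?s z)
        + hprod \<iota> (axis i 1) z * cnj (hprod \<iota> (axis j 1) z) * (inverse (?s z) * inverse (?s z)))" for i j z
  have "ana p (G i j)" for i j
    unfolding G_def[abs_def] by (intro ana_add ana_mult[OF N] ana_mult[OF ana_mult[OF N A] cA] ana_mult[OF T] ana_mult ana_const is1 h1 h2)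
  moreover have "wu_metric (egg \<iota> m) x $ i $ j = G i j x" if "x \<in> ball p e" for x i j
  proof -
    have x: "x \<in> egg \<iota> m" "x $ \<iota> \<noteq> 0" using that e(2) by (auto simp: egg_slice_def)
    show ?thesis unfolding wu_metric_egg[OF m x(1)] egg_wu_def vec_lambda_beta G_def
      normal_coeff_complex[OF m(1) x(1)] tangent_coeff_complex[OF m(1) x] by (simp add: divide_inverse power2_eq_square)
  qed
  ultimately show "\<exists>e>0. \<exists>G. (\<forall>i j. ana p (G i j)) \<and> (\<forall>x\<in>ball p e. \<forall>i j. wu_metric (egg \<iota> m) x $ i $ j = G i j x)"
    using e(1) by blast
qed

section \<open>Continuity and torsion\<close>

lemma continuous_on_gap: "continuous_on S (gap \<iota>)"
  unfolding gap_def[abs_def] by (intro continuous_intros)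

lemma continuous_hermitian_metric_egg:
  assumes m: "0 < m" "m < 1"
  shows "continuous_hermitian_metric_on (egg \<iota> m) (wu_metric (egg \<iota> m))"
  unfolding continuous_hermitian_metric_on_def
proof
  have ne: "0 < gap \<iota> z" "gap \<iota> z \<noteq> 0" "gap \<iota> z powr (1/m) - (cmod (z $ \<iota>))\<^sup>2 \<noteq> 0" "gap \<iota> z - cmod (z $ \<iota>) powr (2 * m) \<noteq> 0"
    if "z \<in> egg \<iota> m" for z
    using egg_facts[OF m(1) that] by auto
  have N: "continuous_on (egg \<iota> m) (normal_coeff \<iota> m)"
    unfolding normal_coeff_def[abs_def]
    by (intro continuous_intros continuous_on_gap continuous_on_powr') (auto dest: ne intro: less_imp_le)
  \<comment> \<open>Continuity extends across the slice because a power with positive exponent is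
    continuous at 0.\<close>
  have T: "continuous_on (egg \<iota> m) (tangent_coeff \<iota> m)"
    unfolding tangent_coeff_def[abs_def] using m(1)
    by (intro continuous_intros continuous_on_gap continuous_on_powr') (auto dest: ne)
  have H: "continuous_on (egg \<iota> m) (\<lambda>z. hprod \<iota> (axis i 1) z)" for i
    unfolding hprod_def by (intro continuous_intros)
  have A: "continuous_on (egg \<iota> m) (\<lambda>z. conn_form \<iota> m z (axis i 1))" for i
    unfolding conn_form_def using m(1)
    by (intro continuous_intros H continuous_on_gap) (auto dest: ne)
  have "continuous_on (egg \<iota> m) (egg_wu \<iota> m)"
    unfolding egg_wu_def[abs_def]
    by (intro continuous_intros H A N T continuous_on_gap) (auto dest: ne)
  then show "continuous_on (egg \<iota> m) (wu_metric (egg \<iota> m))"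
    by (rule continuous_on_eq) (simp add: wu_metric_egg[OF m])
qed (simp add: wu_metric_egg[OF m] hermitian_inner_product_egg_wu[OF m(1)])

text \<open>Total differentiability is obtained from the general rules; the value of the derivative
  in one direction then reduces to calculus in one real variable.\<close>

lemma frechet_derivative_of_real_direction:
  fixes g :: "'a::real_normed_vector \<Rightarrow> real" and f :: "'a \<Rightarrow> complex"
  assumes S: "open S" "p \<in> S" and eq: "\<And>z. z \<in> S \<Longrightarrow> f z = of_real (g z)"
    and g: "g differentiable (at p)" and d: "((\<lambda>t. g (p + t *\<^sub>R u)) has_real_derivative d) (at 0)"
  shows "frechet_derivative f (at p) u = of_real d"
proof -
  define D where "D = frechet_derivative g (at p)"
  have D: "(g has_derivative D) (at p)" using g unfolding D_def by (simp add: frechet_derivative_works)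
  have "((\<lambda>z. complex_of_real (g z)) has_derivative (\<lambda>w. of_real (D w))) (at p)"
    by (rule bounded_linear.has_derivative[OF bounded_linear_of_real D])
  then have "(f has_derivative (\<lambda>w. of_real (D w))) (at p)"
    by (rule has_derivative_transform_within_open[OF _ S]) (simp add: eq)
  then have f: "frechet_derivative f (at p) = (\<lambda>w. of_real (D w))" by (rule frechet_derivative_at[symmetric])
  have "((\<lambda>t. p + t *\<^sub>R u) has_derivative (\<lambda>t. t *\<^sub>R u)) (at 0)" by (auto intro!: derivative_eq_intros)
  then have "((\<lambda>t. g (p + t *\<^sub>R u)) has_derivative (\<lambda>t. D (t *\<^sub>R u))) (at 0)"
    using has_derivative_compose[of "\<lambda>t. p + t *\<^sub>R u" "\<lambda>t. t *\<^sub>R u" 0 UNIV g D] D by simp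
  moreover have "((\<lambda>t. g (p + t *\<^sub>R u)) has_derivative (*) d) (at 0)" using d by (simp add: has_field_derivative_def)
  ultimately have "(\<lambda>t. D (t *\<^sub>R u)) = (*) d" by (rule has_derivative_unique)
  from fun_cong[OF this, of 1] show ?thesis by (simp add: f)
qed

lemma differentiable_powr_real:
  fixes g :: "'a::real_normed_vector \<Rightarrow> real"
  assumes "g differentiable (at p)" "g p > 0"
  shows "(\<lambda>z. g z powr a) differentiable (at p)"
proof -
  obtain D where "(g has_derivative D) (at p)" using assms(1) by (auto simp: differentiable_def)
  from has_derivative_powr[OF this has_derivative_const[of a]] assms(2) show ?thesis by (auto simp: differentiable_def)
qed

lemma differentiable_component:
  fixes p :: "complex ^ 'n::finite"
  shows "(\<lambda>z. Re (z $ i)) differentiable (at p)" "(\<lambda>z. Im (z $ i)) differentiable (at p)"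
proof -
  have "bounded_linear (\<lambda>z :: complex ^ 'n. Re (z $ i))" "bounded_linear (\<lambda>z :: complex ^ 'n. Im (z $ i))"
    by (auto intro: bounded_linear_compose[OF bounded_linear_Re bounded_linear_vec_nth] bounded_linear_compose[OF bounded_linear_Im bounded_linear_vec_nth])
  then show "(\<lambda>z. Re (z $ i)) differentiable (at p)" "(\<lambda>z. Im (z $ i)) differentiable (at p)"
    by (auto intro: bounded_linear_imp_differentiable)
qed

lemma differentiable_cmod_sq:
  fixes p :: "complex ^ 'n::finite"
  shows "(\<lambda>z. (cmod (z $ i))\<^sup>2) differentiable (at p)"
  unfolding cmod_power2 by (intro differentiable_add differentiable_power differentiable_component)

lemma differentiable_gap: "gap \<iota> differentiable (at p)"
  unfolding gap_def[abs_def] by (intro differentiable_diff differentiable_const differentiable_sum) (auto intro: differentiable_cmod_sq)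

lemma differentiable_normal_coeff:
  assumes "0 < m" "p \<in> egg \<iota> m"
  shows "normal_coeff \<iota> m differentiable (at p)"
  unfolding normal_coeff_def[abs_def] using egg_facts[OF assms]
  by (intro differentiable_divide differentiable_power differentiable_diff differentiable_powr_real differentiable_gap differentiable_cmod_sq) auto

lemma differentiable_tangent_coeff:
  assumes "0 < m" "p \<in> egg \<iota> m" "p $ \<iota> \<noteq> 0"
  shows "tangent_coeff \<iota> m differentiable (at p)"
proof -
  have "(\<lambda>z :: complex ^ 'a. (cmod (z $ \<iota>))\<^sup>2 powr m) differentiable (at p)"
    using assms(3) by (intro differentiable_powr_real differentiable_cmod_sq) simp
  then have "(\<lambda>z :: complex ^ 'a. cmod (z $ \<iota>) powr (2 * m)) differentiable (at p)" by (simp add: powr_double)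
  then show ?thesis unfolding tangent_coeff_def[abs_def] using egg_facts[OF assms(1,2)]
    by (intro differentiable_divide differentiable_diff differentiable_gap) auto
qed

section \<open>Torsion of the fundamental form\<close>

lemma fundamental_form_herm: "fundamental_form h z u v = (\<i> / 2) * (herm (h z) u v - herm (h z) v u)"
  unfolding fundamental_form_def herm_def by (simp add: right_diff_distrib sum_subtractf mult.assoc)

text \<open>The function is the value of the fundamental form on (v, \<i> v) along p + t u. The
  motion in the direction u multiplies r = |z|^2 by (1 + t)^2 and leaves s and K = |w_\<kappa>|^2
  unchanged.\<close>

lemma deriv_normal_direction:
  fixes r S s m K :: real
  assumes "0 < r" "r < S" "0 < s" "r powr m < s" "0 < m"
  shows "((\<lambda>t. S / (S - r * (1 + t)\<^sup>2)\<^sup>2 * (r * (1 + t)\<^sup>2) * K / (m\<^sup>2 * s\<^sup>2)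
      + s / (s - (r * (1 + t)\<^sup>2) powr m) * (1 / s + K / s\<^sup>2)) has_real_derivative
    2 * r * S * (S + r) / (S - r) ^ 3 * K / (m\<^sup>2 * s\<^sup>2) + 2 * m * s * r powr m / (s - r powr m)\<^sup>2 * (1 / s + K / s\<^sup>2)) (at 0)"
proof -
  have 1: "((\<lambda>t. r * (1 + t)\<^sup>2) has_real_derivative 2 * r) (at 0)" by (auto intro!: derivative_eq_intros)
  have "((\<lambda>t. (r * (1 + t)\<^sup>2) powr m) has_real_derivative m * r powr (m - 1) * (2 * r)) (at 0)"
    using DERIV_fun_powr[OF 1, of m] assms by simp
  moreover have "r powr (m - 1) * r = r powr m" using assms powr_mult_base[of r "m - 1"] by (simp add: mult.commute)
  then have "m * r powr (m - 1) * (2 * r) = 2 * m * r powr m" by (metis mult.assoc mult.commute)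
  ultimately have 2: "((\<lambda>t. (r * (1 + t)\<^sup>2) powr m) has_real_derivative 2 * m * r powr m) (at 0)" by metis
  have 3: "((\<lambda>t. S / (S - r * (1 + t)\<^sup>2)\<^sup>2 * (r * (1 + t)\<^sup>2)) has_real_derivative 2 * r * S * (S + r) / (S - r) ^ 3) (at 0)"
    using assms by (auto intro!: derivative_eq_intros 1 simp: divide_simps) (simp add: algebra_simps power2_eq_square power3_eq_cube power4_eq_xxxx eval_nat_numeral)
  have 4: "((\<lambda>t. s / (s - (r * (1 + t)\<^sup>2) powr m)) has_real_derivative 2 * m * s * r powr m / (s - r powr m)\<^sup>2) (at 0)"
    using DERIV_divide[OF DERIV_const DERIV_diff[OF DERIV_const 2], of s s] assms by (simp add: power2_eq_square mult_ac)
  show ?thesis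
    using DERIV_add[OF DERIV_cmult_right[OF 3, of "K / (m\<^sup>2 * s\<^sup>2)"] DERIV_cmult_right[OF 4, of "1 / s + K / s\<^sup>2"]]
    by simp
qed

text \<open>One computation serves both tangential directions: x is the real or the imaginary part
  of w_\<kappa>, and moving it by t changes the gap from s to s - 2 x t - t^2.\<close>

lemma deriv_tangent_direction:
  fixes r s m x :: real
  assumes "0 < s" "r < s powr (1 / m)" "0 < m"
  defines "\<Phi> \<equiv> \<lambda>s. s powr (1 / m) / (s powr (1 / m) - r)\<^sup>2 * (r / (m * s))" and "S \<equiv> s powr (1 / m)"
  shows "((\<lambda>t. \<Phi> (s - 2 * x * t - t\<^sup>2) * (x + t)) has_real_derivative
    r * S / (m * s * (S - r)\<^sup>2) - 2 * x\<^sup>2 * (r * S / (m * s\<^sup>2 * (S - r)\<^sup>2) * (1 / m - 1 - 2 * S / (m * (S - r))))) (at 0)"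
proof -
  have 1: "((\<lambda>t. s - 2 * x * t - t\<^sup>2) has_real_derivative - (2 * x)) (at 0)" by (auto intro!: derivative_eq_intros)
  have "((\<lambda>s. s powr (1 / m)) has_real_derivative 1 / m * s powr (1 / m - 1)) (at s)"
    using assms by (auto intro!: derivative_eq_intros)
  moreover have "s powr (1 / m - 1) = S / s" using assms by (simp add: powr_diff S_def)
  ultimately have 2: "((\<lambda>s. s powr (1 / m)) has_real_derivative S / (m * s)) (at s)" by (simp add: mult_ac)
  have Sr: "S - r \<noteq> 0" using assms by simp
  have d: "(\<Phi> has_real_derivative ((S / (m * s) * (S - r)\<^sup>2 - S * (2 * (S - r) * (S / (m * s)))) / ((S - r)\<^sup>2 * (S - r)\<^sup>2) * (r / (m * s)) - S / (S - r)\<^sup>2 * (r / (m * s\<^sup>2)))) (at s)"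
  proof -
    have gen: "((\<lambda>s. f s / (f s - r)\<^sup>2 * (r / (m * s))) has_real_derivative
        ((S / (m * s) * (S - r)\<^sup>2 - S * (2 * (S - r) * (S / (m * s)))) / ((S - r)\<^sup>2 * (S - r)\<^sup>2) * (r / (m * s)) - S / (S - r)\<^sup>2 * (r / (m * s\<^sup>2)))) (at s)"
      if f: "(f has_real_derivative S / (m * s)) (at s)" and "f s = S" for f
    proof -
      have "((\<lambda>s. r / (m * s)) has_real_derivative - (r / (m * s\<^sup>2))) (at s)"
        using assms(1,3) by (auto intro!: derivative_eq_intros simp: power2_eq_square)
      moreover have "((\<lambda>s. f s / (f s - r)\<^sup>2) has_real_derivative (S / (m * s) * (S - r)\<^sup>2 - S * (2 * (S - r) * (S / (m * s)))) / ((S - r)\<^sup>2 * (S - r)\<^sup>2)) (at s)"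
        using DERIV_divide[OF f DERIV_power[OF DERIV_diff[OF f DERIV_const[of r]], of 2]] Sr that(2) by (simp add: mult_ac)
      from DERIV_mult[OF this calculation] show ?thesis using that(2) by (simp add: mult_ac)
    qed
    show ?thesis unfolding \<Phi>_def by (rule gen[OF 2]) (simp add: S_def)
  qed
  have "(S / (m * s) * (S - r)\<^sup>2 - S * (2 * (S - r) * (S / (m * s)))) / ((S - r)\<^sup>2 * (S - r)\<^sup>2) * (r / (m * s)) - S / (S - r)\<^sup>2 * (r / (m * s\<^sup>2))
     = r * S / (m * s\<^sup>2 * (S - r)\<^sup>2) * (1 / m - 1 - 2 * S / (m * (S - r)))"
  proof -
    define D where "D = S - r"
    then have e: "S = D + r" "S - r = D" and "D \<noteq> 0" using Sr by auto
    then show ?thesis unfolding e(2) unfolding e(1) using assms(1,3)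
      by (simp add: divide_simps) (simp add: algebra_simps power2_eq_square power4_eq_xxxx)
  qed
  with d have 3: "(\<Phi> has_real_derivative r * S / (m * s\<^sup>2 * (S - r)\<^sup>2) * (1 / m - 1 - 2 * S / (m * (S - r)))) (at s)" by simp
  have "((\<lambda>t. \<Phi> (s - 2 * x * t - t\<^sup>2)) has_real_derivative r * S / (m * s\<^sup>2 * (S - r)\<^sup>2) * (1 / m - 1 - 2 * S / (m * (S - r))) * - (2 * x)) (at 0)"
    by (rule DERIV_chain2[OF _ 1]) (use 3 in simp)
  from DERIV_mult[OF this DERIV_add[OF DERIV_const DERIV_ident], of x]
  show ?thesis by (simp add: \<Phi>_def S_def[symmetric] power2_eq_square mult_ac)
qed

text \<open>The two tangential derivatives involve x^2 and y^2 separately, but their sum only K. The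
  factor 1 / s + K / s^2, which is the ball metric of v, then splits off.\<close>

lemma torsion_identity:
  fixes r S s m K R x y :: real
  assumes "r < S" "0 < s" "R < s" "0 < m" "K = x\<^sup>2 + y\<^sup>2"
  shows "(2 * r * S * (S + r) / (S - r) ^ 3 * K / (m\<^sup>2 * s\<^sup>2) + 2 * m * s * R / (s - R)\<^sup>2 * (1 / s + K / s\<^sup>2))
     - (r * S / (m * s * (S - r)\<^sup>2) - 2 * x\<^sup>2 * (r * S / (m * s\<^sup>2 * (S - r)\<^sup>2) * (1 / m - 1 - 2 * S / (m * (S - r)))))
     - (r * S / (m * s * (S - r)\<^sup>2) - 2 * y\<^sup>2 * (r * S / (m * s\<^sup>2 * (S - r)\<^sup>2) * (1 / m - 1 - 2 * S / (m * (S - r)))))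
     = 2 / m * (m\<^sup>2 * s * R / (s - R)\<^sup>2 - r * S / (S - r)\<^sup>2) * (1 / s + K / s\<^sup>2)"
proof -
  define D where "D = S - r"
  then have e: "S = D + r" "S - r = D" and D: "D \<noteq> 0" using assms by auto
  define Q where "Q = s * R / (s - R)\<^sup>2"
  have q: "2 * m * s * R / (s - R)\<^sup>2 = 2 * m * Q" "m\<^sup>2 * s * R / (s - R)\<^sup>2 = m\<^sup>2 * Q" by (simp_all add: Q_def)
  show ?thesis unfolding q e(2) unfolding e(1) using D assms(2,4)
    by (simp add: assms(5) divide_simps) (simp add: algebra_simps power2_eq_square power3_eq_cube power4_eq_xxxx)
qed

text \<open>With E = r / S the bracket is the difference of the two sides of
  \<open>Poincare_coeff_less\<close>; both of its terms are invariant under the scaling that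
  normalizes s to 1.\<close>

lemma torsion_pos:
  fixes r S s m K :: real
  assumes m: "0 < m" "m < 1" and s: "0 < s" and S: "S = s powr (1 / m)" and r: "0 < r" "r < S" and K: "0 \<le> K"
  shows "0 < 2 / m * (m\<^sup>2 * s * (r powr m) / (s - r powr m)\<^sup>2 - r * S / (S - r)\<^sup>2) * (1 / s + K / s\<^sup>2)"
proof -
  define E where "E = r / S"
  have S0: "0 < S" using r by linarith
  have E: "0 < E" "E < 1" using r S0 by (auto simp: E_def)
  have "S powr m = s" using S s m by (simp add: powr_powr)
  then have Em: "E powr m = r powr m / s" using r S0 by (simp add: E_def powr_divide)
  have lt: "r powr m < s" using powr_less_one_of[of E m] E m s unfolding Em by simp
  have 1: "r * S / (S - r)\<^sup>2 = E / (1 - E)\<^sup>2"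
  proof -
    have "r = E * S" using S0 by (simp add: E_def)
    then have "S - r = S * (1 - E)" "r * S = E * S\<^sup>2" by (simp_all add: algebra_simps power2_eq_square)
    then show ?thesis using S0 by (simp add: power_mult_distrib)
  qed
  have 2: "m\<^sup>2 * s * (r powr m) / (s - r powr m)\<^sup>2 = m\<^sup>2 * E powr m / (1 - E powr m)\<^sup>2"
  proof -
    have "r powr m = E powr m * s" using s by (simp add: Em)
    then have "s - r powr m = s * (1 - E powr m)" "m\<^sup>2 * s * (r powr m) = m\<^sup>2 * E powr m * s\<^sup>2" by (simp_all only: algebra_simps power2_eq_square)
    then show ?thesis using s by (simp only: power_mult_distrib) simp
  qed
  have "0 < 1 / s + K / s\<^sup>2" using s K by (intro add_pos_nonneg) auto
  moreover have "0 < 2 / m" using m by simp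
  moreover have "0 < m\<^sup>2 * s * (r powr m) / (s - r powr m)\<^sup>2 - r * S / (S - r)\<^sup>2" unfolding 1 2 using Poincare_coeff_less[OF m E] by simp
  ultimately show ?thesis by (intro mult_pos_pos)
qed

lemma gap_update:
  assumes "\<kappa> \<noteq> \<iota>"
  shows "gap \<iota> (p + axis \<kappa> c) = gap \<iota> p - 2 * Re (cnj (p $ \<kappa>) * c) - (cmod c)\<^sup>2"
proof -
  have "(\<Sum>i\<in>UNIV - {\<iota>}. (cmod ((p + axis \<kappa> c) $ i))\<^sup>2) = (\<Sum>i\<in>UNIV - {\<iota>}. (cmod (p $ i))\<^sup>2 + (if i = \<kappa> then 2 * Re (cnj (p $ \<kappa>) * c) + (cmod c)\<^sup>2 else 0))"
    by (intro sum.cong refl) (simp add: axis_def cmod_power2, simp add: power2_eq_square algebra_simps)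
  then show ?thesis using assms by (simp add: gap_def sum.distrib)
qed

lemma gap_axis_normal: "gap \<iota> (p + axis \<iota> c) = gap \<iota> p"
  unfolding gap_def by (simp add: axis_def)

text \<open>The witnesses are \<open>u = z \<partial>\<^sub>z\<close>, \<open>v = \<partial>\<^sub>\<kappa>\<close> and \<open>x = \<i> v\<close>; for these the exterior derivative is
  \<open>2 \<beta>(v, v) / m\<close> times the difference of the two sides of the decisive inequality.\<close>

lemma not_kaehler_egg:
  fixes \<iota> :: "'n::finite"
  assumes m: "0 < m" "m < 1" and p: "p \<in> egg \<iota> m - egg_slice \<iota> m" and \<kappa>: "\<kappa> \<noteq> \<iota>"
  shows "\<not> kaehler_at (wu_metric (egg \<iota> m)) p"
proof -
  let ?E = "egg \<iota> m - egg_slice \<iota> m" and ?w = "fundamental_form (wu_metric (egg \<iota> m))"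
  define a where "a = p $ \<iota>"
  \<comment> \<open>\<open>ext_deriv2\<close> is evaluated on constant vector fields, so the first
    coordinate is frozen at p.\<close>
  define u where "u = (axis \<iota> a :: complex ^ 'n)"
  define v where "v = (axis \<kappa> 1 :: complex ^ 'n)"
  define x where "x = (axis \<kappa> \<i> :: complex ^ 'n)"
  define r where "r = (cmod a)\<^sup>2"
  define s where "s = gap \<iota> p"
  define S where "S = s powr (1 / m)"
  define b where "b = p $ \<kappa>"
  define K where "K = (cmod b)\<^sup>2"
  have pe: "p \<in> egg \<iota> m" and a0: "a \<noteq> 0" using p by (auto simp: egg_slice_def a_def)
  note op = open_egg_minus_slice[OF m(1), of \<iota>]
  have f: "0 < s" "r powr m < s" "r < S" "0 < r"
    using egg_facts[OF m(1) pe] a0 by (auto simp: s_def S_def r_def a_def powr_double)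
  have wu: "wu_metric (egg \<iota> m) z = egg_wu \<iota> m z" "z \<in> egg \<iota> m" if "z \<in> ?E" for z
    using that wu_metric_egg[OF m] by auto
  have uv: "u $ \<iota> = a" "v $ \<iota> = 0" "x $ \<iota> = 0" "v $ \<kappa> = 1" "x $ \<kappa> = \<i>" using \<kappa> by (auto simp: u_def v_def x_def axis_def)
  have hp: "hprod \<iota> u z = 0" "hprod \<iota> v z = cnj (z $ \<kappa>)" "hprod \<iota> x z = \<i> * cnj (z $ \<kappa>)" "hprod \<iota> z u = 0"
      "hprod \<iota> v x = - \<i>" "hprod \<iota> v v = 1" "hprod \<iota> x v = \<i>" for z
    using \<kappa> by (auto simp: u_def v_def x_def hprod_axis_left hprod_axis_right) (auto simp: axis_def)?

  \<comment> \<open>With x = \<i> v, the form is real on each of the three pairs of vectors, so each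
    derivative is one of a real function along a real line.\<close>
  define g1 where "g1 z = normal_coeff \<iota> m z * (cmod (z $ \<iota>))\<^sup>2 * (cmod (z $ \<kappa>))\<^sup>2 / (m\<^sup>2 * (gap \<iota> z)\<^sup>2)
    + tangent_coeff \<iota> m z * (1 / gap \<iota> z + (cmod (z $ \<kappa>))\<^sup>2 / (gap \<iota> z)\<^sup>2)" for z
  define g2 where "g2 z = normal_coeff \<iota> m z * (1 / (m * gap \<iota> z)) * Re (a * cnj (z $ \<iota>) * (z $ \<kappa>))" for z
  define g3 where "g3 z = - (normal_coeff \<iota> m z * (1 / (m * gap \<iota> z)) * Im (a * cnj (z $ \<iota>) * (z $ \<kappa>)))" for z
  have w1: "?w z v x = of_real (g1 z)" if z: "z \<in> ?E" for z
  proof -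
    have "herm (egg_wu \<iota> m z) v x = - \<i> * herm (egg_wu \<iota> m z) v v"
         "herm (egg_wu \<iota> m z) x v = \<i> * herm (egg_wu \<iota> m z) v v"
      unfolding herm_egg_wu conn_form_def uv hp by (simp_all add: algebra_simps)
    then have "?w z v x = herm (egg_wu \<iota> m z) v v" unfolding fundamental_form_herm wu(1)[OF z] by (simp add: algebra_simps)
    also have "\<dots> = of_real (g1 z)"
      unfolding herm_egg_wu conn_form_def uv hp g1_def of_real_add of_real_mult of_real_divide unfolding complex_norm_square
      by (simp add: divide_inverse power2_eq_square algebra_simps)
    finally show ?thesis .
  qed
  have w2: "?w z u x = of_real (g2 z)" if z: "z \<in> ?E" for z
  proof -
    define c where "c = a * cnj (z $ \<iota>) * z $ \<kappa>"
    define n where "n = normal_coeff \<iota> m z * (1 / (m * gap \<iota> z))"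
    have "herm (egg_wu \<iota> m z) u x = of_real n * (- \<i> * c)" "herm (egg_wu \<iota> m z) x u = of_real n * (\<i> * cnj c)"
      unfolding herm_egg_wu conn_form_def uv hp c_def n_def using hprod_axis_left[of \<iota> \<iota> a x] hprod_axis_right[of \<iota> x \<iota> a]
      by (simp_all add: u_def[symmetric] mult_ac)
    then have "?w z u x = of_real n * ((c + cnj c) / 2)" unfolding fundamental_form_herm wu(1)[OF z] by (simp add: algebra_simps)
    also have "(c + cnj c) / 2 = of_real (Re c)" by (simp add: complex_add_cnj)
    finally show ?thesis by (simp only: g2_def n_def c_def of_real_mult[symmetric])
  qed
  have w3: "?w z u v = of_real (g3 z)" if z: "z \<in> ?E" for z
  proof -
    define c where "c = a * cnj (z $ \<iota>) * z $ \<kappa>"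
    define n where "n = normal_coeff \<iota> m z * (1 / (m * gap \<iota> z))"
    have "herm (egg_wu \<iota> m z) u v = of_real n * c" "herm (egg_wu \<iota> m z) v u = of_real n * cnj c"
      unfolding herm_egg_wu conn_form_def uv hp c_def n_def using hprod_axis_left[of \<iota> \<iota> a v] hprod_axis_right[of \<iota> v \<iota> a]
      by (simp_all add: u_def[symmetric] mult_ac)
    then have "?w z u v = of_real n * (\<i> / 2 * (c - cnj c))" unfolding fundamental_form_herm wu(1)[OF z] by (simp add: algebra_simps)
    also have "\<i> / 2 * (c - cnj c) = of_real (- Im c)" by (simp add: complex_eq_iff)
    finally show ?thesis by (simp only: g3_def n_def c_def of_real_mult[symmetric] mult_minus_right)
  qed

  note dN = differentiable_normal_coeff[OF m(1) pe] and dT = differentiable_tangent_coeff[OF m(1) pe a0[unfolded a_def]]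
  have d1: "g1 differentiable (at p)"
    unfolding g1_def[abs_def] using f m
    by (intro differentiable_add differentiable_mult differentiable_divide differentiable_power dN dT differentiable_gap differentiable_cmod_sq differentiable_const)
      (auto simp: s_def)
  have d2: "g2 differentiable (at p)"
    unfolding g2_def[abs_def] times_complex.sel complex_cnj cnj.sel using f m
    by (intro differentiable_add differentiable_diff differentiable_minus differentiable_mult differentiable_divide dN differentiable_gap differentiable_component differentiable_const)
      (auto simp: s_def)
  have d3: "g3 differentiable (at p)"
    unfolding g3_def[abs_def] times_complex.sel complex_cnj cnj.sel using f m
    by (intro differentiable_add differentiable_diff differentiable_minus differentiable_mult differentiable_divide dN differentiable_gap differentiable_component differentiable_const)
      (auto simp: s_def)

  let ?D1 = "2 * r * S * (S + r) / (S - r) ^ 3 * K / (m\<^sup>2 * s\<^sup>2) + 2 * m * s * r powr m / (s - r powr m)\<^sup>2 * (1 / s + K / s\<^sup>2)"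
  let ?D2 = "\<lambda>x. r * S / (m * s * (S - r)\<^sup>2) - 2 * x\<^sup>2 * (r * S / (m * s\<^sup>2 * (S - r)\<^sup>2) * (1 / m - 1 - 2 * S / (m * (S - r))))"
  have e1: "frechet_derivative (\<lambda>z. ?w z v x) (at p) u = of_real ?D1"
  proof (rule frechet_derivative_of_real_direction[OF op p w1 d1])
    have "g1 (p + t *\<^sub>R u) = S / (S - r * (1 + t)\<^sup>2)\<^sup>2 * (r * (1 + t)\<^sup>2) * K / (m\<^sup>2 * s\<^sup>2)
      + s / (s - (r * (1 + t)\<^sup>2) powr m) * (1 / s + K / s\<^sup>2)" for t
    proof -
      have tu: "t *\<^sub>R u = axis \<iota> (t *\<^sub>R a)" by (simp add: u_def vec_eq_iff axis_def)
      have "(p + axis \<iota> (t *\<^sub>R a)) $ \<iota> = a * of_real (1 + t)" by (simp add: a_def axis_def scaleR_conv_of_real algebra_simps)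
      then have "(cmod ((p + axis \<iota> (t *\<^sub>R a)) $ \<iota>))\<^sup>2 = r * (1 + t)\<^sup>2"
        by (simp only: norm_mult power_mult_distrib norm_of_real r_def power2_abs)
      moreover have "(p + axis \<iota> (t *\<^sub>R a)) $ \<kappa> = b" using \<kappa> by (simp add: axis_def b_def)
      ultimately show ?thesis
        unfolding tu g1_def normal_coeff_def tangent_coeff_def powr_double[OF norm_ge_zero] gap_axis_normal
        by (simp only: s_def[symmetric] S_def[symmetric] K_def)
    qed
    then show "((\<lambda>t. g1 (p + t *\<^sub>R u)) has_real_derivative ?D1) (at 0)"
      using deriv_normal_direction[of r S s m K] f m by simp
  qed
  have tang: "normal_coeff \<iota> m (p + axis \<kappa> c) * (1 / (m * gap \<iota> (p + axis \<kappa> c))) * Re (a * cnj ((p + axis \<kappa> c) $ \<iota>) * ((p + axis \<kappa> c) $ \<kappa>))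
     = (\<lambda>s. s powr (1 / m) / (s powr (1 / m) - r)\<^sup>2 * (r / (m * s))) (s - 2 * Re (cnj b * c) - (cmod c)\<^sup>2) * Re (b + c)"
   "normal_coeff \<iota> m (p + axis \<kappa> c) * (1 / (m * gap \<iota> (p + axis \<kappa> c))) * Im (a * cnj ((p + axis \<kappa> c) $ \<iota>) * ((p + axis \<kappa> c) $ \<kappa>))
     = (\<lambda>s. s powr (1 / m) / (s powr (1 / m) - r)\<^sup>2 * (r / (m * s))) (s - 2 * Re (cnj b * c) - (cmod c)\<^sup>2) * Im (b + c)" for c
  proof -
    have i: "(p + axis \<kappa> c) $ \<iota> = a" "(p + axis \<kappa> c) $ \<kappa> = b + c" using \<kappa> by (auto simp: axis_def a_def b_def)
    have g: "gap \<iota> (p + axis \<kappa> c) = s - 2 * Re (cnj b * c) - (cmod c)\<^sup>2" using gap_update[OF \<kappa>] by (simp add: s_def b_def)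
    have ac: "a * cnj a * (b + c) = of_real r * (b + c)" by (simp only: r_def complex_norm_square)
    show "normal_coeff \<iota> m (p + axis \<kappa> c) * (1 / (m * gap \<iota> (p + axis \<kappa> c))) * Re (a * cnj ((p + axis \<kappa> c) $ \<iota>) * ((p + axis \<kappa> c) $ \<kappa>))
     = (\<lambda>s. s powr (1 / m) / (s powr (1 / m) - r)\<^sup>2 * (r / (m * s))) (s - 2 * Re (cnj b * c) - (cmod c)\<^sup>2) * Re (b + c)"
     "normal_coeff \<iota> m (p + axis \<kappa> c) * (1 / (m * gap \<iota> (p + axis \<kappa> c))) * Im (a * cnj ((p + axis \<kappa> c) $ \<iota>) * ((p + axis \<kappa> c) $ \<kappa>))
     = (\<lambda>s. s powr (1 / m) / (s powr (1 / m) - r)\<^sup>2 * (r / (m * s))) (s - 2 * Re (cnj b * c) - (cmod c)\<^sup>2) * Im (b + c)"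
      unfolding i normal_coeff_def g ac r_def[symmetric] by (simp_all only: Re_complex_of_real Im_complex_of_real times_complex.sel) (simp_all add: mult_ac)
  qed
  have e2: "frechet_derivative (\<lambda>z. ?w z u x) (at p) v = of_real (?D2 (Re b))"
  proof (rule frechet_derivative_of_real_direction[OF op p w2 d2])
    have tv: "t *\<^sub>R v = axis \<kappa> (complex_of_real t)" for t by (simp add: v_def vec_eq_iff axis_def of_real_def)
    show "((\<lambda>t. g2 (p + t *\<^sub>R v)) has_real_derivative ?D2 (Re b)) (at 0)"
      using deriv_tangent_direction[of s r m "Re b"] f m unfolding tv g2_def tang(1) S_def[symmetric]
      by (simp add: mult_ac)
  qed
  have e3: "frechet_derivative (\<lambda>z. ?w z u v) (at p) x = of_real (- ?D2 (Im b))"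
  proof (rule frechet_derivative_of_real_direction[OF op p w3 d3])
    have tx: "t *\<^sub>R x = axis \<kappa> (complex_of_real t * \<i>)" for t by (simp add: x_def vec_eq_iff axis_def of_real_def)
    show "((\<lambda>t. g3 (p + t *\<^sub>R x)) has_real_derivative - ?D2 (Im b)) (at 0)"
      using DERIV_minus[OF deriv_tangent_direction[of s r m "Im b"]] f m unfolding tx g3_def tang(2) S_def[symmetric]
      by (simp add: mult_ac norm_mult)
  qed
  have "ext_deriv2 ?w p u v x = of_real (?D1 - ?D2 (Re b) - ?D2 (Im b))"
    unfolding ext_deriv2_def e1 e2 e3 by simp
  moreover have "?D1 - ?D2 (Re b) - ?D2 (Im b) = 2 / m * (m\<^sup>2 * s * (r powr m) / (s - r powr m)\<^sup>2 - r * S / (S - r)\<^sup>2) * (1 / s + K / s\<^sup>2)"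
    by (rule torsion_identity) (use f m in \<open>auto simp: K_def cmod_power2\<close>)
  moreover have K0: "0 \<le> K" by (simp add: K_def)
  ultimately have "ext_deriv2 ?w p u v x \<noteq> 0"
    using torsion_pos[OF m f(1) S_def f(4,3) K0] by (simp only: of_real_eq_0_iff)
  then show ?thesis unfolding kaehler_at_def by blast
qed

section \<open>Non-constancy of the curvature\<close>

text \<open>The linear factor vanishes at 0, so a limit of c there suffices. In this way a second
  derivative is read off without differentiating the coefficient.\<close>

lemma has_derivative_mult_linear:
  fixes c L :: "complex \<Rightarrow> complex"
  assumes c: "(c \<longlongrightarrow> c0) (at 0)" and L: "bounded_linear L"
  shows "((\<lambda>\<zeta>. c \<zeta> * L \<zeta>) has_derivative (\<lambda>w. c0 * L w)) (at 0)"
proof (rule has_derivativeI)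
  show "bounded_linear (\<lambda>w. c0 * L w)" by (rule bounded_linear_compose[OF bounded_linear_mult_right L])
  interpret L: bounded_linear L by (rule L)
  obtain B where B: "0 \<le> B" "\<And>w. norm (L w) \<le> norm w * B" using L.nonneg_bounded by blast
  have lim: "((\<lambda>\<zeta>. B * norm (c \<zeta> - c0)) \<longlongrightarrow> 0) (at 0)"
    using tendsto_mult_left[OF tendsto_norm[OF Lim_null[THEN iffD1, OF c]], of B] by simp
  show "((\<lambda>y. ((c y * L y - c 0 * L 0) - c0 * L (y - 0)) /\<^sub>R norm (y - 0)) \<longlongrightarrow> 0) (at 0)"
  proof (rule Lim_null_comparison[OF _ lim], rule always_eventually, rule allI)
    fix y
    have "norm ((c y * L y - c 0 * L 0) - c0 * L (y - 0)) = norm (c y - c0) * norm (L y)"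
      by (simp add: L.zero left_diff_distrib[symmetric] norm_mult)
    also have "\<dots> \<le> norm (c y - c0) * (norm y * B)" using B(2) by (intro mult_left_mono) auto
    finally show "norm (((c y * L y - c 0 * L 0) - c0 * L (y - 0)) /\<^sub>R norm (y - 0)) \<le> B * norm (c y - c0)"
      by (cases "y = 0") (auto simp: divide_simps L.zero mult_ac B(1))
  qed
qed

lemma dz_of_has_derivative:
  assumes "(f has_derivative D) (at \<zeta>)"
  shows "dz f \<zeta> = (D 1 - \<i> * D \<i>) / 2" "dzbar f \<zeta> = (D 1 + \<i> * D \<i>) / 2"
  unfolding dz_def dzbar_def frechet_derivative_at[OF assms, symmetric] by (rule refl)+

lemma has_derivative_radial:
  fixes g :: "real \<Rightarrow> real"
  assumes "(g has_real_derivative g') (at ((cmod (\<zeta> + a))\<^sup>2))"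
  shows "((\<lambda>w. complex_of_real (g ((cmod (\<zeta> + w))\<^sup>2))) has_derivative (\<lambda>w. of_real (g' * (2 * Re (cnj (\<zeta> + a) * w))))) (at a)"
proof -
  have "((\<lambda>w. (Re (\<zeta> + w))\<^sup>2 + (Im (\<zeta> + w))\<^sup>2) has_derivative (\<lambda>w. 2 * Re (cnj (\<zeta> + a) * w))) (at a)"
    by (auto intro!: derivative_eq_intros simp: algebra_simps)
  then have q: "((\<lambda>w. (cmod (\<zeta> + w))\<^sup>2) has_derivative (\<lambda>w. 2 * Re (cnj (\<zeta> + a) * w))) (at a)"
    by (simp add: cmod_power2)
  have "(g has_derivative (*) g') (at ((cmod (\<zeta> + a))\<^sup>2))" using assms by (simp add: has_field_derivative_def)
  from has_derivative_compose[OF q this] have "((\<lambda>w. g ((cmod (\<zeta> + w))\<^sup>2)) has_derivative (\<lambda>w. g' * (2 * Re (cnj (\<zeta> + a) * w)))) (at a)" .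
  then show ?thesis by (rule bounded_linear.has_derivative[OF bounded_linear_of_real])
qed

text \<open>Only \<open>g'\<close> is needed: \<open>pdzbar k f\<close> is \<open>g' (\<bar>\<zeta>\<bar>\<^sup>2) * \<zeta>\<close> on the line, which is complex differentiable
  at \<open>0\<close> as soon as \<open>g'\<close> is continuous there.\<close>

lemma pdz_pdzbar_radial:
  fixes f :: "complex ^ 'n::finite \<Rightarrow> complex" and g g' :: "real \<Rightarrow> real"
  assumes d: "d > 0" and f: "\<And>\<zeta>. (cmod \<zeta>)\<^sup>2 < d \<Longrightarrow> f (p + axis k \<zeta>) = of_real (g ((cmod \<zeta>)\<^sup>2))"
    and g: "\<And>x. 0 \<le> x \<Longrightarrow> x < d \<Longrightarrow> (g has_real_derivative g' x) (at x)"
    and g': "isCont g' 0"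
  shows "pdz k f p = 0" and "pdz k (pdzbar k f) p = of_real (g' 0)"
proof -
  have op: "open {\<zeta>. (cmod (\<zeta>0 + \<zeta>))\<^sup>2 < d}" for \<zeta>0 by (intro open_Collect_less continuous_intros)
  have line: "((\<lambda>\<zeta>. f (p + axis k \<zeta>0 + axis k \<zeta>)) has_derivative (\<lambda>w. of_real (g' ((cmod \<zeta>0)\<^sup>2) * (2 * Re (cnj \<zeta>0 * w))))) (at 0)"
    if z: "(cmod \<zeta>0)\<^sup>2 < d" for \<zeta>0
  proof -
    have "((\<lambda>w. complex_of_real (g ((cmod (\<zeta>0 + w))\<^sup>2))) has_derivative (\<lambda>w. of_real (g' ((cmod \<zeta>0)\<^sup>2) * (2 * Re (cnj \<zeta>0 * w))))) (at 0)"
      using has_derivative_radial[of g "g' ((cmod \<zeta>0)\<^sup>2)" \<zeta>0 0] g[OF _ z] by simp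
    then show ?thesis
    proof (rule has_derivative_transform_within_open[OF _ op[of \<zeta>0]])
      show "0 \<in> {\<zeta>. (cmod (\<zeta>0 + \<zeta>))\<^sup>2 < d}" using z by simp
      fix \<zeta> assume "\<zeta> \<in> {\<zeta>. (cmod (\<zeta>0 + \<zeta>))\<^sup>2 < d}"
      moreover have "p + axis k \<zeta>0 + axis k \<zeta> = p + axis k (\<zeta>0 + \<zeta>)" by (simp add: vec_eq_iff axis_def)
      ultimately show "of_real (g ((cmod (\<zeta>0 + \<zeta>))\<^sup>2)) = f (p + axis k \<zeta>0 + axis k \<zeta>)" using f by (simp only: mem_Collect_eq)
    qed
  qed
  have a0: "axis k 0 = (0 :: complex ^ 'n)" by (simp add: vec_eq_iff axis_def)
  show "pdz k f p = 0" unfolding pdz_def using dz_of_has_derivative(1)[OF line[of 0]] d a0 by simp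
  have bar: "pdzbar k f (p + axis k \<zeta>) = of_real (g' ((cmod \<zeta>)\<^sup>2)) * \<zeta>" if "(cmod \<zeta>)\<^sup>2 < d" for \<zeta>
    unfolding pdzbar_def dz_of_has_derivative(2)[OF line[OF that]] by (simp add: complex_eq_iff algebra_simps)
  have "((\<lambda>\<zeta>. (cmod \<zeta>)\<^sup>2) \<longlongrightarrow> (cmod 0)\<^sup>2) (at 0)" by (intro tendsto_intros)
  then have "((\<lambda>\<zeta>. (cmod \<zeta>)\<^sup>2) \<longlongrightarrow> 0) (at 0)" by simp
  from isCont_tendsto_compose[OF g' this] have "((\<lambda>\<zeta>. complex_of_real (g' ((cmod \<zeta>)\<^sup>2))) \<longlongrightarrow> of_real (g' 0)) (at 0)"
    by (rule tendsto_of_real)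
  from has_derivative_mult_linear[OF this bounded_linear_ident]
  have "((\<lambda>\<zeta>. pdzbar k f (p + axis k \<zeta>)) has_derivative (\<lambda>w. of_real (g' 0) * w)) (at 0)"
    by (rule has_derivative_transform_within_open[OF _ op[of 0]]) (use d in \<open>auto simp: bar\<close>)
  from dz_of_has_derivative(1)[OF this] show "pdz k (pdzbar k f) p = of_real (g' 0)"
    unfolding pdz_def by (simp only:) (simp add: complex_eq_iff)
qed

text \<open>When the first derivatives of row \<kappa> vanish at p, the quadratic part of the
  curvature tensor drops out, and with it the inverse matrix.\<close>

lemma hol_sectional_curvature_axis:
  fixes p :: "complex ^ 'n::finite"
  assumes "\<And>\<beta>. pdz \<kappa> (\<lambda>z. h z $ \<kappa> $ \<beta>) p = 0"
  shows "hol_sectional_curvature h p (axis \<kappa> 1) = Re (- pdz \<kappa> (pdzbar \<kappa> (\<lambda>z. h z $ \<kappa> $ \<kappa>)) p / (h p $ \<kappa> $ \<kappa>)\<^sup>2)"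
proof -
  have s: "(\<Sum>i\<in>UNIV. \<Sum>j\<in>UNIV. \<Sum>k\<in>UNIV. \<Sum>l\<in>UNIV. F i j k l * (axis \<kappa> 1 :: complex ^ 'n) $ i * cnj (axis \<kappa> 1 $ j) * axis \<kappa> 1 $ k * cnj (axis \<kappa> 1 $ l)) = F \<kappa> \<kappa> \<kappa> \<kappa>" for F
  proof -
    have "F i j k l * (axis \<kappa> 1 :: complex ^ 'n) $ i * cnj (axis \<kappa> 1 $ j) * axis \<kappa> 1 $ k * cnj (axis \<kappa> 1 $ l)
       = (if l = \<kappa> then if k = \<kappa> then if j = \<kappa> then if i = \<kappa> then F i j k l else 0 else 0 else 0 else 0)" for i j k l
      by (simp add: axis_def)
    then show ?thesis by simp
  qed
  show ?thesis unfolding hol_sectional_curvature_def s curvature_tensor_def assms by (simp add: power2_eq_square)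
qed

text \<open>Along p + \<zeta> e_\<kappa>, which stays in the egg for |\<zeta>|^2 < 1 - R, row
  \<kappa> of the metric is explicit: the diagonal entry is radial, the entry in column \<iota> is a
  radial function times cnj \<zeta>, and the others vanish. So all first \<zeta>-derivatives of the
  row are zero at p, and the curvature is -g' 0 divided by the square of the diagonal entry.\<close>

lemma hol_sectional_curvature_egg_axis:
  fixes \<iota> :: "'n::finite"
  assumes m: "0 < m" "m < 1" and \<kappa>: "\<kappa> \<noteq> \<iota>" and E: "0 < E" "E < 1"
  defines "p \<equiv> axis \<iota> (of_real (sqrt E)) :: complex ^ 'n"
  shows "p \<in> egg \<iota> m - egg_slice \<iota> m"
    and "hol_sectional_curvature (wu_metric (egg \<iota> m)) p (axis \<kappa> 1) = - (E / (1 - E)\<^sup>2 / m\<^sup>2 * (1 - E powr m)\<^sup>2 + 2 - E powr m)"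
proof -
  define R where "R = E powr m"
  have R: "0 < R" "R < 1" using powr_less_one_of[of E m] E m by (auto simp: R_def)
  have pn: "(cmod (sqrt E))\<^sup>2 = E" using E by simp
  have pi: "(p + axis \<kappa> \<zeta>) $ \<iota> = of_real (sqrt E)" "(p + axis \<kappa> \<zeta>) $ \<kappa> = \<zeta>" for \<zeta>
    using \<kappa> by (auto simp: p_def axis_def)
  have pj: "(p + axis \<kappa> \<zeta>) $ j = 0" if "j \<noteq> \<iota>" "j \<noteq> \<kappa>" for j \<zeta> using that by (auto simp: p_def axis_def)
  have g0: "gap \<iota> p = 1" unfolding gap_def p_def by (simp add: axis_def)
  have gap: "gap \<iota> (p + axis \<kappa> \<zeta>) = 1 - (cmod \<zeta>)\<^sup>2" for \<zeta>
    unfolding gap_update[OF \<kappa>] g0 using \<kappa> by (simp add: p_def axis_def)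
  have pow: "cmod (of_real (sqrt E)) powr (2 * m) = R" using E by (simp add: powr_double R_def)
  have egg: "p + axis \<kappa> \<zeta> \<in> egg \<iota> m" if "(cmod \<zeta>)\<^sup>2 < 1 - R" for \<zeta>
    unfolding egg_iff gap pi pow using that by simp
  have a0: "axis \<kappa> 0 = (0 :: complex ^ 'n)" by (simp add: vec_eq_iff axis_def)
  show "p \<in> egg \<iota> m - egg_slice \<iota> m" using egg[of 0] pi(1)[of 0] R E by (simp add: a0 egg_slice_def)

  define S where "S x = (1 - x) powr (1 / m)" for x :: real
  define S' where "S' x = - (1 / m * (1 - x) powr (1 / m - 1))" for x :: real
  define N where "N x = S x / (S x - E)\<^sup>2" for x
  define g where "g x = N x * E * x / (m\<^sup>2 * (1 - x)\<^sup>2) + 1 / ((1 - x) * (1 - x - R))" for x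
  define N' where "N' x = (S' x * (S x - E)\<^sup>2 - S x * (2 * (S x - E) * S' x)) / ((S x - E)\<^sup>2 * (S x - E)\<^sup>2)" for x
  define C where "C x = (1 - x - R) + (1 - x)" for x
  define g' where "g' x = ((N' x * E * x + N x * E) * (m\<^sup>2 * (1 - x)\<^sup>2) + N x * E * x * (2 * m\<^sup>2 * (1 - x))) / ((m\<^sup>2 * (1 - x)\<^sup>2) * (m\<^sup>2 * (1 - x)\<^sup>2))
     + C x / (((1 - x) * (1 - x - R)) * ((1 - x) * (1 - x - R)))" for x
  have SE: "E < S x" if "x < 1 - R" for x
  proof -
    have "R powr (1 / m) < S x" unfolding S_def using that R m by (intro powr_less_mono2) auto
    then show ?thesis using E m by (simp add: R_def powr_powr)
  qed
  have N: "normal_coeff \<iota> m (p + axis \<kappa> \<zeta>) = N ((cmod \<zeta>)\<^sup>2)" for \<zeta>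
    unfolding normal_coeff_def gap pi pn N_def S_def ..
  have T: "tangent_coeff \<iota> m (p + axis \<kappa> \<zeta>) = (1 - (cmod \<zeta>)\<^sup>2) / (1 - (cmod \<zeta>)\<^sup>2 - R)" for \<zeta>
    unfolding tangent_coeff_def gap pi pow ..
  have kk: "wu_metric (egg \<iota> m) (p + axis \<kappa> \<zeta>) $ \<kappa> $ \<kappa> = of_real (g ((cmod \<zeta>)\<^sup>2))" if z: "(cmod \<zeta>)\<^sup>2 < 1 - R" for \<zeta>
  proof -
    let ?x = "(cmod \<zeta>)\<^sup>2"
    have hp: "hprod \<iota> (axis \<kappa> 1) (p + axis \<kappa> \<zeta>) = cnj \<zeta>" using \<kappa> pi by (simp add: hprod_axis_left)
    have h1: "hprod \<iota> (axis \<kappa> 1) (axis \<kappa> 1) = 1" using \<kappa> by (simp add: hprod_axis_left)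
    have ax: "axis \<kappa> (1 :: complex) $ \<iota> = 0" using \<kappa> by (simp add: axis_def)
    have "wu_metric (egg \<iota> m) (p + axis \<kappa> \<zeta>) $ \<kappa> $ \<kappa>
       = of_real (N ?x) * (of_real (sqrt E) / of_real (m * (1 - ?x)) * cnj \<zeta>) * cnj (of_real (sqrt E) / of_real (m * (1 - ?x)) * cnj \<zeta>)
         + of_real ((1 - ?x) / (1 - ?x - R)) * (1 / of_real (1 - ?x) + cnj \<zeta> * cnj (cnj \<zeta>) / of_real ((1 - ?x)\<^sup>2))"
      unfolding wu_metric_egg[OF m egg[OF z]] egg_wu_def vec_lambda_beta N T conn_form_def hp h1 ax gap pi by simp
    also have "\<dots> = of_real (N ?x * (sqrt E * sqrt E / (m * (1 - ?x))\<^sup>2 * ?x) + (1 - ?x) / (1 - ?x - R) * (1 / (1 - ?x) + ?x / (1 - ?x)\<^sup>2))"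
      unfolding of_real_add of_real_mult of_real_divide unfolding complex_norm_square by (simp add: power2_eq_square mult_ac)
    also have "(1 - ?x) / (1 - ?x - R) * (1 / (1 - ?x) + ?x / (1 - ?x)\<^sup>2) = 1 / ((1 - ?x) * (1 - ?x - R))"
    proof -
      have "1 - ?x \<noteq> 0" "1 - ?x - R \<noteq> 0" using z R by auto
      then have "1 / (1 - ?x) = (1 - ?x) / (1 - ?x)\<^sup>2" by (simp add: power2_eq_square)
      then have "1 / (1 - ?x) + ?x / (1 - ?x)\<^sup>2 = 1 / (1 - ?x)\<^sup>2" by (simp add: add_divide_distrib[symmetric])
      then show ?thesis using \<open>1 - ?x \<noteq> 0\<close> by (simp add: power2_eq_square)
    qed
    also have "N ?x * (sqrt E * sqrt E / (m * (1 - ?x))\<^sup>2 * ?x) = N ?x * E * ?x / (m\<^sup>2 * (1 - ?x)\<^sup>2)" using E by (simp add: power_mult_distrib)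
    finally show ?thesis by (simp only: g_def)
  qed
  have dS: "(S has_real_derivative S' x) (at x)" if "x < 1" for x
    unfolding S_def[abs_def] S'_def using that by (auto intro!: derivative_eq_intros)
  have dN: "(N has_real_derivative N' x) (at x)" if "x < 1 - R" for x
  proof -
    have "x < 1" using that R by simp
    then show ?thesis unfolding N_def[abs_def] N'_def using SE[OF that]
      by - (rule DERIV_cong, rule DERIV_divide[OF dS DERIV_power[OF DERIV_diff[OF dS DERIV_const]]],
        simp, simp, simp, simp add: algebra_simps power2_eq_square)
  qed
  have dg: "(g has_real_derivative g' x) (at x)" if "x < 1 - R" for x
  proof -
    have ne: "1 - x \<noteq> 0" "1 - x - R \<noteq> 0" using that R by auto
    have a: "((\<lambda>x. N x * E * x) has_real_derivative N' x * E * x + N x * E) (at x)"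
      by (auto intro!: derivative_eq_intros dN that simp: mult_ac)
    have b: "((\<lambda>x. m\<^sup>2 * (1 - x)\<^sup>2) has_real_derivative - (2 * m\<^sup>2 * (1 - x))) (at x)"
      by (auto intro!: derivative_eq_intros simp: algebra_simps)
    have c: "((\<lambda>x. (1 - x) * (1 - x - R)) has_real_derivative - C x) (at x)"
      unfolding C_def by (auto intro!: derivative_eq_intros simp: algebra_simps)
    show ?thesis unfolding g_def[abs_def] g'_def
      using DERIV_add[OF DERIV_divide[OF a b] DERIV_divide[OF DERIV_const c, of 1]] ne m by simp
  qed
  have S0: "S 0 = 1" by (simp add: S_def)
  have contS: "isCont S 0" "isCont S' 0" unfolding S_def[abs_def] S'_def[abs_def] using m by (auto intro!: continuous_intros)
  have contN: "isCont N 0" "isCont N' 0" unfolding N_def[abs_def] N'_def[abs_def] using E by (auto intro!: continuous_intros contS simp: S0)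
  have contg: "isCont g' 0" unfolding g'_def[abs_def] C_def using E R m by (auto intro!: continuous_intros contN)
  have g'0: "g' 0 = E / (1 - E)\<^sup>2 / m\<^sup>2 + (2 - R) / (1 - R)\<^sup>2"
    unfolding g'_def N_def S0 C_def using m by (simp add: power2_eq_square)

  have dR: "1 - R > 0" using R by simp
  have kz: "pdz \<kappa> (\<lambda>z. wu_metric (egg \<iota> m) z $ \<kappa> $ \<beta>) p = 0" for \<beta>
  proof -
    consider "\<beta> = \<kappa>" | "\<beta> = \<iota>" | "\<beta> \<noteq> \<kappa>" "\<beta> \<noteq> \<iota>" by blast
    then show ?thesis
    proof cases
      case 1
      show ?thesis unfolding 1 by (rule pdz_pdzbar_radial(1)[OF dR kk dg contg]) auto
    next
      case 2
      let ?c = "\<lambda>\<zeta>. complex_of_real (N ((cmod \<zeta>)\<^sup>2) * (sqrt E / (m * (1 - (cmod \<zeta>)\<^sup>2))))"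
      have e: "wu_metric (egg \<iota> m) (p + axis \<kappa> \<zeta>) $ \<kappa> $ \<iota> = ?c \<zeta> * cnj \<zeta>" if z: "(cmod \<zeta>)\<^sup>2 < 1 - R" for \<zeta>
      proof -
        have hp: "hprod \<iota> (axis \<kappa> 1) (p + axis \<kappa> \<zeta>) = cnj \<zeta>" "hprod \<iota> (axis \<iota> 1) (p + axis \<kappa> \<zeta>) = 0"
          "hprod \<iota> (axis \<kappa> 1) (axis \<iota> 1) = 0" using \<kappa> pi by (auto simp: hprod_axis_left hprod_axis_right)
        have ax: "axis \<kappa> (1 :: complex) $ \<iota> = 0" "axis \<iota> (1 :: complex) $ \<iota> = 1" using \<kappa> by (auto simp: axis_def)
        show ?thesis unfolding wu_metric_egg[OF m egg[OF z]] egg_wu_def vec_lambda_beta N T conn_form_def hp ax gap pi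
          by simp
      qed
      have "((\<lambda>\<zeta>. (cmod \<zeta>)\<^sup>2) \<longlongrightarrow> (cmod 0)\<^sup>2) (at 0)" by (intro tendsto_intros)
      then have q: "((\<lambda>\<zeta>. (cmod \<zeta>)\<^sup>2) \<longlongrightarrow> 0) (at 0)" by simp
      have "isCont (\<lambda>x. N x * (sqrt E / (m * (1 - x)))) 0" using m by (intro continuous_intros contN) auto
      from tendsto_of_real[OF isCont_tendsto_compose[OF this q]]
      have "(?c \<longlongrightarrow> of_real (N 0 * (sqrt E / (m * (1 - 0))))) (at 0)" .
      from has_derivative_mult_linear[OF this bounded_linear_cnj]
      have "((\<lambda>\<zeta>. wu_metric (egg \<iota> m) (p + axis \<kappa> \<zeta>) $ \<kappa> $ \<iota>) has_derivative (\<lambda>w. of_real (N 0 * (sqrt E / (m * (1 - 0)))) * cnj w)) (at 0)"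
        by (rule has_derivative_transform_within_open[where s = "{\<zeta>. (cmod \<zeta>)\<^sup>2 < 1 - R}"])
          (use dR in \<open>auto simp: e intro!: open_Collect_less continuous_intros\<close>)
      from dz_of_has_derivative(1)[OF this] show ?thesis unfolding pdz_def 2 by (simp only:) (simp add: complex_eq_iff)
    next
      case 3
      have e: "wu_metric (egg \<iota> m) (p + axis \<kappa> \<zeta>) $ \<kappa> $ \<beta> = 0" if z: "(cmod \<zeta>)\<^sup>2 < 1 - R" for \<zeta>
      proof -
        have hp: "hprod \<iota> (axis \<beta> 1) (p + axis \<kappa> \<zeta>) = 0" "hprod \<iota> (axis \<kappa> 1) (axis \<beta> 1) = 0"
          unfolding hprod_axis_left pj[OF 3(2,1)] using 3 by (auto simp: axis_def)
        have ax: "axis \<beta> (1 :: complex) $ \<iota> = 0" using 3 by (simp add: axis_def)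
        show ?thesis unfolding wu_metric_egg[OF m egg[OF z]] egg_wu_def vec_lambda_beta conn_form_def hp ax by simp
      qed
      have "((\<lambda>\<zeta>. wu_metric (egg \<iota> m) (p + axis \<kappa> \<zeta>) $ \<kappa> $ \<beta>) has_derivative (\<lambda>w. 0)) (at 0)"
        by (rule has_derivative_transform_within_open[OF has_derivative_const, where s = "{\<zeta>. (cmod \<zeta>)\<^sup>2 < 1 - R}"])
          (use dR in \<open>auto simp: e intro!: open_Collect_less continuous_intros\<close>)
      from dz_of_has_derivative(1)[OF this] show ?thesis unfolding pdz_def by simp
    qed
  qed
  have R2: "pdz \<kappa> (pdzbar \<kappa> (\<lambda>z. wu_metric (egg \<iota> m) z $ \<kappa> $ \<kappa>)) p = of_real (g' 0)"
    by (rule pdz_pdzbar_radial(2)[OF dR kk dg contg]) auto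
  have h0: "wu_metric (egg \<iota> m) p $ \<kappa> $ \<kappa> = of_real (1 / (1 - R))"
    using kk[of 0] dR by (simp add: a0 g_def)
  have "hol_sectional_curvature (wu_metric (egg \<iota> m)) p (axis \<kappa> 1) = - g' 0 / (1 / (1 - R))\<^sup>2"
    unfolding hol_sectional_curvature_axis[OF kz] R2 h0 by (simp only: of_real_minus[symmetric] of_real_power[symmetric] of_real_divide[symmetric] Re_complex_of_real)
  also have "\<dots> = - (E / (1 - E)\<^sup>2 / m\<^sup>2 * (1 - R)\<^sup>2 + (2 - R))"
  proof -
    have "- (X + Z / y\<^sup>2) / (1 / y)\<^sup>2 = - (X * y\<^sup>2 + Z)" if "y \<noteq> 0" for X Z y :: real using that by (simp add: field_simps)
    from this[of "1 - R"] show ?thesis unfolding g'0 using dR by simp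
  qed
  finally show "hol_sectional_curvature (wu_metric (egg \<iota> m)) p (axis \<kappa> 1) = - (E / (1 - E)\<^sup>2 / m\<^sup>2 * (1 - E powr m)\<^sup>2 + 2 - E powr m)"
    by (simp add: R_def)
qed

lemma curvature_not_constant_egg:
  fixes \<iota> :: "'n::finite"
  assumes m: "0 < m" "m < 1" and \<kappa>: "\<kappa> \<noteq> \<iota>"
  shows "\<not> (\<exists>c. \<forall>p \<in> egg \<iota> m - egg_slice \<iota> m. \<forall>\<xi>. \<xi> \<noteq> 0 \<longrightarrow> hol_sectional_curvature (wu_metric (egg \<iota> m)) p \<xi> = c)"
proof
  assume "\<exists>c. \<forall>p \<in> egg \<iota> m - egg_slice \<iota> m. \<forall>\<xi>. \<xi> \<noteq> 0 \<longrightarrow> hol_sectional_curvature (wu_metric (egg \<iota> m)) p \<xi> = c"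
  then obtain c where c: "\<And>p \<xi>. p \<in> egg \<iota> m - egg_slice \<iota> m \<Longrightarrow> \<xi> \<noteq> 0 \<Longrightarrow> hol_sectional_curvature (wu_metric (egg \<iota> m)) p \<xi> = c" by blast
  define F where "F E = E / (1 - E)\<^sup>2 / m\<^sup>2 * (1 - E powr m)\<^sup>2 + 2 - E powr m" for E
  have F: "F E = - c" if "0 < E" "E < 1" for E
  proof -
    have "axis \<kappa> (1 :: complex) \<noteq> 0" by (simp add: axis_eq_0_iff)
    then show ?thesis using c[OF hol_sectional_curvature_egg_axis(1)[OF m \<kappa> that]] hol_sectional_curvature_egg_axis(2)[OF m \<kappa> that]
      unfolding F_def by fastforce
  qed
  \<comment> \<open>E = 0 corresponds to a point of the slice, so the value there is available only
    as a limit from the right.\<close>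
  have "(F \<longlongrightarrow> 0 / (1 - 0)\<^sup>2 / m\<^sup>2 * (1 - 0 powr m)\<^sup>2 + 2 - 0 powr m) (at_right 0)"
    unfolding F_def[abs_def] using m
    by (intro tendsto_intros tendsto_powr') (auto simp: eventually_at_filter)
  moreover have "\<forall>\<^sub>F E in at_right 0. F E = - c"
    by (rule eventually_mono[OF eventually_at_right_real[of 0 1]]) (auto intro: F)
  then have "(F \<longlongrightarrow> - c) (at_right 0)" by (rule tendsto_eventually)
  ultimately have c2: "- c = 2" using tendsto_unique[OF trivial_limit_at_right_real] by fastforce
  define R where "R = (1 / 4) powr m"
  have R: "R < 1" using powr_less_one_of[of "1/4" m] m by (simp add: R_def)
  \<comment> \<open>Any E strictly between 0 and 1 would serve in place of 1/4: the strict
    inequality there keeps F below its limit 2.\<close>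
  have "(1 / 4) / (1 - 1 / 4)\<^sup>2 < m\<^sup>2 * R / (1 - R)\<^sup>2" unfolding R_def by (rule Poincare_coeff_less[OF m]) auto
  then have "(1 / 4) / (1 - 1 / 4)\<^sup>2 * (1 - R)\<^sup>2 < m\<^sup>2 * R" using R by (simp add: pos_less_divide_eq)
  then have "(1 / 4) / (1 - 1 / 4)\<^sup>2 / m\<^sup>2 * (1 - R)\<^sup>2 < R" using m by (simp add: pos_divide_less_eq mult_ac)
  then have "F (1 / 4) < 2" unfolding F_def R_def by linarith
  with F[of "1 / 4"] c2 show False by simp
qed

theorem theorem1p1:
  fixes \<iota> :: "'n::finite"
  assumes "CARD('n) \<ge> 2"
  shows "\<exists>c<0. \<forall>m. 0 < m \<and> m < 1 / 2 \<longrightarrow>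
    continuous_hermitian_metric_on (egg \<iota> m) (wu_metric (egg \<iota> m)) \<and>
    real_analytic_on (egg \<iota> m - egg_slice \<iota> m) (wu_metric (egg \<iota> m)) \<and>
    (\<forall>p \<in> egg \<iota> m - egg_slice \<iota> m. \<not> kaehler_at (wu_metric (egg \<iota> m)) p) \<and>
    \<not> (\<exists>\<kappa>. \<forall>p \<in> egg \<iota> m - egg_slice \<iota> m. \<forall>\<xi>. \<xi> \<noteq> 0 \<longrightarrow>
          hol_sectional_curvature (wu_metric (egg \<iota> m)) p \<xi> = \<kappa>) \<and>
    curvature_bounded_above_currents (egg \<iota> m) (wu_metric (egg \<iota> m)) c"
proof -
  \<comment> \<open>A tangential index has to exist, since both the torsion and the variation of the
    curvature are exhibited in a direction \<kappa> other than \<iota>.\<close>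
  have "UNIV \<noteq> {\<iota>}" using assms by (metis card.empty card.insert empty_iff finite.emptyI not_less_eq_eq numeral_2_eq_2 One_nat_def order_refl)
  then obtain \<kappa> :: 'n where \<kappa>: "\<kappa> \<noteq> \<iota>" by blast
  show ?thesis
  proof (intro exI[of _ "- 1 / 2"] conjI allI impI ballI)
    fix m :: real assume "0 < m \<and> m < 1 / 2"
    then have m: "0 < m" "m < 1" by auto
    show "continuous_hermitian_metric_on (egg \<iota> m) (wu_metric (egg \<iota> m))"
      by (rule continuous_hermitian_metric_egg[OF m])
    show "real_analytic_on (egg \<iota> m - egg_slice \<iota> m) (wu_metric (egg \<iota> m))"
      by (rule real_analytic_wu_egg[OF m])
    show "\<not> kaehler_at (wu_metric (egg \<iota> m)) p" if "p \<in> egg \<iota> m - egg_slice \<iota> m" for p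
      by (rule not_kaehler_egg[OF m that \<kappa>])
    show "\<not> (\<exists>\<kappa>. \<forall>p \<in> egg \<iota> m - egg_slice \<iota> m. \<forall>\<xi>. \<xi> \<noteq> 0 \<longrightarrow>
        hol_sectional_curvature (wu_metric (egg \<iota> m)) p \<xi> = \<kappa>)"
      by (rule curvature_not_constant_egg[OF m \<kappa>])
    show "curvature_bounded_above_currents (egg \<iota> m) (wu_metric (egg \<iota> m)) (- 1 / 2)"
      using curvature_bounded_currents_egg[OF m] by simp
  qed simp
qed

end
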